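(* Let $\Gamma$ be a finite simplicial graph, with each vertex $v$ labelled by a finitely generated group $G_v$. Then the graph product $G_\Gamma$ is a hierarchically hyperbolic group relative to the vertex groups. That is, for some $E>0$ the group $G_\Gamma$ is a relatively $E$-hierarchically hyperbolic group, with a relative HHG structure in which every space associated to a $\sqsubseteq$-minimal domain is isometric to the Cayley graph of one of the vertex groups $G_v$ with respect to a finite generating set.
   Context: **Graph products.** Let $\Gamma$ be a finite non-empty simplicial graph with each vertex $v$ labelled by a group $G_v$; vertex groups are always assumed non-trivial. The graph product is $G_\Gamma=\left(\ast_{v\in V(\Gamma)}G_v\right)/\langle\langle [g_v,g_w] : g_v\in G_v,\ g_w\in G_w,\ \{v,w\}\in E(\Gamma)\rangle\rangle$. **Proto-hierarchy structure.** Let $\mathcal X$ be a quasi-geodesic metric space and $E>0$. An $E$-proto-hierarchy structure on $\mathcal X$ is an index set $\mathfrak S$ (elements called domains) and geodesic spaces $(C(W),\mathsf d_W)$, $W\in\mathfrak S$, such that (for subsets $A,B$ of $C(W)$, $\mathsf d_W(A,B)$ denotes the infimal distance): - (Projections) For each $W$ there is $\pi_W:\mathcal X\to 2^{C(W)}$ with $\pi_W(x)\ne\emptyset$, $\operatorname{diam}\pi_W(x)\le E$ for all $x$; $\pi_W$ is $(E,E)$-coarsely Lipschitz; and $C(W)$ is contained in the $E$-neighbourhood of $\pi_W(\mathcal X)$. - (Nesting) If $\mathfrak S\neq\emptyset$, it has a partial order $\sqsubseteq$ with a unique maximal element. $\mathfrak S_W=\{V: V\sqsubseteq W\}$. If $V\sqsubsetneq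 W$ there is a specified non-empty $\rho^V_W\subseteq C(W)$ with $\operatorname{diam}\rho^V_W\le E$. - (Orthogonality) There is a symmetric relation $\perp$ on $\mathfrak S$; orthogonal elements are not $\sqsubseteq$-comparable; $V\sqsubseteq W$ and $W\perp U$ imply $V\perp U$. $\mathfrak S_W^\perp=\{V:V\perp W\}$. - (Transversality) If $V,W$ are not orthogonal and neither is nested in the other, write $V\pitchfork W$; then there are specified non-empty $\rho^V_W\subseteq C(W)$, $\rho^W_V\subseteq C(V)$ of diameter at most $E$. **Relative HHS structure.** An $E$-proto-hierarchy structure is a relative $E$-HHS structure if in addition (writing $\mathsf d_W(x,y)$ for $\mathsf d_W(\pi_W(x),\pi_W(y))$): 1. (Hyperbolicity) For each $W$, either $W$ is $\sqsubseteq$-minimal or $C(W)$ is $E$-hyperbolic. 2. (Finite complexity) Any set of pairwise $\sqsubseteq$-comparable elements has at most $E$ elements. 3. (Containers) For $W\in\mathfrak S$ and $U\in\mathfrak S_W$ with $\mathfrak S_W\cap\mathfrak S_U^\perp\ne\emptyset$ there is $Q\in\mathfrak S_W$ with $V\sqsubseteq Q$ for all $V\in\mathfrak S_W\cap\mathfrak S_U^\perp$. 4. (Uniqueness) There is $\theta:[0,\infty)\to[0,\infty)$ such that for all $r\ge0$, if $\mathsf d_{\mathcal X}(x,y)\ge\theta(r)$ then $\mathsf d_W(x,y)\ge r$ for some $W$. 5. (Bounded geodesic image) If $V\sqsubsetneq W$ and $\mathsf d_V(x,y)\ge E$, then every $C(W)$-geodesic from $\pi_W(x)$ to $\pi_W(y)$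 meets the $E$-neighbourhood of $\rho^V_W$. 6. (Large links) For all $W$ and $x,y\in\mathcal X$ there is $\{V_1,\dots,V_m\}\subseteq\mathfrak S_W\smallsetminus\{W\}$ with $m\le E\,\mathsf d_W(x,y)+E$ such that for all $U\in\mathfrak S_W\smallsetminus\{W\}$, either $U\sqsubseteq V_i$ for some $i$ or $\mathsf d_U(x,y)\le E$. 7. (Consistency) If $V\pitchfork W$ then $\min\{\mathsf d_W(\pi_W(x),\rho^V_W),\mathsf d_V(\pi_V(x),\rho^W_V)\}\le E$ for all $x$. If $U\sqsubseteq V$ and either $V\sqsubsetneq W$, or $V\pitchfork W$ and $W\not\perp U$, then $\mathsf d_W(\rho^U_W,\rho^V_W)\le E$. 8. (Partial realisation) If $\{V_i\}$ is a finite collection of pairwise orthogonal elements and $p_i\in C(V_i)$, there is $x\in\mathcal X$ with $\mathsf d_{V_i}(\pi_{V_i}(x),p_i)\le E$ for all $i$, and $\mathsf d_W(\pi_W(x),\rho^{V_i}_W)\le E$ whenever $V_i\sqsubsetneq W$ or $W\pitchfork V_i$. It is a (non-relative) $E$-HHS structure if moreover every $C(W)$ is $E$-hyperbolic. **(Relatively) hierarchically hyperbolic group.** A finitely generated group $G$ with Cayley graph $X$ (for some finite generating set) is a (relatively) $E$-hierarchically hyperbolic group (HHG) if (1) $X$ admits a (relative) $E$-HHS structure $\mathfrak S$; (2) $G$ acts on $\mathfrak S$ by bijections preserving $\sqsubseteq,\perp,\pitchfork$, with finitely many orbits; (3) for all $W\in\mathfrak S$, $g\in G$ there is an isometry $g_W:C(W)\to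 C(gW)$ such that $(gh)_W=g_{hW}\circ h_W$; $g_W(\pi_W(x))$ and $\pi_{gW}(gx)$ are at most $E$ apart for all $x \in X$; and if $V\pitchfork W$ or $V\sqsubsetneq W$, then $g_W(\rho^V_W)$ and $\rho^{gV}_{gW}$ are at most $E$ apart. Such an $\mathfrak S$ is called a (relative) HHG structure. *)

theory Defs
  imports "HOL-Analysis.Analysis" "HOL-Algebra.Algebra"
begin

section \<open>Graph products of groups\<close>

definition finite_simplicial_graph :: "'v set \<Rightarrow> 'v set set \<Rightarrow> bool" where
  "finite_simplicial_graph V E \<longleftrightarrow> finite V \<and> V \<noteq> {} \<and> (\<forall>e\<in>E. e \<subseteq> V \<and> card e = 2)"

definition free_words :: "'v set \<Rightarrow> ('v \<Rightarrow> ('a, 'b) monoid_scheme) \<Rightarrow> ('v \<times> 'a) list set" where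
  "free_words V G = lists (SIGMA v:V. carrier (G v))"

inductive free_eq :: "'v set \<Rightarrow> ('v \<Rightarrow> ('a, 'b) monoid_scheme) \<Rightarrow> ('v \<times> 'a) list \<Rightarrow> ('v \<times> 'a) list \<Rightarrow> bool"
  for V G where
  refl: "u \<in> free_words V G \<Longrightarrow> free_eq V G u u"
| sym: "free_eq V G u w \<Longrightarrow> free_eq V G w u"
| trans: "free_eq V G u w \<Longrightarrow> free_eq V G w z \<Longrightarrow> free_eq V G u z"
| one: "u \<in> free_words V G \<Longrightarrow> w \<in> free_words V G \<Longrightarrow> v \<in> V \<Longrightarrow>
    free_eq V G (u @ [(v, \<one>\<^bsub>G v\<^esub>)] @ w) (u @ w)"
| mult: "u \<in> free_words V G \<Longrightarrow> w \<in> free_words V G \<Longrightarrow> v \<in> V \<Longrightarrow> g \<in> carrier (G v) \<Longrightarrow> h \<in> carrier (G v) \<Longrightarrow>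
    free_eq V G (u @ [(v, g), (v, h)] @ w) (u @ [(v, g \<otimes>\<^bsub>G v\<^esub> h)] @ w)"

definition free_rel :: "'v set \<Rightarrow> ('v \<Rightarrow> ('a, 'b) monoid_scheme) \<Rightarrow> (('v \<times> 'a) list \<times> ('v \<times> 'a) list) set" where
  "free_rel V G = {(u, w). free_eq V G u w}"

definition free_product :: "'v set \<Rightarrow> ('v \<Rightarrow> ('a, 'b) monoid_scheme) \<Rightarrow> ('v \<times> 'a) list set monoid" where
  "free_product V G =
    \<lparr>carrier = free_words V G // free_rel V G,
     mult = (\<lambda>A B. \<Union>a\<in>A. \<Union>b\<in>B. free_rel V G `` {a @ b}),
     one = free_rel V G `` {[]}\<rparr>"

definition free_incl :: "'v set \<Rightarrow> ('v \<Rightarrow> ('a, 'b) monoid_scheme) \<Rightarrow> 'v \<Rightarrow> 'a \<Rightarrow> ('v \<times> 'a) list set" where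
  "free_incl V G v g = free_rel V G `` {[(v, g)]}"

definition commutator :: "('g, 'm) monoid_scheme \<Rightarrow> 'g \<Rightarrow> 'g \<Rightarrow> 'g" where
  "commutator G a b = a \<otimes>\<^bsub>G\<^esub> b \<otimes>\<^bsub>G\<^esub> inv\<^bsub>G\<^esub> a \<otimes>\<^bsub>G\<^esub> inv\<^bsub>G\<^esub> b"

definition normal_closure :: "('g, 'm) monoid_scheme \<Rightarrow> 'g set \<Rightarrow> 'g set" where
  "normal_closure G R = generate G {g \<otimes>\<^bsub>G\<^esub> r \<otimes>\<^bsub>G\<^esub> inv\<^bsub>G\<^esub> g | g r. g \<in> carrier G \<and> r \<in> R}"

definition graph_product_relators ::
  "'v set \<Rightarrow> 'v set set \<Rightarrow> ('v \<Rightarrow> ('a, 'b) monoid_scheme) \<Rightarrow> ('v \<times> 'a) list set set" where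
  "graph_product_relators V E G =
    {commutator (free_product V G) (free_incl V G v g) (free_incl V G w h) | v w g h.
      v \<in> V \<and> w \<in> V \<and> {v, w} \<in> E \<and> g \<in> carrier (G v) \<and> h \<in> carrier (G w)}"

type_synonym ('v, 'a) graph_product_elt = "('v \<times> 'a) list set set"

definition graph_product ::
  "'v set \<Rightarrow> 'v set set \<Rightarrow> ('v \<Rightarrow> ('a, 'b) monoid_scheme) \<Rightarrow> ('v, 'a) graph_product_elt monoid" where
  "graph_product V E G = free_product V G Mod normal_closure (free_product V G) (graph_product_relators V E G)"

lemma free_words_append [simp]:
  "u @ w \<in> free_words V G \<longleftrightarrow> u \<in> free_words V G \<and> w \<in> free_words V G"
  by (auto simp: free_words_def)

lemma free_words_Nil [simp]: "[] \<in> free_words V G"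
  by (simp add: free_words_def)

lemma free_words_Cons [simp]:
  "(v, g) # w \<in> free_words V G \<longleftrightarrow> v \<in> V \<and> g \<in> carrier (G v) \<and> w \<in> free_words V G"
  by (auto simp: free_words_def)

lemma free_eq_words:
  assumes "\<And>v. v \<in> V \<Longrightarrow> group (G v)" and "free_eq V G u w"
  shows "u \<in> free_words V G \<and> w \<in> free_words V G"
  using assms(2)
  by induction (auto dest!: assms(1) intro: monoid.m_closed group.is_monoid monoid.one_closed)

lemma equiv_free_rel:
  assumes "\<And>v. v \<in> V \<Longrightarrow> group (G v)"
  shows "equiv (free_words V G) (free_rel V G)"
  unfolding free_rel_def
proof (rule equivI)
  have w: "u \<in> free_words V G \<and> w \<in> free_words V G" if "free_eq V G u w" for u w
    using free_eq_words[of V G u w] assms that by blast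
  then show "{(u, w). free_eq V G u w} \<subseteq> free_words V G \<times> free_words V G" by blast
  show "refl_on (free_words V G) {(u, w). free_eq V G u w}"
    by (auto simp: refl_on_def intro: free_eq.refl)
  show "sym {(u, w). free_eq V G u w}"
    by (auto simp: sym_on_def intro: free_eq.sym)
  show "trans {(u, w). free_eq V G u w}"
    by (auto simp: trans_on_def intro: free_eq.trans)
qed

lemma free_eq_append1:
  assumes "free_eq V G u w" "z \<in> free_words V G"
  shows "free_eq V G (u @ z) (w @ z)"
  using assms
proof induction
  case (one u w v) then show ?case using free_eq.one[of u V G "w @ z" v] by simp
next
  case (mult u w v g h) then show ?case using free_eq.mult[of u V G "w @ z" v g h] by simp
qed (auto intro: free_eq.refl free_eq.sym free_eq.trans)

lemma free_eq_append2:
  assumes "free_eq V G u w" "z \<in> free_words V G"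
  shows "free_eq V G (z @ u) (z @ w)"
  using assms
proof induction
  case (one u w v) then show ?case using free_eq.one[of "z @ u" V G w v] by simp
next
  case (mult u w v g h) then show ?case using free_eq.mult[of "z @ u" V G w v g h] by simp
qed (auto intro: free_eq.refl free_eq.sym free_eq.trans)

lemma free_eq_append:
  assumes "\<And>v. v \<in> V \<Longrightarrow> group (G v)" "free_eq V G u u'" "free_eq V G w w'"
  shows "free_eq V G (u @ w) (u' @ w')"
  using free_eq_words[OF assms(1,2)] free_eq_words[OF assms(1,3)] assms(2,3)
  by (meson free_eq_append1 free_eq_append2 free_eq.trans)

lemma free_product_mult_class:
  assumes G: "\<And>v. v \<in> V \<Longrightarrow> group (G v)" and u: "u \<in> free_words V G" and w: "w \<in> free_words V G"
  shows "free_rel V G `` {u} \<otimes>\<^bsub>free_product V G\<^esub> free_rel V G `` {w} = free_rel V G `` {u @ w}"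
proof -
  let ?c = "\<lambda>u. free_rel V G `` {u}"
  have eqv: "equiv (free_words V G) (free_rel V G)"
    using equiv_free_rel[of V G] G by blast
  have "?c (a @ b) = ?c (u @ w)" if "a \<in> ?c u" "b \<in> ?c w" for a b
  proof -
    have "free_eq V G (u @ w) (a @ b)"
      using that G by (intro free_eq_append) (simp_all add: free_rel_def)
    then show ?thesis
      by (intro equiv_class_eq[OF eqv, symmetric]) (simp add: free_rel_def)
  qed
  moreover have "u \<in> ?c u" "w \<in> ?c w"
    using u w by (auto simp: free_rel_def intro: free_eq.refl)
  ultimately have "(\<Union>a\<in>?c u. \<Union>b\<in>?c w. ?c (a @ b)) = ?c (u @ w)"
    by blast
  then show ?thesis by (simp add: free_product_def)
qed

lemma free_eq_inverse:
  assumes G: "\<And>v. v \<in> V \<Longrightarrow> group (G v)" and w: "w \<in> free_words V G"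
  shows "\<exists>z\<in>free_words V G. free_eq V G (z @ w) []"
  using w
proof (induction w)
  case Nil then show ?case by (auto intro!: bexI[of _ "[]"] free_eq.refl)
next
  case (Cons p w)
  obtain v g where p: "p = (v, g)" by force
  have v: "v \<in> V" "g \<in> carrier (G v)" "w \<in> free_words V G"
    using Cons.prems p by auto
  interpret Gv: group "G v" using G v by blast
  obtain z where z: "z \<in> free_words V G" "free_eq V G (z @ w) []"
    using Cons v by auto
  let ?y = "z @ [(v, inv\<^bsub>G v\<^esub> g)]"
  have "free_eq V G (?y @ p # w) (z @ [(v, \<one>\<^bsub>G v\<^esub>)] @ w)"
    using free_eq.mult[of z V G w v "inv\<^bsub>G v\<^esub> g" g] z v p by simp
  also have "free_eq V G \<dots> (z @ w)"
    by (rule free_eq.one) (use z v in auto)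
  finally (free_eq.trans) have "free_eq V G (?y @ p # w) []"
    using z free_eq.trans by metis
  moreover have "?y \<in> free_words V G" using z v by simp
  ultimately show ?case by metis
qed

lemma group_free_product:
  assumes G: "\<And>v. v \<in> V \<Longrightarrow> group (G v)"
  shows "group (free_product V G)"
proof (rule groupI)
  let ?P = "free_product V G" and ?c = "\<lambda>u. free_rel V G `` {u}"
  have car: "x \<in> carrier ?P \<longleftrightarrow> (\<exists>u\<in>free_words V G. x = ?c u)" for x
    by (auto simp: free_product_def quotient_def)
  have one: "\<one>\<^bsub>?P\<^esub> = ?c []" by (simp add: free_product_def)
  have m: "?c u \<otimes>\<^bsub>?P\<^esub> ?c w = ?c (u @ w)" if "u \<in> free_words V G" "w \<in> free_words V G" for u w
    using free_product_mult_class[of V G] G that by blast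
  show "\<one>\<^bsub>?P\<^esub> \<in> carrier ?P" unfolding car one by (auto intro!: bexI[of _ "[]"])
  show "x \<otimes>\<^bsub>?P\<^esub> y \<in> carrier ?P" if xy: "x \<in> carrier ?P" "y \<in> carrier ?P" for x y
  proof -
    obtain u w where "u \<in> free_words V G" "w \<in> free_words V G" "x = ?c u" "y = ?c w"
      using xy unfolding car by blast
    then show ?thesis unfolding car by (intro bexI[of _ "u @ w"]) (simp_all add: m)
  qed
  show "x \<otimes>\<^bsub>?P\<^esub> y \<otimes>\<^bsub>?P\<^esub> z = x \<otimes>\<^bsub>?P\<^esub> (y \<otimes>\<^bsub>?P\<^esub> z)"
    if "x \<in> carrier ?P" "y \<in> carrier ?P" "z \<in> carrier ?P" for x y z
    using that unfolding car by (auto simp: m)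
  show "\<one>\<^bsub>?P\<^esub> \<otimes>\<^bsub>?P\<^esub> x = x" if "x \<in> carrier ?P" for x
    using that unfolding car one by (auto simp: m)
  show "\<exists>y\<in>carrier ?P. y \<otimes>\<^bsub>?P\<^esub> x = \<one>\<^bsub>?P\<^esub>" if x: "x \<in> carrier ?P" for x
  proof -
    obtain u where u: "u \<in> free_words V G" "x = ?c u" using x unfolding car by blast
    obtain z where z: "z \<in> free_words V G" "free_eq V G (z @ u) []"
      using free_eq_inverse[OF G u(1)] by blast
    have "?c (z @ u) = ?c []"
      by (rule equiv_class_eq[OF equiv_free_rel[of V G]]) (use G z in \<open>auto simp: free_rel_def\<close>)
    then show ?thesis using u z m[OF z(1) u(1)] one by (intro bexI[of _ "?c z"]) (auto simp: car)
  qed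
qed

lemma normal_normal_closure:
  assumes "group G" "R \<subseteq> carrier G"
  shows "normal_closure G R \<lhd> G"
proof -
  interpret group G by fact
  let ?T = "{g \<otimes>\<^bsub>G\<^esub> r \<otimes>\<^bsub>G\<^esub> inv\<^bsub>G\<^esub> g | g r. g \<in> carrier G \<and> r \<in> R}"
  have "h \<otimes>\<^bsub>G\<^esub> t \<otimes>\<^bsub>G\<^esub> inv\<^bsub>G\<^esub> h \<in> ?T" if t: "t \<in> ?T" and h: "h \<in> carrier G" for t h
  proof -
    obtain g r where gr: "t = g \<otimes>\<^bsub>G\<^esub> r \<otimes>\<^bsub>G\<^esub> inv\<^bsub>G\<^esub> g" "g \<in> carrier G" "r \<in> R"
      using t by blast
    then have "r \<in> carrier G" using assms by blast
    then have "h \<otimes>\<^bsub>G\<^esub> t \<otimes>\<^bsub>G\<^esub> inv\<^bsub>G\<^esub> h = (h \<otimes>\<^bsub>G\<^esub> g) \<otimes>\<^bsub>G\<^esub> r \<otimes>\<^bsub>G\<^esub> inv\<^bsub>G\<^esub> (h \<otimes>\<^bsub>G\<^esub> g)"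
      using gr h by (simp add: inv_mult_group m_assoc)
    then show ?thesis using gr h m_closed by blast
  qed
  moreover have "?T \<subseteq> carrier G" using assms by auto
  ultimately show ?thesis
    unfolding normal_closure_def by (intro normal_generateI) auto
qed

lemma group_graph_product:
  assumes G: "\<And>v. v \<in> V \<Longrightarrow> group (G v)"
  shows "group (graph_product V E G)"
proof -
  interpret P: group "free_product V G" using group_free_product[OF G] .
  have "free_incl V G v g \<in> carrier (free_product V G)" if "v \<in> V" "g \<in> carrier (G v)" for v g
    using that by (auto simp: free_incl_def free_product_def intro: quotientI)
  then have "graph_product_relators V E G \<subseteq> carrier (free_product V G)"
    by (auto simp: graph_product_relators_def commutator_def)
  then show ?thesis
    unfolding graph_product_def
    by (intro normal.factorgroup_is_group normal_normal_closure P.is_group)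
qed


section \<open>Cayley graphs as metric spaces\<close>

text \<open>
  A point of the realisation of a simplicial graph is given by its barycentric coordinates:
  a function supported on a single vertex or on the two ends of an edge, with total mass 1.
  On a common edge \<open>{u, v}\<close> the distance between \<open>p\<close> and \<open>q\<close> is \<open>\<bar>p u - q u\<bar> = \<bar>p v - q v\<bar>\<close>,
  so that edges have length 1, and the metric is the induced length metric.
\<close>

definition supp :: "('x \<Rightarrow> real) \<Rightarrow> 'x set" where
  "supp p = {x. p x \<noteq> 0}"

definition graph_points :: "'x set \<Rightarrow> 'x set set \<Rightarrow> ('x \<Rightarrow> real) set" where
  "graph_points Vs Es =
    {p. (\<forall>x. 0 \<le> p x) \<and> ((\<exists>v\<in>Vs. supp p = {v}) \<or> supp p \<in> Es) \<and> (\<Sum>x\<in>supp p. p x) = 1}"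

inductive graph_path :: "'x set \<Rightarrow> 'x set set \<Rightarrow> real \<Rightarrow> ('x \<Rightarrow> real) \<Rightarrow> ('x \<Rightarrow> real) \<Rightarrow> bool"
  for Vs Es where
  nil: "p \<in> graph_points Vs Es \<Longrightarrow> graph_path Vs Es 0 p p"
| step: "graph_path Vs Es l p q \<Longrightarrow> r \<in> graph_points Vs Es \<Longrightarrow> {u, v} \<in> Es \<Longrightarrow>
    supp q \<union> supp r \<subseteq> {u, v} \<Longrightarrow> graph_path Vs Es (l + \<bar>q u - r u\<bar>) p r"

definition graph_dist :: "'x set \<Rightarrow> 'x set set \<Rightarrow> ('x \<Rightarrow> real) \<Rightarrow> ('x \<Rightarrow> real) \<Rightarrow> real" where
  "graph_dist Vs Es p q =
    (if p \<in> graph_points Vs Es \<and> q \<in> graph_points Vs Es then Inf {l. graph_path Vs Es l p q} else 0)"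

definition graph_metric :: "'x set \<Rightarrow> 'x set set \<Rightarrow> ('x \<Rightarrow> real) metric" where
  "graph_metric Vs Es = metric (graph_points Vs Es, graph_dist Vs Es)"

definition generates :: "('g, 'm) monoid_scheme \<Rightarrow> 'g set \<Rightarrow> bool" where
  "generates G T \<longleftrightarrow> T \<subseteq> carrier G \<and> generate G T = carrier G"

definition finitely_generated :: "('g, 'm) monoid_scheme \<Rightarrow> bool" where
  "finitely_generated G \<longleftrightarrow> (\<exists>T. finite T \<and> generates G T)"

text \<open>Cayley graphs are simplicial: there are no loops and no multiple edges.\<close>

definition cayley_edges :: "('g, 'm) monoid_scheme \<Rightarrow> 'g set \<Rightarrow> 'g set set" where
  "cayley_edges G T = {{g, g \<otimes>\<^bsub>G\<^esub> t} | g t. g \<in> carrier G \<and> t \<in> T \<and> t \<noteq> \<one>\<^bsub>G\<^esub>}"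

definition cayley_graph :: "('g, 'm) monoid_scheme \<Rightarrow> 'g set \<Rightarrow> ('g \<Rightarrow> real) metric" where
  "cayley_graph G T = graph_metric (carrier G) (cayley_edges G T)"

lemma graph_path_points:
  "graph_path Vs Es l p q \<Longrightarrow> p \<in> graph_points Vs Es \<and> q \<in> graph_points Vs Es \<and> 0 \<le> l"
  by (induction rule: graph_path.induct) auto

lemma graph_path_trans:
  "graph_path Vs Es l q r \<Longrightarrow> graph_path Vs Es k p q \<Longrightarrow> graph_path Vs Es (k + l) p r"
proof (induction rule: graph_path.induct)
  case (step l p' q' r u v)
  then show ?case using graph_path.step[of Vs Es "k + l" p q' r u v] by (simp add: add.assoc)
qed auto

lemma graph_path_sym: "graph_path Vs Es l p q \<Longrightarrow> graph_path Vs Es l q p"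
proof (induction rule: graph_path.induct)
  case (step l p q r u v)
  have "graph_path Vs Es (0 + \<bar>r u - q u\<bar>) r q"
    by (rule graph_path.step[of _ _ _ _ _ _ _ v]) (use step graph_path_points[OF step(1)] in \<open>auto intro: graph_path.nil\<close>)
  then show ?case using graph_path_trans[OF step.IH] by (fastforce simp: abs_minus_commute add.commute)
qed (rule graph_path.nil)

lemma graph_points_edge:
  assumes "p \<in> graph_points Vs Es" "supp p \<subseteq> {u, v}" "u \<noteq> v"
  shows "p u + p v = 1"
proof -
  have "(\<Sum>x\<in>supp p. p x) = (\<Sum>x\<in>{u, v}. p x)"
    by (rule sum.mono_neutral_left) (use assms in \<open>auto simp: supp_def\<close>)
  then show ?thesis using assms by (auto simp: graph_points_def)
qed

lemma graph_path_lower: "graph_path Vs Es l p q \<Longrightarrow> \<bar>p x - q x\<bar> \<le> l"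
proof (induction rule: graph_path.induct)
  case (step l p q r u v)
  have "\<bar>q x - r x\<bar> \<le> \<bar>q u - r u\<bar>"
  proof (cases "x = v \<and> u \<noteq> v")
    case True
    then have "q u + q v = 1" "r u + r v = 1"
      using step graph_path_points[OF step(1)] by (auto intro!: graph_points_edge[of _ Vs Es])
    then show ?thesis using True by auto
  next
    case False
    show ?thesis
    proof (cases "x = u")
      case False
      then have "x \<notin> supp q" "x \<notin> supp r" using step \<open>\<not> (x = v \<and> u \<noteq> v)\<close> by auto
      then show ?thesis by (simp add: supp_def)
    qed simp
  qed
  then show ?case using step.IH by linarith
qed auto

lemma Metric_space_graph_dist:
  assumes conn: "\<And>p q. p \<in> graph_points Vs Es \<Longrightarrow> q \<in> graph_points Vs Es \<Longrightarrow> \<exists>l. graph_path Vs Es l p q"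
  shows "Metric_space (graph_points Vs Es) (graph_dist Vs Es)"
proof
  let ?L = "\<lambda>p q. {l. graph_path Vs Es l p q}"
  have bdd: "bdd_below (?L p q)" for p q
    using graph_path_points by (intro bdd_belowI[of _ 0]) blast
  have le: "c \<le> Inf (?L p q)"
    if "p \<in> graph_points Vs Es" "q \<in> graph_points Vs Es" "\<And>l. graph_path Vs Es l p q \<Longrightarrow> c \<le> l" for p q c
    using that conn[of p q] by (intro cInf_greatest) auto
  have low: "Inf (?L p q) \<le> l" if "graph_path Vs Es l p q" for p q l
    using that bdd by (intro cInf_lower) auto
  show "0 \<le> graph_dist Vs Es p q" for p q
    using graph_path_points by (auto simp: graph_dist_def intro!: le) blast
  have "?L p q = ?L q p" for p q
    using graph_path_sym by blast
  then show "graph_dist Vs Es p q = graph_dist Vs Es q p" for p q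
    by (simp add: graph_dist_def)
  show "graph_dist Vs Es p q = 0 \<longleftrightarrow> p = q"
    if p: "p \<in> graph_points Vs Es" and q: "q \<in> graph_points Vs Es" for p q
  proof
    assume "graph_dist Vs Es p q = 0"
    moreover have "\<bar>p x - q x\<bar> \<le> Inf (?L p q)" for x
      using p q graph_path_lower by (intro le) blast+
    ultimately have "p x = q x" for x
      using p q by (simp add: graph_dist_def)
    then show "p = q" by blast
  next
    assume "p = q"
    then have "Inf (?L p q) \<le> 0" using p by (intro low) (simp add: graph_path.nil)
    moreover have "0 \<le> Inf (?L p q)" using p q graph_path_points by (intro le) blast+
    ultimately show "graph_dist Vs Es p q = 0" by (simp add: graph_dist_def)
  qed
  show "graph_dist Vs Es p r \<le> graph_dist Vs Es p q + graph_dist Vs Es q r"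
    if p: "p \<in> graph_points Vs Es" and q: "q \<in> graph_points Vs Es" and r: "r \<in> graph_points Vs Es" for p q r
  proof -
    have "Inf (?L p r) - k \<le> Inf (?L q r)" if "graph_path Vs Es k p q" for k
    proof (rule le[OF q r])
      fix l assume "graph_path Vs Es l q r"
      then show "Inf (?L p r) - k \<le> l" using low[OF graph_path_trans[OF _ that]] by fastforce
    qed
    then have "Inf (?L p r) - Inf (?L q r) \<le> Inf (?L p q)"
      by (intro le[OF p q]) (simp add: algebra_simps)
    then show ?thesis using p q r by (simp add: graph_dist_def)
  qed
qed

lemma cayley_graph_connected:
  assumes "group G" "generates G T"
    and p: "p \<in> graph_points (carrier G) (cayley_edges G T)" and q: "q \<in> graph_points (carrier G) (cayley_edges G T)"
  shows "\<exists>l. graph_path (carrier G) (cayley_edges G T) l p q"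
proof -
  interpret group G by fact
  let ?Es = "cayley_edges G T" and ?P = "\<lambda>l. graph_path (carrier G) (cayley_edges G T) l"
  define \<delta> where "\<delta> g = (\<lambda>x. if x = g then 1 else 0 :: real)" for g :: 'a
  have supp_\<delta>: "supp (\<delta> g) = {g}" for g by (auto simp: supp_def \<delta>_def)
  have \<delta>: "\<delta> g \<in> graph_points (carrier G) ?Es" if "g \<in> carrier G" for g
    using that by (auto simp: graph_points_def supp_\<delta>) (auto simp: \<delta>_def)
  have T: "T \<subseteq> carrier G" using assms by (simp add: generates_def)
  have edge: "\<exists>l. ?P l (\<delta> g) (\<delta> (g \<otimes>\<^bsub>G\<^esub> t))" if g: "g \<in> carrier G" and t: "t \<in> T" for g t
  proof (cases "t = \<one>\<^bsub>G\<^esub>")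
    case True
    then show ?thesis using g \<delta> by (auto intro: graph_path.nil)
  next
    case False
    then have "{g, g \<otimes>\<^bsub>G\<^esub> t} \<in> ?Es" using g t by (auto simp: cayley_edges_def)
    then show ?thesis
      using graph_path.step[OF graph_path.nil[OF \<delta>[OF g]], of "\<delta> (g \<otimes>\<^bsub>G\<^esub> t)" g "g \<otimes>\<^bsub>G\<^esub> t"] g t T \<delta>
      by (auto simp: supp_\<delta> subset_iff)
  qed
  have gen: "\<exists>l. ?P l (\<delta> g) (\<delta> (g \<otimes>\<^bsub>G\<^esub> h))" if "h \<in> generate G T" "g \<in> carrier G" for g h
    using that
  proof (induction h arbitrary: g rule: generate.induct)
    case one then show ?case using \<delta> by (auto intro: graph_path.nil)
  next
    case (incl h) then show ?case using edge by blast
  next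
    case (inv h)
    then have "h \<in> carrier G" using T by blast
    then have "\<exists>l. ?P l (\<delta> (g \<otimes>\<^bsub>G\<^esub> inv\<^bsub>G\<^esub> h)) (\<delta> g)"
      using edge[of "g \<otimes>\<^bsub>G\<^esub> inv\<^bsub>G\<^esub> h" h] inv by (simp add: m_assoc)
    then show ?case using graph_path_sym by blast
  next
    case (eng h1 h2)
    have h: "h1 \<in> carrier G" "h2 \<in> carrier G"
      using eng generate_in_carrier[OF T] by blast+
    obtain k where k: "?P k (\<delta> g) (\<delta> (g \<otimes>\<^bsub>G\<^esub> h1))" using eng by blast
    obtain l where "?P l (\<delta> (g \<otimes>\<^bsub>G\<^esub> h1)) (\<delta> (g \<otimes>\<^bsub>G\<^esub> h1 \<otimes>\<^bsub>G\<^esub> h2))"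
      using eng h by blast
    from graph_path_trans[OF this k] show ?case using h eng by (auto simp: m_assoc)
  qed
  have vert: "\<exists>l. ?P l (\<delta> g) (\<delta> h)" if "g \<in> carrier G" "h \<in> carrier G" for g h
    using gen[of "inv\<^bsub>G\<^esub> g \<otimes>\<^bsub>G\<^esub> h" g] that assms(2) by (simp add: generates_def flip: m_assoc)
  have pt: "\<exists>g\<in>carrier G. \<exists>l. ?P l p (\<delta> g)" if p: "p \<in> graph_points (carrier G) ?Es" for p
  proof -
    consider (vertex) g where "g \<in> carrier G" "supp p = {g}"
      | (edge) g t where "g \<in> carrier G" "t \<in> T" "supp p = {g, g \<otimes>\<^bsub>G\<^esub> t}" "supp p \<in> ?Es"
      using p unfolding graph_points_def cayley_edges_def by blast
    then show ?thesis
    proof cases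
      case vertex
      then have "p = \<delta> g"
        using p by (auto simp: graph_points_def supp_def \<delta>_def fun_eq_iff)
      then show ?thesis using vertex p by (auto intro: graph_path.nil)
    next
      case edge
      then show ?thesis
        using graph_path.step[OF graph_path.nil[OF p], of "\<delta> g" g "g \<otimes>\<^bsub>G\<^esub> t"] \<delta>
        by (auto simp: supp_\<delta>)
    qed
  qed
  obtain g k where g: "g \<in> carrier G" "?P k p (\<delta> g)" using pt[OF p] by blast
  obtain h l where h: "h \<in> carrier G" "?P l q (\<delta> h)" using pt[OF q] by blast
  obtain m where "?P m (\<delta> g) (\<delta> h)" using vert g h by blast
  from graph_path_trans[OF graph_path_sym[OF h(2)] graph_path_trans[OF this g(2)]] show ?thesis ..
qed

lemma
  assumes "group G" "generates G T"
  shows mspace_cayley_graph: "mspace (cayley_graph G T) = graph_points (carrier G) (cayley_edges G T)"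
    and mdist_cayley_graph: "mdist (cayley_graph G T) = graph_dist (carrier G) (cayley_edges G T)"
proof -
  interpret Metric_space "graph_points (carrier G) (cayley_edges G T)" "graph_dist (carrier G) (cayley_edges G T)"
    using cayley_graph_connected[OF assms] by (rule Metric_space_graph_dist)
  show "mspace (cayley_graph G T) = graph_points (carrier G) (cayley_edges G T)"
    and "mdist (cayley_graph G T) = graph_dist (carrier G) (cayley_edges G T)"
    by (simp_all add: cayley_graph_def graph_metric_def)
qed

text \<open>Left translation of the Cayley graph by \<open>g\<close>, in barycentric coordinates.\<close>

definition cayley_translate :: "('g, 'm) monoid_scheme \<Rightarrow> 'g \<Rightarrow> ('g \<Rightarrow> real) \<Rightarrow> 'g \<Rightarrow> real" where
  "cayley_translate G g p = (\<lambda>x. if x \<in> carrier G then p (inv\<^bsub>G\<^esub> g \<otimes>\<^bsub>G\<^esub> x) else 0)"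


section \<open>Coarse geometry\<close>

text \<open>Infimal distance; meaningful only for non-empty sets.\<close>

definition set_dist :: "'c metric \<Rightarrow> 'c set \<Rightarrow> 'c set \<Rightarrow> real" where
  "set_dist m A B = Inf {mdist m a b | a b. a \<in> A \<and> b \<in> B}"

definition nbhd :: "'c metric \<Rightarrow> real \<Rightarrow> 'c set \<Rightarrow> 'c set" where
  "nbhd m r A = {x \<in> mspace m. \<exists>a\<in>A. mdist m x a \<le> r}"

definition diam_le :: "'c metric \<Rightarrow> 'c set \<Rightarrow> real \<Rightarrow> bool" where
  "diam_le m A r \<longleftrightarrow> (\<forall>a\<in>A. \<forall>b\<in>A. mdist m a b \<le> r)"

text \<open>Geodesics from \<open>x\<close> to \<open>y\<close> are parametrised by arc length on \<open>[0, d(x, y)]\<close>.\<close>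

definition geodesic :: "'c metric \<Rightarrow> 'c \<Rightarrow> 'c \<Rightarrow> (real \<Rightarrow> 'c) \<Rightarrow> bool" where
  "geodesic m x y \<gamma> \<longleftrightarrow>
    \<gamma> \<in> {0..mdist m x y} \<rightarrow> mspace m \<and> \<gamma> 0 = x \<and> \<gamma> (mdist m x y) = y \<and>
    (\<forall>s\<in>{0..mdist m x y}. \<forall>t\<in>{0..mdist m x y}. mdist m (\<gamma> s) (\<gamma> t) = \<bar>s - t\<bar>)"

definition geodesic_space :: "'c metric \<Rightarrow> bool" where
  "geodesic_space m \<longleftrightarrow> (\<forall>x\<in>mspace m. \<forall>y\<in>mspace m. \<exists>\<gamma>. geodesic m x y \<gamma>)"

definition quasi_geodesic_space :: "'c metric \<Rightarrow> bool" where
  "quasi_geodesic_space m \<longleftrightarrow>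
    (\<exists>k\<ge>1. \<exists>c\<ge>0. \<forall>x\<in>mspace m. \<forall>y\<in>mspace m. \<exists>L\<ge>0. \<exists>\<gamma> \<in> {0..L} \<rightarrow> mspace m.
      \<gamma> 0 = x \<and> \<gamma> L = y \<and>
      (\<forall>s\<in>{0..L}. \<forall>t\<in>{0..L}.
        \<bar>s - t\<bar> / k - c \<le> mdist m (\<gamma> s) (\<gamma> t) \<and> mdist m (\<gamma> s) (\<gamma> t) \<le> k * \<bar>s - t\<bar> + c))"

text \<open>Hyperbolicity in the sense of \<open>\<delta>\<close>-slim geodesic triangles.\<close>

definition hyperbolic :: "real \<Rightarrow> 'c metric \<Rightarrow> bool" where
  "hyperbolic \<delta> m \<longleftrightarrow>
    (\<forall>x\<in>mspace m. \<forall>y\<in>mspace m. \<forall>z\<in>mspace m. \<forall>\<alpha> \<beta> \<gamma>.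
      geodesic m x y \<alpha> \<longrightarrow> geodesic m y z \<beta> \<longrightarrow> geodesic m x z \<gamma> \<longrightarrow>
      \<alpha> ` {0..mdist m x y} \<subseteq> nbhd m \<delta> (\<beta> ` {0..mdist m y z} \<union> \<gamma> ` {0..mdist m x z}))"

definition isometry :: "'c metric \<Rightarrow> 'd metric \<Rightarrow> ('c \<Rightarrow> 'd) \<Rightarrow> bool" where
  "isometry m m' f \<longleftrightarrow>
    f ` mspace m = mspace m' \<and> (\<forall>x\<in>mspace m. \<forall>y\<in>mspace m. mdist m' (f x) (f y) = mdist m x y)"

definition isometric :: "'c metric \<Rightarrow> 'd metric \<Rightarrow> bool" where
  "isometric m m' \<longleftrightarrow> (\<exists>f. isometry m m' f)"


section \<open>Relative hierarchical hyperbolicity\<close>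

definition transverse :: "('w \<Rightarrow> 'w \<Rightarrow> bool) \<Rightarrow> ('w \<Rightarrow> 'w \<Rightarrow> bool) \<Rightarrow> 'w \<Rightarrow> 'w \<Rightarrow> bool" where
  "transverse nest orth V W \<longleftrightarrow> \<not> orth V W \<and> \<not> nest V W \<and> \<not> nest W V"

definition minimal_domain :: "'w set \<Rightarrow> ('w \<Rightarrow> 'w \<Rightarrow> bool) \<Rightarrow> 'w \<Rightarrow> bool" where
  "minimal_domain \<SS> nest W \<longleftrightarrow> W \<in> \<SS> \<and> (\<forall>V\<in>\<SS>. nest V W \<longrightarrow> V = W)"

definition maximal_domain :: "'w set \<Rightarrow> ('w \<Rightarrow> 'w \<Rightarrow> bool) \<Rightarrow> 'w \<Rightarrow> bool" where
  "maximal_domain \<SS> nest W \<longleftrightarrow> W \<in> \<SS> \<and> (\<forall>V\<in>\<SS>. nest W V \<longrightarrow> V = W)"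

text \<open>\<open>\<rho> V W\<close> is the set \<open>\<rho>\<^sup>V\<^sub>W \<subseteq> C(W)\<close>; it is constrained only where \<open>V\<close> is properly nested in or transverse to \<open>W\<close>.\<close>

locale hierarchy_data =
  fixes M :: "'p metric" and \<SS> :: "'w set"
    and nest :: "'w \<Rightarrow> 'w \<Rightarrow> bool" (infix "\<preceq>" 50)
    and orth :: "'w \<Rightarrow> 'w \<Rightarrow> bool"
    and C :: "'w \<Rightarrow> 'c metric"
    and proj :: "'w \<Rightarrow> 'p \<Rightarrow> 'c set"
    and \<rho> :: "'w \<Rightarrow> 'w \<Rightarrow> 'c set"
begin

abbreviation proper_nest :: "'w \<Rightarrow> 'w \<Rightarrow> bool" (infix "\<prec>" 50) where
  "V \<prec> W \<equiv> V \<preceq> W \<and> V \<noteq> W"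

abbreviation transv :: "'w \<Rightarrow> 'w \<Rightarrow> bool" where
  "transv \<equiv> transverse nest orth"

abbreviation d :: "'w \<Rightarrow> 'c set \<Rightarrow> 'c set \<Rightarrow> real" where
  "d W \<equiv> set_dist (C W)"

abbreviation dpi :: "'w \<Rightarrow> 'p \<Rightarrow> 'p \<Rightarrow> real" where
  "dpi W x y \<equiv> set_dist (C W) (proj W x) (proj W y)"

end

locale proto_hierarchy = hierarchy_data +
  fixes E :: real
  assumes E_pos: "0 < E"
    and quasi_geodesic: "quasi_geodesic_space M"
    and geodesic: "W \<in> \<SS> \<Longrightarrow> geodesic_space (C W)"
    and proj: "W \<in> \<SS> \<Longrightarrow> x \<in> mspace M \<Longrightarrow>
      proj W x \<subseteq> mspace (C W) \<and> proj W x \<noteq> {} \<and> diam_le (C W) (proj W x) E"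
    and proj_coarsely_Lipschitz: "W \<in> \<SS> \<Longrightarrow> x \<in> mspace M \<Longrightarrow> y \<in> mspace M \<Longrightarrow>
      dpi W x y \<le> E * mdist M x y + E"
    and proj_coarsely_onto: "W \<in> \<SS> \<Longrightarrow> mspace (C W) \<subseteq> nbhd (C W) E (\<Union>x\<in>mspace M. proj W x)"
    and nest_refl: "reflp_on \<SS> (\<preceq>)"
    and nest_antisym: "antisymp_on \<SS> (\<preceq>)"
    and nest_trans: "transp_on \<SS> (\<preceq>)"
    and unique_maximal: "\<SS> \<noteq> {} \<Longrightarrow> \<exists>!W. maximal_domain \<SS> (\<preceq>) W"
    and rho_nest: "V \<in> \<SS> \<Longrightarrow> W \<in> \<SS> \<Longrightarrow> V \<prec> W \<Longrightarrow>
      \<rho> V W \<subseteq> mspace (C W) \<and> \<rho> V W \<noteq> {} \<and> diam_le (C W) (\<rho> V W) E"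
    and orth_sym: "symp_on \<SS> orth"
    and orth_not_nest: "V \<in> \<SS> \<Longrightarrow> W \<in> \<SS> \<Longrightarrow> orth V W \<Longrightarrow> \<not> V \<preceq> W \<and> \<not> W \<preceq> V"
    and orth_nest: "U \<in> \<SS> \<Longrightarrow> V \<in> \<SS> \<Longrightarrow> W \<in> \<SS> \<Longrightarrow> V \<preceq> W \<Longrightarrow> orth W U \<Longrightarrow> orth V U"
    \<comment> \<open>the set in the other space is covered by exchanging \<open>V\<close> and \<open>W\<close>\<close>
    and rho_transv: "V \<in> \<SS> \<Longrightarrow> W \<in> \<SS> \<Longrightarrow> transv V W \<Longrightarrow>
      \<rho> V W \<subseteq> mspace (C W) \<and> \<rho> V W \<noteq> {} \<and> diam_le (C W) (\<rho> V W) E"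

locale relative_HHS = proto_hierarchy +
  assumes hyperbolicity: "W \<in> \<SS> \<Longrightarrow> minimal_domain \<SS> (\<preceq>) W \<or> hyperbolic E (C W)"
    and finite_complexity: "F \<subseteq> \<SS> \<Longrightarrow> pairwise (\<lambda>V W. V \<preceq> W \<or> W \<preceq> V) F \<Longrightarrow> finite F \<and> card F \<le> E"
    and containers: "W \<in> \<SS> \<Longrightarrow> U \<in> \<SS> \<Longrightarrow> U \<preceq> W \<Longrightarrow> \<exists>V\<in>\<SS>. V \<preceq> W \<and> orth V U \<Longrightarrow>
      \<exists>Q\<in>\<SS>. Q \<preceq> W \<and> (\<forall>V\<in>\<SS>. V \<preceq> W \<and> orth V U \<longrightarrow> V \<preceq> Q)"
    and uniqueness: "\<exists>\<theta> \<in> {0..} \<rightarrow> {0..}. \<forall>r\<ge>0. \<forall>x\<in>mspace M. \<forall>y\<in>mspace M.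
      mdist M x y \<ge> \<theta> r \<longrightarrow> (\<exists>W\<in>\<SS>. dpi W x y \<ge> r)"
    and bounded_geodesic_image:
      "V \<in> \<SS> \<Longrightarrow> W \<in> \<SS> \<Longrightarrow> V \<prec> W \<Longrightarrow> x \<in> mspace M \<Longrightarrow> y \<in> mspace M \<Longrightarrow> dpi V x y \<ge> E \<Longrightarrow>
       a \<in> proj W x \<Longrightarrow> b \<in> proj W y \<Longrightarrow> geodesic (C W) a b \<gamma> \<Longrightarrow>
       \<gamma> ` {0..mdist (C W) a b} \<inter> nbhd (C W) E (\<rho> V W) \<noteq> {}"
    and large_links: "W \<in> \<SS> \<Longrightarrow> x \<in> mspace M \<Longrightarrow> y \<in> mspace M \<Longrightarrow>
      \<exists>F\<subseteq>{V \<in> \<SS>. V \<prec> W}. finite F \<and> card F \<le> E * dpi W x y + E \<and>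
        (\<forall>U\<in>\<SS>. U \<prec> W \<longrightarrow> (\<exists>V\<in>F. U \<preceq> V) \<or> dpi U x y \<le> E)"
    and consistency_transv: "V \<in> \<SS> \<Longrightarrow> W \<in> \<SS> \<Longrightarrow> transv V W \<Longrightarrow> x \<in> mspace M \<Longrightarrow>
      min (d W (proj W x) (\<rho> V W)) (d V (proj V x) (\<rho> W V)) \<le> E"
    and consistency_rho: "U \<in> \<SS> \<Longrightarrow> V \<in> \<SS> \<Longrightarrow> W \<in> \<SS> \<Longrightarrow> U \<preceq> V \<Longrightarrow>
      V \<prec> W \<or> (transv V W \<and> \<not> orth W U) \<Longrightarrow> d W (\<rho> U W) (\<rho> V W) \<le> E"
    and partial_realisation: "finite F \<Longrightarrow> F \<subseteq> \<SS> \<Longrightarrow> pairwise orth F \<Longrightarrow> \<forall>V\<in>F. p V \<in> mspace (C V) \<Longrightarrow>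
      \<exists>x\<in>mspace M. \<forall>V\<in>F. d V (proj V x) {p V} \<le> E \<and>
        (\<forall>W\<in>\<SS>. V \<prec> W \<or> transv W V \<longrightarrow> d W (proj W x) (\<rho> V W) \<le> E)"

text \<open>
  \<open>T\<close> is the finite generating set of \<open>G\<close>, \<open>act\<close> the action of \<open>G\<close> on \<open>\<SS>\<close> and
  \<open>iso g W\<close> the isometry \<open>g\<^sub>W : C(W) \<rightarrow> C(gW)\<close>.
\<close>

locale relative_HHG =
  group_action G \<SS> act + relative_HHS "cayley_graph G T" \<SS> nest orth C proj \<rho> E
  for G :: "('g, 'm) monoid_scheme" and T :: "'g set" and \<SS> :: "'w set"
    and nest :: "'w \<Rightarrow> 'w \<Rightarrow> bool" (infix "\<preceq>" 50) and orth and C :: "'w \<Rightarrow> 'c metric"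
    and proj and \<rho> and E and act :: "'g \<Rightarrow> 'w \<Rightarrow> 'w" +
  fixes iso :: "'g \<Rightarrow> 'w \<Rightarrow> 'c \<Rightarrow> 'c"
  assumes finite_T: "finite T"
    and generates_T: "generates G T"
    and finitely_many_orbits: "finite (orbits G \<SS> act)"
    and act_nest: "g \<in> carrier G \<Longrightarrow> V \<in> \<SS> \<Longrightarrow> W \<in> \<SS> \<Longrightarrow> act g V \<preceq> act g W \<longleftrightarrow> V \<preceq> W"
    and act_orth: "g \<in> carrier G \<Longrightarrow> V \<in> \<SS> \<Longrightarrow> W \<in> \<SS> \<Longrightarrow> orth (act g V) (act g W) \<longleftrightarrow> orth V W"
    and act_transv: "g \<in> carrier G \<Longrightarrow> V \<in> \<SS> \<Longrightarrow> W \<in> \<SS> \<Longrightarrow> transv (act g V) (act g W) \<longleftrightarrow> transv V W"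
    and iso_isometry: "g \<in> carrier G \<Longrightarrow> W \<in> \<SS> \<Longrightarrow> isometry (C W) (C (act g W)) (iso g W)"
    and iso_mult: "g \<in> carrier G \<Longrightarrow> h \<in> carrier G \<Longrightarrow> W \<in> \<SS> \<Longrightarrow> p \<in> mspace (C W) \<Longrightarrow>
      iso (g \<otimes>\<^bsub>G\<^esub> h) W p = iso g (act h W) (iso h W p)"
    and iso_proj: "g \<in> carrier G \<Longrightarrow> W \<in> \<SS> \<Longrightarrow> x \<in> mspace (cayley_graph G T) \<Longrightarrow>
      d (act g W) (iso g W ` proj W x) (proj (act g W) (cayley_translate G g x)) \<le> E"
    and iso_rho: "g \<in> carrier G \<Longrightarrow> V \<in> \<SS> \<Longrightarrow> W \<in> \<SS> \<Longrightarrow> transv V W \<or> V \<prec> W \<Longrightarrow>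
      d (act g W) (iso g W ` \<rho> V W) (\<rho> (act g V) (act g W)) \<le> E"

end

(*
  The whole hierarchy is read off the heads of group elements: the head of x of type v is the maximal
  prefix of x in the vertex group of v. Heads determine the gate (closest point projection) of x in a
  parabolic subgroup <L>, and they play the role of hyperplanes. A domain is a parallelism class of
  cosets g<L>; its space is the Cayley graph of <L> with respect to all proper parabolic subgroups,
  or to a finite generating set if L is a vertex, and projections are given by gates.

  Two facts drive everything. First, the gate in <L> of a coset x<D> lies in a coset of a proper
  parabolic subgroup of <L>, unless L is contained in D and the two are parallel; this yields small
  relative projections, consistency, large links and uniqueness. Secondly, a step inside a proper
  parabolic subgroup of <L> changes the gate in <O>, where O is a proper subset of L, only near <O>;
  this yields the bounded geodesic image property and, by a bottleneck argument, hyperbolicity.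
*)
theory Submission
  imports Defs
begin

section \<open>Gates in groups with heads\<close>

text \<open>The theory uses only the laws of heads stated in the locale \<open>graph_group\<close>;
  that the graph product satisfies them is a separate matter, settled by an action on reduced words.
  The obstacle that shapes the proof is an asymmetry: heads describe prefixes, hence multiplication
  on the left, whereas paths in a Cayley graph multiply on the right. \<open>s_right_mult\<close>
  links the two sides: a letter on the right alters a head only if the edge crosses the
  corresponding hyperplane. Relative projections are images of whole parallelism classes, that is of
  cosets of \<open>par (st \<Lambda>)\<close>, not of single cosets of \<open>par \<Lambda>\<close>.
  Nested or orthogonal domains then share an element, whose image lies in both relative projections.
  This makes consistency of nested domains, partial realisation and equivariance hold with distance
  0, and reduces containers and common base points to the Helly property of cosets. All metric
  arguments are carried out with integer word lengths along discrete paths; the realisations enter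
  only through the rounding of points to vertices, at a cost of 1 per point.\<close>

primrec prods :: "('g, 'm) monoid_scheme \<Rightarrow> 'g set \<Rightarrow> nat \<Rightarrow> 'g set" where
  "prods G S 0 = {\<one>\<^bsub>G\<^esub>}"
| "prods G S (Suc n) = {t \<otimes>\<^bsub>G\<^esub> x | t x. t \<in> S \<and> x \<in> prods G S n}"

definition wlen :: "('g, 'm) monoid_scheme \<Rightarrow> 'g set \<Rightarrow> 'g \<Rightarrow> nat" where
  "wlen G S x = (LEAST n. x \<in> prods G S n)"

text \<open>The identity is included so that products of exactly \<open>n\<close> factors are the
  same as products of at most \<open>n\<close> factors.\<close>

definition symset :: "('g, 'm) monoid_scheme \<Rightarrow> 'g set \<Rightarrow> bool" where
  "symset G S \<longleftrightarrow> S \<subseteq> carrier G \<and> \<one>\<^bsub>G\<^esub> \<in> S \<and> (\<forall>t\<in>S. inv\<^bsub>G\<^esub> t \<in> S)"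

text \<open>The multiplication does not depend on the carrier, so lengths in a parabolic subgroup,
  viewed as a group of its own, can be computed in the ambient group.\<close>

lemma prods_carrier_update [simp]: "prods (G\<lparr>carrier := Y\<rparr>) S n = prods G S n"
  by (induction n) auto

lemma wlen_carrier_update [simp]: "wlen (G\<lparr>carrier := Y\<rparr>) S x = wlen G S x"
  by (simp add: wlen_def)

section \<open>Products and word lengths\<close>

context group
begin

lemma inv_cancel [simp]:
  "a \<in> carrier G \<Longrightarrow> x \<in> carrier G \<Longrightarrow> inv a \<otimes> (a \<otimes> x) = x"
  "a \<in> carrier G \<Longrightarrow> x \<in> carrier G \<Longrightarrow> a \<otimes> (inv a \<otimes> x) = x"
  by (simp_all flip: m_assoc)

lemma symset_closed: "symset G S \<Longrightarrow> t \<in> S \<Longrightarrow> t \<in> carrier G"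
  by (auto simp: symset_def)

lemma prods_closed: "symset G S \<Longrightarrow> x \<in> prods G S n \<Longrightarrow> x \<in> carrier G"
  by (induction n arbitrary: x) (auto simp: symset_closed)

lemma prods_Suc_mono: "symset G S \<Longrightarrow> x \<in> prods G S n \<Longrightarrow> x \<in> prods G S (Suc n)"
proof -
  assume S: "symset G S" and x: "x \<in> prods G S n"
  then have "x = \<one> \<otimes> x" "\<one> \<in> S" using prods_closed[OF S x] by (auto simp: symset_def)
  then show ?thesis using x unfolding prods.simps by blast
qed

lemma prods_mono: "symset G S \<Longrightarrow> m \<le> n \<Longrightarrow> x \<in> prods G S m \<Longrightarrow> x \<in> prods G S n"
  by (rotate_tac 1, induction n rule: dec_induct) (auto intro: prods_Suc_mono simp del: prods.simps)

lemma prods_mult: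
  assumes S: "symset G S" and "x \<in> prods G S m" and y: "y \<in> prods G S n"
  shows "x \<otimes> y \<in> prods G S (m + n)"
  using assms(2)
proof (induction m arbitrary: x)
  case (Suc m)
  then obtain t x' where t: "x = t \<otimes> x'" "t \<in> S" "x' \<in> prods G S m" by auto
  have "x \<otimes> y = t \<otimes> (x' \<otimes> y)"
    using t S y by (simp add: m_assoc symset_closed prods_closed)
  then show ?case using Suc.IH[OF t(3)] t(2) by auto
qed (use S y prods_closed in auto)

lemma prods_single: "symset G S \<Longrightarrow> t \<in> S \<Longrightarrow> t \<in> prods G S 1"
  by (auto simp: symset_closed intro!: exI[of _ t])

lemma prods_inv:
  assumes S: "symset G S" and "x \<in> prods G S n"
  shows "inv x \<in> prods G S n"
  using assms(2)
proof (induction n arbitrary: x)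
  case (Suc n)
  then obtain t x' where t: "x = t \<otimes> x'" "t \<in> S" "x' \<in> prods G S n" by auto
  have "inv x = inv x' \<otimes> inv t"
    using t S by (simp add: inv_mult_group symset_closed prods_closed)
  moreover have "inv t \<in> prods G S 1" using S t by (intro prods_single) (auto simp: symset_def)
  ultimately show ?case using prods_mult[OF S Suc.IH[OF t(3)], of "inv t" 1] by simp
qed auto

text \<open>On \<open>Y\<close> the \<open>LEAST\<close> in \<open>wlen\<close> is taken over a
  non-empty set; elsewhere its value is unspecified.\<close>

definition total_gen :: "'a set \<Rightarrow> 'a set \<Rightarrow> bool" where
  "total_gen S Y \<longleftrightarrow> symset G S \<and> Y \<subseteq> (\<Union>n. prods G S n)"

lemma wlen_prods: "total_gen S Y \<Longrightarrow> x \<in> Y \<Longrightarrow> x \<in> prods G S (wlen G S x)"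
  unfolding wlen_def total_gen_def by (rule LeastI_ex) auto

lemma wlen_le: "x \<in> prods G S n \<Longrightarrow> wlen G S x \<le> n"
  unfolding wlen_def by (rule Least_le)

lemma wlen_le_iff: "total_gen S Y \<Longrightarrow> x \<in> Y \<Longrightarrow> wlen G S x \<le> n \<longleftrightarrow> x \<in> prods G S n"
  using wlen_le wlen_prods prods_mono unfolding total_gen_def by metis

lemma wlen_one [simp]: "wlen G S \<one> = 0"
  using wlen_le[of \<one> S 0] by simp

lemma wlen_mult:
  assumes "total_gen S Y" "x \<in> Y" "y \<in> Y"
  shows "wlen G S (x \<otimes> y) \<le> wlen G S x + wlen G S y"
  using assms by (intro wlen_le prods_mult wlen_prods) (auto simp: total_gen_def)

lemma wlen_inv:
  assumes "total_gen S Y" "x \<in> Y" "inv x \<in> Y" "x \<in> carrier G"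
  shows "wlen G S (inv x) = wlen G S x"
  using assms prods_inv[of S x "wlen G S x"] prods_inv[of S "inv x" "wlen G S (inv x)"]
    wlen_prods[of S Y] wlen_le[of "inv x" S] wlen_le[of x S]
  by (intro antisym) (auto simp: total_gen_def)

lemma total_gen_generate:
  assumes T: "T \<subseteq> carrier G"
  shows "total_gen (insert \<one> (T \<union> (\<lambda>x. inv x) ` T)) (generate G T)"
proof -
  let ?S = "insert \<one> (T \<union> (\<lambda>x. inv x) ` T)"
  have S: "symset G ?S" using T by (auto simp: symset_def)
  have "\<exists>n. x \<in> prods G ?S n" if "x \<in> generate G T" for x
    using that
  proof (induction rule: generate.induct)
    case one then show ?case by (intro exI[of _ 0]) simp
  next
    case (incl h) then show ?case using prods_single[OF S] by blast
  next
    case (inv h) then show ?case using prods_single[OF S] by blast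
  next
    case (eng h1 h2) then show ?case using prods_mult[OF S] by blast
  qed
  then show ?thesis using S by (auto simp: total_gen_def)
qed

end

text \<open>
  \<open>s v x\<close> is the head of \<open>x\<close> of type \<open>v\<close>: the maximal prefix of \<open>x\<close> in the vertex group \<open>A v\<close>.
  The hyperplane given by \<open>g\<close> and \<open>v\<close> separates \<open>x\<close> from \<open>y\<close> iff \<open>s v (inv g \<otimes> x) \<noteq> s v (inv g \<otimes> y)\<close>.
  Vertices outside \<open>V\<close> carry trivial groups, so that no lemma has to assume \<open>v \<in> V\<close>.
\<close>

locale graph_group = group P for P (structure) +
  fixes V :: "'v set" and adj :: "'v \<Rightarrow> 'v \<Rightarrow> bool" and A :: "'v \<Rightarrow> 'a set" and s :: "'v \<Rightarrow> 'a \<Rightarrow> 'a"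
  assumes finite_V: "finite V"
    and adj_sym: "adj v w \<Longrightarrow> adj w v"
    and adj_irrefl: "\<not> adj v v"
    and A_subgroup: "subgroup (A v) P"
    and A_outside: "v \<notin> V \<Longrightarrow> A v = {\<one>}"
    and A_commute: "adj v w \<Longrightarrow> a \<in> A v \<Longrightarrow> b \<in> A w \<Longrightarrow> a \<otimes> b = b \<otimes> a"
    and generate_A: "carrier P \<subseteq> generate P (\<Union>v. A v)"
    and s_in: "x \<in> carrier P \<Longrightarrow> s v x \<in> A v"
    and s_one [simp]: "s v \<one> = \<one>"
    and s_mult: "a \<in> A v \<Longrightarrow> x \<in> carrier P \<Longrightarrow> s v (a \<otimes> x) = a \<otimes> s v x"
    and s_adj: "a \<in> A v \<Longrightarrow> x \<in> carrier P \<Longrightarrow> adj v w \<Longrightarrow> s w (a \<otimes> x) = s w x"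
    and s_nonadj: "x \<in> carrier P \<Longrightarrow> v \<noteq> w \<Longrightarrow> \<not> adj v w \<Longrightarrow> s v x = \<one> \<or> s w x = \<one>"
begin

section \<open>Parabolic subgroups and reduced expressions\<close>

definition par :: "'v set \<Rightarrow> 'a set" where
  "par \<Lambda> = generate P (\<Union>v\<in>\<Lambda>. A v)"

definition lk :: "'v set \<Rightarrow> 'v set" where
  "lk \<Lambda> = {v. \<forall>w\<in>\<Lambda>. adj v w}"

text \<open>Cosets of \<open>par (st \<Lambda>)\<close> are the parallelism classes of cosets of
  \<open>par \<Lambda>\<close>, because the link factor commutes with
  \<open>par \<Lambda>\<close>.\<close>

definition st :: "'v set \<Rightarrow> 'v set" where
  "st \<Lambda> = \<Lambda> \<union> lk \<Lambda>"

lemma A_closed [simp]: "a \<in> A v \<Longrightarrow> a \<in> carrier P"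
  by (rule subgroup.mem_carrier[OF A_subgroup])

lemma A_one [simp]: "\<one> \<in> A v"
  by (rule subgroup.one_closed[OF A_subgroup])

lemma A_mult [simp]: "a \<in> A v \<Longrightarrow> b \<in> A v \<Longrightarrow> a \<otimes> b \<in> A v"
  by (rule subgroup.m_closed[OF A_subgroup])

lemma A_inv [simp]: "a \<in> A v \<Longrightarrow> inv a \<in> A v"
  by (rule subgroup.m_inv_closed[OF A_subgroup])

lemma s_closed [simp]: "x \<in> carrier P \<Longrightarrow> s v x \<in> carrier P"
  using s_in A_closed by blast

lemma par_subgroup: "subgroup (par \<Lambda>) P"
  unfolding par_def by (intro generate_is_subgroup) auto

lemma par_closed [simp]: "x \<in> par \<Lambda> \<Longrightarrow> x \<in> carrier P"
  by (rule subgroup.mem_carrier[OF par_subgroup])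

lemma par_one [simp]: "\<one> \<in> par \<Lambda>"
  by (rule subgroup.one_closed[OF par_subgroup])

lemma par_mult [simp]: "x \<in> par \<Lambda> \<Longrightarrow> y \<in> par \<Lambda> \<Longrightarrow> x \<otimes> y \<in> par \<Lambda>"
  by (rule subgroup.m_closed[OF par_subgroup])

lemma par_inv [simp]: "x \<in> par \<Lambda> \<Longrightarrow> inv x \<in> par \<Lambda>"
  by (rule subgroup.m_inv_closed[OF par_subgroup])

lemma par_inv_iff: "x \<in> carrier P \<Longrightarrow> inv x \<in> par \<Lambda> \<longleftrightarrow> x \<in> par \<Lambda>"
  using par_inv[of x] par_inv[of "inv x"] by auto

lemma par_mult_iff: "x \<in> par \<Lambda> \<Longrightarrow> y \<in> carrier P \<Longrightarrow> x \<otimes> y \<in> par \<Lambda> \<longleftrightarrow> y \<in> par \<Lambda>"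
  using par_mult[of "inv x" \<Lambda> "x \<otimes> y"] by auto

lemma par_mult_iff2: "x \<in> par \<Lambda> \<Longrightarrow> y \<in> carrier P \<Longrightarrow> y \<otimes> x \<in> par \<Lambda> \<longleftrightarrow> y \<in> par \<Lambda>"
  using par_mult[of "y \<otimes> x" \<Lambda> "inv x"] by (auto simp: m_assoc)

lemma A_par: "a \<in> A v \<Longrightarrow> v \<in> \<Lambda> \<Longrightarrow> a \<in> par \<Lambda>"
  unfolding par_def by (intro generate.incl) auto

lemma cons_par: "b \<in> A u \<Longrightarrow> u \<in> \<Lambda> \<Longrightarrow> y \<in> par \<Lambda> \<Longrightarrow> b \<otimes> y \<in> par \<Lambda>"
  using A_par par_mult by blast

lemma par_mono: "\<Lambda> \<subseteq> \<Omega> \<Longrightarrow> par \<Lambda> \<subseteq> par \<Omega>"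
  unfolding par_def by (intro mono_generate) auto

lemma par_mono': "x \<in> par \<Lambda> \<Longrightarrow> \<Lambda> \<subseteq> \<Omega> \<Longrightarrow> x \<in> par \<Omega>"
  using par_mono by blast

lemma par_UNIV: "par UNIV = carrier P"
  using generate_A par_closed unfolding par_def by auto

text \<open>Apart from the type of the new syllable, only heads adjacent to it survive: a head of
  another type would coexist with the head \<open>b\<close>, against
  \<open>s_nonadj\<close>.\<close>

lemma s_cons:
  assumes x: "x \<in> carrier P" and "s u x = \<one>" and b: "b \<in> A u" and "b \<noteq> \<one>"
  shows "s w (b \<otimes> x) = (if w = u then b else if adj u w then s w x else \<one>)"
  using assms s_mult[OF b x] s_adj[OF b x, of w] s_nonadj[of "b \<otimes> x" u w] by auto

lemma s_rest:
  assumes "x \<in> carrier P"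
  shows "s u (inv (s u x) \<otimes> x) = \<one>"
  using s_mult[of "inv (s u x)" u x] s_in[OF assms, of u] assms by simp

text \<open>Each new syllable finds no head of its own type to merge with, so these are the elements
  with a reduced expression over \<open>\<Lambda>\<close>.\<close>

inductive red :: "'v set \<Rightarrow> 'a \<Rightarrow> bool" for \<Lambda> where
  red_one: "red \<Lambda> \<one>"
| red_cons: "red \<Lambda> y \<Longrightarrow> u \<in> \<Lambda> \<Longrightarrow> b \<in> A u \<Longrightarrow> b \<noteq> \<one> \<Longrightarrow> s u y = \<one> \<Longrightarrow> red \<Lambda> (b \<otimes> y)"

lemma red_closed: "red \<Lambda> x \<Longrightarrow> x \<in> carrier P"
  by (induction rule: red.induct) auto

lemma red_par: "red \<Lambda> x \<Longrightarrow> x \<in> par \<Lambda>"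
  by (induction rule: red.induct) (auto intro: cons_par)

text \<open>Prepares multiplication by a letter of type \<open>u\<close>: once the head of that type
  is split off, the letter can absorb it and the expression stays reduced.\<close>

lemma red_split: "red \<Lambda> x \<Longrightarrow> red \<Lambda> (inv (s u x) \<otimes> x)"
proof (induction rule: red.induct)
  case (red_cons y w b)
  have y: "y \<in> carrier P" using red_cons(1) red_closed by blast
  consider "w = u" | "w \<noteq> u" "adj w u" | "w \<noteq> u" "\<not> adj w u" by blast
  then show ?case
  proof cases
    case 1
    then show ?thesis using red_cons y s_cons[OF y, of w b u] by simp
  next
    case 2
    \<comment> \<open>\<open>w\<close> is adjacent to \<open>u\<close>, so the head of
      \<open>y\<close> can be pulled out in front of \<open>b\<close>.\<close>
    let ?y = "inv (s u y) \<otimes> y"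
    have a: "inv (s u y) \<in> A u" using s_in[OF y] by simp
    have "inv (s u y) \<otimes> (b \<otimes> y) = b \<otimes> ?y"
      using A_commute[OF 2(2) red_cons(3) a] y a red_cons(3) by (simp flip: m_assoc)
    moreover have "s w ?y = \<one>" using s_adj[OF a y, of w] 2 red_cons by (simp add: adj_sym)
    ultimately show ?thesis
      using red.red_cons[OF red_cons.IH, of w b] red_cons 2 s_cons[OF y, of w b u] by simp
  next
    case 3
    then show ?thesis using red.red_cons[OF red_cons(1), of w b] red_cons y s_cons[OF y, of w b u] by simp
  qed
qed (auto intro: red.intros)

lemma red_A_mult:
  assumes "red \<Lambda> x" "u \<in> \<Lambda>" "a \<in> A u"
  shows "red \<Lambda> (a \<otimes> x)"
proof -
  have x: "x \<in> carrier P" using assms red_closed by blast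
  let ?x = "inv (s u x) \<otimes> x"
  have c: "a \<otimes> s u x \<in> A u" using s_in[OF x] assms by simp
  have "a \<otimes> x = (a \<otimes> s u x) \<otimes> ?x" using x assms by (simp add: m_assoc)
  then show ?thesis
    using red_split[OF assms(1), of u] s_rest[OF x, of u] c assms(2) x
    by (cases "a \<otimes> s u x = \<one>") (auto intro!: red_cons)
qed

text \<open>Reduced elements contain the identity and are closed under left multiplication by
  letters with type in \<open>\<Lambda>\<close>, hence by all of
  \<open>par \<Lambda>\<close>.\<close>

lemma par_red: "x \<in> par \<Lambda> \<Longrightarrow> red \<Lambda> x"
proof -
  have "\<forall>x. red \<Lambda> x \<longrightarrow> red \<Lambda> (h \<otimes> x)" if "h \<in> par \<Lambda>" for h
    using that unfolding par_def
  proof (induction rule: generate.induct)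
    case one then show ?case using red_closed by auto
  next
    case (incl h) then show ?case using red_A_mult by auto
  next
    case (inv h) then show ?case using red_A_mult A_inv by auto
  next
    case (eng h1 h2)
    then have "h1 \<in> carrier P" "h2 \<in> carrier P" using par_closed unfolding par_def by blast+
    then show ?case using eng by (metis m_assoc red_closed)
  qed
  then show "x \<in> par \<Lambda> \<Longrightarrow> red \<Lambda> x" using red_one par_closed r_one by metis
qed

text \<open>The induction used throughout. The peeled syllable is not trivial and the rest has no
  head of its type, so \<open>s_cons\<close> computes all heads of
  \<open>b \<otimes> y\<close>.\<close>

lemma par_induct [consumes 1, case_names one cons]:
  assumes "x \<in> par \<Lambda>" and "Q \<one>"
    and "\<And>y u b. y \<in> par \<Lambda> \<Longrightarrow> Q y \<Longrightarrow> u \<in> \<Lambda> \<Longrightarrow> b \<in> A u \<Longrightarrow> b \<noteq> \<one> \<Longrightarrow> s u y = \<one> \<Longrightarrow> Q (b \<otimes> y)"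
  shows "Q x"
  using par_red[OF assms(1)] by induction (auto intro: assms(2,3) red_par)

lemma s_par: "x \<in> par \<Lambda> \<Longrightarrow> v \<notin> \<Lambda> \<Longrightarrow> s v x = \<one>"
  by (induction rule: par_induct) (auto simp: s_cons)

text \<open>The outermost syllable of a reduced expression is a head. The uniqueness of gates rests
  on this.\<close>

lemma s_trivial:
  assumes "x \<in> par \<Lambda>" "\<forall>v\<in>\<Lambda>. s v x = \<one>"
  shows "x = \<one>"
  using par_red[OF assms(1)]
proof cases
  case (red_cons y u b)
  then show ?thesis using assms(2) s_cons[OF red_closed[OF red_cons(2)], of u b u] by auto
qed

text \<open>Since \<open>y\<close> has no head with type in \<open>\<Lambda>\<close>, nothing behind
  \<open>m\<close> can become or change such a head of \<open>m \<otimes> y\<close>.\<close>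

lemma s_prefix:
  assumes "m \<in> par \<Lambda>" "y \<in> carrier P" "\<forall>v\<in>\<Lambda>. s v y = \<one>"
  shows "\<forall>v\<in>\<Lambda>. s v (m \<otimes> y) = s v m"
  using assms(1)
proof (induction rule: par_induct)
  case (cons x u b)
  then have "s v (b \<otimes> (x \<otimes> y)) = s v (b \<otimes> x)" if "v \<in> \<Lambda>" for v
    using that assms(2) s_cons[of "x \<otimes> y" u b v] s_cons[of x u b v] by auto
  then show ?case using cons assms(2) by (simp add: m_assoc)
qed (use assms in simp)

text \<open>\<open>gate \<Lambda> x\<close> is the maximal prefix of \<open>x\<close> in \<open>par \<Lambda>\<close>, that is, its closest point to \<open>x\<close>.\<close>

definition gate :: "'v set \<Rightarrow> 'a \<Rightarrow> 'a" where
  "gate \<Lambda> x = (THE l. l \<in> par \<Lambda> \<and> (\<forall>v\<in>\<Lambda>. s v (inv l \<otimes> x) = \<one>))"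

section \<open>Existence, uniqueness and recursion of gates\<close>

lemma gate_unique:
  assumes x: "x \<in> carrier P" and l: "l \<in> par \<Lambda>" "\<forall>v\<in>\<Lambda>. s v (inv l \<otimes> x) = \<one>"
    and m: "m \<in> par \<Lambda>" "\<forall>v\<in>\<Lambda>. s v (inv m \<otimes> x) = \<one>"
  shows "l = m"
proof -
  have e: "inv m \<otimes> l \<otimes> (inv l \<otimes> x) = inv m \<otimes> x" using assms by (simp add: m_assoc)
  have "\<forall>v\<in>\<Lambda>. s v (inv m \<otimes> l) = \<one>"
    using s_prefix[of "inv m \<otimes> l" \<Lambda> "inv l \<otimes> x"] assms unfolding e by auto
  then have "inv m \<otimes> l = \<one>" using s_trivial[of "inv m \<otimes> l" \<Lambda>] l m by simp
  then show ?thesis using l m by (metis inv_cancel(2) par_closed r_one)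
qed

lemma commute_A_par:
  assumes "a \<in> A u" "x \<in> par (lk {u})"
  shows "a \<otimes> x = x \<otimes> a"
  using assms(2)
proof (induction rule: par_induct)
  case (cons y w b)
  have "a \<otimes> b = b \<otimes> a" using cons assms A_commute by (auto simp: lk_def adj_sym)
  then show ?case using cons assms by (simp flip: m_assoc) (simp add: m_assoc)
qed (use assms in simp)

text \<open>Induction on a reduced expression of \<open>x\<close>, for all \<open>\<Lambda>\<close>
  at once: behind a syllable of type \<open>u\<close> outside \<open>\<Lambda>\<close>, only a
  prefix commuting with that syllable can come to the front, so the gate is that of the smaller type
  \<open>\<Lambda> \<inter> lk {u}\<close>.\<close>

lemma gate_ex:
  assumes "x \<in> carrier P"
  shows "\<exists>l. l \<in> par \<Lambda> \<and> (\<forall>v\<in>\<Lambda>. s v (inv l \<otimes> x) = \<one>)"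
proof -
  have "\<forall>\<Lambda>. \<exists>l. l \<in> par \<Lambda> \<and> (\<forall>v\<in>\<Lambda>. s v (inv l \<otimes> x) = \<one>)" if "x \<in> par UNIV"
    using that
  proof (induction rule: par_induct)
    case one show ?case by (auto intro!: exI[of _ \<one>])
  next
    case (cons y u b)
    show ?case
    proof (rule allI)
      fix \<Lambda>
      show "\<exists>l. l \<in> par \<Lambda> \<and> (\<forall>v\<in>\<Lambda>. s v (inv l \<otimes> (b \<otimes> y)) = \<one>)"
      proof (cases "u \<in> \<Lambda>")
        case True
        obtain l where "l \<in> par \<Lambda>" "\<forall>v\<in>\<Lambda>. s v (inv l \<otimes> y) = \<one>" using cons by blast
        then show ?thesis using cons True
          by (intro exI[of _ "b \<otimes> l"]) (auto simp: A_par inv_mult_group m_assoc)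
      next
        case False
        let ?L = "\<Lambda> \<inter> lk {u}"
        obtain l where l: "l \<in> par ?L" "\<forall>v\<in>?L. s v (inv l \<otimes> y) = \<one>" using cons by blast
        have li: "inv l \<in> par (lk {u})" using par_mono'[OF l(1)] by auto
        have c: "inv l \<otimes> (b \<otimes> y) = b \<otimes> (inv l \<otimes> y)"
          using commute_A_par[OF \<open>b \<in> A u\<close> li] cons l by (simp flip: m_assoc)
        have "s u (m \<otimes> y) = \<one>" if "m \<in> par (lk {u})" for m
          using that
        proof (induction rule: par_induct)
          case (cons z w d)
          then show ?case using s_adj[of d w "z \<otimes> y" u] \<open>y \<in> par UNIV\<close> by (simp add: lk_def m_assoc)
        qed (use cons in simp)
        then have "s u (inv l \<otimes> y) = \<one>" using li by blast
        then have "s v (b \<otimes> (inv l \<otimes> y)) = \<one>" if "v \<in> \<Lambda>" for v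
          using that s_cons[of "inv l \<otimes> y" u b v] cons l False by (auto simp: lk_def adj_sym)
        then show ?thesis using l c by (intro exI[of _ l]) (auto intro: par_mono')
      qed
    qed
  qed
  then show ?thesis using assms par_UNIV by blast
qed

lemma
  assumes "x \<in> carrier P"
  shows gate_in: "gate \<Lambda> x \<in> par \<Lambda>" and s_gate: "v \<in> \<Lambda> \<Longrightarrow> s v (inv (gate \<Lambda> x) \<otimes> x) = \<one>"
proof -
  have "\<exists>!l. l \<in> par \<Lambda> \<and> (\<forall>v\<in>\<Lambda>. s v (inv l \<otimes> x) = \<one>)"
    using gate_ex[OF assms, of \<Lambda>] gate_unique[OF assms] by blast
  from theI'[OF this] show "gate \<Lambda> x \<in> par \<Lambda>" and "v \<in> \<Lambda> \<Longrightarrow> s v (inv (gate \<Lambda> x) \<otimes> x) = \<one>"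
    unfolding gate_def by auto
qed

lemma gate_closed [simp]: "x \<in> carrier P \<Longrightarrow> gate \<Lambda> x \<in> carrier P"
  using gate_in[of x \<Lambda>] by (rule par_closed)

lemma gateI:
  assumes "x \<in> carrier P" "l \<in> par \<Lambda>" "\<And>v. v \<in> \<Lambda> \<Longrightarrow> s v (inv l \<otimes> x) = \<one>"
  shows "gate \<Lambda> x = l"
  using gate_unique[OF assms(1) gate_in[OF assms(1)] _ assms(2)] s_gate[OF assms(1)] assms(3) by blast

lemma gate_mult:
  assumes m: "m \<in> par \<Lambda>" and x: "x \<in> carrier P"
  shows "gate \<Lambda> (m \<otimes> x) = m \<otimes> gate \<Lambda> x"
  using assms gate_in[OF x, of \<Lambda>] s_gate[OF x, of _ \<Lambda>]
  by (intro gateI) (auto simp: inv_mult_group m_assoc)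

lemma gate_one [simp]: "gate \<Lambda> \<one> = \<one>"
  by (rule gateI) auto

lemma gate_par [simp]: "x \<in> par \<Lambda> \<Longrightarrow> gate \<Lambda> x = x"
  using gate_mult[of x \<Lambda> \<one>] by simp

lemma gate_eq_one_iff: "x \<in> carrier P \<Longrightarrow> gate \<Lambda> x = \<one> \<longleftrightarrow> (\<forall>v\<in>\<Lambda>. s v x = \<one>)"
  using s_gate[of x _ \<Lambda>] gateI[of x \<one> \<Lambda>] by auto

lemma s_of_gate:
  assumes "x \<in> carrier P" "v \<in> \<Lambda>"
  shows "s v (gate \<Lambda> x) = s v x"
  using s_prefix[of "gate \<Lambda> x" \<Lambda> "inv (gate \<Lambda> x) \<otimes> x"] assms gate_in s_gate by auto

text \<open>Dividing by the inner gate is compatible with the outer gate, and heads with type in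
  \<open>\<Omega>\<close> are already visible on the gate in the larger type.\<close>

lemma gate_gate:
  assumes x: "x \<in> carrier P" and "\<Omega> \<subseteq> \<Lambda>"
  shows "gate \<Omega> (gate \<Lambda> x) = gate \<Omega> x"
proof -
  let ?o = "gate \<Omega> (gate \<Lambda> x)"
  have o1: "?o \<in> par \<Omega>" using gate_in[OF gate_closed[OF x]] .
  note o = o1 par_mono'[OF o1 assms(2)]
  have "gate \<Omega> x = ?o"
  proof (rule gateI[OF x o(1)])
    fix v assume v: "v \<in> \<Omega>"
    have c: "inv ?o \<otimes> x \<in> carrier P" using par_closed[OF o(1)] x by simp
    have "s v (inv ?o \<otimes> x) = s v (gate \<Lambda> (inv ?o \<otimes> x))" using s_of_gate[OF c, of v \<Lambda>] v assms(2) by auto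
    also have "gate \<Lambda> (inv ?o \<otimes> x) = inv ?o \<otimes> gate \<Lambda> x" using gate_mult[OF par_inv[OF o(2)] x] .
    also have "s v \<dots> = \<one>" using s_gate[OF gate_closed[OF x] v] .
    finally show "s v (inv ?o \<otimes> x) = \<one>" .
  qed
  then show ?thesis by simp
qed

lemma s_lk:
  assumes "m \<in> par (lk {u})" "x \<in> carrier P"
  shows "s u (m \<otimes> x) = s u x"
  using assms(1)
proof (induction rule: par_induct)
  case (cons z w d)
  then show ?case using s_adj[of d w "z \<otimes> x" u] assms by (simp add: lk_def m_assoc)
qed (use assms in simp)

text \<open>Makes the gate a recursion over syllables, so that inclusions such as
  \<open>gate_par_inter\<close> become set algebra of types.\<close>

lemma gate_cons:
  assumes x: "x \<in> carrier P" and b: "b \<in> A u" "b \<noteq> \<one>" "s u x = \<one>"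
  shows "gate \<Lambda> (b \<otimes> x) = (if u \<in> \<Lambda> then b \<otimes> gate \<Lambda> x else gate (\<Lambda> \<inter> lk {u}) x)"
proof (cases "u \<in> \<Lambda>")
  case True then show ?thesis using gate_mult[of b \<Lambda> x] b x by (simp add: A_par)
next
  case False
  let ?L = "\<Lambda> \<inter> lk {u}"
  let ?l = "gate ?L x"
  have l: "?l \<in> par ?L" "?l \<in> par \<Lambda>" "inv ?l \<in> par (lk {u})"
    using gate_in[OF x, of ?L] par_mono'[of _ ?L] by (auto intro!: par_inv)
  have c: "inv ?l \<otimes> (b \<otimes> x) = b \<otimes> (inv ?l \<otimes> x)"
    using commute_A_par[OF b(1) l(3)] b x by (simp flip: m_assoc)
  have "s u (inv ?l \<otimes> x) = \<one>" using s_lk[OF l(3) x] b by simp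
  then have "s v (b \<otimes> (inv ?l \<otimes> x)) = \<one>" if "v \<in> \<Lambda>" for v
    using that s_cons[of "inv ?l \<otimes> x" u b v] b x False s_gate[OF x, of v ?L] by (auto simp: lk_def adj_sym)
  then have "gate \<Lambda> (b \<otimes> x) = ?l" using l x b by (intro gateI) (auto simp: c)
  then show ?thesis using False by simp
qed

text \<open>By \<open>gate_cons\<close> a gate only collects syllables of the element itself. In
  particular intersections of parabolic subgroups are parabolic.\<close>

lemma gate_par_inter:
  assumes "x \<in> par D"
  shows "gate \<Lambda> x \<in> par (\<Lambda> \<inter> D)"
  using assms
proof (induction arbitrary: \<Lambda> rule: par_induct)
  case (cons y u b)
  then show ?case using cons.IH[of \<Lambda>] cons.IH[of "\<Lambda> \<inter> lk {u}"]
    by (auto simp: gate_cons intro: cons_par par_mono'[of _ "\<Lambda> \<inter> lk {u} \<inter> D"])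
qed auto

lemma par_Int: "par \<Lambda> \<inter> par D = par (\<Lambda> \<inter> D)"
  using gate_par_inter[of _ D \<Lambda>] by (fastforce intro: par_mono')

lemma par_cons_iff:
  assumes "y \<in> carrier P" "s u y = \<one>" "b \<in> A u" "b \<noteq> \<one>"
  shows "b \<otimes> y \<in> par \<Lambda> \<longleftrightarrow> u \<in> \<Lambda> \<and> y \<in> par \<Lambda>"
proof
  assume a: "b \<otimes> y \<in> par \<Lambda>"
  then have "u \<in> \<Lambda>" using s_par[OF a, of u] s_cons[of y u b u] assms by auto
  then show "u \<in> \<Lambda> \<and> y \<in> par \<Lambda>" using a par_mult_iff[of b \<Lambda> y] assms A_par by auto
qed (use assms A_par in auto)

text \<open>By \<open>par_cons_iff\<close>, membership in a parabolic subgroup is read off the types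
  in a reduced expression, so it is compatible with arbitrary intersections, the empty one
  included.\<close>

lemma par_INT:
  assumes "x \<in> carrier P" "\<And>i. i \<in> I \<Longrightarrow> x \<in> par (F i)"
  shows "x \<in> par (\<Inter>i\<in>I. F i)"
proof -
  have "x \<in> par UNIV" using assms par_UNIV by simp
  then have "(\<forall>i\<in>I. x \<in> par (F i)) \<longrightarrow> x \<in> par (\<Inter>i\<in>I. F i)"
  proof (induction rule: par_induct)
    case (cons y u b)
    then show ?case using par_cons_iff[of y u b] by auto
  qed auto
  then show ?thesis using assms by blast
qed

section \<open>Links, stars and joins\<close>

lemma lk_INT: "lk \<Lambda> = (\<Inter>v\<in>\<Lambda>. lk {v})"
  by (auto simp: lk_def)

lemma commute_par:
  assumes "x \<in> par \<Lambda>" "y \<in> par \<Omega>" "\<Omega> \<subseteq> lk \<Lambda>"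
  shows "x \<otimes> y = y \<otimes> x"
  using assms(1)
proof (induction rule: par_induct)
  case (cons z u b)
  have "y \<in> par (lk {u})" using assms(2) by (rule par_mono') (use assms cons in \<open>auto simp: lk_def\<close>)
  then have e: "b \<otimes> y = y \<otimes> b" using cons commute_A_par by blast
  have "b \<otimes> z \<otimes> y = b \<otimes> y \<otimes> z" using cons assms(2) by (simp add: m_assoc)
  also have "\<dots> = y \<otimes> (b \<otimes> z)" unfolding e using cons assms(2) by (simp add: m_assoc)
  finally show ?case .
qed (use assms in simp)

lemma lk_swap: "\<Omega> \<subseteq> lk \<Lambda> \<longleftrightarrow> \<Lambda> \<subseteq> lk \<Omega>"
  by (auto simp: lk_def adj_sym)

lemma lk_disjoint: "\<Lambda> \<inter> lk \<Lambda> = {}"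
  by (auto simp: lk_def adj_irrefl)

lemma par_join:
  assumes "x \<in> par (\<Lambda> \<union> \<Omega>)" "\<Omega> \<subseteq> lk \<Lambda>"
  shows "\<exists>l\<in>par \<Lambda>. \<exists>m\<in>par \<Omega>. x = l \<otimes> m"
  using assms(1)
proof (induction rule: par_induct)
  case one show ?case by (auto intro!: bexI[of _ \<one>])
next
  case (cons y u b)
  then obtain l m where lm: "l \<in> par \<Lambda>" "m \<in> par \<Omega>" "y = l \<otimes> m" by blast
  show ?case
  proof (cases "u \<in> \<Lambda>")
    case True
    then show ?thesis using lm cons by (intro bexI[of _ "b \<otimes> l"] bexI[of _ m]) (auto simp: m_assoc A_par)
  next
    case False
    then have b: "b \<in> par \<Omega>" using cons A_par by auto
    then have "l \<otimes> b = b \<otimes> l" using commute_par[OF lm(1) b assms(2)] by simp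
    then show ?thesis using lm b cons
      by (intro bexI[of _ l] bexI[of _ "b \<otimes> m"]) (simp_all flip: m_assoc)
  qed
qed

lemma par_st:
  assumes "x \<in> par (st \<Lambda>)"
  shows "\<exists>l\<in>par \<Lambda>. \<exists>m\<in>par (lk \<Lambda>). x = l \<otimes> m \<and> l \<otimes> m = m \<otimes> l"
  using par_join[of x \<Lambda> "lk \<Lambda>"] assms commute_par[of _ \<Lambda> _ "lk \<Lambda>"] unfolding st_def by blast

text \<open>After division by the gate of \<open>x\<close>, the factor from the link can be moved to
  the front, where it does not influence heads with type in \<open>\<Lambda>\<close>.\<close>

lemma gate_lk:
  assumes m: "m \<in> par (lk \<Lambda>)" and x: "x \<in> carrier P"
  shows "gate \<Lambda> (m \<otimes> x) = gate \<Lambda> x"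
proof (rule gateI)
  let ?l = "gate \<Lambda> x"
  have l: "?l \<in> par \<Lambda>" using gate_in x by blast
  show "?l \<in> par \<Lambda>" by fact
  have c: "inv ?l \<otimes> (m \<otimes> x) = m \<otimes> (inv ?l \<otimes> x)"
    using commute_par[of "inv ?l" \<Lambda> m "lk \<Lambda>"] l m x by (simp flip: m_assoc)
  show "s v (inv ?l \<otimes> (m \<otimes> x)) = \<one>" if v: "v \<in> \<Lambda>" for v
  proof -
    have "m \<in> par (lk {v})" using m by (rule par_mono') (use v in \<open>auto simp: lk_def\<close>)
    then show ?thesis unfolding c using s_lk[of m v "inv ?l \<otimes> x"] s_gate[OF x v] m x by auto
  qed
qed (use m x in auto)

text \<open>The cocycle rule behind every change of base point: gates in parallel cosets of
  \<open>par \<Lambda>\<close> differ by a left translation of \<open>par \<Lambda>\<close> that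
  does not depend on \<open>x\<close>.\<close>

lemma gate_st:
  assumes a: "a \<in> par (st \<Lambda>)" and x: "x \<in> carrier P"
  shows "gate \<Lambda> (a \<otimes> x) = gate \<Lambda> a \<otimes> gate \<Lambda> x"
proof -
  obtain l m where lm: "l \<in> par \<Lambda>" "m \<in> par (lk \<Lambda>)" "a = l \<otimes> m" using par_st[OF a] by blast
  have "gate \<Lambda> m = \<one>" using gate_lk[OF lm(2), of \<one>] lm by simp
  then show ?thesis using lm x by (simp add: m_assoc gate_mult gate_lk)
qed

lemma st_singleton: "st {v} = insert v (lk {v})"
  by (auto simp: st_def)

lemma par_st_s:
  assumes "x \<in> par (st {v})" "s v x = \<one>"
  shows "x \<in> par (lk {v})"
proof -
  obtain l m where lm: "l \<in> par {v}" "m \<in> par (lk {v})" "x = l \<otimes> m" "x = m \<otimes> l" using par_st[OF assms(1)] by auto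
  have "s v x = s v l" using lm s_lk[of m v l] by simp
  then have "l = \<one>" using assms s_trivial[OF lm(1)] by auto
  then show ?thesis using lm by simp
qed

text \<open>In terms of hyperplanes: the edge from \<open>y\<close> to \<open>y \<otimes> a\<close>
  crosses the hyperplane of type \<open>w\<close> at the identity only if \<open>w = v\<close> and
  \<open>y\<close> lies in its carrier \<open>par (st {v})\<close>. Heads, defined through prefixes,
  thereby give information about paths.\<close>

lemma s_right_mult:
  assumes "y \<in> carrier P" and a: "a \<in> A v"
  shows "s w (y \<otimes> a) = s w y \<or> w = v \<and> y \<in> par (st {v})"
proof -
  have "y \<in> par UNIV" using assms par_UNIV by simp
  then have "\<forall>w. s w (y \<otimes> a) = s w y \<or> w = v \<and> y \<in> par (st {v})"
  proof (induction rule: par_induct)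
    case one
    have "s w (a \<otimes> \<one>) = \<one>" if "w \<noteq> v" for w
      using that s_par[of a "{v}" w] A_par[OF a, of "{v}"] a by simp
    then show ?case using a by auto
  next
    case (cons z u b)
    note z = cons(1)[THEN par_closed]
    have e: "b \<otimes> z \<otimes> a = b \<otimes> (z \<otimes> a)" using cons a by (simp add: m_assoc)
    consider "s u (z \<otimes> a) = \<one>" | "u = v" "z \<in> par (st {v})" using cons by metis
    then show ?case
    proof cases
      case 1
      show ?thesis
      proof (rule allI)
        fix w
        have h: "s w (b \<otimes> z \<otimes> a) = (if w = u then b else if adj u w then s w (z \<otimes> a) else \<one>)"
          unfolding e using s_cons[of "z \<otimes> a" u b w] z a 1 cons by simp
        have h': "s w (b \<otimes> z) = (if w = u then b else if adj u w then s w z else \<one>)"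
          using s_cons[of z u b w] z cons by simp
        show "s w (b \<otimes> z \<otimes> a) = s w (b \<otimes> z) \<or> w = v \<and> b \<otimes> z \<in> par (st {v})"
        proof (cases "w \<noteq> u \<and> adj u w \<and> s w (z \<otimes> a) \<noteq> s w z")
          case True
          \<comment> \<open>Here \<open>u\<close> is adjacent to \<open>v\<close>, so prefixing
            \<open>b\<close> does not leave the star of \<open>v\<close>.\<close>
          then have "w = v" "z \<in> par (st {v})" using cons by metis+
          then show ?thesis using True cons by (auto intro!: cons_par simp: st_singleton lk_def)
        next
          case False then show ?thesis using h h' by auto
        qed
      qed
    next
      case 2
      have zl: "z \<in> par (lk {v})" using par_st_s 2 cons by blast
      have za: "z \<otimes> a = a \<otimes> z" using commute_A_par[OF a zl] by simp
      have bz: "b \<otimes> z \<in> par (st {v})" using 2 cons zl by (auto intro!: cons_par intro: par_mono' simp: st_singleton)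
      have "s w (b \<otimes> z \<otimes> a) = s w (b \<otimes> z)" if w: "w \<noteq> v" for w
      proof -
        \<comment> \<open>\<open>a\<close> passes through \<open>z\<close> and merges with
          \<open>b\<close>. A head of type \<open>w \<noteq> v\<close> depends only on whether
          \<open>w\<close> is adjacent to \<open>v\<close>, not on whether \<open>b\<close> or
          \<open>b \<otimes> a\<close> stands in front.\<close>
        have e2: "b \<otimes> z \<otimes> a = (b \<otimes> a) \<otimes> z" unfolding e za using cons a by (simp add: m_assoc)
        have b': "b \<in> A v" and bav: "b \<otimes> a \<in> A v" using 2 cons a by auto
        show ?thesis
        proof (cases "adj v w")
          case True
          then show ?thesis unfolding e2 using s_adj[OF bav z] s_adj[OF b' z] by auto
        next
          case False
          have "s w z = \<one>" using s_par[OF zl, of w] False adj_sym[of w v] by (auto simp: lk_def)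
          moreover have "s w (c \<otimes> z) = \<one>" if "c \<in> A v" "c \<noteq> \<one>" for c
            using s_cons[OF z, of v c w] that 2 cons False w by auto
          ultimately show ?thesis unfolding e2 using b' bav cons z by (cases "b \<otimes> a = \<one>") auto
        qed
      qed
      then show ?thesis using bz by auto
    qed
  qed
  then show ?thesis by blast
qed

text \<open>A letter on the right can change a trivial gate only by being commuted all the way to
  the front.\<close>

lemma gate_right_mult:
  assumes y: "y \<in> carrier P" and a: "a \<in> A v" and g: "gate \<Lambda> y = \<one>"
  shows "gate \<Lambda> (y \<otimes> a) = \<one> \<or> (v \<in> \<Lambda> \<and> y \<in> par (lk {v}) \<and> gate \<Lambda> (y \<otimes> a) = a)"
proof (cases "gate \<Lambda> (y \<otimes> a) = \<one>")
  case False
  then obtain w where w: "w \<in> \<Lambda>" "s w (y \<otimes> a) \<noteq> \<one>" using gate_eq_one_iff[of "y \<otimes> a" \<Lambda>] y a by auto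
  have sy: "\<forall>w\<in>\<Lambda>. s w y = \<one>" using g gate_eq_one_iff[OF y] by blast
  then have v: "w = v" "y \<in> par (st {v})" using s_right_mult[OF y a, of w] w by auto
  then have l: "y \<in> par (lk {v})" using par_st_s sy w by blast
  then have "gate \<Lambda> (y \<otimes> a) = a \<otimes> gate \<Lambda> y"
    using commute_A_par[OF a l] gate_mult[of a \<Lambda> y] A_par[OF a] v w y by simp
  then show ?thesis using g l v w a by simp
qed simp

end


section \<open>Cosets of parabolic subgroups\<close>

context graph_group
begin

section \<open>Syllable length and double cosets\<close>

definition letters :: "'a set" where
  "letters = (\<Union>v. A v)"

lemma symset_letters: "symset P letters"
  unfolding symset_def letters_def using A_inv A_one A_closed by blast

lemma total_letters: "total_gen letters (carrier P)"
proof -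
  have "insert \<one> (letters \<union> (\<lambda>x. inv x) ` letters) = letters"
    by (auto simp: letters_def)
  moreover have "letters \<subseteq> carrier P" by (auto simp: letters_def)
  ultimately have "total_gen letters (generate P letters)"
    using total_gen_generate[of letters] by simp
  then show ?thesis using generate_A unfolding total_gen_def letters_def by blast
qed

text \<open>A head can be cancelled at the gain of one syllable in any given expression, reduced or
  not. If the first syllable \<open>a\<close> is not trivial and its type is neither
  \<open>v\<close> nor adjacent to it, then \<open>x\<close> has no head of the type of
  \<open>a\<close>; so \<open>a\<close> cancels against such a head of \<open>y\<close>.\<close>

lemma exchange:
  assumes "x \<in> prods P letters n" "s v x \<noteq> \<one>"
  shows "\<exists>m. n = Suc m \<and> inv (s v x) \<otimes> x \<in> prods P letters m"
  using assms
proof (induction n arbitrary: x v)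
  case (Suc n)
  note S = symset_letters
  obtain a u y where a: "a \<in> A u" and y: "y \<in> prods P letters n" and x: "x = a \<otimes> y"
    using Suc.prems(1) by (auto simp: letters_def)
  have yc: "y \<in> carrier P" using y prods_closed S by blast
  have sy: "inv (s v y) \<in> A v" using s_in[OF yc] by simp
  consider "u = v" | "adj u v" | "u \<noteq> v" "\<not> adj u v" by blast
  then have "inv (s v x) \<otimes> x \<in> prods P letters n"
  proof cases
    case 1
    then have "inv (s v x) \<otimes> x = inv (s v y) \<otimes> y"
      using s_mult[OF a yc] a yc by (simp add: x inv_mult_group m_assoc)
    then show ?thesis using Suc.IH[OF y, of v] y yc prods_Suc_mono[OF S]
      by (cases "s v y = \<one>") (auto simp del: prods.simps)
  next
    case 2
    then have e: "s v x = s v y" using s_adj[OF a yc] x by simp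
    obtain m where m: "n = Suc m" "inv (s v y) \<otimes> y \<in> prods P letters m"
      using Suc.IH[OF y, of v] Suc.prems(2) e by auto
    have "inv (s v x) \<otimes> x = a \<otimes> (inv (s v y) \<otimes> y)"
      using A_commute[OF 2 a sy] sy yc a unfolding e unfolding x by (simp flip: m_assoc)
    then show ?thesis using m a by (auto simp: letters_def)
  next
    case 3
    have xc: "x \<in> carrier P" using x a yc by simp
    have sx: "s u x = \<one>" using s_nonadj[OF xc 3] Suc.prems(2) by auto
    show ?thesis
    proof (cases "a = \<one>")
      case True
      then show ?thesis using Suc.IH[OF y, of v] Suc.prems(2) x yc prods_Suc_mono[OF S]
        by (auto simp del: prods.simps)
    next
      case False
      have "a \<otimes> s u y = \<one>" using sx s_mult[OF a yc] x by simp
      then have i: "inv (s u y) = a" using inv_equality[of a "s u y"] a yc by simp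
      then have "s u y \<noteq> \<one>" using False by auto
      then obtain m where m: "n = Suc m" "x \<in> prods P letters m"
        using Suc.IH[OF y, of u] unfolding i x by auto
      have "inv (s v x) \<in> letters" using A_inv[OF s_in[OF xc]] unfolding letters_def by blast
      then show ?thesis using m by auto
    qed
  qed
  then show ?case by blast
qed simp

lemma wlen_exchange:
  assumes "x \<in> carrier P" "s v x \<noteq> \<one>"
  shows "wlen P letters (inv (s v x) \<otimes> x) < wlen P letters x"
  using exchange[OF wlen_prods[OF total_letters assms(1)] assms(2)] wlen_le
  by (metis less_Suc_eq_le)

text \<open>An element of minimal syllable length in its double coset has no head in
  \<open>\<Lambda>\<close> on the left and none in \<open>D\<close> on the right, since
  \<open>wlen_exchange\<close> would shorten it.\<close>

lemma double_coset:
  assumes x: "x \<in> carrier P"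
  shows "\<exists>l\<in>par \<Lambda>. \<exists>d\<in>par D. \<exists>y\<in>carrier P. x = l \<otimes> y \<otimes> d \<and> gate \<Lambda> y = \<one> \<and> gate D (inv y) = \<one>"
proof -
  let ?Q = "\<lambda>y. y \<in> carrier P \<and> (\<exists>l\<in>par \<Lambda>. \<exists>d\<in>par D. x = l \<otimes> y \<otimes> d)"
  have "?Q x" using x by (auto intro!: bexI[of _ \<one>])
  from ex_has_least_nat[of ?Q, OF this, of "wlen P letters"]
  obtain y where y: "?Q y" and min: "\<And>z. ?Q z \<Longrightarrow> wlen P letters y \<le> wlen P letters z" by blast
  obtain l d where ld: "l \<in> par \<Lambda>" "d \<in> par D" "x = l \<otimes> y \<otimes> d" and yc: "y \<in> carrier P" using y by blast
  have "s v y = \<one>" if v: "v \<in> \<Lambda>" for v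
  proof (rule ccontr)
    assume ne: "s v y \<noteq> \<one>"
    have "x = (l \<otimes> s v y) \<otimes> (inv (s v y) \<otimes> y) \<otimes> d" using ld yc by (simp add: m_assoc)
    moreover have "l \<otimes> s v y \<in> par \<Lambda>" using ld A_par[OF s_in[OF yc] v] by simp
    ultimately have "?Q (inv (s v y) \<otimes> y)" using ld yc by auto
    from min[OF this] show False using wlen_exchange[OF yc ne] by simp
  qed
  moreover have "s v (inv y) = \<one>" if v: "v \<in> D" for v
  proof (rule ccontr)
    let ?a = "s v (inv y)"
    assume ne: "?a \<noteq> \<one>"
    have a: "?a \<in> A v" using s_in yc by simp
    have "x = l \<otimes> (y \<otimes> ?a) \<otimes> (inv ?a \<otimes> d)" using ld yc a by (simp add: m_assoc)
    moreover have "inv ?a \<otimes> d \<in> par D" using ld A_par[OF a v] by simp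
    ultimately have "?Q (y \<otimes> ?a)" using ld yc a by auto
    from min[OF this] have "wlen P letters y \<le> wlen P letters (y \<otimes> ?a)" .
    also have "\<dots> = wlen P letters (inv (y \<otimes> ?a))"
      using wlen_inv[OF total_letters, of "y \<otimes> ?a"] yc a by simp
    also have "inv (y \<otimes> ?a) = inv ?a \<otimes> inv y" using yc a by (simp add: inv_mult_group)
    finally show False
      using wlen_exchange[of "inv y" v] ne yc wlen_inv[OF total_letters, of y] by simp
  qed
  ultimately have "gate \<Lambda> y = \<one>" "gate D (inv y) = \<one>" using yc gate_eq_one_iff by auto
  then show ?thesis using ld yc by blast
qed

text \<open>\<open>y\<close> is a shortest connection between the two cosets. From
  \<open>par \<Lambda>\<close> only those letters of \<open>d\<close> are visible that commute with
  all of \<open>y\<close>, and their types form a set that does not depend on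
  \<open>d\<close>.\<close>

lemma gate_coset_reduced:
  assumes y: "y \<in> carrier P" "gate \<Lambda> y = \<one>" "gate D (inv y) = \<one>" and d: "d \<in> par D"
  shows "gate \<Lambda> (y \<otimes> d) \<in> par {v \<in> \<Lambda> \<inter> D. y \<in> par (lk {v})}"
proof -
  let ?L = "{v \<in> \<Lambda> \<inter> D. y \<in> par (lk {v})}"
  have yl: "y \<in> par (lk ?L)" unfolding lk_INT[of ?L] by (rule par_INT) (use y in auto)
  \<comment> \<open>\<open>par_induct\<close> adds syllables on the left of \<open>e\<close>, hence
    on the right of \<open>inv e\<close>, where the path continues.\<close>
  have "gate \<Lambda> (y \<otimes> inv e) \<in> par ?L" if "e \<in> par D" for e
    using that
  proof (induction rule: par_induct)
    case (cons e u b)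
    let ?q = "gate \<Lambda> (y \<otimes> inv e)"
    have q: "?q \<in> par ?L" "?q \<in> par \<Lambda>" "?q \<in> par D"
      using cons by (auto intro: par_mono'[OF cons.IH])
    let ?z = "inv ?q \<otimes> (y \<otimes> inv e)"
    have zc: "?z \<in> carrier P" using q cons y by simp
    have gz: "gate \<Lambda> ?z = \<one>" using gate_mult[of "inv ?q" \<Lambda> "y \<otimes> inv e"] q cons y by simp
    have "y \<otimes> inv (b \<otimes> e) = ?q \<otimes> (?z \<otimes> inv b)"
      using q cons y by (simp add: inv_mult_group m_assoc)
    then have g: "gate \<Lambda> (y \<otimes> inv (b \<otimes> e)) = ?q \<otimes> gate \<Lambda> (?z \<otimes> inv b)"
      using gate_mult[OF q(2), of "?z \<otimes> inv b"] zc cons by simp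
    have ib: "inv b \<in> A u" using cons by simp
    from gate_right_mult[OF zc ib gz] show ?case
    proof
      assume "gate \<Lambda> (?z \<otimes> inv b) = \<one>" then show ?thesis using g q by simp
    next
      assume h: "u \<in> \<Lambda> \<and> ?z \<in> par (lk {u}) \<and> gate \<Lambda> (?z \<otimes> inv b) = inv b"
      let ?d = "inv ?q \<otimes> inv e"
      have d: "?d \<in> par D" using q cons by simp
      have "inv ?q \<otimes> y = y \<otimes> inv ?q"
        using commute_par[OF par_inv[OF q(1)] yl] by simp
      then have z: "?z = y \<otimes> ?d" using q cons y by (simp flip: m_assoc)
      \<comment> \<open>Seen from the other coset: \<open>inv y\<close> has trivial gate in
        \<open>par D\<close>, so the gate of \<open>inv ?z\<close> is \<open>inv ?d\<close>. As
        \<open>?z\<close> lies in the link of \<open>u\<close>, so does \<open>?d\<close>, and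
        therefore \<open>y\<close>.\<close>
      have "inv ?z = inv ?d \<otimes> inv y" unfolding z using y d by (simp add: inv_mult_group)
      then have "gate D (inv ?z) = inv ?d" using gate_mult[OF par_inv[OF d], of "inv y"] d y by simp
      moreover have "gate D (inv ?z) \<in> par (D \<inter> lk {u})" by (rule gate_par_inter) (use h par_inv in blast)
      ultimately have "inv ?d \<in> par (D \<inter> lk {u})" by (rule subst)
      then have "inv ?d \<in> par (lk {u})" by (rule par_mono') blast
      then have "?d \<in> par (lk {u})" using par_inv_iff[OF par_closed[OF d]] by blast
      then have "y \<in> par (lk {u})" using h y(1) par_mult_iff2[of ?d "lk {u}" y] unfolding z by simp
      then have "inv b \<in> par ?L" using h cons A_par by auto
      then show ?thesis using g q h by simp
    qed
  qed (use y in simp)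
  from this[OF par_inv[OF d]] d show ?thesis by simp
qed

text \<open>Distinguishes whether the type found in \<open>gate_coset_reduced\<close> is all of
  \<open>\<Lambda>\<close>. If it is, the connecting element lies in the link of
  \<open>\<Lambda>\<close>, which makes the coset of \<open>par D\<close> contain a parallel copy of
  \<open>par \<Lambda>\<close>.\<close>

lemma gate_coset:
  assumes x: "x \<in> carrier P"
  shows "(\<exists>L\<subset>\<Lambda>. \<exists>q\<in>par \<Lambda>. \<forall>d\<in>par D. inv q \<otimes> gate \<Lambda> (x \<otimes> d) \<in> par L) \<or>
    (\<Lambda> \<subseteq> D \<and> (\<exists>d\<in>par D. x \<otimes> d \<in> par (st \<Lambda>)))"
proof -
  obtain l d y where ld: "l \<in> par \<Lambda>" "d \<in> par D" "x = l \<otimes> y \<otimes> d" and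
    y: "y \<in> carrier P" "gate \<Lambda> y = \<one>" "gate D (inv y) = \<one>"
    using double_coset[OF x, of \<Lambda> D] by blast
  let ?L = "{v \<in> \<Lambda> \<inter> D. y \<in> par (lk {v})}"
  show ?thesis
  proof (cases "?L = \<Lambda>")
    case True
    then have "y \<in> par (lk \<Lambda>)" unfolding lk_INT[of \<Lambda>] by (intro par_INT y) blast
    then have "l \<otimes> y \<in> par (st \<Lambda>)" using ld(1) by (auto simp: st_def intro!: par_mult intro: par_mono')
    moreover have "x \<otimes> inv d = l \<otimes> y" using ld y by (simp add: m_assoc)
    ultimately show ?thesis using True par_inv[OF ld(2)] by (metis (no_types, lifting) Int_iff mem_Collect_eq subsetI)
  next
    case False
    have "inv l \<otimes> gate \<Lambda> (x \<otimes> e) \<in> par ?L" if e: "e \<in> par D" for e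
    proof -
      have "gate \<Lambda> (x \<otimes> e) = l \<otimes> gate \<Lambda> (y \<otimes> (d \<otimes> e))"
        using gate_mult[OF ld(1), of "y \<otimes> (d \<otimes> e)"] ld y e by (simp add: m_assoc)
      then show ?thesis using gate_coset_reduced[OF y, of "d \<otimes> e"] ld e y by simp
    qed
    then show ?thesis using False ld(1) by (intro disjI1 exI[of _ ?L]) auto
  qed
qed

section \<open>The Helly property of cosets\<close>

lemma gate_coset_meets:
  assumes x: "x \<in> par D" and y: "y \<in> par \<Lambda>" and "inv x \<otimes> y \<in> par C"
  shows "inv x \<otimes> gate \<Lambda> x \<in> par C"
proof -
  have "gate \<Lambda> x = y \<otimes> gate \<Lambda> (inv y \<otimes> x)" using gate_mult[OF y, of "inv y \<otimes> x"] x y by simp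
  moreover have "inv y \<otimes> x \<in> par C" using assms par_inv[OF assms(3)] by (simp add: inv_mult_group)
  then have "gate \<Lambda> (inv y \<otimes> x) \<in> par C" by (rule par_mono'[OF gate_par_inter]) auto
  ultimately show ?thesis using assms by (simp flip: m_assoc)
qed

text \<open>The point \<open>b\<close> lies in two of the three cosets. Its gate in the third one is
  a common point, because it does not leave the other two.\<close>

lemma helly3:
  assumes c: "a \<in> carrier P" "b \<in> carrier P" "c \<in> carrier P" "inv a \<otimes> b \<in> par B" "inv b \<otimes> c \<in> par C" "inv c \<otimes> a \<in> par D"
  shows "\<exists>z\<in>carrier P. inv a \<otimes> z \<in> par D \<and> inv a \<otimes> z \<in> par B \<and> inv b \<otimes> z \<in> par C"
proof -
  let ?x = "inv a \<otimes> b" and ?y = "inv a \<otimes> c"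
  have x: "?x \<in> par B" by fact
  have y: "?y \<in> par D" using par_inv[OF c(6)] c by (simp add: inv_mult_group)
  have "inv ?x \<otimes> ?y = inv b \<otimes> c" using c by (simp add: inv_mult_group m_assoc)
  then have "inv ?x \<otimes> gate D ?x \<in> par C" using gate_coset_meets[OF x y] c by simp
  moreover have "gate D ?x \<in> par (D \<inter> B)" by (rule gate_par_inter[OF x])
  ultimately show ?thesis using c
    by (intro bexI[of _ "a \<otimes> gate D ?x"]) (auto simp: inv_mult_group m_assoc intro: par_mono')
qed

lemma coset_eq: "k \<in> carrier P \<Longrightarrow> z \<in> carrier P \<Longrightarrow> y \<in> carrier P \<Longrightarrow> inv k \<otimes> z \<in> par B \<Longrightarrow>
  inv k \<otimes> y \<in> par B \<longleftrightarrow> inv z \<otimes> y \<in> par B"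
  using par_mult[of "inv z \<otimes> k" B "inv k \<otimes> y"] par_mult[of "inv k \<otimes> z" B "inv z \<otimes> y"] par_inv[of "inv k \<otimes> z" B]
  by (auto simp: inv_mult_group m_assoc)

text \<open>Intersecting all cosets with the one of index \<open>i\<close> leaves one coset less; by
  \<open>helly3\<close> the intersections still meet pairwise.\<close>

lemma helly:
  assumes "finite I" "\<And>i. i \<in> I \<Longrightarrow> k i \<in> carrier P"
    and "\<And>i j. i \<in> I \<Longrightarrow> j \<in> I \<Longrightarrow> i \<noteq> j \<Longrightarrow> \<exists>z\<in>carrier P. inv (k i) \<otimes> z \<in> par (B i) \<and> inv (k j) \<otimes> z \<in> par (B j)"
  shows "\<exists>z\<in>carrier P. \<forall>i\<in>I. inv (k i) \<otimes> z \<in> par (B i)"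
  using assms
proof (induction I arbitrary: k B rule: finite_induct)
  case (insert i I)
  show ?case
  proof (cases "I = {}")
    case True
    then show ?thesis using insert.prems(1) by (intro bexI[of _ "k i"]) auto
  next
    case False
    have "\<forall>j\<in>I. \<exists>z. z \<in> carrier P \<and> inv (k i) \<otimes> z \<in> par (B i) \<and> inv (k j) \<otimes> z \<in> par (B j)"
      using insert.prems(2)[of i] insert.hyps by blast
    then obtain m where m: "\<And>j. j \<in> I \<Longrightarrow> m j \<in> carrier P \<and> inv (k i) \<otimes> m j \<in> par (B i) \<and> inv (k j) \<otimes> m j \<in> par (B j)"
      by metis
    have ki: "k i \<in> carrier P" and kj: "\<And>j. j \<in> I \<Longrightarrow> k j \<in> carrier P" using insert.prems by auto
    have "\<exists>z\<in>carrier P. \<forall>j\<in>I. inv (m j) \<otimes> z \<in> par (B i \<inter> B j)"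
    proof (rule insert.IH)
      fix j l assume jl: "j \<in> I" "l \<in> I" "j \<noteq> l"
      obtain c where c: "c \<in> carrier P" "inv (k j) \<otimes> c \<in> par (B j)" "inv (k l) \<otimes> c \<in> par (B l)"
        using insert.prems(2)[of j l] jl by blast
      have 1: "inv (m l) \<otimes> m j \<in> par (B i)" using coset_eq[of "k i" "m l" "m j" "B i"] m jl ki by blast
      have 2: "inv (m j) \<otimes> c \<in> par (B j)" using coset_eq[of "k j" "m j" c "B j"] m jl kj c by blast
      have "inv (m l) \<otimes> c \<in> par (B l)" using coset_eq[of "k l" "m l" c "B l"] m jl kj c by blast
      from par_inv[OF this] have 3: "inv c \<otimes> m l \<in> par (B l)" using m jl c by (simp add: inv_mult_group)
      obtain z where z: "z \<in> carrier P" "inv (m l) \<otimes> z \<in> par (B l)" "inv (m l) \<otimes> z \<in> par (B i)" "inv (m j) \<otimes> z \<in> par (B j)"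
        using helly3[OF _ _ c(1) 1 2 3] m jl by blast
      have "inv (m j) \<otimes> z \<in> par (B i)" using coset_eq[of "m l" "m j" z "B i"] 1 z m jl by blast
      then show "\<exists>z\<in>carrier P. inv (m j) \<otimes> z \<in> par (B i \<inter> B j) \<and> inv (m l) \<otimes> z \<in> par (B i \<inter> B l)"
        using z par_Int by blast
    qed (use m in blast)
    then obtain z where z: "z \<in> carrier P" "\<And>j. j \<in> I \<Longrightarrow> inv (m j) \<otimes> z \<in> par (B i)" "\<And>j. j \<in> I \<Longrightarrow> inv (m j) \<otimes> z \<in> par (B j)"
      using par_Int by blast
    have "inv (k j) \<otimes> z \<in> par (B j)" if "j \<in> I" for j
      using coset_eq[of "k j" "m j" z "B j"] z m kj that by blast
    moreover have "inv (k i) \<otimes> z \<in> par (B i)"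
      using False coset_eq[of "k i" _ z "B i"] z m ki by blast
    ultimately show ?thesis using z(1) by blast
  qed
qed auto

end


section \<open>Coned-off word lengths\<close>

locale generated_graph_group = graph_group P V adj A s
  for P (structure) and V :: "'v set" and adj A s +
  fixes T :: "'v \<Rightarrow> 'a set"
  assumes finite_T: "finite (T v)"
    and generate_T: "generate P (T v) = A v"
    and A_nontrivial: "v \<in> V \<Longrightarrow> A v \<noteq> {\<one>}"
begin

text \<open>Only the trivial subgroup is proper parabolic in a vertex group, so a vertex group keeps
  its own finite generating set.\<close>

definition gen :: "'v set \<Rightarrow> 'a set" where
  "gen \<Lambda> = (if is_singleton \<Lambda> then T (the_elem \<Lambda>) else \<Union>{par \<Omega> | \<Omega>. \<Omega> \<subset> \<Lambda>})"

definition sgen :: "'v set \<Rightarrow> 'a set" where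
  "sgen \<Lambda> = insert \<one> (gen \<Lambda> \<union> (\<lambda>x. inv x) ` gen \<Lambda>)"

text \<open>
  Unless \<open>\<Lambda>\<close> is a singleton, \<open>len \<Lambda>\<close> is the syllable length with respect to the proper parabolic
  subgroups of \<open>par \<Lambda>\<close>.
\<close>

definition len :: "'v set \<Rightarrow> 'a \<Rightarrow> nat" where
  "len \<Lambda> x = wlen P (sgen \<Lambda>) x"

lemma T_A: "T v \<subseteq> A v"
  using generate_T[of v] generate.incl[of _ "T v" P] by blast

lemma par_singleton: "par {v} = A v"
  using generate_subgroup_incl[OF subset_refl A_subgroup[of v]] generate.incl[of _ "A v" P]
  unfolding par_def by auto

lemma par_empty: "par {} = {\<one>}"
  unfolding par_def using generate_empty by simp

lemma gen_singleton: "gen {v} = T v"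
  by (simp add: gen_def)

lemma gen_par: "gen \<Lambda> \<subseteq> par \<Lambda>"
proof (cases "is_singleton \<Lambda>")
  case True
  then obtain v where "\<Lambda> = {v}" by (auto simp: is_singleton_def)
  then show ?thesis using T_A[of v] by (simp add: gen_singleton par_singleton)
next
  case False
  then show ?thesis using par_mono[of _ \<Lambda>] by (auto simp: gen_def)
qed

lemma gen_closed: "gen \<Lambda> \<subseteq> carrier P"
  using gen_par par_closed by blast

lemma sgen_par: "sgen \<Lambda> \<subseteq> par \<Lambda>"
  using gen_par[of \<Lambda>] by (auto simp: sgen_def)

lemma generate_gen: "\<Lambda> \<noteq> {} \<Longrightarrow> generate P (gen \<Lambda>) = par \<Lambda>"
proof (cases "is_singleton \<Lambda>")
  case True
  then obtain v where "\<Lambda> = {v}" by (auto simp: is_singleton_def)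
  then show ?thesis by (simp add: gen_singleton par_singleton generate_T)
next
  case False
  assume "\<Lambda> \<noteq> {}"
  have "A v \<subseteq> gen \<Lambda>" if "v \<in> \<Lambda>" for v
  proof -
    have "{v} \<subset> \<Lambda>" using False that by (auto simp: is_singleton_def)
    then have "par {v} \<subseteq> \<Union>{par \<Omega> | \<Omega>. \<Omega> \<subset> \<Lambda>}" by blast
    then show ?thesis using False by (simp add: gen_def par_singleton)
  qed
  then have "par \<Lambda> \<subseteq> generate P (gen \<Lambda>)" unfolding par_def by (intro mono_generate) blast
  moreover have "generate P (gen \<Lambda>) \<subseteq> par \<Lambda>" using generate_subgroup_incl[OF gen_par par_subgroup] .
  ultimately show ?thesis by blast
qed

lemma total_sgen: "\<Lambda> \<noteq> {} \<Longrightarrow> total_gen (sgen \<Lambda>) (par \<Lambda>)"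
  using total_gen_generate[OF gen_closed, of \<Lambda>] generate_gen[of \<Lambda>] by (simp add: sgen_def)

lemma symset_sgen: "symset P (sgen \<Lambda>)"
  using total_gen_generate[OF gen_closed, of \<Lambda>] unfolding total_gen_def sgen_def by blast

lemma prods_sgen_par: "x \<in> prods P (sgen \<Lambda>) n \<Longrightarrow> x \<in> par \<Lambda>"
  by (induction n arbitrary: x) (use sgen_par in \<open>auto intro: par_mult\<close>)

lemma len_one [simp]: "len \<Lambda> \<one> = 0"
  by (simp add: len_def)

lemma len_mult: "\<Lambda> \<noteq> {} \<Longrightarrow> x \<in> par \<Lambda> \<Longrightarrow> y \<in> par \<Lambda> \<Longrightarrow> len \<Lambda> (x \<otimes> y) \<le> len \<Lambda> x + len \<Lambda> y"
  unfolding len_def by (intro wlen_mult[OF total_sgen])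

lemma len_inv: "\<Lambda> \<noteq> {} \<Longrightarrow> x \<in> par \<Lambda> \<Longrightarrow> len \<Lambda> (inv x) = len \<Lambda> x"
  unfolding len_def by (intro wlen_inv[OF total_sgen]) auto

lemma len_le_iff: "\<Lambda> \<noteq> {} \<Longrightarrow> x \<in> par \<Lambda> \<Longrightarrow> len \<Lambda> x \<le> n \<longleftrightarrow> x \<in> prods P (sgen \<Lambda>) n"
  unfolding len_def by (intro wlen_le_iff[OF total_sgen])

lemma len_sgen: "t \<in> sgen \<Lambda> \<Longrightarrow> len \<Lambda> t \<le> 1"
  unfolding len_def by (intro wlen_le prods_single symset_sgen)

lemma len_dist_triangle:
  assumes "\<Lambda> \<noteq> {}" "inv x \<otimes> y \<in> par \<Lambda>" "inv y \<otimes> z \<in> par \<Lambda>" "x \<in> carrier P" "y \<in> carrier P" "z \<in> carrier P"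
  shows "len \<Lambda> (inv x \<otimes> z) \<le> len \<Lambda> (inv x \<otimes> y) + len \<Lambda> (inv y \<otimes> z)"
proof -
  have "inv x \<otimes> z = (inv x \<otimes> y) \<otimes> (inv y \<otimes> z)" using assms by (simp add: m_assoc)
  then show ?thesis using len_mult[OF assms(1-3)] by simp
qed

lemma len_dist_sym:
  assumes "\<Lambda> \<noteq> {}" "inv x \<otimes> y \<in> par \<Lambda>" "x \<in> carrier P" "y \<in> carrier P"
  shows "len \<Lambda> (inv y \<otimes> x) = len \<Lambda> (inv x \<otimes> y)"
  using len_inv[OF assms(1,2)] assms by (simp add: inv_mult_group)

lemma par_sgen: "\<Omega> \<subset> \<Lambda> \<Longrightarrow> x \<in> par \<Omega> \<Longrightarrow> x \<in> sgen \<Lambda>"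
proof (cases "is_singleton \<Lambda>")
  case True
  assume "\<Omega> \<subset> \<Lambda>" "x \<in> par \<Omega>"
  then have "\<Omega> = {}" using True by (auto simp: is_singleton_def)
  then show ?thesis using \<open>x \<in> par \<Omega>\<close> par_empty by (simp add: sgen_def)
next
  case False
  assume "\<Omega> \<subset> \<Lambda>" "x \<in> par \<Omega>"
  then show ?thesis using False by (auto simp: gen_def sgen_def)
qed

lemma len_small: "\<Omega> \<subset> \<Lambda> \<Longrightarrow> x \<in> par \<Omega> \<Longrightarrow> len \<Lambda> x \<le> 1"
  by (intro len_sgen par_sgen)

text \<open>\<open>\<Omega>\<close> is chosen non-empty because it becomes the type of a domain in
  the large links axiom.\<close>

lemma sgen_proper:
  assumes "\<not> is_singleton \<Lambda>" "\<Lambda> \<noteq> {}" "t \<in> sgen \<Lambda>"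
  shows "\<exists>\<Omega>. \<Omega> \<noteq> {} \<and> \<Omega> \<subset> \<Lambda> \<and> t \<in> par \<Omega>"
proof -
  obtain v where v: "v \<in> \<Lambda>" "{v} \<subset> \<Lambda>" using assms by (auto simp: is_singleton_def)
  have "\<exists>\<Omega>. \<Omega> \<subset> \<Lambda> \<and> t \<in> par \<Omega>"
    using assms v par_one by (auto simp: sgen_def gen_def intro: par_inv)
  then obtain \<Omega> where O: "\<Omega> \<subset> \<Lambda>" "t \<in> par \<Omega>" by blast
  show ?thesis
  proof (cases "\<Omega> = {}")
    case True
    then have "t \<in> par {v}" using O(2) par_empty by simp
    then show ?thesis using v(2) by (intro exI[of _ "{v}"]) simp
  next
    case False
    then show ?thesis using O by blast
  qed
qed

text \<open>A join is the product of two commuting proper parabolic subgroups, each of length at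
  most 1. Domains whose type is a join thus have bounded spaces, which disposes of the degenerate
  cases below.\<close>

lemma len_join:
  assumes "x \<in> par \<Lambda>" "L1 \<subset> \<Lambda>" "L2 \<subset> \<Lambda>" "\<Lambda> \<subseteq> L1 \<union> L2" "L2 \<subseteq> lk L1"
  shows "len \<Lambda> x \<le> 2"
proof -
  obtain l m where lm: "l \<in> par L1" "m \<in> par L2" "x = l \<otimes> m"
    using par_join[of x L1 L2] assms par_mono' by metis
  have "\<Lambda> \<noteq> {}" using assms by blast
  then have "len \<Lambda> x \<le> len \<Lambda> l + len \<Lambda> m"
    unfolding lm(3) by (intro len_mult) (use lm assms par_mono' in blast)+
  then show ?thesis using len_small[OF assms(2) lm(1)] len_small[OF assms(3) lm(2)] by simp
qed

lemma len_join_st: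
  assumes "x \<in> par \<Lambda>" "\<Lambda> \<subseteq> st \<Omega>" "\<not> \<Lambda> \<subseteq> \<Omega>" "\<not> \<Lambda> \<subseteq> lk \<Omega>"
  shows "len \<Lambda> x \<le> 2"
  by (rule len_join[of x \<Lambda> "\<Lambda> \<inter> \<Omega>" "\<Lambda> \<inter> lk \<Omega>"]) (use assms in \<open>auto simp: st_def lk_def\<close>)

section \<open>Gates in the coned-off metrics\<close>

lemma gate_dist_in: "x \<in> carrier P \<Longrightarrow> y \<in> carrier P \<Longrightarrow> inv (gate \<Lambda> x) \<otimes> gate \<Lambda> y \<in> par \<Lambda>"
  by (intro par_mult par_inv gate_in)

lemma gate_coset_len:
  assumes x: "x \<in> carrier P"
  shows "(\<forall>d\<in>par D. \<forall>e\<in>par D. len \<Lambda> (inv (gate \<Lambda> (x \<otimes> d)) \<otimes> gate \<Lambda> (x \<otimes> e)) \<le> 1) \<or>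
    (\<Lambda> \<subseteq> D \<and> (\<exists>d\<in>par D. x \<otimes> d \<in> par (st \<Lambda>)))"
  using gate_coset[OF x, of \<Lambda> D]
proof
  assume "\<exists>L\<subset>\<Lambda>. \<exists>q\<in>par \<Lambda>. \<forall>d\<in>par D. inv q \<otimes> gate \<Lambda> (x \<otimes> d) \<in> par L"
  then obtain L q where L: "L \<subset> \<Lambda>" "q \<in> par \<Lambda>" "\<And>d. d \<in> par D \<Longrightarrow> inv q \<otimes> gate \<Lambda> (x \<otimes> d) \<in> par L" by blast
  have "len \<Lambda> (inv (gate \<Lambda> (x \<otimes> d)) \<otimes> gate \<Lambda> (x \<otimes> e)) \<le> 1" if de: "d \<in> par D" "e \<in> par D" for d e
  proof -
    have c: "gate \<Lambda> (x \<otimes> d) \<in> carrier P" "gate \<Lambda> (x \<otimes> e) \<in> carrier P" "q \<in> carrier P"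
      by (intro gate_closed m_closed x par_closed[OF de(1)] par_closed[OF de(2)] par_closed[OF L(2)])+
    have "inv (inv q \<otimes> gate \<Lambda> (x \<otimes> d)) \<otimes> (inv q \<otimes> gate \<Lambda> (x \<otimes> e)) \<in> par L"
      by (rule par_mult[OF par_inv[OF L(3)[OF de(1)]] L(3)[OF de(2)]])
    moreover have "inv (inv q \<otimes> gate \<Lambda> (x \<otimes> d)) \<otimes> (inv q \<otimes> gate \<Lambda> (x \<otimes> e)) = inv (gate \<Lambda> (x \<otimes> d)) \<otimes> gate \<Lambda> (x \<otimes> e)"
      using c by (simp add: inv_mult_group m_assoc)
    ultimately show ?thesis using len_small[OF L(1)] by metis
  qed
  then show ?thesis by blast
qed blast

text \<open>By \<open>gate_right_mult\<close> the gate stays or is multiplied by \<open>t\<close>;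
  for \<open>\<Lambda> = {v}\<close> this is one of the chosen generators, otherwise it lies in a
  coned-off vertex group.\<close>

lemma gate_step:
  assumes y: "y \<in> carrier P" and t: "t \<in> sgen {v}"
  shows "len \<Lambda> (inv (gate \<Lambda> y) \<otimes> gate \<Lambda> (y \<otimes> t)) \<le> 1"
proof -
  let ?g = "gate \<Lambda> y"
  have ta: "t \<in> A v" using t sgen_par[of "{v}"] par_singleton by blast
  have g: "?g \<in> par \<Lambda>" using gate_in y by blast
  have gc: "?g \<in> carrier P" using g by simp
  have "gate \<Lambda> (inv ?g \<otimes> y) = \<one>" using gate_mult[OF par_inv[OF g] y] gc by simp
  then have "gate \<Lambda> (inv ?g \<otimes> y \<otimes> t) = \<one> \<or> v \<in> \<Lambda> \<and> gate \<Lambda> (inv ?g \<otimes> y \<otimes> t) = t"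
    using gate_right_mult[of "inv ?g \<otimes> y" t v \<Lambda>] ta y by auto
  moreover have "gate \<Lambda> (inv ?g \<otimes> y \<otimes> t) = inv ?g \<otimes> gate \<Lambda> (y \<otimes> t)"
    using gate_mult[OF par_inv[OF g], of "y \<otimes> t"] y gc ta by (simp add: m_assoc)
  moreover have "len \<Lambda> t \<le> 1" if "v \<in> \<Lambda>"
  proof (cases "\<Lambda> = {v}")
    case False
    then have "{v} \<subset> \<Lambda>" using that by blast
    then show ?thesis using len_small ta par_singleton by blast
  qed (use t len_sgen in auto)
  ultimately show ?thesis by auto
qed

text \<open>Where the gate changes along the coset of \<open>par L\<close>, an edge of the coset is
  parallel to an edge of \<open>par \<Omega>\<close>; \<open>gate_right_mult\<close> places its
  initial point in \<open>par (lk {v})\<close>.\<close>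

lemma gate_change_coset:
  assumes p: "p \<in> carrier P" "gate \<Omega> p = \<one>" and e: "e \<in> par L" and ne: "gate \<Omega> (p \<otimes> e) \<noteq> \<one>"
  shows "\<exists>v\<in>\<Omega>. \<exists>f\<in>par L. p \<otimes> f \<in> par (lk {v})"
proof -
  have "gate \<Omega> (p \<otimes> inv e) \<noteq> \<one> \<longrightarrow> (\<exists>v\<in>\<Omega>. \<exists>f\<in>par L. p \<otimes> f \<in> par (lk {v}))" if "e \<in> par L" for e
    using that
  proof (induction rule: par_induct)
    case (cons e u b)
    have eq: "p \<otimes> inv (b \<otimes> e) = (p \<otimes> inv e) \<otimes> inv b" using p cons by (simp add: inv_mult_group m_assoc)
    show ?case
    proof (cases "gate \<Omega> (p \<otimes> inv e) = \<one>")
      case True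
      have "p \<otimes> inv e \<in> par (lk {u}) \<and> u \<in> \<Omega>" if "gate \<Omega> (p \<otimes> inv (b \<otimes> e)) \<noteq> \<one>"
        using gate_right_mult[of "p \<otimes> inv e" "inv b" u \<Omega>] that True p cons unfolding eq by auto
      then show ?thesis using par_inv[OF cons(1)] by blast
    qed (use cons in blast)
  qed (use p in simp)
  from this[OF par_inv[OF e]] show ?thesis using e ne by simp
qed

text \<open>Once the gate of \<open>p\<close> is moved to the identity,
  \<open>gate_change_coset\<close> writes \<open>p\<close> as an element of
  \<open>par (\<Lambda> \<inter> lk {v})\<close> times one of \<open>par L\<close>. Both subgroups
  are proper parabolic, hence the 2.\<close>

lemma gate_change:
  assumes p: "p \<in> par \<Lambda>" and l: "l \<in> par L" "L \<subset> \<Lambda>" and O: "\<Omega> \<subseteq> \<Lambda>" and ne: "gate \<Omega> (p \<otimes> l) \<noteq> gate \<Omega> p"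
  shows "len \<Lambda> (inv (gate \<Omega> p) \<otimes> p) \<le> 2"
proof -
  let ?c = "gate \<Omega> p"
  have pc: "p \<in> carrier P" and lc: "l \<in> carrier P" using p l by auto
  have c: "?c \<in> par \<Omega>" using gate_in pc by blast
  have cL: "?c \<in> par \<Lambda>" using c O par_mono' by blast
  let ?p = "inv ?c \<otimes> p"
  have pp: "?p \<in> par \<Lambda>" using cL p by simp
  have g: "gate \<Omega> ?p = \<one>" using gate_mult[OF par_inv[OF c] pc] c by simp
  have "gate \<Omega> (?p \<otimes> l) = inv ?c \<otimes> gate \<Omega> (p \<otimes> l)"
    using gate_mult[OF par_inv[OF c], of "p \<otimes> l"] pc lc c by (simp add: m_assoc)
  then have "gate \<Omega> (?p \<otimes> l) \<noteq> \<one>"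
    using ne inv_equality[of "inv ?c" "gate \<Omega> (p \<otimes> l)"] pc lc c by auto
  from gate_change_coset[OF _ g l(1) this] obtain v f where
    vf: "v \<in> \<Omega>" "f \<in> par L" "?p \<otimes> f \<in> par (lk {v})" using pp by auto
  have f: "f \<in> par \<Lambda>" using vf l(2) par_mono' by blast
  have "?p \<otimes> f \<in> par (\<Lambda> \<inter> lk {v})" using vf(3) pp f par_Int by (metis IntI par_mult)
  moreover have "\<Lambda> \<inter> lk {v} \<subset> \<Lambda>" using vf(1) O lk_disjoint[of "{v}"] by blast
  ultimately have 1: "len \<Lambda> (?p \<otimes> f) \<le> 1" using len_small by blast
  have ne: "\<Lambda> \<noteq> {}" using O vf(1) by blast
  have 2: "len \<Lambda> (inv f) \<le> 1" using len_small[OF l(2)] vf(2) by simp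
  have "?p = (?p \<otimes> f) \<otimes> inv f" using pp f cL pc by (simp add: m_assoc)
  then have "len \<Lambda> ?p \<le> len \<Lambda> (?p \<otimes> f) + len \<Lambda> (inv f)"
    using len_mult[OF ne, of "?p \<otimes> f" "inv f"] pp f by simp
  then show ?thesis using 1 2 by simp
qed

section \<open>Cancelling prefixes, and the uniqueness estimate\<close>

lemma gate_singleton: "x \<in> carrier P \<Longrightarrow> gate {v} x = s v x"
  using gate_in[of x "{v}"] s_of_gate[of x v "{v}"] s_mult[of "gate {v} x" v \<one>] by (auto simp: par_singleton)

text \<open>A head with type outside \<open>\<Omega>\<close> must come from \<open>y\<close> and
  commute past every syllable of \<open>m\<close>.\<close>

lemma s_prefix_lk:
  assumes "m \<in> par \<Omega>" "y \<in> carrier P" "\<forall>w\<in>\<Omega>. s w y = \<one>" "v \<notin> \<Omega>" "s v (m \<otimes> y) \<noteq> \<one>"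
  shows "m \<in> par (lk {v})"
proof -
  have "s v (m \<otimes> y) \<noteq> \<one> \<longrightarrow> m \<in> par (lk {v})"
    using assms(1)
  proof (induction rule: par_induct)
    case (cons x u b)
    have "s u (x \<otimes> y) = \<one>" using s_prefix[OF cons(1) assms(2,3)] cons by auto
    then have "s v (b \<otimes> (x \<otimes> y)) = (if v = u then b else if adj u v then s v (x \<otimes> y) else \<one>)"
      using s_cons[of "x \<otimes> y" u b v] cons assms(2) by simp
    then show ?case using cons assms(2,4) by (auto simp: m_assoc lk_def intro: cons_par)
  qed simp
  then show ?thesis using assms by blast
qed

text \<open>Cancelling a gate does not increase the coned-off length: each of its heads either
  belongs to the first factor of the given product, or commutes with it and is cancelled further
  on.\<close>

lemma gate_removal:
  assumes L: "\<not> is_singleton \<Lambda>" "\<Lambda> \<noteq> {}" and "x \<in> prods P (sgen \<Lambda>) n"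
  shows "inv (gate B x) \<otimes> x \<in> prods P (sgen \<Lambda>) n"
  using assms(3)
proof (induction n arbitrary: x B)
  case (Suc n)
  have single: "inv (s v x) \<otimes> x \<in> prods P (sgen \<Lambda>) (Suc n)" if x: "x \<in> prods P (sgen \<Lambda>) (Suc n)" for x v
  proof -
    have xc: "x \<in> carrier P" using prods_sgen_par[OF x] by simp
    obtain a y where a: "a \<in> sgen \<Lambda>" and y: "y \<in> prods P (sgen \<Lambda>) n" and xy: "x = a \<otimes> y"
      using x by auto
    have yc: "y \<in> carrier P" using prods_sgen_par[OF y] by simp
    obtain \<Omega> where O: "\<Omega> \<subset> \<Lambda>" "a \<in> par \<Omega>" using sgen_proper[OF L a] by blast
    \<comment> \<open>The first factor is enlarged to the full gate of \<open>x\<close> in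
      \<open>par \<Omega>\<close>. By induction \<open>n\<close> factors suffice for the remainder,
      which now has no head with type in \<open>\<Omega>\<close>.\<close>
    let ?w = "gate \<Omega> x"
    let ?z = "inv ?w \<otimes> x"
    have w: "?w \<in> par \<Omega>" using gate_in xc by blast
    have z: "?z \<in> prods P (sgen \<Lambda>) n"
      using Suc.IH[OF y, of \<Omega>] O(2) yc gate_in[OF yc, of \<Omega>]
      by (simp add: xy gate_mult inv_mult_group m_assoc)
    have zc: "?z \<in> carrier P" using w xc by simp
    have sz: "\<forall>w\<in>\<Omega>. s w ?z = \<one>" using s_gate[OF xc] by blast
    have sx: "s v x \<in> A v" using s_in xc by blast
    consider "v \<in> \<Omega>" | "s v x = \<one>" | "v \<notin> \<Omega>" "s v x \<noteq> \<one>" by blast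
    then show ?thesis
    proof cases
      case 1
      have "inv (s v x) \<otimes> ?w \<in> par \<Omega>" using A_par[OF sx 1] w by simp
      then have "inv (s v x) \<otimes> ?w \<in> sgen \<Lambda>" using par_sgen O(1) by blast
      moreover have "inv (s v x) \<otimes> x = inv (s v x) \<otimes> ?w \<otimes> ?z" using sx w xc by (simp add: m_assoc)
      ultimately show ?thesis using z by auto
    next
      case 2 then show ?thesis using x xc by (simp del: prods.simps)
    next
      case 3
      have xz: "?w \<otimes> ?z = x" using w xc by simp
      then have wl: "?w \<in> par (lk {v})" using s_prefix_lk[OF w zc sz 3(1)] 3(2) by metis
      have ss: "s v x = s v ?z" using s_lk[OF wl zc] xz by simp
      have c: "inv (s v ?z) \<in> A v" using s_in[OF zc] by simp
      have "inv (s v x) \<otimes> x = inv (s v ?z) \<otimes> (?w \<otimes> ?z)" using xz ss by simp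
      also have "\<dots> = inv (s v ?z) \<otimes> ?w \<otimes> ?z" using c w zc by (simp add: m_assoc)
      also have "\<dots> = ?w \<otimes> (inv (s v ?z) \<otimes> ?z)" using commute_A_par[OF c wl] c w zc by (simp add: m_assoc)
      finally have "inv (s v x) \<otimes> x = ?w \<otimes> (inv (s v ?z) \<otimes> ?z)" .
      moreover have "inv (s v ?z) \<otimes> ?z \<in> prods P (sgen \<Lambda>) n"
        using Suc.IH[OF z, of "{v}"] gate_singleton[OF zc] by simp
      moreover have "?w \<in> sgen \<Lambda>" using par_sgen O(1) w by blast
      ultimately show ?thesis by auto
    qed
  qed
  \<comment> \<open>A whole gate is cancelled syllable by syllable along a reduced expression of
    it.\<close>
  have "\<forall>x. x \<in> prods P (sgen \<Lambda>) (Suc n) \<longrightarrow> gate B x = m \<longrightarrow> inv m \<otimes> x \<in> prods P (sgen \<Lambda>) (Suc n)"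
    if "m \<in> par B" for m
    using that
  proof (induction rule: par_induct)
    case one then show ?case using prods_sgen_par[of _ \<Lambda> "Suc n"] by (metis inv_one l_one par_closed)
  next
    case (cons m u b)
    show ?case
    proof (intro allI impI)
      fix x assume x: "x \<in> prods P (sgen \<Lambda>) (Suc n)" "gate B x = b \<otimes> m"
      have xc: "x \<in> carrier P" using prods_sgen_par[OF x(1)] by simp
      have "s u x = b" using s_of_gate[OF xc \<open>u \<in> B\<close>] x(2) s_cons[of m u b u] cons by simp
      then have b: "inv b \<otimes> x \<in> prods P (sgen \<Lambda>) (Suc n)" using single[OF x(1), of u] by simp
      have "gate B (inv b \<otimes> x) = m" using gate_mult[of "inv b" B x] A_par[OF \<open>b \<in> A u\<close> \<open>u \<in> B\<close>] x xc cons by simp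
      then have "inv m \<otimes> (inv b \<otimes> x) \<in> prods P (sgen \<Lambda>) (Suc n)" using cons.IH b by blast
      moreover have "inv m \<otimes> (inv b \<otimes> x) = inv (b \<otimes> m) \<otimes> x" using cons xc by (simp add: inv_mult_group m_assoc)
      ultimately show "inv (b \<otimes> m) \<otimes> x \<in> prods P (sgen \<Lambda>) (Suc n)" by simp
    qed
  qed
  moreover have "gate B x \<in> par B" using gate_in prods_sgen_par[OF Suc.prems] by simp
  ultimately show ?case using Suc.prems by blast
qed simp

text \<open>In every domain the projections of the identity and of \<open>x\<close> are at distance
  at most \<open>r\<close>: the coset of \<open>par \<Omega>\<close> through \<open>inv c\<close> is
  translated to \<open>par \<Omega>\<close>, and \<open>c\<close> runs over all base points.\<close>

definition bounded_proj :: "'a \<Rightarrow> nat \<Rightarrow> bool" where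
  "bounded_proj x r \<longleftrightarrow> (\<forall>\<Omega> c. \<Omega> \<noteq> {} \<longrightarrow> \<Omega> \<subseteq> V \<longrightarrow> c \<in> carrier P \<longrightarrow> len \<Omega> (inv (gate \<Omega> c) \<otimes> gate \<Omega> (c \<otimes> x)) \<le> r)"

text \<open>If a coset of \<open>par \<Omega>\<close> is parallel into the coset of
  \<open>par B\<close>, passing through the gate in \<open>par B\<close> loses nothing, because
  gates in nested types compose.\<close>

lemma gate_parallel:
  assumes x: "x \<in> carrier P" and c: "c \<in> carrier P" and O: "\<Omega> \<subseteq> B" and d: "d \<in> par B" "c \<otimes> d \<in> par (st \<Omega>)"
  shows "gate \<Omega> (c \<otimes> gate B x) = gate \<Omega> (c \<otimes> x)"
proof -
  have g: "gate B x \<in> par B" using gate_in x by blast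
  have id: "inv d \<in> par B" using d by simp
  have e: "c \<otimes> y = (c \<otimes> d) \<otimes> (inv d \<otimes> y)" if "y \<in> carrier P" for y using that c d by (simp add: m_assoc)
  have "gate \<Omega> (inv d \<otimes> x) = gate \<Omega> (gate B (inv d \<otimes> x))" using gate_gate[of "inv d \<otimes> x" \<Omega> B] O d x by simp
  also have "gate B (inv d \<otimes> x) = inv d \<otimes> gate B x" using gate_mult[OF id x] .
  finally have "gate \<Omega> (inv d \<otimes> x) = gate \<Omega> (inv d \<otimes> gate B x)" .
  then show ?thesis
    using gate_st[OF d(2), of "inv d \<otimes> x"] gate_st[OF d(2), of "inv d \<otimes> gate B x"] d(1) x g
    by (subst (1 2) e) auto
qed

text \<open>Cutting \<open>x\<close> at its gate costs 1 in every domain: by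
  \<open>gate_coset_len\<close> a domain either sees the coset of \<open>par B\<close> as a set of
  diameter at most 1, or does not distinguish \<open>x\<close> from its gate.\<close>

lemma bounded_proj_gate:
  assumes x: "x \<in> carrier P" and h: "bounded_proj x r"
  shows "bounded_proj (gate B x) (Suc r)" "bounded_proj (inv (gate B x) \<otimes> x) (Suc r)"
proof -
  have g: "gate B x \<in> par B" using gate_in x by blast
  have gc: "gate B x \<in> carrier P" using g by simp
  show "bounded_proj (gate B x) (Suc r)"
    unfolding bounded_proj_def
  proof (intro allI impI)
    fix \<Omega> c assume O: "\<Omega> \<noteq> {}" "\<Omega> \<subseteq> V" and c: "c \<in> carrier P"
    have hr: "len \<Omega> (inv (gate \<Omega> c) \<otimes> gate \<Omega> (c \<otimes> x)) \<le> r" using h O c by (auto simp: bounded_proj_def)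
    show "len \<Omega> (inv (gate \<Omega> c) \<otimes> gate \<Omega> (c \<otimes> gate B x)) \<le> Suc r"
      using gate_coset_len[OF c, of B \<Omega>]
    proof
      assume "\<forall>d\<in>par B. \<forall>e\<in>par B. len \<Omega> (inv (gate \<Omega> (c \<otimes> d)) \<otimes> gate \<Omega> (c \<otimes> e)) \<le> 1"
      from bspec[OF bspec[OF this par_one] g] show ?thesis using c by simp
    qed (use gate_parallel[OF x c] hr in auto)
  qed
  show "bounded_proj (inv (gate B x) \<otimes> x) (Suc r)"
    unfolding bounded_proj_def
  proof (intro allI impI)
    fix \<Omega> c assume O: "\<Omega> \<noteq> {}" "\<Omega> \<subseteq> V" and c: "c \<in> carrier P"
    let ?c = "c \<otimes> inv (gate B x)"
    have cc: "?c \<in> carrier P" using c gc by simp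
    have hr: "len \<Omega> (inv (gate \<Omega> ?c) \<otimes> gate \<Omega> (?c \<otimes> x)) \<le> r" using h O cc by (auto simp: bounded_proj_def)
    have e: "c = ?c \<otimes> gate B x" "c \<otimes> (inv (gate B x) \<otimes> x) = ?c \<otimes> x" using c gc x by (simp_all add: m_assoc)
    show "len \<Omega> (inv (gate \<Omega> c) \<otimes> gate \<Omega> (c \<otimes> (inv (gate B x) \<otimes> x))) \<le> Suc r"
      using gate_coset_len[OF cc, of B \<Omega>]
    proof
      assume "\<forall>d\<in>par B. \<forall>e\<in>par B. len \<Omega> (inv (gate \<Omega> (?c \<otimes> d)) \<otimes> gate \<Omega> (?c \<otimes> e)) \<le> 1"
      from bspec[OF bspec[OF this g] par_one] have "len \<Omega> (inv (gate \<Omega> c) \<otimes> gate \<Omega> ?c) \<le> 1" using cc e(1) by simp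
      moreover have "len \<Omega> (inv (gate \<Omega> c) \<otimes> gate \<Omega> (?c \<otimes> x)) \<le>
          len \<Omega> (inv (gate \<Omega> c) \<otimes> gate \<Omega> ?c) + len \<Omega> (inv (gate \<Omega> ?c) \<otimes> gate \<Omega> (?c \<otimes> x))"
        using O c cc x by (intro len_dist_triangle gate_dist_in gate_closed) auto
      ultimately show ?thesis unfolding e(2) using hr by linarith
    next
      assume "\<Omega> \<subseteq> B \<and> (\<exists>d\<in>par B. ?c \<otimes> d \<in> par (st \<Omega>))"
      then have "gate \<Omega> c = gate \<Omega> (?c \<otimes> x)" using gate_parallel[OF x cc] e(1) by metis
      then show ?thesis unfolding e(2) using x cc by simp
    qed
  qed
qed

definition all_gens :: "'a set" where
  "all_gens = (\<Union>v\<in>V. T v)"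

definition sall :: "'a set" where
  "sall = insert \<one> (all_gens \<union> (\<lambda>x. inv x) ` all_gens)"

lemma all_gens_closed: "all_gens \<subseteq> carrier P"
  using T_A A_closed unfolding all_gens_def by blast

lemma symset_sall: "symset P sall"
  using total_gen_generate[OF all_gens_closed] unfolding total_gen_def sall_def by blast

lemma prods_gens_mono: "S \<subseteq> S' \<Longrightarrow> prods P S n \<subseteq> prods P S' n"
  by (induction n) auto

text \<open>Induction on the type. The projection to \<open>\<Lambda>\<close> itself bounds the
  coned-off length, and cutting at gates yields factors from smaller parabolic subgroups that
  inherit bounded projections. Every cut raises the bound by 1, so the claim is stated for all
  \<open>r\<close> at once.\<close>

lemma uniqueness_aux:
  assumes "finite \<Lambda>" "\<Lambda> \<subseteq> V"
  shows "\<forall>r. \<exists>N. \<forall>x\<in>par \<Lambda>. bounded_proj x r \<longrightarrow> x \<in> prods P sall N"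
  using assms
proof (induction \<Lambda> rule: finite_psubset_induct)
  case (psubset \<Lambda>)
  consider "\<Lambda> = {}" | v where "\<Lambda> = {v}" | "\<Lambda> \<noteq> {}" "\<not> is_singleton \<Lambda>" by (auto simp: is_singleton_def)
  then show ?case
  proof cases
    case 1
    then show ?thesis using par_empty by (intro allI exI[of _ 0]) auto
  next
    case 2
    have "x \<in> prods P sall r" if x: "x \<in> par \<Lambda>" "bounded_proj x r" for x r
    proof -
      have "len \<Lambda> (inv (gate \<Lambda> \<one>) \<otimes> gate \<Lambda> (\<one> \<otimes> x)) \<le> r"
        using x 2 psubset.prems unfolding bounded_proj_def by blast
      then have "x \<in> prods P (sgen \<Lambda>) r" using x 2 len_le_iff[of \<Lambda> x r] by simp
      moreover have "sgen \<Lambda> \<subseteq> sall"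
        using 2 psubset.prems by (auto simp: sgen_def sall_def gen_singleton all_gens_def)
      ultimately show ?thesis using prods_gens_mono by blast
    qed
    then show ?thesis by blast
  next
    case 3
    \<comment> \<open>An inner induction on the coned-off length; stripping the gate in the type of
      the first factor leaves a remainder of length at most \<open>n\<close> by
      \<open>gate_removal\<close>.\<close>
    have main: "\<forall>r. \<exists>N. \<forall>x\<in>prods P (sgen \<Lambda>) n. bounded_proj x r \<longrightarrow> x \<in> prods P sall N" for n
    proof (induction n)
      case 0 show ?case by (intro allI exI[of _ 0]) simp
    next
      case (Suc n)
      show ?case
      proof (rule allI)
        fix r
        obtain N where N: "\<And>x. x \<in> prods P (sgen \<Lambda>) n \<Longrightarrow> bounded_proj x (Suc r) \<Longrightarrow> x \<in> prods P sall N"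
          using Suc by blast
        have "\<forall>\<Omega>. \<exists>M. \<Omega> \<subset> \<Lambda> \<longrightarrow> (\<forall>x\<in>par \<Omega>. bounded_proj x (Suc r) \<longrightarrow> x \<in> prods P sall M)"
        proof (rule allI)
          fix \<Omega>
          show "\<exists>M. \<Omega> \<subset> \<Lambda> \<longrightarrow> (\<forall>x\<in>par \<Omega>. bounded_proj x (Suc r) \<longrightarrow> x \<in> prods P sall M)"
          proof (cases "\<Omega> \<subset> \<Lambda>")
            case True
            then show ?thesis using psubset.IH[OF True] psubset.prems by blast
          qed simp
        qed
        then obtain M where M: "\<And>\<Omega> x. \<Omega> \<subset> \<Lambda> \<Longrightarrow> x \<in> par \<Omega> \<Longrightarrow> bounded_proj x (Suc r) \<Longrightarrow> x \<in> prods P sall (M \<Omega>)"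
          by metis
        \<comment> \<open>\<open>\<Omega>\<close> depends on \<open>x\<close>; summing over all
          subsets gives a bound that does not.\<close>
        have "x \<in> prods P sall (sum M (Pow \<Lambda>) + N)" if x: "x \<in> prods P (sgen \<Lambda>) (Suc n)" "bounded_proj x r" for x
        proof -
          have xc: "x \<in> carrier P" using prods_sgen_par[OF x(1)] by simp
          obtain a y where a: "a \<in> sgen \<Lambda>" and y: "y \<in> prods P (sgen \<Lambda>) n" and xy: "x = a \<otimes> y"
            using x by auto
          have yc: "y \<in> carrier P" using prods_sgen_par[OF y] by simp
          obtain \<Omega> where O: "\<Omega> \<subset> \<Lambda>" "a \<in> par \<Omega>" using sgen_proper[OF 3(2,1) a] by blast
          let ?w = "gate \<Omega> x"
          have w: "?w \<in> par \<Omega>" using gate_in xc by blast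
          have "inv ?w \<otimes> x = inv (gate \<Omega> y) \<otimes> y"
            using O(2) yc gate_in[OF yc, of \<Omega>] by (simp add: xy gate_mult inv_mult_group m_assoc)
          then have "inv ?w \<otimes> x \<in> prods P (sgen \<Lambda>) n" using gate_removal[OF 3(2,1) y] by simp
          then have 1: "inv ?w \<otimes> x \<in> prods P sall N" using N bounded_proj_gate(2)[OF xc x(2)] by blast
          have "?w \<in> prods P sall (M \<Omega>)" using M O(1) w bounded_proj_gate(1)[OF xc x(2)] by blast
          moreover have "M \<Omega> \<le> sum M (Pow \<Lambda>)" using O(1) psubset.hyps by (intro member_le_sum) auto
          ultimately have "?w \<in> prods P sall (sum M (Pow \<Lambda>))" using prods_mono[OF symset_sall] by blast
          from prods_mult[OF symset_sall this 1] show ?thesis using w xc by simp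
        qed
        then show "\<exists>N. \<forall>x\<in>prods P (sgen \<Lambda>) (Suc n). bounded_proj x r \<longrightarrow> x \<in> prods P sall N" by blast
      qed
    qed
    show ?thesis
    proof (rule allI)
      fix r
      obtain N where N: "\<And>x. x \<in> prods P (sgen \<Lambda>) r \<Longrightarrow> bounded_proj x r \<Longrightarrow> x \<in> prods P sall N"
        using main[of r] by blast
      have "x \<in> prods P (sgen \<Lambda>) r" if x: "x \<in> par \<Lambda>" "bounded_proj x r" for x
      proof -
        have "len \<Lambda> (inv (gate \<Lambda> \<one>) \<otimes> gate \<Lambda> (\<one> \<otimes> x)) \<le> r"
          using x 3 psubset.prems unfolding bounded_proj_def by blast
        then show ?thesis using x 3 len_le_iff[of \<Lambda> x r] by simp
      qed
      then show "\<exists>N. \<forall>x\<in>par \<Lambda>. bounded_proj x r \<longrightarrow> x \<in> prods P sall N" using N by blast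
    qed
  qed
qed

end


section \<open>Discrete geodesics, large links and bounded geodesic images\<close>

lemma (in group) prods_path:
  assumes "S \<subseteq> carrier G" "z \<in> prods G S n"
  shows "\<exists>c. c 0 = \<one> \<and> c n = z \<and> (\<forall>i<n. c i \<in> carrier G \<and> inv (c i) \<otimes> c (Suc i) \<in> S)"
  using assms(2)
proof (induction n arbitrary: z)
  case (Suc n)
  then obtain t x where t: "t \<in> S" "x \<in> prods G S n" "z = t \<otimes> x" by auto
  obtain c where c: "c 0 = \<one>" "c n = x" "\<forall>i<n. c i \<in> carrier G \<and> inv (c i) \<otimes> c (Suc i) \<in> S"
    using Suc.IH[OF t(2)] by blast
  have tc: "t \<in> carrier G" using t assms(1) by blast
  have xc: "x \<in> carrier G" using t(2) assms(1)
    by (induction n arbitrary: x) auto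
  have cc: "c i \<in> carrier G" if "i \<le> n" for i using that c xc by (cases "i = n") auto
  let ?d = "\<lambda>i. case i of 0 \<Rightarrow> \<one> | Suc j \<Rightarrow> t \<otimes> c j"
  have "?d i \<in> carrier G \<and> inv (?d i) \<otimes> ?d (Suc i) \<in> S" if i: "i < Suc n" for i
  proof (cases i)
    case 0 then show ?thesis using c(1) t(1) tc by simp
  next
    case (Suc j)
    then have j: "j < n" using i by simp
    have cj: "c j \<in> carrier G" "c (Suc j) \<in> carrier G" using cc j by auto
    then have "inv (t \<otimes> c j) \<otimes> (t \<otimes> c (Suc j)) = inv (c j) \<otimes> c (Suc j)"
      using tc by (simp add: inv_mult_group m_assoc)
    then show ?thesis using Suc c(3) j tc cj by simp
  qed
  moreover have "?d (Suc n) = z" using c(2) t(3) by simp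
  ultimately show ?case by (intro exI[of _ ?d]) simp
qed (auto intro!: exI[of _ "\<lambda>_. \<one>"])

lemma seq_change:
  fixes a b :: nat
  assumes "f a \<noteq> f b" "a \<le> b"
  shows "\<exists>j. a \<le> j \<and> j < b \<and> f j \<noteq> f (Suc j)"
  using assms(2,1)
proof (induction b rule: dec_induct)
  case (step n)
  then show ?case by (cases "f a = f n") (auto intro: less_SucI)
qed simp

context generated_graph_group
begin

text \<open>Keeps a proper type for every step of a geodesic. These types supply the list of domains
  in \<open>large_links_alg\<close>.\<close>

lemma len_path:
  assumes L: "\<not> is_singleton \<Lambda>" "\<Lambda> \<noteq> {}" and a: "a \<in> par \<Lambda>" and b: "b \<in> par \<Lambda>"
  shows "\<exists>c L. c 0 = a \<and> c (len \<Lambda> (inv a \<otimes> b)) = b \<and> (\<forall>i\<le>len \<Lambda> (inv a \<otimes> b). c i \<in> par \<Lambda>) \<and>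
    (\<forall>i<len \<Lambda> (inv a \<otimes> b). L i \<noteq> {} \<and> L i \<subset> \<Lambda> \<and> inv (c i) \<otimes> c (Suc i) \<in> par (L i)) \<and>
    (\<forall>i j. i \<le> j \<longrightarrow> j \<le> len \<Lambda> (inv a \<otimes> b) \<longrightarrow> len \<Lambda> (inv (c i) \<otimes> c j) = j - i)"
proof -
  let ?n = "len \<Lambda> (inv a \<otimes> b)"
  have z: "inv a \<otimes> b \<in> par \<Lambda>" using a b by simp
  have "inv a \<otimes> b \<in> prods P (sgen \<Lambda>) ?n" using len_le_iff[OF L(2) z] by blast
  moreover have "sgen \<Lambda> \<subseteq> carrier P" using sgen_par par_closed by blast
  ultimately obtain d where d: "d 0 = \<one>" "d ?n = inv a \<otimes> b"
    "\<And>i. i < ?n \<Longrightarrow> d i \<in> carrier P" "\<And>i. i < ?n \<Longrightarrow> inv (d i) \<otimes> d (Suc i) \<in> sgen \<Lambda>"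
    using prods_path[of "sgen \<Lambda>" "inv a \<otimes> b" ?n] by blast
  have dp: "d i \<in> par \<Lambda>" if "i \<le> ?n" for i
    using that
  proof (induction i)
    case (Suc i)
    have "d (Suc i) \<in> carrier P" using d(2) d(3)[of "Suc i"] Suc.prems par_closed[OF z] by (cases "Suc i = ?n") auto
    then show ?case using par_mult_iff[of "inv (d i)" \<Lambda> "d (Suc i)"] Suc d(4)[of i] sgen_par by auto
  qed (use d in simp)
  define c where "c = (\<lambda>i. a \<otimes> d i)"
  have c: "c 0 = a" "c ?n = b" using d a b by (auto simp: c_def)
  have cp: "c i \<in> par \<Lambda>" if "i \<le> ?n" for i using dp[OF that] a by (simp add: c_def)
  have st: "inv (c i) \<otimes> c (Suc i) \<in> sgen \<Lambda>" if i: "i < ?n" for i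
  proof -
    have "inv (c i) \<otimes> c (Suc i) = inv (d i) \<otimes> d (Suc i)"
      using par_closed[OF dp[of i]] par_closed[OF dp[of "Suc i"]] par_closed[OF a] i
      by (simp add: c_def inv_mult_group m_assoc)
    then show ?thesis using d(4)[OF i] by simp
  qed
  then have "\<exists>L. i < ?n \<longrightarrow> L \<noteq> {} \<and> L \<subset> \<Lambda> \<and> inv (c i) \<otimes> c (Suc i) \<in> par L" for i
    using sgen_proper[OF L st[of i]] by (cases "i < ?n") simp_all
  then obtain M where M: "\<And>i. i < ?n \<Longrightarrow> M i \<noteq> {} \<and> M i \<subset> \<Lambda> \<and> inv (c i) \<otimes> c (Suc i) \<in> par (M i)" by metis
  have tri: "len \<Lambda> (inv x \<otimes> w) \<le> len \<Lambda> (inv x \<otimes> y) + len \<Lambda> (inv y \<otimes> w)"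
    if "x \<in> par \<Lambda>" "y \<in> par \<Lambda>" "w \<in> par \<Lambda>" for x y w
    by (rule len_dist_triangle[OF L(2)]) (use that in auto)
  have up: "len \<Lambda> (inv (c i) \<otimes> c j) \<le> j - i" if "i \<le> j" "j \<le> ?n" for i j
    using that
  proof (induction j rule: dec_induct)
    case base
    then show ?case using par_closed[OF cp[of i]] by simp
  next
    case (step m)
    have "len \<Lambda> (inv (c i) \<otimes> c (Suc m)) \<le> len \<Lambda> (inv (c i) \<otimes> c m) + len \<Lambda> (inv (c m) \<otimes> c (Suc m))"
      using step by (intro tri cp) auto
    moreover have "len \<Lambda> (inv (c m) \<otimes> c (Suc m)) \<le> 1" using st[of m] step len_sgen by simp
    ultimately show ?case using step by simp
  qed
  have "len \<Lambda> (inv (c i) \<otimes> c j) = j - i" if ij: "i \<le> j" "j \<le> ?n" for i j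
  proof -
    \<comment> \<open>The upper bounds for the three pieces of the path add up to exactly
      \<open>?n\<close>, so all of them are attained.\<close>
    have "?n \<le> len \<Lambda> (inv (c 0) \<otimes> c i) + len \<Lambda> (inv (c i) \<otimes> c ?n)"
      using tri[of "c 0" "c i" "c ?n"] cp[of i] a b ij unfolding c by simp
    moreover have "len \<Lambda> (inv (c i) \<otimes> c ?n) \<le> len \<Lambda> (inv (c i) \<otimes> c j) + len \<Lambda> (inv (c j) \<otimes> c ?n)"
      using ij by (intro tri cp) auto
    ultimately show ?thesis using up[of 0 i] up[of j ?n] up[of i j] ij by simp
  qed
  then show ?thesis using c cp M by (intro exI[of _ c] exI[of _ M]) blast
qed

text \<open>\<open>F\<close> collects the cosets of the steps of a geodesic. If none of them
  contains a parallel copy of the coset of \<open>par \<Omega>\<close> at \<open>m\<close>, every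
  step moves the gate by at most 1, and by \<open>gate_change\<close> only steps near that coset
  move it at all.\<close>

lemma large_links_alg:
  assumes L: "\<not> is_singleton \<Lambda>" "\<Lambda> \<noteq> {}" and a: "a \<in> par \<Lambda>" and b: "b \<in> par \<Lambda>"
  shows "\<exists>F. finite F \<and> card F \<le> len \<Lambda> (inv a \<otimes> b) \<and> (\<forall>(c, M)\<in>F. c \<in> par \<Lambda> \<and> M \<noteq> {} \<and> M \<subset> \<Lambda>) \<and>
    (\<forall>\<Omega> m. \<Omega> \<noteq> {} \<longrightarrow> \<Omega> \<subset> \<Lambda> \<longrightarrow> m \<in> par \<Lambda> \<longrightarrow>
      (\<exists>(c, M)\<in>F. \<Omega> \<subseteq> M \<and> (\<exists>d\<in>par M. inv m \<otimes> (c \<otimes> d) \<in> par (st \<Omega>))) \<or>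
      len \<Omega> (inv (gate \<Omega> (inv m \<otimes> a)) \<otimes> gate \<Omega> (inv m \<otimes> b)) \<le> 6)"
proof -
  let ?n = "len \<Lambda> (inv a \<otimes> b)"
  obtain c M where c: "c 0 = a" "c ?n = b" and cp: "\<And>i. i \<le> ?n \<Longrightarrow> c i \<in> par \<Lambda>"
    and M: "\<And>i. i < ?n \<Longrightarrow> M i \<noteq> {}" "\<And>i. i < ?n \<Longrightarrow> M i \<subset> \<Lambda>" "\<And>i. i < ?n \<Longrightarrow> inv (c i) \<otimes> c (Suc i) \<in> par (M i)"
    and geo: "\<And>i j. i \<le> j \<Longrightarrow> j \<le> ?n \<Longrightarrow> len \<Lambda> (inv (c i) \<otimes> c j) = j - i"
    using len_path[OF L a b] by blast
  let ?F = "(\<lambda>i. (c i, M i)) ` {..<?n}"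
  have card: "card ?F \<le> ?n" using card_image_le[of "{..<?n}"] by simp
  have main: "len \<Omega> (inv (gate \<Omega> (inv m \<otimes> a)) \<otimes> gate \<Omega> (inv m \<otimes> b)) \<le> 6"
    if O: "\<Omega> \<noteq> {}" "\<Omega> \<subset> \<Lambda>" and m: "m \<in> par \<Lambda>"
      and no: "\<And>i. i < ?n \<Longrightarrow> \<not> (\<Omega> \<subseteq> M i \<and> (\<exists>d\<in>par (M i). inv m \<otimes> (c i \<otimes> d) \<in> par (st \<Omega>)))" for \<Omega> m
  proof -
    define p where "p i = inv m \<otimes> c i" for i
    define g where "g i = gate \<Omega> (p i)" for i
    have pp: "p i \<in> par \<Lambda>" if "i \<le> ?n" for i using cp[OF that] m by (simp add: p_def)
    have pc: "p i \<in> carrier P" if "i \<le> ?n" for i using par_closed[OF pp[OF that]] .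
    have gp: "g i \<in> par \<Omega>" if "i \<le> ?n" for i using gate_in[OF pc[OF that]] by (simp add: g_def)
    have gL: "g i \<in> par \<Lambda>" if "i \<le> ?n" for i using par_mono'[OF gp[OF that]] O by blast
    have pd: "inv (p i) \<otimes> p j = inv (c i) \<otimes> c j" if "i \<le> ?n" "j \<le> ?n" for i j
      using par_closed[OF cp[OF that(1)]] par_closed[OF cp[OF that(2)]] par_closed[OF m]
      by (simp add: p_def inv_mult_group m_assoc)
    have tri: "len \<Lambda> (inv x \<otimes> w) \<le> len \<Lambda> (inv x \<otimes> y) + len \<Lambda> (inv y \<otimes> w)"
      if "x \<in> par \<Lambda>" "y \<in> par \<Lambda>" "w \<in> par \<Lambda>" for x y w
      by (rule len_dist_triangle[OF L(2)]) (use that in auto)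
    have ps: "p (Suc i) = p i \<otimes> (inv (c i) \<otimes> c (Suc i))" if i: "i < ?n" for i
      using par_closed[OF cp[of i]] par_closed[OF cp[of "Suc i"]] par_closed[OF m] i
      by (simp add: p_def m_assoc)
    let ?J = "{i. i < ?n \<and> g i \<noteq> g (Suc i)}"
    have near: "len \<Lambda> (inv (g i) \<otimes> p i) \<le> 2" if i: "i \<in> ?J" for i
      using gate_change[OF pp M(3) M(2), of i i \<Omega>] i O ps[of i] by (auto simp: g_def)
    \<comment> \<open>Both points are within 2 of \<open>par \<Omega>\<close>, whose diameter in the
      length of \<open>\<Lambda>\<close> is at most 1, and the path is geodesic: 2 + 1 + 2 = 5. So
      the gate changes at no more than 6 indices.\<close>
    have close: "j - i \<le> 5" if ij: "i \<in> ?J" "j \<in> ?J" "i < j" for i j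
    proof -
      have n: "i \<le> ?n" "j \<le> ?n" using ij by auto
      have "len \<Lambda> (inv (p i) \<otimes> p j) \<le> len \<Lambda> (inv (p i) \<otimes> g i) + len \<Lambda> (inv (g i) \<otimes> p j)"
        by (intro tri pp gL n)
      moreover have "len \<Lambda> (inv (g i) \<otimes> p j) \<le> len \<Lambda> (inv (g i) \<otimes> g j) + len \<Lambda> (inv (g j) \<otimes> p j)"
        by (intro tri pp gL n)
      moreover have "len \<Lambda> (inv (p i) \<otimes> g i) \<le> 2"
        using near[OF ij(1)] len_dist_sym[OF L(2), of "g i" "p i"] gL[OF n(1)] pp[OF n(1)] by simp
      moreover have "len \<Lambda> (inv (g j) \<otimes> p j) \<le> 2" using near[OF ij(2)] .
      moreover have "len \<Lambda> (inv (g i) \<otimes> g j) \<le> 1"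
        by (rule len_small[OF O(2)]) (use gp n in auto)
      moreover have "len \<Lambda> (inv (p i) \<otimes> p j) = j - i" using geo[of i j] pd[OF n] n ij(3) by simp
      ultimately show ?thesis by simp
    qed
    have step: "len \<Omega> (inv (g i) \<otimes> g (Suc i)) \<le> 1" if i: "i < ?n" for i
    proof -
      have x: "p i \<in> carrier P" using pc i by simp
      have "\<not> (\<Omega> \<subseteq> M i \<and> (\<exists>d\<in>par (M i). p i \<otimes> d \<in> par (st \<Omega>)))"
      proof
        assume "\<Omega> \<subseteq> M i \<and> (\<exists>d\<in>par (M i). p i \<otimes> d \<in> par (st \<Omega>))"
        then obtain d where d: "\<Omega> \<subseteq> M i" "d \<in> par (M i)" "p i \<otimes> d \<in> par (st \<Omega>)" by blast
        have "p i \<otimes> d = inv m \<otimes> (c i \<otimes> d)"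
          using par_closed[OF cp[of i]] par_closed[OF m] par_closed[OF d(2)] i by (simp add: p_def m_assoc)
        then show False using no[OF i] d by auto
      qed
      then have "\<forall>d\<in>par (M i). \<forall>e\<in>par (M i). len \<Omega> (inv (gate \<Omega> (p i \<otimes> d)) \<otimes> gate \<Omega> (p i \<otimes> e)) \<le> 1"
        using gate_coset_len[OF x, of "M i" \<Omega>] by blast
      from bspec[OF bspec[OF this par_one] M(3)[OF i]] show ?thesis using x by (simp add: g_def ps[OF i])
    qed
    have "len \<Omega> (inv (g 0) \<otimes> g k) \<le> card (?J \<inter> {..<k})" if "k \<le> ?n" for k
      using that
    proof (induction k)
      case 0
      then show ?case using par_closed[OF gp[of 0]] by simp
    next
      case (Suc k)
      have "len \<Omega> (inv (g 0) \<otimes> g (Suc k)) \<le> len \<Omega> (inv (g 0) \<otimes> g k) + len \<Omega> (inv (g k) \<otimes> g (Suc k))"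
        by (rule len_dist_triangle[OF O(1)]) (use gp[of 0] gp[of k] gp[of "Suc k"] Suc.prems in auto)
      moreover have "?J \<inter> {..<Suc k} = (if g k = g (Suc k) then ?J \<inter> {..<k} else insert k (?J \<inter> {..<k}))"
        using Suc.prems by (auto simp: less_Suc_eq)
      moreover have "len \<Omega> (inv (g k) \<otimes> g (Suc k)) = 0" if "g k = g (Suc k)"
        using that par_closed[OF gp[of "Suc k"]] Suc.prems by simp
      ultimately show ?case using Suc step[of k] by (auto split: if_splits)
    qed
    from this[OF le_refl] have "len \<Omega> (inv (g 0) \<otimes> g ?n) \<le> card (?J \<inter> {..<?n})" .
    also have "\<dots> \<le> 6"
    proof (cases "?J = {}")
      case False
      have fin: "finite ?J" by simp
      have "?J \<subseteq> {Min ?J..Min ?J + 5}"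
      proof
        fix j assume j: "j \<in> ?J"
        have mi: "Min ?J \<in> ?J" "Min ?J \<le> j" using Min_in[OF fin False] Min_le[OF fin j] by auto
        have "j - Min ?J \<le> 5" using close[OF mi(1) j] mi(2) by (cases "Min ?J = j") auto
        then show "j \<in> {Min ?J..Min ?J + 5}" using mi by simp
      qed
      then have "card (?J \<inter> {..<?n}) \<le> card {Min ?J..Min ?J + 5}" by (intro card_mono) auto
      then show ?thesis by simp
    next
      case True
      show ?thesis unfolding True by simp
    qed
    finally show ?thesis using c by (simp add: g_def p_def)
  qed
  show ?thesis
  proof (intro exI[of _ ?F] conjI allI impI)
    show "\<forall>(c, M)\<in>?F. c \<in> par \<Lambda> \<and> M \<noteq> {} \<and> M \<subset> \<Lambda>" using cp M by (auto simp: less_imp_le)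
    fix \<Omega> m assume O: "\<Omega> \<noteq> {}" "\<Omega> \<subset> \<Lambda>" "m \<in> par \<Lambda>"
    show "(\<exists>(c, M)\<in>?F. \<Omega> \<subseteq> M \<and> (\<exists>d\<in>par M. inv m \<otimes> (c \<otimes> d) \<in> par (st \<Omega>))) \<or>
      len \<Omega> (inv (gate \<Omega> (inv m \<otimes> a)) \<otimes> gate \<Omega> (inv m \<otimes> b)) \<le> 6"
    proof (rule disjCI)
      assume "\<not> len \<Omega> (inv (gate \<Omega> (inv m \<otimes> a)) \<otimes> gate \<Omega> (inv m \<otimes> b)) \<le> 6"
      then obtain i where i: "i < ?n" "\<Omega> \<subseteq> M i \<and> (\<exists>d\<in>par (M i). inv m \<otimes> (c i \<otimes> d) \<in> par (st \<Omega>))"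
        using main[OF O] by metis
      then show "\<exists>(c, M)\<in>?F. \<Omega> \<subseteq> M \<and> (\<exists>d\<in>par M. inv m \<otimes> (c \<otimes> d) \<in> par (st \<Omega>))"
        by (intro bexI[of _ "(c i, M i)"]) auto
    qed
  qed (use card in auto)
qed

text \<open>\<open>gate_change\<close> treats steps inside one proper parabolic subgroup. Longer
  steps, as they occur along sampled geodesics, are filled in by a discrete geodesic, and the
  witness is the gate at a place where it changes.\<close>

lemma step_change:
  assumes L: "\<not> is_singleton \<Lambda>" "\<Lambda> \<noteq> {}" and p: "p \<in> par \<Lambda>" and q: "q \<in> par \<Lambda>" and a: "a \<in> par \<Lambda>"
    and O: "\<Omega> \<subseteq> \<Lambda>" and ne: "gate \<Omega> (a \<otimes> p) \<noteq> gate \<Omega> (a \<otimes> q)"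
  shows "\<exists>w\<in>par \<Omega>. len \<Lambda> (inv p \<otimes> (inv a \<otimes> w)) \<le> 2 + len \<Lambda> (inv p \<otimes> q)"
proof -
  let ?n = "len \<Lambda> (inv p \<otimes> q)"
  obtain c M where c: "c 0 = p" "c ?n = q" and cp: "\<And>i. i \<le> ?n \<Longrightarrow> c i \<in> par \<Lambda>"
    and M: "\<And>i. i < ?n \<Longrightarrow> M i \<subset> \<Lambda>" "\<And>i. i < ?n \<Longrightarrow> inv (c i) \<otimes> c (Suc i) \<in> par (M i)"
    and geo: "\<And>i j. i \<le> j \<Longrightarrow> j \<le> ?n \<Longrightarrow> len \<Lambda> (inv (c i) \<otimes> c j) = j - i"
    using len_path[OF L p q] by blast
  obtain i where i: "i < ?n" "gate \<Omega> (a \<otimes> c i) \<noteq> gate \<Omega> (a \<otimes> c (Suc i))"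
    using seq_change[of "\<lambda>i. gate \<Omega> (a \<otimes> c i)" 0 ?n] ne c by auto
  have cc: "c i \<in> carrier P" "c (Suc i) \<in> carrier P" "a \<in> carrier P" "p \<in> carrier P"
    using par_closed[OF cp[of i]] par_closed[OF cp[of "Suc i"]] i a p by auto
  let ?w = "gate \<Omega> (a \<otimes> c i)"
  have w: "?w \<in> par \<Omega>" using gate_in cc by simp
  have wL: "?w \<in> par \<Lambda>" using par_mono'[OF w O] .
  have ap: "a \<otimes> c i \<in> par \<Lambda>" using a cp i by simp
  have "a \<otimes> c (Suc i) = (a \<otimes> c i) \<otimes> (inv (c i) \<otimes> c (Suc i))" using cc by (simp add: m_assoc)
  then have "len \<Lambda> (inv ?w \<otimes> (a \<otimes> c i)) \<le> 2"
    using gate_change[OF ap M(2)[OF i(1)] M(1)[OF i(1)] O] i(2) by auto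
  then have 1: "len \<Lambda> (inv (a \<otimes> c i) \<otimes> ?w) \<le> 2"
    using len_dist_sym[OF L(2), of ?w "a \<otimes> c i"] ap wL by simp
  have e: "inv (a \<otimes> c i) \<otimes> ?w = inv (c i) \<otimes> (inv a \<otimes> ?w)" using cc wL by (simp add: inv_mult_group m_assoc)
  have "len \<Lambda> (inv p \<otimes> (inv a \<otimes> ?w)) \<le> len \<Lambda> (inv p \<otimes> c i) + len \<Lambda> (inv (c i) \<otimes> (inv a \<otimes> ?w))"
    by (rule len_dist_triangle[OF L(2)]) (use p cp[of i] i a wL in auto)
  moreover have "len \<Lambda> (inv p \<otimes> c i) \<le> ?n" using geo[of 0 i] i c by simp
  ultimately have "len \<Lambda> (inv p \<otimes> (inv a \<otimes> ?w)) \<le> 2 + ?n" using 1 unfolding e by simp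
  then show ?thesis using w by blast
qed

text \<open>\<open>k\<close> is a common base point of both domains. Relative to it the gate in
  \<open>\<Omega>\<close> factors through the gate in \<open>\<Lambda>\<close>, so it has to change
  somewhere along the path \<open>p\<close>.\<close>

lemma bounded_geodesic_image_alg:
  assumes g: "g \<in> carrier P" and h: "h \<in> carrier P" and x: "x \<in> carrier P" and y: "y \<in> carrier P" and k: "k \<in> carrier P"
    and gk: "inv g \<otimes> k \<in> par (st \<Lambda>)" and hk: "inv h \<otimes> k \<in> par (st \<Omega>)" and O: "\<Omega> \<subset> \<Lambda>" "\<Omega> \<noteq> {}"
    and ne: "gate \<Omega> (inv h \<otimes> x) \<noteq> gate \<Omega> (inv h \<otimes> y)"
    and p: "\<And>i. i \<le> n \<Longrightarrow> p i \<in> par \<Lambda>" "p 0 = gate \<Lambda> (inv g \<otimes> x)" "p n = gate \<Lambda> (inv g \<otimes> y)"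
    and step: "\<And>i. i < n \<Longrightarrow> len \<Lambda> (inv (p i) \<otimes> p (Suc i)) \<le> r"
  shows "\<exists>i\<le>n. \<exists>c\<in>carrier P. inv h \<otimes> c \<in> par (st \<Omega>) \<and> len \<Lambda> (inv (p i) \<otimes> gate \<Lambda> (inv g \<otimes> c)) \<le> 2 + r"
proof -
  have L: "\<not> is_singleton \<Lambda>" "\<Lambda> \<noteq> {}" using O by (auto simp: is_singleton_def)
  have kg: "inv k \<otimes> g \<in> par (st \<Lambda>)" using par_inv[OF gk] g k by (simp add: inv_mult_group)
  \<comment> \<open>Left translation by \<open>?a\<close> converts gates based at \<open>g\<close>
    into gates based at \<open>k\<close>.\<close>
  let ?a = "gate \<Lambda> (inv k \<otimes> g)"
  have a: "?a \<in> par \<Lambda>" using gate_in g k by simp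
  have ai: "gate \<Lambda> (inv g \<otimes> k) = inv ?a"
  proof -
    have "(inv k \<otimes> g) \<otimes> (inv g \<otimes> k) = \<one>" using g k by (simp add: m_assoc)
    then have "?a \<otimes> gate \<Lambda> (inv g \<otimes> k) = \<one>" using gate_st[OF kg, of "inv g \<otimes> k"] g k by simp
    then show ?thesis using g k by (metis gate_closed inv_closed inv_equality inv_inv m_closed)
  qed
  have e: "gate \<Omega> (?a \<otimes> gate \<Lambda> (inv g \<otimes> z)) = gate \<Omega> (inv k \<otimes> z)" if z: "z \<in> carrier P" for z
  proof -
    have "(inv k \<otimes> g) \<otimes> (inv g \<otimes> z) = inv k \<otimes> z" using g k z by (simp add: m_assoc)
    then have "?a \<otimes> gate \<Lambda> (inv g \<otimes> z) = gate \<Lambda> (inv k \<otimes> z)" using gate_st[OF kg, of "inv g \<otimes> z"] g k z by simp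
    then show ?thesis using gate_gate[of "inv k \<otimes> z" \<Omega> \<Lambda>] O k z by auto
  qed
  have e2: "gate \<Omega> (inv h \<otimes> z) = gate \<Omega> (inv h \<otimes> k) \<otimes> gate \<Omega> (inv k \<otimes> z)" if z: "z \<in> carrier P" for z
    using gate_st[OF hk, of "inv k \<otimes> z"] h k z by (simp add: m_assoc)
  have "gate \<Omega> (?a \<otimes> p 0) \<noteq> gate \<Omega> (?a \<otimes> p n)"
    using ne e[OF x] e[OF y] e2[OF x] e2[OF y] p by auto
  then obtain i where i: "i < n" "gate \<Omega> (?a \<otimes> p i) \<noteq> gate \<Omega> (?a \<otimes> p (Suc i))"
    using seq_change[of "\<lambda>i. gate \<Omega> (?a \<otimes> p i)" 0 n] by auto
  obtain w where w: "w \<in> par \<Omega>" "len \<Lambda> (inv (p i) \<otimes> (inv ?a \<otimes> w)) \<le> 2 + len \<Lambda> (inv (p i) \<otimes> p (Suc i))"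
    using step_change[OF L p(1) p(1) a _ i(2)] i(1) O by auto
  have wL: "w \<in> par \<Lambda>" using par_mono'[OF w(1)] O by blast
  have wc: "w \<in> carrier P" using w(1) by simp
  have "inv h \<otimes> (k \<otimes> w) = (inv h \<otimes> k) \<otimes> w" using h k wc by (simp add: m_assoc)
  then have "inv h \<otimes> (k \<otimes> w) \<in> par (st \<Omega>)"
    using par_mult[OF hk par_mono'[OF w(1), of "st \<Omega>"]] by (simp add: st_def)
  moreover have "gate \<Lambda> (inv g \<otimes> (k \<otimes> w)) = inv ?a \<otimes> w"
  proof -
    have "inv g \<otimes> (k \<otimes> w) = (inv g \<otimes> k) \<otimes> w" using g k wc by (simp add: m_assoc)
    then show ?thesis using gate_st[OF gk wc] ai wL by simp
  qed
  ultimately show ?thesis using w(2) step[OF i(1)] i(1) k wc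
    by (intro exI[of _ i] conjI bexI[of _ "k \<otimes> w"]) auto
qed

text \<open>For a head \<open>f\<close> this finds an edge at which a path from \<open>z\<close> to
  \<open>z \<otimes> y\<close> crosses a hyperplane. The path spells a reduced expression of
  \<open>y\<close>, so its prefixes have trivial gates wherever \<open>y\<close> has one.\<close>

lemma prefix_change:
  assumes "y \<in> carrier P" "z \<in> carrier P" "f z \<noteq> f (z \<otimes> y)"
  shows "\<exists>p a v. a \<in> A v \<and> p \<in> carrier P \<and> f (z \<otimes> p) \<noteq> f (z \<otimes> p \<otimes> a) \<and> (\<forall>B. gate B y = \<one> \<longrightarrow> gate B p = \<one>)"
proof -
  have "\<forall>z. z \<in> carrier P \<longrightarrow> f z \<noteq> f (z \<otimes> y) \<longrightarrow>
     (\<exists>p a v. a \<in> A v \<and> p \<in> carrier P \<and> f (z \<otimes> p) \<noteq> f (z \<otimes> p \<otimes> a) \<and> (\<forall>B. gate B y = \<one> \<longrightarrow> gate B p = \<one>))"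
    if "y \<in> par UNIV"
    using that
  proof (induction rule: par_induct)
    case (cons y u b)
    have yc: "y \<in> carrier P" using cons(1) by simp
    show ?case
    proof (intro allI impI)
      fix z assume z: "z \<in> carrier P" and ne: "f z \<noteq> f (z \<otimes> (b \<otimes> y))"
      show "\<exists>p a v. a \<in> A v \<and> p \<in> carrier P \<and> f (z \<otimes> p) \<noteq> f (z \<otimes> p \<otimes> a) \<and> (\<forall>B. gate B (b \<otimes> y) = \<one> \<longrightarrow> gate B p = \<one>)"
      proof (cases "f z = f (z \<otimes> b)")
        case False
        then show ?thesis using z cons by (intro exI[of _ \<one>] exI[of _ b] exI[of _ u]) auto
      next
        case True
        have bc: "b \<in> carrier P" using cons by simp
        then have "f (z \<otimes> b) \<noteq> f (z \<otimes> b \<otimes> y)" using ne True z yc by (simp add: m_assoc)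
        then obtain p a v where p: "a \<in> A v" "p \<in> carrier P" "f (z \<otimes> b \<otimes> p) \<noteq> f (z \<otimes> b \<otimes> p \<otimes> a)"
          "\<And>B. gate B y = \<one> \<Longrightarrow> gate B p = \<one>"
          using cons.IH z bc by (metis m_closed)
        \<comment> \<open>The clause on gates is applied to \<open>B = {u}\<close>: like
          \<open>y\<close>, the prefix \<open>p\<close> has no head of type \<open>u\<close>, so
          \<open>b \<otimes> p\<close> is again reduced.\<close>
        have "gate {u} p = \<one>" using p(4)[of "{u}"] gate_singleton[OF yc] cons by simp
        then have sp: "s u p = \<one>" using gate_singleton[OF p(2)] by simp
        have "gate B (b \<otimes> p) = \<one>" if gB: "gate B (b \<otimes> y) = \<one>" for B
        proof -
          have "u \<notin> B" using gB gate_eq_one_iff[of "b \<otimes> y" B] s_cons[OF yc, of u b u] cons yc by auto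
          then have "gate (B \<inter> lk {u}) y = \<one>" using gB gate_cons[OF yc, of b u B] cons by simp
          then show ?thesis using p(4) gate_cons[OF p(2), of b u B] cons sp \<open>u \<notin> B\<close> by simp
        qed
        then show ?thesis using p z bc by (intro exI[of _ "b \<otimes> p"] exI[of _ a] exI[of _ v]) (simp add: m_assoc)
      qed
    qed
  qed simp
  then show ?thesis using assms par_UNIV by blast
qed


text \<open>The parallelism classes of two cosets share an element \<open>k\<close>. Together with
  inclusion of types this becomes nesting, together with adjacency of types orthogonality.\<close>

definition meets :: "'a \<Rightarrow> 'v set \<Rightarrow> 'a \<Rightarrow> 'v set \<Rightarrow> bool" where
  "meets g \<Lambda> h \<Omega> \<longleftrightarrow> (\<exists>k\<in>carrier P. inv g \<otimes> k \<in> par (st \<Lambda>) \<and> inv h \<otimes> k \<in> par (st \<Omega>))"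

text \<open>If \<open>x\<close> does not project to \<open>\<Omega>\<close> near the class of
  \<open>g\<close>, a hyperplane with type in \<open>\<Omega>\<close> separates \<open>x\<close>
  from that class. A path from the class to \<open>x\<close> crosses it at a point with the same
  gate in \<open>\<Lambda>\<close> as \<open>x\<close>. Apart from degenerate cases, the carrier of
  the hyperplane has a small image in \<open>\<Lambda>\<close>, and it contains a point of the class
  of \<open>h\<close>.\<close>

lemma consistency_alg:
  assumes g: "g \<in> carrier P" and h: "h \<in> carrier P" and x: "x \<in> carrier P"
    and ne: "\<Lambda> \<noteq> {}" "\<Omega> \<noteq> {}" "\<Omega> \<subseteq> V"
    and tr: "meets g \<Lambda> h \<Omega> \<Longrightarrow> \<not> \<Lambda> \<subseteq> \<Omega> \<and> \<not> \<Omega> \<subseteq> \<Lambda> \<and> \<not> \<Omega> \<subseteq> lk \<Lambda>"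
  shows "(\<exists>k\<in>carrier P. inv h \<otimes> k \<in> par (st \<Omega>) \<and> len \<Lambda> (inv (gate \<Lambda> (inv g \<otimes> x)) \<otimes> gate \<Lambda> (inv g \<otimes> k)) \<le> 2) \<or>
    (\<exists>k\<in>carrier P. inv g \<otimes> k \<in> par (st \<Lambda>) \<and> len \<Omega> (inv (gate \<Omega> (inv h \<otimes> x)) \<otimes> gate \<Omega> (inv h \<otimes> k)) \<le> 2)"
    (is "?A \<or> ?B")
proof -
  have hg: "inv h \<otimes> g \<in> carrier P" using g h by simp
  from gate_coset[OF hg, of \<Omega> "st \<Lambda>"] consider
    (par) d where "\<Omega> \<subseteq> st \<Lambda>" "d \<in> par (st \<Lambda>)" "inv h \<otimes> g \<otimes> d \<in> par (st \<Omega>)"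
  | (small) L q where "L \<subset> \<Omega>" "q \<in> par \<Omega>" "\<And>d. d \<in> par (st \<Lambda>) \<Longrightarrow> inv q \<otimes> gate \<Omega> (inv h \<otimes> g \<otimes> d) \<in> par L"
    by blast
  then show ?thesis
  proof cases
    case par
    \<comment> \<open>The classes meet, and \<open>\<Omega>\<close> is covered by the star of
      \<open>\<Lambda>\<close> without lying in either of its factors; so it is a join and its space
      has diameter at most 2.\<close>
    have dc: "d \<in> carrier P" using par(2) by simp
    have "meets g \<Lambda> h \<Omega>" unfolding meets_def
      by (rule bexI[of _ "g \<otimes> d"]) (use par g h dc in \<open>auto simp: m_assoc\<close>)
    then have O: "\<not> \<Omega> \<subseteq> \<Lambda>" "\<not> \<Omega> \<subseteq> lk \<Lambda>" using tr by auto
    have "len \<Omega> (inv (gate \<Omega> (inv h \<otimes> x)) \<otimes> gate \<Omega> (inv h \<otimes> g)) \<le> 2"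
      using g h x by (intro len_join_st[OF _ par(1) O] gate_dist_in) auto
    then have ?B using g by (intro bexI[of _ g]) auto
    then show ?thesis ..
  next
    case small
    let ?t = "gate \<Omega> (inv h \<otimes> x)"
    have t: "?t \<in> par \<Omega>" using gate_in h x by simp
    have tc: "?t \<in> carrier P" and qc: "q \<in> carrier P" using t small(2) by auto
    \<comment> \<open>Moves the base point within its coset of \<open>par L\<close> to the point
      closest to \<open>?t\<close>; the remainder \<open>?r\<close> has no head with type in
      \<open>L\<close>.\<close>
    let ?l = "gate L (inv q \<otimes> ?t)"
    have l: "?l \<in> par L" using gate_in qc tc by simp
    have lc: "?l \<in> carrier P" using l by simp
    have lO: "?l \<in> par \<Omega>" using par_mono'[OF l] small(1) by blast
    let ?q = "q \<otimes> ?l"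
    have q: "?q \<in> par \<Omega>" using par_mult[OF small(2) lO] .
    have q'c: "?q \<in> carrier P" using q by simp
    let ?r = "inv ?q \<otimes> ?t"
    have r: "?r \<in> par \<Omega>" using q t by simp
    have re: "?r = inv ?l \<otimes> (inv q \<otimes> ?t)" using qc lc tc by (simp add: inv_mult_group m_assoc)
    have rL: "gate L ?r = \<one>" unfolding re using gate_mult[OF par_inv[OF l], of "inv q \<otimes> ?t"] qc tc lc by simp
    have img: "inv ?q \<otimes> gate \<Omega> (inv h \<otimes> g \<otimes> d) \<in> par L" if d: "d \<in> par (st \<Lambda>)" for d
    proof -
      have c: "gate \<Omega> (inv h \<otimes> g \<otimes> d) \<in> carrier P" using hg par_closed[OF d] by simp
      have "inv ?q \<otimes> gate \<Omega> (inv h \<otimes> g \<otimes> d) = inv ?l \<otimes> (inv q \<otimes> gate \<Omega> (inv h \<otimes> g \<otimes> d))"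
        using qc lc c by (simp add: inv_mult_group m_assoc)
      then show ?thesis using par_mult[OF par_inv[OF l] small(3)[OF d]] by simp
    qed
    show ?thesis
    proof (cases "?r = \<one>")
      case True
      then have "?q = ?t" using q'c tc by (metis inv_cancel(2) r_one)
      then have "inv ?t \<otimes> gate \<Omega> (inv h \<otimes> g) \<in> par L" using img[OF par_one] hg by simp
      then have "len \<Omega> (inv ?t \<otimes> gate \<Omega> (inv h \<otimes> g)) \<le> 1" using len_small small(1) by blast
      then have ?B using g by (intro bexI[of _ g]) auto
      then show ?thesis ..
    next
      case False
      then obtain w where w: "w \<in> \<Omega>" "s w ?r \<noteq> \<one>" using s_trivial[OF r] by blast
      have rc: "?r \<in> carrier P" using r by simp
      have wL: "w \<notin> L" using rL w(2) gate_eq_one_iff[OF rc] by blast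
      \<comment> \<open>\<open>?f\<close> tells the sides of the hyperplane of type \<open>w\<close>
        at \<open>?m\<close> apart: it is trivial on the whole class of \<open>g\<close>, but not at
        \<open>x\<close>.\<close>
      let ?m = "h \<otimes> ?q"
      have m: "?m \<in> carrier P" using h q'c by simp
      let ?f = "\<lambda>z. s w (inv ?m \<otimes> z)"
      have f: "?f z = s w (inv ?q \<otimes> gate \<Omega> (inv h \<otimes> z))" if z: "z \<in> carrier P" for z
      proof -
        have "inv ?m \<otimes> z = inv ?q \<otimes> (inv h \<otimes> z)" using h q'c z by (simp add: inv_mult_group m_assoc)
        then have "gate \<Omega> (inv ?m \<otimes> z) = inv ?q \<otimes> gate \<Omega> (inv h \<otimes> z)"
          using gate_mult[OF par_inv[OF q], of "inv h \<otimes> z"] h z by simp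
        then show ?thesis using s_of_gate[of "inv ?m \<otimes> z" w \<Omega>] w(1) m z by simp
      qed
      have fx: "?f x \<noteq> \<one>" using f[OF x] w(2) by simp
      have fZ: "?f (g \<otimes> d) = \<one>" if d: "d \<in> par (st \<Lambda>)" for d
        using f[of "g \<otimes> d"] s_par[OF img[OF d] wL] g h par_closed[OF d] by (simp add: m_assoc)
      \<comment> \<open>The path to \<open>x\<close> starts at the gate of \<open>x\<close> in the
        class of \<open>g\<close>. Its prefixes have trivial gate in \<open>st \<Lambda>\<close>, so
        the gate in \<open>\<Lambda>\<close> is constant along it, in particular at the crossing
        \<open>?e\<close>.\<close>
      let ?d0 = "gate (st \<Lambda>) (inv g \<otimes> x)"
      have d0: "?d0 \<in> par (st \<Lambda>)" using gate_in g x by simp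
      have d0c: "?d0 \<in> carrier P" using d0 by simp
      let ?x = "inv ?d0 \<otimes> (inv g \<otimes> x)"
      have xc: "?x \<in> carrier P" using d0c g x by simp
      have gx: "gate (st \<Lambda>) ?x = \<one>" using gate_mult[OF par_inv[OF d0], of "inv g \<otimes> x"] g x d0c by simp
      have zx: "g \<otimes> ?d0 \<otimes> ?x = x" using g d0c x by (simp add: m_assoc)
      have zc: "g \<otimes> ?d0 \<in> carrier P" using g d0c by simp
      have "?f (g \<otimes> ?d0) \<noteq> ?f (g \<otimes> ?d0 \<otimes> ?x)" using fZ[OF d0] fx zx by simp
      from prefix_change[where f = ?f, OF xc zc this] obtain p a v where p: "a \<in> A v" "p \<in> carrier P"
        "?f (g \<otimes> ?d0 \<otimes> p) \<noteq> ?f (g \<otimes> ?d0 \<otimes> p \<otimes> a)" "gate (st \<Lambda>) p = \<one>" using gx by blast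
      let ?e = "g \<otimes> ?d0 \<otimes> p"
      have ec: "?e \<in> carrier P" using zc p(2) by simp
      have emc: "inv ?m \<otimes> ?e \<in> carrier P" using ec m by simp
      have "s w (inv ?m \<otimes> ?e \<otimes> a) \<noteq> s w (inv ?m \<otimes> ?e)" using p(3) m ec p(1) by (simp add: m_assoc)
      then have em: "inv ?m \<otimes> ?e \<in> par (st {w})" using s_right_mult[OF emc p(1), of w] by metis
      have gp: "gate \<Lambda> p = \<one>" using p(4) gate_eq_one_iff[OF p(2)] by (auto simp: st_def)
      have "gate \<Lambda> (inv g \<otimes> ?e) = gate \<Lambda> ?d0"
        using gate_st[OF d0 p(2)] gp g d0c p(2) by (simp add: m_assoc)
      moreover have "gate \<Lambda> (inv g \<otimes> x) = gate \<Lambda> ?d0"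
      proof -
        have "gate \<Lambda> ?x = \<one>" using gx gate_eq_one_iff[OF xc] by (auto simp: st_def)
        moreover have "inv g \<otimes> x = ?d0 \<otimes> ?x" using g d0c x by (simp add: m_assoc)
        ultimately show ?thesis using gate_st[OF d0 xc] d0c by simp
      qed
      ultimately have ge: "gate \<Lambda> (inv g \<otimes> x) = gate \<Lambda> (inv g \<otimes> ?e)" by simp
      have gm: "inv g \<otimes> ?m \<in> carrier P" using g m by simp
      have hm: "inv h \<otimes> ?m \<in> par (st \<Omega>)"
        using h q'c par_mono'[OF q, of "st \<Omega>"] by (simp add: st_def flip: m_assoc)
      from gate_coset_len[OF gm, of "st {w}" \<Lambda>] show ?thesis
      proof
        assume H: "\<forall>d\<in>par (st {w}). \<forall>e\<in>par (st {w}).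
          len \<Lambda> (inv (gate \<Lambda> (inv g \<otimes> ?m \<otimes> d)) \<otimes> gate \<Lambda> (inv g \<otimes> ?m \<otimes> e)) \<le> 1"
        have "inv g \<otimes> ?m \<otimes> (inv ?m \<otimes> ?e) = inv g \<otimes> ?e" "inv g \<otimes> ?m \<otimes> \<one> = inv g \<otimes> ?m"
          using g m ec by (simp_all add: m_assoc)
        then have "len \<Lambda> (inv (gate \<Lambda> (inv g \<otimes> ?e)) \<otimes> gate \<Lambda> (inv g \<otimes> ?m)) \<le> 1"
          using bspec[OF bspec[OF H em] par_one] by metis
        then have ?A using m hm unfolding ge by (intro bexI[of _ ?m]) auto
        then show ?thesis ..
      next
        assume "\<Lambda> \<subseteq> st {w} \<and> (\<exists>d\<in>par (st {w}). inv g \<otimes> ?m \<otimes> d \<in> par (st \<Lambda>))"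
        then obtain d where d: "\<Lambda> \<subseteq> st {w}" "d \<in> par (st {w})" "inv g \<otimes> ?m \<otimes> d \<in> par (st \<Lambda>)" by blast
        have dc: "d \<in> carrier P" using d(2) by simp
        show ?thesis
        proof (cases "w \<in> \<Lambda>")
          case True
          show ?thesis
          proof (cases "\<Lambda> = {w}")
            case True
            \<comment> \<open>The classes would meet at \<open>?m\<close> although
              \<open>\<Lambda> = {w}\<close> is contained in \<open>\<Omega>\<close>, against
              \<open>tr\<close>.\<close>
            then have "inv g \<otimes> ?m \<in> par (st \<Lambda>)" using d par_mult_iff2[of d "st \<Lambda>" "inv g \<otimes> ?m"] gm by simp
            then have "meets g \<Lambda> h \<Omega>" using hm m unfolding meets_def by blast
            then show ?thesis using tr True w(1) by auto
          next
            case False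
            \<comment> \<open>\<open>\<Lambda>\<close> is the join of \<open>{w}\<close> and a
              non-empty part of its link, so any point of the class of \<open>h\<close> will
              do.\<close>
            have "len \<Lambda> (inv (gate \<Lambda> (inv g \<otimes> x)) \<otimes> gate \<Lambda> (inv g \<otimes> h)) \<le> 2"
            proof (rule len_join_st[OF _ d(1)])
              show "inv gate \<Lambda> (inv g \<otimes> x) \<otimes> gate \<Lambda> (inv g \<otimes> h) \<in> par \<Lambda>" using g h x by (intro gate_dist_in) auto
              show "\<not> \<Lambda> \<subseteq> {w}" using False \<open>w \<in> \<Lambda>\<close> by blast
              show "\<not> \<Lambda> \<subseteq> lk {w}" using \<open>w \<in> \<Lambda>\<close> lk_disjoint[of "{w}"] by blast
            qed
            then have ?A using h by (intro bexI[of _ h]) auto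
            then show ?thesis ..
          qed
        next
          case False
          \<comment> \<open>Now \<open>w\<close> commutes with \<open>\<Lambda>\<close>, so the
            class of \<open>g\<close> contains an edge labelled \<open>b\<close> that crosses the
            hyperplane, contradicting \<open>fZ\<close>. The edge exists because the vertex group of
            \<open>w\<close> is not trivial.\<close>
          then have wl: "w \<in> lk \<Lambda>" using d(1) lk_swap[of "{w}" \<Lambda>] by (auto simp: st_def)
          have "w \<in> V" using w(1) ne(3) by blast
          then obtain b where b: "b \<in> A w" "b \<noteq> \<one>" using A_nontrivial[of w] A_one by blast
          have bs: "b \<in> par (st \<Lambda>)" using A_par[OF b(1)] wl by (simp add: st_def)
          have fk: "?f (?m \<otimes> d \<otimes> c) = \<one>" if c: "c \<in> par (st \<Lambda>)" for c
          proof -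
            have "?m \<otimes> d \<otimes> c = g \<otimes> (inv g \<otimes> ?m \<otimes> d \<otimes> c)" using g m dc par_closed[OF c] by (simp add: m_assoc)
            then show ?thesis using fZ[OF par_mult[OF d(3) c]] by simp
          qed
          have e: "inv ?m \<otimes> (?m \<otimes> d \<otimes> c) = d \<otimes> c" if "c \<in> carrier P" for c
            using that m dc by (simp add: m_assoc)
          have "s w d = \<one>" using fk[OF par_one] e[of \<one>] dc by simp
          then have "d \<in> par (lk {w})" using par_st_s d(2) by blast
          then have "d \<otimes> b = b \<otimes> d" using commute_A_par[OF b(1), of d] by simp
          moreover have "s w (d \<otimes> b) = \<one>" using fk[OF bs] e[of b] b by simp
          ultimately show ?thesis using s_mult[OF b(1) dc] \<open>s w d = \<one>\<close> b by simp
        qed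
      qed
    qed
  qed
qed

section \<open>Hyperplanes as bottlenecks\<close>

lemma sep_near:
  assumes L: "\<not> is_singleton \<Lambda>" "\<Lambda> \<noteq> {}" and x: "x \<in> par \<Lambda>" and y: "y \<in> par \<Lambda>" and e: "e \<in> par \<Lambda>" and v: "v \<in> \<Lambda>"
    and ne: "s v (inv e \<otimes> x) \<noteq> s v (inv e \<otimes> y)"
  shows "len \<Lambda> (inv e \<otimes> x) \<le> 3 + len \<Lambda> (inv x \<otimes> y)"
proof -
  have c: "x \<in> carrier P" "y \<in> carrier P" "e \<in> carrier P" using x y e by auto
  have "gate {v} (inv e \<otimes> x) \<noteq> gate {v} (inv e \<otimes> y)" using ne c by (simp add: gate_singleton)
  then obtain w where w: "w \<in> par {v}" "len \<Lambda> (inv x \<otimes> (inv (inv e) \<otimes> w)) \<le> 2 + len \<Lambda> (inv x \<otimes> y)"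
    using step_change[OF L x y par_inv[OF e], of "{v}"] v by auto
  \<comment> \<open>\<open>w\<close> lies in a coned-off vertex group; this adds 1 to the 2 of
    \<open>step_change\<close>.\<close>
  have p: "{v} \<subset> \<Lambda>" using L v by (auto simp: is_singleton_def)
  have wL: "w \<in> par \<Lambda>" using par_mono'[OF w(1)] v by simp
  have wc: "w \<in> carrier P" using wL by simp
  have "len \<Lambda> (inv x \<otimes> e) \<le> len \<Lambda> (inv x \<otimes> (e \<otimes> w)) + len \<Lambda> (inv (e \<otimes> w) \<otimes> e)"
    by (rule len_dist_triangle[OF L(2)]) (use c wc x y e wL in \<open>auto simp: par_mult_iff par_inv_iff\<close>)
  moreover have "inv (e \<otimes> w) \<otimes> e = inv w" using c wc by (simp add: inv_mult_group m_assoc)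
  moreover have "len \<Lambda> (inv w) \<le> 1" using len_small[OF p] w(1) by simp
  moreover have "len \<Lambda> (inv x \<otimes> e) = len \<Lambda> (inv e \<otimes> x)" using len_dist_sym[OF L(2), of e x] c x e by simp
  ultimately show ?thesis using w(2) c by simp
qed

text \<open>Follow a reduced expression of \<open>x\<close> until the distance from \<open>z\<close>
  is about to exceed \<open>H\<close>, and take the hyperplane crossed there. A reduced expression
  crosses no hyperplane twice, so this one separates the two ends.\<close>

lemma mid_wall:
  assumes L: "\<not> is_singleton \<Lambda>" "\<Lambda> \<noteq> {}" and x: "x \<in> par \<Lambda>" and o: "z \<in> par \<Lambda>" and "p \<in> par \<Lambda>"
    and "len \<Lambda> (inv z \<otimes> p) \<le> H" "H < len \<Lambda> (inv z \<otimes> (p \<otimes> x))"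
  shows "\<exists>e\<in>par \<Lambda>. \<exists>v\<in>\<Lambda>. len \<Lambda> (inv z \<otimes> e) = H \<and> s v (inv e \<otimes> p) \<noteq> s v (inv e \<otimes> (p \<otimes> x))"
  using x assms(5-7)
proof (induction arbitrary: p rule: par_induct)
  case one
  then show ?case by simp
next
  case (cons y u b)
  have c: "y \<in> carrier P" "b \<in> carrier P" "p \<in> carrier P" "z \<in> carrier P" using cons o by auto
  have b: "b \<in> par \<Lambda>" using A_par cons by blast
  have as: "p \<otimes> (b \<otimes> y) = p \<otimes> b \<otimes> y" using c by (simp add: m_assoc)
  show ?case
  proof (cases "len \<Lambda> (inv z \<otimes> (p \<otimes> b)) \<le> H")
    case False
    have u: "{u} \<subset> \<Lambda>" using L cons by (auto simp: is_singleton_def)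
    have "len \<Lambda> (inv z \<otimes> (p \<otimes> b)) \<le> len \<Lambda> (inv z \<otimes> p) + len \<Lambda> b"
      using len_mult[OF L(2), of "inv z \<otimes> p" b] o cons.prems b c by (simp add: m_assoc)
    moreover have "len \<Lambda> b \<le> 1" using len_small[OF u] cons par_singleton by simp
    \<comment> \<open>A letter changes the coned-off length by at most 1, so the threshold is hit
      exactly.\<close>
    ultimately have "len \<Lambda> (inv z \<otimes> p) = H" using False cons.prems by simp
    moreover have "s u (inv p \<otimes> p) \<noteq> s u (inv p \<otimes> (p \<otimes> (b \<otimes> y)))"
      using c cons s_cons[of y u b u] by simp
    ultimately show ?thesis using cons by blast
  next
    case True
    then obtain e v where e: "e \<in> par \<Lambda>" "v \<in> \<Lambda>" "len \<Lambda> (inv z \<otimes> e) = H"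
      "s v (inv e \<otimes> (p \<otimes> b)) \<noteq> s v (inv e \<otimes> (p \<otimes> b \<otimes> y))"
      using cons.IH[of "p \<otimes> b"] cons.prems b unfolding as by auto
    have ec: "e \<in> carrier P" using e by simp
    \<comment> \<open>Otherwise \<open>b\<close> would cross the hyperplane and \<open>y\<close>
      would cross it back; but then both crossings have type \<open>u\<close>, and \<open>y\<close>
      has no head of that type.\<close>
    have "s v (inv e \<otimes> p) \<noteq> s v (inv e \<otimes> (p \<otimes> b \<otimes> y))"
    proof
      assume eq: "s v (inv e \<otimes> p) = s v (inv e \<otimes> (p \<otimes> b \<otimes> y))"
      let ?a = "inv e \<otimes> p"
      have ac: "?a \<in> carrier P" using ec c by simp
      have "s v (?a \<otimes> b) \<noteq> s v ?a" using e(4) eq c ec by (simp add: m_assoc)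
      then have v: "v = u" "?a \<in> par (st {u})" using s_right_mult[OF ac, of b u v] cons by auto
      have "gate {u} (?a \<otimes> b) = gate {u} ?a \<otimes> b"
        using gate_st[OF v(2) c(2)] cons par_singleton by simp
      moreover have "gate {u} (?a \<otimes> (b \<otimes> y)) = gate {u} ?a \<otimes> b"
        using gate_st[OF v(2), of "b \<otimes> y"] gate_singleton[of "b \<otimes> y" u] s_cons[of y u b u] cons c by simp
      ultimately have "s v (?a \<otimes> b) = s v (?a \<otimes> (b \<otimes> y))" using gate_singleton v(1) ac c by simp
      then show False using e(4) c ec by (simp add: m_assoc)
    qed
    then show ?thesis using e unfolding as by blast
  qed
qed

text \<open>
  A bottleneck argument. Some hyperplane separates \<open>p i\<close> from \<open>p (i + 107)\<close> and passes at distance 52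
  from \<open>p i\<close>. It is crossed by \<open>p\<close> only at steps at most 15 apart, hence (as \<open>52 > 3 * 15 + 6\<close> and
  \<open>107 = 2 * 52 + 3\<close>) only between these two points. So it separates the ends, and \<open>q\<close> has to cross it.
\<close>

lemma hyperbolic_alg:
  assumes L: "\<not> is_singleton \<Lambda>" "\<Lambda> \<noteq> {}"
    and p: "\<And>i. i \<le> n \<Longrightarrow> p i \<in> par \<Lambda>" "\<And>i. i < n \<Longrightarrow> len \<Lambda> (inv (p i) \<otimes> p (Suc i)) \<le> 3"
    and quasi: "\<And>i j. i \<le> j \<Longrightarrow> j \<le> n \<Longrightarrow> j \<le> i + len \<Lambda> (inv (p i) \<otimes> p j) + 3"
    and q: "\<And>j. j \<le> m \<Longrightarrow> q j \<in> par \<Lambda>" "\<And>j. j < m \<Longrightarrow> len \<Lambda> (inv (q j) \<otimes> q (Suc j)) \<le> 3"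
    and ends: "q 0 = p 0" "q m = p n" and i: "i \<le> n"
  shows "\<exists>j\<le>m. len \<Lambda> (inv (p i) \<otimes> q j) \<le> 333"
proof -
  have tri: "len \<Lambda> (inv x \<otimes> w) \<le> len \<Lambda> (inv x \<otimes> y) + len \<Lambda> (inv y \<otimes> w)"
    if "x \<in> par \<Lambda>" "y \<in> par \<Lambda>" "w \<in> par \<Lambda>" for x y w
    by (rule len_dist_triangle[OF L(2)]) (use that in auto)
  have sym: "len \<Lambda> (inv x \<otimes> y) = len \<Lambda> (inv y \<otimes> x)" if "x \<in> par \<Lambda>" "y \<in> par \<Lambda>" for x y
    using len_dist_sym[OF L(2), of y x] that by simp
  have up: "len \<Lambda> (inv (p a) \<otimes> p b) \<le> 3 * (b - a)" if "a \<le> b" "b \<le> n" for a b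
    using that
  proof (induction b rule: dec_induct)
    case base then show ?case using par_closed[OF p(1)[of a]] by simp
  next
    case (step b)
    have "len \<Lambda> (inv (p a) \<otimes> p (Suc b)) \<le> len \<Lambda> (inv (p a) \<otimes> p b) + len \<Lambda> (inv (p b) \<otimes> p (Suc b))"
      using step by (intro tri p) auto
    then show ?case using step p(2)[of b] by simp
  qed
  show ?thesis
  proof (cases "i + 107 \<le> n")
    case False
    \<comment> \<open>At most 106 steps of length at most 3 are left, which is 318; the value 333
      leaves some room.\<close>
    then have "len \<Lambda> (inv (p i) \<otimes> q m) \<le> 333" using up[OF i le_refl] ends by simp
    then show ?thesis by blast
  next
    case True
    let ?i = "i + 107"
    let ?x = "inv (p i) \<otimes> p ?i"
    have pi: "p i \<in> par \<Lambda>" "p ?i \<in> par \<Lambda>" using p True by auto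
    have pic: "p i \<in> carrier P" "p ?i \<in> carrier P" using pi by auto
    have far: "104 \<le> len \<Lambda> ?x" using quasi[of i ?i] True by simp
    have px: "p i \<otimes> ?x = p ?i" using pic by simp
    have "len \<Lambda> (inv (p i) \<otimes> p i) \<le> 52" using pic by simp
    from mid_wall[OF L _ pi(1) pi(1) this, of ?x] obtain e v where
      e: "e \<in> par \<Lambda>" "v \<in> \<Lambda>" "len \<Lambda> (inv (p i) \<otimes> e) = 52" "s v (inv e \<otimes> p i) \<noteq> s v (inv e \<otimes> p ?i)"
      using far pi unfolding px by auto
    let ?f = "\<lambda>z. s v (inv e \<otimes> z)"
    have near: "len \<Lambda> (inv e \<otimes> y) \<le> 6" if "y \<in> par \<Lambda>" "z \<in> par \<Lambda>" "?f y \<noteq> ?f z" "len \<Lambda> (inv y \<otimes> z) \<le> 3" for y z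
      using sep_near[OF L that(1,2) e(1,2) that(3)] that(4) by simp
    \<comment> \<open>15 = 6 + 6 + 3: two applications of \<open>near\<close> and the additive
      constant of \<open>quasi\<close>.\<close>
    have two: "b \<le> a + 15" if ab: "a \<le> b" "b < n" "?f (p a) \<noteq> ?f (p (Suc a))" "?f (p b) \<noteq> ?f (p (Suc b))" for a b
    proof -
      have m: "p a \<in> par \<Lambda>" "p (Suc a) \<in> par \<Lambda>" "p b \<in> par \<Lambda>" "p (Suc b) \<in> par \<Lambda>" using ab p by auto
      have "len \<Lambda> (inv (p a) \<otimes> p b) \<le> len \<Lambda> (inv (p a) \<otimes> e) + len \<Lambda> (inv e \<otimes> p b)" by (intro tri m e)
      moreover have "len \<Lambda> (inv e \<otimes> p b) \<le> 6" by (rule near[OF m(3,4) ab(4)]) (use p(2) ab in auto)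
      moreover have "len \<Lambda> (inv (p a) \<otimes> e) \<le> 6"
        unfolding sym[OF m(1) e(1)] by (rule near[OF m(1,2) ab(3)]) (use p(2) ab in auto)
      ultimately show ?thesis using quasi[of a b] ab by simp
    qed
    obtain l where l: "i \<le> l" "l < ?i" "?f (p l) \<noteq> ?f (p (Suc l))"
      using seq_change[of "\<lambda>j. ?f (p j)" i ?i] e(4) by auto
    have lm: "p l \<in> par \<Lambda>" "p (Suc l) \<in> par \<Lambda>" using l True p by auto
    have el: "len \<Lambda> (inv e \<otimes> p l) \<le> 6" by (rule near[OF lm l(3)]) (use p(2) l True in auto)
    have left: "?f (p 0) = ?f (p i)"
    proof (rule ccontr)
      assume "?f (p 0) \<noteq> ?f (p i)"
      then obtain j where j: "j < i" "?f (p j) \<noteq> ?f (p (Suc j))"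
        using seq_change[of "\<lambda>j. ?f (p j)" 0 i] by auto
      have "l \<le> j + 15" using two[of j l] j l True by simp
      then have "l - i \<le> 15" using j by simp
      then have "len \<Lambda> (inv (p i) \<otimes> p l) \<le> 45" using up[of i l] l True by simp
      moreover have "len \<Lambda> (inv (p i) \<otimes> e) \<le> len \<Lambda> (inv (p i) \<otimes> p l) + len \<Lambda> (inv (p l) \<otimes> e)"
        by (intro tri pi lm e)
      ultimately show False using e(3) el sym[OF lm(1) e(1)] by simp
    qed
    have right: "?f (p ?i) = ?f (p n)"
    proof (rule ccontr)
      assume "?f (p ?i) \<noteq> ?f (p n)"
      then obtain j where j: "?i \<le> j" "j < n" "?f (p j) \<noteq> ?f (p (Suc j))"
        using seq_change[of "\<lambda>j. ?f (p j)" ?i n] True by auto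
      have "j \<le> l + 15" using two[of l j] j l by simp
      then have "len \<Lambda> (inv (p l) \<otimes> p ?i) \<le> 45" using up[of l ?i] l j True by simp
      moreover have "len \<Lambda> (inv e \<otimes> p ?i) \<le> len \<Lambda> (inv e \<otimes> p l) + len \<Lambda> (inv (p l) \<otimes> p ?i)"
        by (intro tri pi lm e)
      moreover have "len \<Lambda> ?x \<le> len \<Lambda> (inv (p i) \<otimes> e) + len \<Lambda> (inv e \<otimes> p ?i)" by (intro tri pi e)
      ultimately show False using e(3) el far by simp
    qed
    have "?f (q 0) \<noteq> ?f (q m)" using left right e(4) ends by simp
    then obtain j where j: "j < m" "?f (q j) \<noteq> ?f (q (Suc j))"
      using seq_change[of "\<lambda>j. ?f (q j)" 0 m] by auto
    have qm: "q j \<in> par \<Lambda>" "q (Suc j) \<in> par \<Lambda>" using q j by auto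
    have "len \<Lambda> (inv e \<otimes> q j) \<le> 6" by (rule near[OF qm j(2)]) (use q(2) j in auto)
    moreover have "len \<Lambda> (inv (p i) \<otimes> q j) \<le> len \<Lambda> (inv (p i) \<otimes> e) + len \<Lambda> (inv e \<otimes> q j)"
      by (intro tri pi qm e)
    ultimately have "len \<Lambda> (inv (p i) \<otimes> q j) \<le> 333" using e(3) by simp
    then show ?thesis using j(1) less_imp_le by blast
  qed
qed

end


section \<open>Geometric realisations of graphs\<close>

definition vert :: "'x \<Rightarrow> 'x \<Rightarrow> real" where
  "vert g = (\<lambda>x. if x = g then 1 else 0)"

lemma supp_vert [simp]: "supp (vert g) = {g}"
  by (auto simp: supp_def vert_def)

lemma vert_same [simp]: "vert g g = 1"
  by (simp add: vert_def)

lemma vert_other [simp]: "x \<noteq> g \<Longrightarrow> vert g x = 0"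
  by (simp add: vert_def)

text \<open>Relabels barycentric coordinates along a bijection of vertices, given by its inverse
  \<open>g\<close>.\<close>

definition push :: "'y set \<Rightarrow> ('y \<Rightarrow> 'x) \<Rightarrow> ('x \<Rightarrow> real) \<Rightarrow> 'y \<Rightarrow> real" where
  "push Y g p = (\<lambda>y. if y \<in> Y then p (g y) else 0)"

text \<open>The last two conditions identify \<open>D u\<close> as the edge-path distance from
  \<open>u\<close>: it grows by at most 1 along an edge, and every vertex other than
  \<open>u\<close> has a neighbour that is closer to \<open>u\<close>.\<close>

locale metric_graph =
  fixes Vs :: "'x set" and Es :: "'x set set" and D :: "'x \<Rightarrow> 'x \<Rightarrow> nat"
  assumes edges: "e \<in> Es \<Longrightarrow> \<exists>u\<in>Vs. \<exists>v\<in>Vs. u \<noteq> v \<and> e = {u, v}"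
    and D_refl: "u \<in> Vs \<Longrightarrow> D u u = 0"
    and D_zero: "u \<in> Vs \<Longrightarrow> v \<in> Vs \<Longrightarrow> D u v = 0 \<Longrightarrow> u = v"
    and D_edge: "u \<in> Vs \<Longrightarrow> {w, v} \<in> Es \<Longrightarrow> D u v \<le> D u w + 1"
    and D_Suc: "u \<in> Vs \<Longrightarrow> v \<in> Vs \<Longrightarrow> D u v = Suc n \<Longrightarrow> \<exists>w\<in>Vs. D u w = n \<and> {w, v} \<in> Es"
begin

abbreviation "Pt \<equiv> graph_points Vs Es"
abbreviation (input) "gpath \<equiv> graph_path Vs Es"

lemma edge_ends: "{u, v} \<in> Es \<Longrightarrow> u \<in> Vs \<and> v \<in> Vs \<and> u \<noteq> v"
  using edges[of "{u, v}"] by (auto simp: doubleton_eq_iff)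

lemma edge_iff: "u \<in> Vs \<Longrightarrow> v \<in> Vs \<Longrightarrow> {u, v} \<in> Es \<longleftrightarrow> D u v = 1"
  using D_edge[of u u v] D_zero[of u v] D_Suc[of u v 0] D_zero[of u] D_refl[of u] edge_ends[of u v] by force

lemma vert_point: "v \<in> Vs \<Longrightarrow> vert v \<in> Pt"
  by (auto simp: graph_points_def) (auto simp: vert_def)

lemma point_cases:
  assumes "p \<in> Pt"
  obtains (vertex) v where "v \<in> Vs" "p = vert v"
  | (edge) u v where "{u, v} \<in> Es" "supp p = {u, v}" "u \<in> Vs" "v \<in> Vs" "u \<noteq> v"
proof -
  consider v where "v \<in> Vs" "supp p = {v}" | "supp p \<in> Es" using assms by (auto simp: graph_points_def)
  then show ?thesis
  proof cases
    case 1
    then have "p = vert v"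
      using assms by (auto simp: graph_points_def supp_def vert_def fun_eq_iff)
    then show ?thesis using vertex 1 by blast
  next
    case 2
    then show ?thesis using edges[OF 2] edge by metis
  qed
qed

lemma supp_point: "p \<in> Pt \<Longrightarrow> supp p \<noteq> {} \<and> finite (supp p) \<and> supp p \<subseteq> Vs"
  by (erule point_cases) auto

lemma point_le_1: "p \<in> Pt \<Longrightarrow> 0 \<le> p x \<and> p x \<le> 1"
proof -
  assume "p \<in> Pt"
  then show ?thesis
  proof (cases rule: point_cases)
  case (edge u v)
  note p = \<open>p \<in> Pt\<close> edge(2,5)
  have "p u + p v = 1" using graph_points_edge[OF p(1)] p by simp
  moreover have "0 \<le> p u" "0 \<le> p v" "0 \<le> p x" using p by (auto simp: graph_points_def)
  moreover have "x \<notin> {u, v} \<Longrightarrow> p x = 0" using p(2) by (auto simp: supp_def)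
  ultimately show ?thesis by (cases "x = u"; cases "x = v") auto
  qed (auto simp: vert_def)
qed

lemma edge_point:
  assumes "{u, v} \<in> Es" "supp f \<subseteq> {u, v}" "0 \<le> f u" "0 \<le> f v" "f u + f v = 1"
  shows "f \<in> Pt"
proof -
  have uv: "u \<in> Vs" "v \<in> Vs" "u \<noteq> v" using edge_ends[OF assms(1)] by auto
  have z: "f x = 0" if "x \<notin> {u, v}" for x using that assms(2) by (auto simp: supp_def)
  have "(\<Sum>x\<in>supp f. f x) = (\<Sum>x\<in>{u, v}. f x)"
    by (rule sum.mono_neutral_left) (use assms in \<open>auto simp: supp_def\<close>)
  then have "(\<Sum>x\<in>supp f. f x) = 1" using assms uv by simp
  moreover have "0 \<le> f x" for x using z[of x] assms by (cases "x \<in> {u, v}") auto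
  moreover have "supp f = {u} \<or> supp f = {v} \<or> supp f = {u, v}"
  proof -
    have "f u \<noteq> 0 \<or> f v \<noteq> 0" using assms by auto
    then have "supp f \<noteq> {}" by (auto simp: supp_def)
    then show ?thesis using assms(2) by blast
  qed
  ultimately show ?thesis using uv assms(1) by (auto simp: graph_points_def)
qed

lemma path_edge: "p \<in> Pt \<Longrightarrow> q \<in> Pt \<Longrightarrow> {u, v} \<in> Es \<Longrightarrow> supp p \<union> supp q \<subseteq> {u, v} \<Longrightarrow> gpath \<bar>p u - q u\<bar> p q"
  using graph_path.step[OF graph_path.nil[of p Vs Es], of q u v] by simp

lemma path_vert: "u \<in> Vs \<Longrightarrow> v \<in> Vs \<Longrightarrow> gpath (real (D u v)) (vert u) (vert v)"
proof (induction "D u v" arbitrary: v)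
  case 0
  then show ?case using D_zero[of u v] graph_path.nil[OF vert_point, of u] by simp
next
  case (Suc n)
  obtain w where w: "w \<in> Vs" "D u w = n" "{w, v} \<in> Es" using D_Suc[OF Suc.prems] Suc.hyps(2) by metis
  have wv: "w \<noteq> v" using edge_ends[OF w(3)] by simp
  have "gpath (real n) (vert u) (vert w)" using Suc.hyps(1)[of w] w Suc.prems by simp
  then have "gpath (real n + \<bar>vert w w - vert v w\<bar>) (vert u) (vert v)"
    by (rule graph_path.step[where v = v]) (use w Suc.prems vert_point in auto)
  then show ?case using wv by (simp add: vert_def Suc.hyps(2)[symmetric] add.commute)
qed

lemma path_to_vert:
  assumes "p \<in> Pt" "a \<in> supp p"
  shows "gpath (1 - p a) p (vert a)"
  using assms(1)
proof (cases rule: point_cases)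
  case (vertex v)
  then show ?thesis using assms graph_path.nil[OF vert_point, of v] by simp
next
  case (edge u v)
  note p = assms edge
  then have "supp p = {a, u} \<and> {a, u} \<in> Es \<or> supp p = {a, v} \<and> {a, v} \<in> Es" by (auto simp: insert_commute)
  then obtain b where b: "supp p = {a, b}" "{a, b} \<in> Es" by blast
  have "gpath \<bar>p a - vert a a\<bar> p (vert a)"
    by (rule path_edge[of _ _ _ b]) (use p b vert_point in auto)
  then show ?thesis using point_le_1[OF p(1), of a] by (simp add: vert_def)
qed

text \<open>
  The finitely many candidates for the distance of \<open>p\<close> and \<open>q\<close>: they are lengths of paths, and every path
  is at least as long as some candidate. Hence the infimum over all paths is attained.
\<close>

definition cand :: "('x \<Rightarrow> real) \<Rightarrow> ('x \<Rightarrow> real) \<Rightarrow> real \<Rightarrow> bool" where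
  "cand p q l \<longleftrightarrow> (\<exists>a\<in>supp p. \<exists>b\<in>supp q. l = (1 - p a) + D a b + (1 - q b)) \<or>
    (\<exists>u v. {u, v} \<in> Es \<and> supp p \<union> supp q \<subseteq> {u, v} \<and> l = \<bar>p u - q u\<bar>)"

lemma cand_path:
  assumes p: "p \<in> Pt" and q: "q \<in> Pt" and "cand p q l"
  shows "gpath l p q"
  using assms(3) unfolding cand_def
proof
  assume "\<exists>a\<in>supp p. \<exists>b\<in>supp q. l = (1 - p a) + D a b + (1 - q b)"
  then obtain a b where ab: "a \<in> supp p" "b \<in> supp q" "l = (1 - p a) + (D a b + (1 - q b))" by auto
  have V: "a \<in> Vs" "b \<in> Vs" using ab supp_point p q by blast+
  show ?thesis unfolding ab(3)
    by (intro graph_path_trans[of _ _ _ "vert a"] graph_path_trans[of _ _ _ "vert b"] path_vert V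
      graph_path_sym[OF path_to_vert] path_to_vert p q ab)
qed (use path_edge p q in blast)

lemma cand_exists: "p \<in> Pt \<Longrightarrow> q \<in> Pt \<Longrightarrow> \<exists>l. cand p q l"
  using supp_point[of p] supp_point[of q] unfolding cand_def by blast

lemma cand_finite: "p \<in> Pt \<Longrightarrow> q \<in> Pt \<Longrightarrow> finite {l. cand p q l}"
proof (rule finite_subset)
  assume p: "p \<in> Pt" and q: "q \<in> Pt"
  let ?A = "(\<lambda>(a, b). (1 - p a) + D a b + (1 - q b)) ` (supp p \<times> supp q)"
  let ?B = "insert 0 ((\<lambda>u. \<bar>p u - q u\<bar>) ` (supp p \<union> supp q))"
  show "{l. cand p q l} \<subseteq> ?A \<union> ?B"
  proof
    fix l assume "l \<in> {l. cand p q l}"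
    then have c: "cand p q l" by simp
    have "\<bar>p u - q u\<bar> \<in> ?B" for u by (cases "u \<in> supp p \<union> supp q") (auto simp: supp_def)
    moreover have "(1 - p a) + D a b + (1 - q b) \<in> ?A" if "a \<in> supp p" "b \<in> supp q" for a b
      using that by (intro image_eqI[of _ _ "(a, b)"]) auto
    ultimately show "l \<in> ?A \<union> ?B" using c unfolding cand_def by blast
  qed
  show "finite (?A \<union> ?B)" using supp_point[OF p] supp_point[OF q] by simp
qed

lemma edge_diff:
  assumes "p \<in> Pt" "q \<in> Pt" "{u, v} \<in> Es" "supp p \<union> supp q \<subseteq> {u, v}" "x \<in> {u, v}"
  shows "\<bar>p x - q x\<bar> = \<bar>p u - q u\<bar>"
proof (cases "x = u")
  case False
  have "u \<noteq> v" using edge_ends[OF assms(3)] by simp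
  then have "p u + p v = 1" "q u + q v = 1" using assms by (auto intro!: graph_points_edge[of _ Vs Es])
  then have "p v - q v = - (p u - q u)" by linarith
  then show ?thesis using False assms(5) by simp
qed simp

lemma vert_of_supp: "q \<in> Pt \<Longrightarrow> supp q \<subseteq> {c} \<Longrightarrow> q = vert c"
  by (erule point_cases) auto

text \<open>Induction over the path: appending a step extends some candidate by at most the length
  of the step. A candidate inside one edge can be continued into another edge only through their
  common vertex.\<close>

lemma path_cand: "gpath l p r \<Longrightarrow> \<exists>l'\<le>l. cand p r l'"
proof (induction rule: graph_path.induct)
  case (nil p)
  then show ?case
  proof (cases rule: point_cases)
    case (vertex v)
    then have "cand p p 0" by (simp add: cand_def D_refl)
    then show ?thesis by blast
  next
    case (edge u v)
    then have "cand p p 0" unfolding cand_def by (intro disjI2 exI[of _ u] exI[of _ v]) auto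
    then show ?thesis by blast
  qed
next
  case (step l p q r u v)
  have p: "p \<in> Pt" and q: "q \<in> Pt" using graph_path_points[OF step(1)] by auto
  note r = step(2)
  obtain l' where l': "l' \<le> l" "cand p q l'" using step.IH by blast
  have uv: "u \<in> Vs" "v \<in> Vs" "u \<noteq> v" using edge_ends[OF step(3)] by auto
  \<comment> \<open>A candidate running through the vertices \<open>a\<close> and \<open>b\<close>.
    If \<open>b\<close> is not in the support of \<open>r\<close>, then \<open>r\<close> is the
    other end \<open>c\<close> of the edge, and the candidate is extended to
    \<open>c\<close>.\<close>
  have vertex_case: "\<exists>l''\<le>m + \<bar>q u - r u\<bar>. cand p r l''"
    if ab: "a \<in> supp p" "b \<in> supp q" and m: "(1 - p a) + D a b + (1 - q b) \<le> m" for a b m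
  proof (cases "b \<in> supp r")
    case True
    have "\<bar>q b - r b\<bar> = \<bar>q u - r u\<bar>" by (rule edge_diff[OF q r step(3,4)]) (use ab step(4) in auto)
    then have "(1 - p a) + D a b + (1 - r b) \<le> m + \<bar>q u - r u\<bar>" using m by linarith
    moreover have "cand p r ((1 - p a) + D a b + (1 - r b))" using ab True unfolding cand_def by blast
    ultimately show ?thesis by blast
  next
    case False
    have b: "b \<in> {u, v}" using ab step(4) by blast
    obtain c where c: "{u, v} = {b, c}" "b \<noteq> c" using b uv by blast
    have rc: "r = vert c" by (rule vert_of_supp[OF r]) (use False step(4) c in auto)
    have "\<bar>q b - r b\<bar> = \<bar>q u - r u\<bar>" by (rule edge_diff[OF q r step(3,4)]) (use b in auto)
    then have "q b = \<bar>q u - r u\<bar>" using rc c point_le_1[OF q, of b] by (simp add: vert_def)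
    moreover have "a \<in> Vs" using ab supp_point[OF p] by blast
    then have "D a c \<le> D a b + 1" using D_edge[of a b c] step(3) c by simp
    then have "real (D a c) \<le> D a b + 1" by linarith
    ultimately have "(1 - p a) + D a c + (1 - r c) \<le> m + \<bar>q u - r u\<bar>" using m rc by (simp add: vert_def)
    moreover have "cand p r ((1 - p a) + D a c + (1 - r c))" using ab rc unfolding cand_def by auto
    ultimately show ?thesis by blast
  qed
  have "\<exists>l''\<le>l' + \<bar>q u - r u\<bar>. cand p r l''"
    using l'(2) unfolding cand_def[of p q]
  proof
    assume "\<exists>a\<in>supp p. \<exists>b\<in>supp q. l' = (1 - p a) + D a b + (1 - q b)"
    then show ?thesis using vertex_case by fastforce
  next
    assume "\<exists>x y. {x, y} \<in> Es \<and> supp p \<union> supp q \<subseteq> {x, y} \<and> l' = \<bar>p x - q x\<bar>"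
    then obtain x y where xy: "{x, y} \<in> Es" "supp p \<union> supp q \<subseteq> {x, y}" "l' = \<bar>p x - q x\<bar>" by blast
    have ne: "x \<noteq> y" "x \<in> Vs" "y \<in> Vs" using edge_ends[OF xy(1)] by auto
    show ?thesis
    proof (cases "{x, y} = {u, v}")
      case True
      have "cand p r \<bar>p u - r u\<bar>" unfolding cand_def
        by (intro disjI2 exI[of _ u] exI[of _ v]) (use xy True step in auto)
      moreover have "l' = \<bar>p u - q u\<bar>" using edge_diff[OF p q xy(1,2), of u] True xy(3) by auto
      ultimately show ?thesis by (intro exI[of _ "\<bar>p u - r u\<bar>"]) auto
    next
      case False
      \<comment> \<open>Two different edges share at most one vertex, so \<open>q\<close> is that
        vertex and the candidate ends there.\<close>
      have "supp q \<subseteq> {x, y} \<inter> {u, v}" using xy step by blast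
      moreover have "\<exists>c. {x, y} \<inter> {u, v} \<subseteq> {c}" using False uv ne by auto
      ultimately obtain c where c: "supp q \<subseteq> {c}" by blast
      have qc: "q = vert c" by (rule vert_of_supp[OF q c])
      have cxy: "c \<in> {x, y}" using qc xy by auto
      have lc: "l' = \<bar>p c - 1\<bar>" using edge_diff[OF p q xy(1,2) cxy] xy(3) qc by (simp add: vert_def)
      show ?thesis
      proof (cases "c \<in> supp p")
        case True
        have "(1 - p c) + D c c + (1 - q c) \<le> l'"
          using lc point_le_1[OF p, of c] D_refl cxy ne qc by (auto simp: vert_def)
        then show ?thesis using vertex_case[OF True, of c] qc by simp
      next
        case F: False
        obtain b where b: "{x, y} = {c, b}" using cxy by auto
        have pb: "p = vert b" by (rule vert_of_supp[OF p]) (use F xy b in auto)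
        have bV: "b \<in> Vs" "{b, c} \<in> Es" "b \<noteq> c" using b ne xy(1) by (auto simp: doubleton_eq_iff insert_commute)
        have "D b c = 1" using edge_iff[of b c] bV edge_ends by auto
        then have "(1 - p b) + D b c + (1 - q c) \<le> l'" using lc pb qc bV by (simp add: vert_def)
        then show ?thesis using vertex_case[of b c] pb qc by simp
      qed
    qed
  qed
  then obtain l'' where "l'' \<le> l' + \<bar>q u - r u\<bar>" "cand p r l''" by blast
  then show ?case using l'(1) by (intro exI[of _ l'']) auto
qed

section \<open>The length metric and its geodesics\<close>

lemma Metric_space: "Metric_space Pt (graph_dist Vs Es)"
  by (rule Metric_space_graph_dist) (use cand_exists cand_path in blast)

sublocale M: Metric_space Pt "graph_dist Vs Es"
  by (rule Metric_space)

lemma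
  shows mspace_graph: "mspace (graph_metric Vs Es) = Pt"
    and mdist_graph: "mdist (graph_metric Vs Es) = graph_dist Vs Es"
  by (simp_all add: graph_metric_def)

lemma graph_dist_le: "gpath l p q \<Longrightarrow> graph_dist Vs Es p q \<le> l"
proof -
  assume l: "gpath l p q"
  have "bdd_below {l. gpath l p q}" using graph_path_points[of Vs Es] by (intro bdd_belowI[of _ 0]) blast
  then have "Inf {l. gpath l p q} \<le> l" using l by (intro cInf_lower) auto
  then show ?thesis using graph_path_points[OF l] by (simp add: graph_dist_def)
qed

lemma graph_dist_attained:
  assumes p: "p \<in> Pt" and q: "q \<in> Pt"
  shows "cand p q (graph_dist Vs Es p q)"
proof -
  let ?N = "{l. cand p q l}"
  have N: "finite ?N" "?N \<noteq> {}" using cand_finite[OF p q] cand_exists[OF p q] by auto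
  have m: "cand p q (Min ?N)" using Min_in[OF N] by simp
  have "Min ?N \<le> l" if "gpath l p q" for l
    using path_cand[OF that] Min_le[OF N(1)] by (auto intro: order_trans)
  then have "Min ?N \<le> graph_dist Vs Es p q"
    using p q cand_path[OF p q m] unfolding graph_dist_def by (auto intro!: cInf_greatest)
  moreover have "graph_dist Vs Es p q \<le> Min ?N" using graph_dist_le[OF cand_path[OF p q m]] .
  ultimately have "graph_dist Vs Es p q = Min ?N" by (rule antisym[rotated])
  then show ?thesis using m by metis
qed

lemma graph_dist_edge:
  "p \<in> Pt \<Longrightarrow> q \<in> Pt \<Longrightarrow> {u, v} \<in> Es \<Longrightarrow> supp p \<union> supp q \<subseteq> {u, v} \<Longrightarrow> graph_dist Vs Es p q \<le> \<bar>p u - q u\<bar>"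
  by (intro graph_dist_le path_edge)

lemma graph_dist_vert:
  assumes "u \<in> Vs" "v \<in> Vs"
  shows "graph_dist Vs Es (vert u) (vert v) = D u v"
proof (rule antisym)
  show "graph_dist Vs Es (vert u) (vert v) \<le> D u v" by (rule graph_dist_le[OF path_vert[OF assms]])
  have "cand (vert u) (vert v) (graph_dist Vs Es (vert u) (vert v))"
    by (intro graph_dist_attained vert_point assms)
  then show "D u v \<le> graph_dist Vs Es (vert u) (vert v)" unfolding cand_def
  proof
    assume "\<exists>x y. {x, y} \<in> Es \<and> supp (vert u) \<union> supp (vert v) \<subseteq> {x, y} \<and> graph_dist Vs Es (vert u) (vert v) = \<bar>vert u x - vert v x\<bar>"
    then obtain x y where xy: "{x, y} \<in> Es" "u \<in> {x, y}" "v \<in> {x, y}" "graph_dist Vs Es (vert u) (vert v) = \<bar>vert u x - vert v x\<bar>"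
      by auto
    have "x \<noteq> y" using edge_ends[OF xy(1)] by simp
    show ?thesis
    proof (cases "u = v")
      case True then show ?thesis using D_refl assms xy(4) by simp
    next
      case False
      then have "{u, v} \<in> Es" using xy by (metis doubleton_eq_iff insertE singletonD)
      then have "D u v = 1" using edge_iff assms by simp
      then show ?thesis using False xy by (auto simp: vert_def)
    qed
  qed auto
qed

lemma graph_dist_near: "p \<in> Pt \<Longrightarrow> a \<in> supp p \<Longrightarrow> graph_dist Vs Es p (vert a) \<le> 1"
  using graph_dist_le[OF path_to_vert, of p a] point_le_1[of p a] by linarith

text \<open>Concatenates affine parametrisations of the steps. A 1-Lipschitz curve is enough: it is
  a geodesic as soon as \<open>l\<close> equals the distance of its ends.\<close>

lemma path_curve:
  "gpath l p q \<Longrightarrow> \<exists>c. c 0 = p \<and> c l = q \<and> (\<forall>t\<in>{0..l}. c t \<in> Pt) \<and>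
    (\<forall>t\<in>{0..l}. \<forall>t'\<in>{0..l}. graph_dist Vs Es (c t) (c t') \<le> \<bar>t - t'\<bar>)"
proof (induction rule: graph_path.induct)
  case (nil p)
  then show ?case by (intro exI[of _ "\<lambda>_. p"]) (auto simp: M.zero)
next
  case (step l p q r u v)
  obtain c where c: "c 0 = p" "c l = q" "\<forall>t\<in>{0..l}. c t \<in> Pt"
    "\<forall>t\<in>{0..l}. \<forall>t'\<in>{0..l}. graph_dist Vs Es (c t) (c t') \<le> \<bar>t - t'\<bar>" using step.IH by blast
  have q: "q \<in> Pt" and l: "0 \<le> l" using graph_path_points[OF step(1)] by auto
  note r = step(2)
  have uv: "u \<noteq> v" using edge_ends[OF step(3)] by simp
  have sum1: "q u + q v = 1" "r u + r v = 1"
    using step q uv by (auto intro!: graph_points_edge[of _ Vs Es])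
  let ?L = "\<bar>q u - r u\<bar>"
  show ?case
  proof (cases "?L = 0")
    case True
    \<comment> \<open>Steps of length 0 are treated apart because the parametrisation divides by
      \<open>?L\<close>.\<close>
    then have "q u = r u" by simp
    then have "q v = r v" using sum1 by simp
    have "q x = r x" for x
    proof (cases "x \<in> {u, v}")
      case True then show ?thesis using \<open>q u = r u\<close> \<open>q v = r v\<close> by auto
    next
      case False
      then have "x \<notin> supp q" "x \<notin> supp r" using step(4) by auto
      then show ?thesis by (simp add: supp_def)
    qed
    then have "q = r" by blast
    then show ?thesis using c True by (intro exI[of _ c]) simp
  next
    case False
    then have L: "0 < ?L" by simp
    define w where "w t = (\<lambda>x. q x + t / ?L * (r x - q x))" for t
    have w0: "w 0 = q" by (simp add: w_def)
    have wL: "w ?L = r" using L by (auto simp: w_def fun_eq_iff)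
    have ws: "supp (w t) \<subseteq> {u, v}" for t
    proof
      fix x assume "x \<in> supp (w t)"
      then have "q x \<noteq> 0 \<or> r x \<noteq> 0" by (auto simp: supp_def w_def)
      then show "x \<in> {u, v}" using step(4) by (auto simp: supp_def)
    qed
    have wP: "w t \<in> Pt" if t: "t \<in> {0..?L}" for t
    proof (rule edge_point[OF step(3) ws])
      have pos: "0 \<le> w t x" for x
      proof -
        have tl: "0 \<le> t / ?L" "t / ?L \<le> 1" using t L by auto
        have "q x + k * (r x - q x) = (1 - k) * q x + k * r x" for k by (simp add: algebra_simps)
        then have "w t x = (1 - t / ?L) * q x + t / ?L * r x" unfolding w_def .
        moreover have "0 \<le> (1 - t / ?L) * q x + t / ?L * r x"
          using tl point_le_1[OF q, of x] point_le_1[OF r, of x]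
          by (intro add_nonneg_nonneg mult_nonneg_nonneg) auto
        ultimately show ?thesis by simp
      qed
      show "0 \<le> w t u" "0 \<le> w t v" by (rule pos)+
      have "w t u + w t v = (q u + q v) + t / ?L * ((r u + r v) - (q u + q v))"
        unfolding w_def by (simp only: algebra_simps)
      then show "w t u + w t v = 1" using sum1 by simp
    qed
    have wd: "graph_dist Vs Es (w t) (w t') \<le> \<bar>t - t'\<bar>" if "t \<in> {0..?L}" "t' \<in> {0..?L}" for t t'
    proof -
      have "graph_dist Vs Es (w t) (w t') \<le> \<bar>w t u - w t' u\<bar>"
        by (rule graph_dist_edge[OF wP[OF that(1)] wP[OF that(2)] step(3)]) (use ws in blast)
      also have "w t u - w t' u = (t - t') / ?L * (r u - q u)"
      proof -
        have "w t u - w t' u = t / ?L * (r u - q u) - t' / ?L * (r u - q u)" by (simp only: w_def)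
        then show ?thesis by (simp only: left_diff_distrib diff_divide_distrib)
      qed
      also have "\<bar>\<dots>\<bar> = \<bar>t - t'\<bar>" using L by (simp add: abs_mult abs_minus_commute)
      finally show ?thesis .
    qed
    define e where "e t = (if t \<le> l then c t else w (t - l))" for t
    have eP: "e t \<in> Pt" if "t \<in> {0..l + ?L}" for t using that c(3) wP by (auto simp: e_def)
    have el: "e l = q" using c by (simp add: e_def)
    have e2: "e t = w (t - l)" if "l \<le> t" for t using that c(2) w0 by (auto simp: e_def)
    have mixed: "graph_dist Vs Es (e t) (e t') \<le> \<bar>t - t'\<bar>" if "t \<in> {0..l}" "t' \<in> {l..l + ?L}" for t t'
    proof -
      have "graph_dist Vs Es (e t) (e t') \<le> graph_dist Vs Es (e t) (e l) + graph_dist Vs Es (e l) (e t')"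
        by (rule M.triangle) (use that l in \<open>auto intro!: eP\<close>)
      also have "graph_dist Vs Es (e t) (e l) \<le> \<bar>t - l\<bar>" using bspec[OF bspec[OF c(4), of t], of l] that l by (simp add: e_def)
      also have "graph_dist Vs Es (e l) (e t') \<le> \<bar>0 - (t' - l)\<bar>"
        using wd[of 0 "t' - l"] that e2[of l] e2[of t'] by simp
      finally show ?thesis using that by simp
    qed
    have "graph_dist Vs Es (e t) (e t') \<le> \<bar>t - t'\<bar>" if tt: "t \<in> {0..l + ?L}" "t' \<in> {0..l + ?L}" for t t'
    proof -
      consider "t \<le> l" "t' \<le> l" | "t \<le> l" "l \<le> t'" | "l \<le> t" "t' \<le> l" | "l \<le> t" "l \<le> t'" by linarith
      then show ?thesis
      proof cases
        case 1 then show ?thesis using c(4) tt by (simp add: e_def)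
      next
        case 2 then show ?thesis using mixed tt by auto
      next
        case 3 then show ?thesis using mixed[of t' t] tt by (auto simp: M.commute abs_minus_commute)
      next
        case 4 then show ?thesis using wd[of "t - l" "t' - l"] tt by (simp add: e2)
      qed
    qed
    moreover have "e 0 = p" "e (l + ?L) = r" using c l L wL by (auto simp: e_def)
    ultimately show ?thesis using eP by (intro exI[of _ e]) blast
  qed
qed

lemma geodesic_space_graph: "geodesic_space (graph_metric Vs Es)"
  unfolding geodesic_space_def mspace_graph
proof (intro ballI)
  fix p q assume p: "p \<in> Pt" and q: "q \<in> Pt"
  let ?d = "graph_dist Vs Es p q"
  obtain c where c: "c 0 = p" "c ?d = q" "\<forall>t\<in>{0..?d}. c t \<in> Pt"
    "\<forall>t\<in>{0..?d}. \<forall>t'\<in>{0..?d}. graph_dist Vs Es (c t) (c t') \<le> \<bar>t - t'\<bar>"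
    using path_curve[OF cand_path[OF p q graph_dist_attained[OF p q]]] by blast
  \<comment> \<open>The pieces of the curve are at most as long as their parameter intervals, which
    add up to the distance of the ends; hence no piece is shorter.\<close>
  have ge: "t' - t \<le> graph_dist Vs Es (c t) (c t')" if "t \<in> {0..?d}" "t' \<in> {0..?d}" "t \<le> t'" for t t'
  proof -
    have d0: "0 \<in> {0..?d}" "?d \<in> {0..?d}" using that by auto
    have "graph_dist Vs Es (c 0) (c ?d) \<le> graph_dist Vs Es (c 0) (c t) + graph_dist Vs Es (c t) (c ?d)"
      by (rule M.triangle) (use c(3) d0 that in blast)+
    moreover have "graph_dist Vs Es (c t) (c ?d) \<le> graph_dist Vs Es (c t) (c t') + graph_dist Vs Es (c t') (c ?d)"
      by (rule M.triangle) (use c(3) d0 that in blast)+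
    moreover have "graph_dist Vs Es (c 0) (c t) \<le> \<bar>0 - t\<bar>" "graph_dist Vs Es (c t') (c ?d) \<le> \<bar>t' - ?d\<bar>"
      using c(4) d0 that by blast+
    ultimately show ?thesis using that c(1,2) by simp
  qed
  have "graph_dist Vs Es (c t) (c t') = \<bar>t - t'\<bar>" if "t \<in> {0..?d}" "t' \<in> {0..?d}" for t t'
  proof (rule antisym)
    show "\<bar>t - t'\<bar> \<le> graph_dist Vs Es (c t) (c t')"
      using ge[of t t'] ge[of t' t] that by (cases "t \<le> t'") (auto simp: M.commute)
  qed (use c(4) that in blast)
  then have "geodesic (graph_metric Vs Es) p q c"
    using c unfolding geodesic_def mdist_graph mspace_graph by auto
  then show "\<exists>\<gamma>. geodesic (graph_metric Vs Es) p q \<gamma>" by blast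
qed

text \<open>Rounds a point to an end of its edge, which moves it by at most 1.\<close>

definition vx :: "('x \<Rightarrow> real) \<Rightarrow> 'x" where
  "vx p = (SOME a. a \<in> supp p)"

lemma vx_supp: "p \<in> Pt \<Longrightarrow> vx p \<in> supp p"
  using supp_point[of p] unfolding vx_def by (meson ex_in_conv someI_ex)

lemma vx_Vs: "p \<in> Pt \<Longrightarrow> vx p \<in> Vs"
  using vx_supp supp_point by blast

lemma vx_vert: "vx (vert a) = a"
  by (simp add: vx_def)

lemma vx_near: "p \<in> Pt \<Longrightarrow> graph_dist Vs Es p (vert (vx p)) \<le> 1"
  using graph_dist_near vx_supp by blast

lemma D_le_dist: "p \<in> Pt \<Longrightarrow> q \<in> Pt \<Longrightarrow> D (vx p) (vx q) \<le> graph_dist Vs Es p q + 2"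
proof -
  assume p: "p \<in> Pt" and q: "q \<in> Pt"
  note P = vert_point[OF vx_Vs[OF p]] vert_point[OF vx_Vs[OF q]]
  have "D (vx p) (vx q) = graph_dist Vs Es (vert (vx p)) (vert (vx q))"
    using graph_dist_vert[OF vx_Vs[OF p] vx_Vs[OF q]] by simp
  also have "\<dots> \<le> graph_dist Vs Es (vert (vx p)) p + graph_dist Vs Es p (vert (vx q))"
    by (rule M.triangle[OF P(1) p P(2)])
  also have "graph_dist Vs Es p (vert (vx q)) \<le> graph_dist Vs Es p q + graph_dist Vs Es q (vert (vx q))"
    by (rule M.triangle[OF p q P(2)])
  finally show ?thesis using vx_near[OF p] vx_near[OF q] by (simp add: M.commute)
qed

lemma dist_le_D: "p \<in> Pt \<Longrightarrow> q \<in> Pt \<Longrightarrow> graph_dist Vs Es p q \<le> D (vx p) (vx q) + 2"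
proof -
  assume p: "p \<in> Pt" and q: "q \<in> Pt"
  note P = vert_point[OF vx_Vs[OF p]] vert_point[OF vx_Vs[OF q]]
  have "graph_dist Vs Es p q \<le> graph_dist Vs Es p (vert (vx p)) + graph_dist Vs Es (vert (vx p)) q"
    by (rule M.triangle[OF p P(1) q])
  also have "graph_dist Vs Es (vert (vx p)) q \<le> graph_dist Vs Es (vert (vx p)) (vert (vx q)) + graph_dist Vs Es (vert (vx q)) q"
    by (rule M.triangle[OF P q])
  finally show ?thesis
    using vx_near[OF p] vx_near[OF q] graph_dist_vert[OF vx_Vs[OF p] vx_Vs[OF q]] by (simp add: M.commute)
qed

text \<open>Sampling at integer times and rounding to vertices. Rounding two points costs 2, so
  steps have length at most 1 + 2; in the lower bound the last interval, possibly shorter than 1,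
  costs 1 more.\<close>

lemma geodesic_sample:
  assumes g: "geodesic (graph_metric Vs Es) x y \<gamma>" and x: "x \<in> Pt" and y: "y \<in> Pt"
  shows "\<exists>n v. v 0 = vx x \<and> v n = vx y \<and> (\<forall>i<n. D (v i) (v (Suc i)) \<le> 3) \<and>
    (\<forall>i j. i \<le> j \<longrightarrow> j \<le> n \<longrightarrow> j \<le> i + D (v i) (v j) + 3) \<and>
    (\<forall>i\<le>n. \<exists>t\<in>{0..graph_dist Vs Es x y}. v i = vx (\<gamma> t)) \<and>
    (\<forall>t\<in>{0..graph_dist Vs Es x y}. \<exists>i\<le>n. graph_dist Vs Es (\<gamma> t) (vert (v i)) \<le> 2)"
proof -
  let ?d = "graph_dist Vs Es x y"
  have d: "0 \<le> ?d" by (rule M.nonneg)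
  have G: "\<gamma> 0 = x" "\<gamma> ?d = y" "\<And>t. t \<in> {0..?d} \<Longrightarrow> \<gamma> t \<in> Pt"
    "\<And>s t. s \<in> {0..?d} \<Longrightarrow> t \<in> {0..?d} \<Longrightarrow> graph_dist Vs Es (\<gamma> s) (\<gamma> t) = \<bar>s - t\<bar>"
    using g unfolding geodesic_def mdist_graph mspace_graph by auto
  define n where "n = nat \<lceil>?d\<rceil>"
  have n: "?d \<le> real n" "real n < ?d + 1" using d unfolding n_def by linarith+
  \<comment> \<open>Clipped at \<open>?d\<close>, so that the last sample is the end point.\<close>
  define \<tau> where "\<tau> i = min (real i) ?d" for i
  have t: "\<tau> i \<in> {0..?d}" for i using d by (auto simp: \<tau>_def)
  define v where "v i = vx (\<gamma> (\<tau> i))" for i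
  have "D (v i) (v (Suc i)) \<le> 3" for i
  proof -
    have "D (v i) (v (Suc i)) \<le> graph_dist Vs Es (\<gamma> (\<tau> i)) (\<gamma> (\<tau> (Suc i))) + 2"
      unfolding v_def by (intro D_le_dist G(3) t)
    also have "graph_dist Vs Es (\<gamma> (\<tau> i)) (\<gamma> (\<tau> (Suc i))) \<le> 1" unfolding G(4)[OF t t] by (auto simp: \<tau>_def)
    finally show ?thesis by linarith
  qed
  moreover have "j \<le> i + D (v i) (v j) + 3" if ij: "i \<le> j" "j \<le> n" for i j
  proof -
    have "real j - real i - 1 \<le> \<bar>\<tau> i - \<tau> j\<bar>" using ij n by (auto simp: \<tau>_def)
    also have "\<dots> \<le> D (v i) (v j) + 2" unfolding G(4)[OF t t, symmetric] v_def by (intro dist_le_D G(3) t)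
    finally show ?thesis by linarith
  qed
  moreover have "\<exists>i\<le>n. graph_dist Vs Es (\<gamma> s) (vert (v i)) \<le> 2" if s: "s \<in> {0..?d}" for s
  proof -
    define k where "k = nat \<lfloor>s\<rfloor>"
    have i: "real k \<le> s" "s < real k + 1" using s by (auto simp: k_def)
    have "graph_dist Vs Es (\<gamma> s) (vert (v k)) \<le>
        graph_dist Vs Es (\<gamma> s) (\<gamma> (\<tau> k)) + graph_dist Vs Es (\<gamma> (\<tau> k)) (vert (v k))"
      unfolding v_def by (intro M.triangle G(3) t s vert_point vx_Vs)
    moreover have "graph_dist Vs Es (\<gamma> s) (\<gamma> (\<tau> k)) \<le> 1" unfolding G(4)[OF s t] using i s by (auto simp: \<tau>_def)
    moreover have "graph_dist Vs Es (\<gamma> (\<tau> k)) (vert (v k)) \<le> 1" unfolding v_def by (intro vx_near G(3) t)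
    moreover have "k \<le> n" using i s n by simp
    ultimately show ?thesis by (intro exI[of _ k]) auto
  qed
  moreover have "v 0 = vx x" "v n = vx y" using G n d by (auto simp: v_def \<tau>_def min_def)
  moreover have "\<exists>s\<in>{0..?d}. v i = vx (\<gamma> s)" for i using t v_def by blast
  ultimately show ?thesis by (intro exI[of _ n] exI[of _ v]) blast
qed

end

section \<open>Isometries induced by bijections of vertices\<close>

lemma supp_push:
  assumes "\<And>x. x \<in> X1 \<Longrightarrow> f x \<in> Y \<and> g (f x) = x" "\<And>y. y \<in> Y \<Longrightarrow> g y \<in> X1 \<and> f (g y) = y" "supp p \<subseteq> X1"
  shows "supp (push Y g p) = f ` supp p"
proof
  show "supp (push Y g p) \<subseteq> f ` supp p"
  proof
    fix y assume "y \<in> supp (push Y g p)"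
    then have "y \<in> Y" "g y \<in> supp p" by (auto simp: supp_def push_def split: if_splits)
    then show "y \<in> f ` supp p" using assms(2) by (metis image_eqI)
  qed
  show "f ` supp p \<subseteq> supp (push Y g p)"
    using assms by (auto simp: supp_def push_def subset_iff)
qed

lemma push_graph_path:
  assumes f: "\<And>x. x \<in> X1 \<Longrightarrow> f x \<in> Y \<and> g (f x) = x" and g: "\<And>y. y \<in> Y \<Longrightarrow> g y \<in> X1 \<and> f (g y) = y"
    and E: "\<And>e. e \<in> Es \<Longrightarrow> e \<subseteq> X1 \<and> f ` e \<in> Fs"
  shows "p \<in> graph_points X1 Es \<Longrightarrow> push Y g p \<in> graph_points Y Fs"
    and "graph_path X1 Es l p q \<Longrightarrow> graph_path Y Fs l (push Y g p) (push Y g q)"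
proof -
  have sub: "supp p \<subseteq> X1" if "p \<in> graph_points X1 Es" for p
    using that E by (auto simp: graph_points_def)
  have pt: "push Y g p \<in> graph_points Y Fs" if p: "p \<in> graph_points X1 Es" for p
  proof -
    have s: "supp (push Y g p) = f ` supp p" by (rule supp_push[of X1 f Y g p, OF f g sub[OF p]])
    have inj: "inj_on f (supp p)" using f sub[OF p] by (metis inj_on_def subsetD)
    have "(\<Sum>x\<in>supp (push Y g p). push Y g p x) = (\<Sum>x\<in>f ` supp p. push Y g p x)"
      by (simp only: s)
    also have "\<dots> = (\<Sum>x\<in>supp p. push Y g p (f x))"
      by (simp add: sum.reindex[OF inj])
    also have "\<dots> = (\<Sum>x\<in>supp p. p x)"
      by (rule sum.cong) (use f sub[OF p] in \<open>auto simp: push_def\<close>)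
    finally have "(\<Sum>x\<in>supp (push Y g p). push Y g p x) = 1" using p by (simp add: graph_points_def)
    moreover have "(\<exists>v\<in>Y. supp (push Y g p) = {v}) \<or> supp (push Y g p) \<in> Fs"
      unfolding s using p f E by (auto simp: graph_points_def)
    ultimately show ?thesis using p by (auto simp: graph_points_def push_def)
  qed
  then show "p \<in> graph_points X1 Es \<Longrightarrow> push Y g p \<in> graph_points Y Fs" .
  show "graph_path X1 Es l p q \<Longrightarrow> graph_path Y Fs l (push Y g p) (push Y g q)"
  proof (induction rule: graph_path.induct)
    case (nil p) then show ?case by (intro graph_path.nil pt)
  next
    case (step l p q r u v)
    have q: "q \<in> graph_points X1 Es" using graph_path_points[OF step(1)] by blast
    have uv: "u \<in> X1" "{f u, f v} \<in> Fs" using E[OF step(3)] by auto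
    have s: "supp (push Y g q) \<union> supp (push Y g r) \<subseteq> {f u, f v}"
      using supp_push[OF f g sub[OF q]] supp_push[OF f g sub[OF step(2)]] step(4) by auto
    have "graph_path Y Fs (l + \<bar>push Y g q (f u) - push Y g r (f u)\<bar>) (push Y g p) (push Y g r)"
      by (rule graph_path.step[OF step.IH pt[OF step(2)] uv(2) s])
    then show ?case using f uv by (simp add: push_def)
  qed
qed

lemma push_push:
  assumes "\<And>x. x \<in> X1 \<Longrightarrow> f x \<in> Y \<and> g (f x) = x" "supp p \<subseteq> X1"
  shows "push X1 f (push Y g p) = p"
  using assms by (auto simp: push_def supp_def fun_eq_iff)

text \<open>Edges are the pairs at \<open>D\<close>-distance 1, so a bijection preserving
  \<open>D\<close> maps edges to edges, and paths to paths of the same length.\<close>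

lemma isometry_push:
  assumes G1: "metric_graph X1 Es D1" and G2: "metric_graph Y Fs D2"
    and f: "\<And>x. x \<in> X1 \<Longrightarrow> f x \<in> Y \<and> g (f x) = x" and g: "\<And>y. y \<in> Y \<Longrightarrow> g y \<in> X1 \<and> f (g y) = y"
    and D: "\<And>u v. u \<in> X1 \<Longrightarrow> v \<in> X1 \<Longrightarrow> D2 (f u) (f v) = D1 u v"
  shows "isometry (graph_metric X1 Es) (graph_metric Y Fs) (push Y g)"
proof -
  interpret A: metric_graph X1 Es D1 by fact
  interpret B: metric_graph Y Fs D2 by fact
  have E: "e \<subseteq> X1 \<and> f ` e \<in> Fs" if e: "e \<in> Es" for e
  proof -
    obtain u v where uv: "u \<in> X1" "v \<in> X1" "e = {u, v}" using A.edges[OF e] by blast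
    then show ?thesis using A.edge_iff[of u v] B.edge_iff[of "f u" "f v"] f D e by auto
  qed
  have F: "e \<subseteq> Y \<and> g ` e \<in> Es" if e: "e \<in> Fs" for e
  proof -
    obtain u v where uv: "u \<in> Y" "v \<in> Y" "e = {u, v}" using B.edges[OF e] by blast
    then show ?thesis using B.edge_iff[of u v] A.edge_iff[of "g u" "g v"] g D[of "g u" "g v"] e by auto
  qed
  note PF = push_graph_path[OF f g E]
  note PG = push_graph_path[OF g f F]
  have inv1: "push X1 f (push Y g p) = p" if "p \<in> A.Pt" for p
    using push_push[of X1 f Y g p] f A.supp_point[OF that] by blast
  have inv2: "push Y g (push X1 f p) = p" if "p \<in> B.Pt" for p
    using push_push[of Y g X1 f p] g B.supp_point[OF that] by blast
  have "push Y g ` A.Pt = B.Pt"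
    using PF(1) PG(1) inv2 by (metis image_subsetI imageI subset_antisym subsetI)
  moreover have "graph_dist Y Fs (push Y g p) (push Y g q) = graph_dist X1 Es p q" if "p \<in> A.Pt" "q \<in> A.Pt" for p q
  proof -
    have "graph_path Y Fs l (push Y g p) (push Y g q) \<longleftrightarrow> graph_path X1 Es l p q" for l
      using PF(2)[where l = l and p = p and q = q] inv1 that
        PG(2)[where l = l and p = "push Y g p" and q = "push Y g q"] by auto
    then show ?thesis using PF(1) that by (simp add: graph_dist_def)
  qed
  ultimately show ?thesis unfolding isometry_def A.mspace_graph B.mspace_graph A.mdist_graph B.mdist_graph by blast
qed


section \<open>Cayley graphs\<close>

definition cayley_gens :: "('g, 'm) monoid_scheme \<Rightarrow> 'g set \<Rightarrow> 'g set" where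
  "cayley_gens G T = insert \<one>\<^bsub>G\<^esub> (T \<union> (\<lambda>x. inv\<^bsub>G\<^esub> x) ` T)"

definition cayley_len :: "('g, 'm) monoid_scheme \<Rightarrow> 'g set \<Rightarrow> 'g \<Rightarrow> nat" where
  "cayley_len G T x = wlen G (cayley_gens G T) x"

lemma metric_graph_cong:
  assumes "metric_graph Vs Es D" "\<And>u v. u \<in> Vs \<Longrightarrow> v \<in> Vs \<Longrightarrow> D u v = D' u v"
  shows "metric_graph Vs Es D'"
proof -
  interpret metric_graph Vs Es D by fact
  show ?thesis
  proof
    show "D' u v \<le> D' u w + 1" if "u \<in> Vs" "{w, v} \<in> Es" for u v w
      using D_edge[OF that] edge_ends[OF that(2)] assms(2) that(1) by metis
    show "\<exists>w\<in>Vs. D' u w = n \<and> {w, v} \<in> Es" if "u \<in> Vs" "v \<in> Vs" "D' u v = Suc n" for u v n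
      using D_Suc[OF that(1,2), of n] assms(2) that by metis
  qed (use edges assms(2) D_refl D_zero in auto)
qed

context group
begin

text \<open>\<open>prods\<close> splits off factors on the left, while edges of a Cayley graph
  append them on the right; inversion exchanges the two sides.\<close>

lemma prods_snoc:
  assumes S: "symset G S" and x: "x \<in> prods G S (Suc n)"
  shows "\<exists>y\<in>prods G S n. \<exists>t\<in>S. x = y \<otimes> t"
proof -
  obtain t y where t: "t \<in> S" "y \<in> prods G S n" "inv x = t \<otimes> y"
    using prods_inv[OF S x] by auto
  have c: "t \<in> carrier G" "y \<in> carrier G" "x \<in> carrier G"
    using t prods_closed[OF S] x symset_closed[OF S] by blast+
  have "x = inv y \<otimes> inv t" using t(3) c by (metis inv_inv inv_mult_group)
  moreover have "inv t \<in> S" using S t by (simp add: symset_def)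
  ultimately show ?thesis using prods_inv[OF S t(2)] by blast
qed

lemma cayley_total:
  assumes "generates G T"
  shows "total_gen (cayley_gens G T) (carrier G)"
  using total_gen_generate[of T] assms by (simp add: generates_def cayley_gens_def)

lemma metric_graph_cayley:
  assumes T: "generates G T"
  shows "metric_graph (carrier G) (cayley_edges G T) (\<lambda>u v. cayley_len G T (inv u \<otimes> v))"
proof
  let ?S = "cayley_gens G T"
  note tot = cayley_total[OF T]
  have S: "symset G ?S" using tot by (simp add: total_gen_def)
  have TG: "T \<subseteq> carrier G" using T by (simp add: generates_def)
  note le = wlen_le_iff[OF tot, folded cayley_len_def]
  show "\<exists>u\<in>carrier G. \<exists>v\<in>carrier G. u \<noteq> v \<and> e = {u, v}" if e: "e \<in> cayley_edges G T" for e
  proof -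
    obtain g t where g: "e = {g, g \<otimes> t}" "g \<in> carrier G" "t \<in> T" "t \<noteq> \<one>"
      using e by (auto simp: cayley_edges_def)
    have tc: "t \<in> carrier G" using g TG by blast
    have "inv g \<otimes> (g \<otimes> t) = t" "inv g \<otimes> g = \<one>" using g tc by simp_all
    then have "g \<noteq> g \<otimes> t" using g(4) by metis
    then show ?thesis using g tc by (intro bexI[of _ g] bexI[of _ "g \<otimes> t"]) auto
  qed
  show "cayley_len G T (inv u \<otimes> u) = 0" if "u \<in> carrier G" for u
    using that by (simp add: cayley_len_def)
  show "u = v" if "u \<in> carrier G" "v \<in> carrier G" "cayley_len G T (inv u \<otimes> v) = 0" for u v
    using le[of "inv u \<otimes> v" 0] that by simp (metis inv_cancel(2) r_one)
  show "cayley_len G T (inv u \<otimes> v) \<le> cayley_len G T (inv u \<otimes> w) + 1"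
    if u: "u \<in> carrier G" and e: "{w, v} \<in> cayley_edges G T" for u v w
  proof -
    obtain g t where g: "{w, v} = {g, g \<otimes> t}" "g \<in> carrier G" "t \<in> T"
      using e by (auto simp: cayley_edges_def)
    have t: "t \<in> carrier G" using g TG by blast
    have "w = g \<and> v = g \<otimes> t \<or> w = g \<otimes> t \<and> v = g" using g by (simp add: doubleton_eq_iff)
    then have "w \<in> carrier G" "v \<in> carrier G" "inv w \<otimes> v \<in> ?S"
      using g t by (auto simp: cayley_gens_def inv_mult_group m_assoc)
    then have "cayley_len G T (inv w \<otimes> v) \<le> 1" using prods_single[OF S] le by simp
    moreover have "inv u \<otimes> v = (inv u \<otimes> w) \<otimes> (inv w \<otimes> v)"
      using u \<open>w \<in> carrier G\<close> \<open>v \<in> carrier G\<close> by (simp add: m_assoc)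
    ultimately show ?thesis
      using wlen_mult[OF tot, of "inv u \<otimes> w" "inv w \<otimes> v"] u \<open>w \<in> carrier G\<close> \<open>v \<in> carrier G\<close>
      by (simp add: cayley_len_def)
  qed
  show "\<exists>w\<in>carrier G. cayley_len G T (inv u \<otimes> w) = n \<and> {w, v} \<in> cayley_edges G T"
    if uv: "u \<in> carrier G" "v \<in> carrier G" "cayley_len G T (inv u \<otimes> v) = Suc n" for u v n
  proof -
    have c: "inv u \<otimes> v \<in> carrier G" using uv by simp
    have "inv u \<otimes> v \<in> prods G ?S (Suc n)" using le[OF c, of "Suc n"] uv by simp
    then obtain y t where yt: "y \<in> prods G ?S n" "t \<in> ?S" "inv u \<otimes> v = y \<otimes> t" using prods_snoc[OF S] by blast
    have yc: "y \<in> carrier G" and tc: "t \<in> carrier G" using yt prods_closed[OF S] symset_closed[OF S] by blast+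
    let ?w = "u \<otimes> y"
    have uw: "inv u \<otimes> ?w = y" using uv yc by simp
    have ln: "cayley_len G T y \<le> n" using le[OF yc] yt by simp
    have "cayley_len G T t \<le> 1" using prods_single[OF S yt(2)] le[OF tc] by simp
    then have "Suc n \<le> cayley_len G T y + 1"
      using wlen_mult[OF tot yc tc] uv(3) yt(3) by (simp add: cayley_len_def)
    then have l: "cayley_len G T y = n" using ln by simp
    have "t \<noteq> \<one>" using l uv(3) yt(3) yc by auto
    have v: "v = ?w \<otimes> t" using yt(3) uv yc tc by (metis inv_cancel(2) m_assoc)
    have "{?w, v} \<in> cayley_edges G T"
    proof (cases "t \<in> T")
      case True
      then show ?thesis using v \<open>t \<noteq> \<one>\<close> uv yc unfolding cayley_edges_def by auto
    next
      case False
      \<comment> \<open>The last letter is the inverse of a generator, so the edge is labelled when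
        read from \<open>v\<close> to \<open>?w\<close>.\<close>
      then obtain r where r: "r \<in> T" "t = inv r" using yt(2) \<open>t \<noteq> \<one>\<close> by (auto simp: cayley_gens_def)
      have rc: "r \<in> carrier G" using r TG by blast
      have "?w = v \<otimes> r" using v r rc uv yc by (simp add: m_assoc)
      moreover have "r \<noteq> \<one>" using \<open>t \<noteq> \<one>\<close> r by auto
      ultimately have "\<exists>g t. {?w, v} = {g, g \<otimes> t} \<and> g \<in> carrier G \<and> t \<in> T \<and> t \<noteq> \<one>"
        using r uv by (intro exI[of _ v] exI[of _ r]) (simp add: insert_commute)
      then show ?thesis by (simp add: cayley_edges_def)
    qed
    then show ?thesis using uw l uv yc by (intro bexI[of _ ?w]) auto
  qed
qed

lemma isometry_translate:
  assumes T: "generates G T" and a: "a \<in> carrier G"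
  shows "isometry (cayley_graph G T) (cayley_graph G T) (cayley_translate G a)"
proof -
  have "cayley_translate G a = push (carrier G) (\<lambda>x. inv a \<otimes> x)"
    by (auto simp: cayley_translate_def push_def fun_eq_iff)
  moreover have "inv (a \<otimes> u) \<otimes> (a \<otimes> v) = inv u \<otimes> v" if "u \<in> carrier G" "v \<in> carrier G" for u v
    using that a by (simp add: inv_mult_group m_assoc)
  ultimately show ?thesis
    unfolding cayley_graph_def using a
    by (simp only:, intro isometry_push[OF metric_graph_cayley[OF T] metric_graph_cayley[OF T], where f = "\<lambda>x. a \<otimes> x"])
      (auto simp: m_assoc)
qed

lemma supp_translate:
  assumes a: "a \<in> carrier G" and p: "supp p \<subseteq> carrier G"
  shows "supp (cayley_translate G a p) = (\<lambda>x. a \<otimes> x) ` supp p"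
proof -
  have "cayley_translate G a p = push (carrier G) (\<lambda>x. inv a \<otimes> x) p"
    by (auto simp: cayley_translate_def push_def fun_eq_iff)
  then show ?thesis
    using supp_push[of "carrier G" "\<lambda>x. a \<otimes> x" "carrier G" "\<lambda>x. inv a \<otimes> x" p] a p by (simp add: m_assoc)
qed

lemma translate_vert:
  assumes a: "a \<in> carrier G" and x: "x \<in> carrier G"
  shows "cayley_translate G a (vert x) = vert (a \<otimes> x)"
proof
  fix y
  show "cayley_translate G a (vert x) y = vert (a \<otimes> x) y"
  proof (cases "y \<in> carrier G")
    case True
    have "inv a \<otimes> y = x \<longleftrightarrow> y = a \<otimes> x" using a x True by (metis inv_cancel)
    then show ?thesis using True by (auto simp: cayley_translate_def vert_def)
  next
    case False
    then have "y \<noteq> a \<otimes> x" using a x by auto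
    then show ?thesis using False by (simp add: cayley_translate_def)
  qed
qed

end

text \<open>An isomorphism that carries generators to generators preserves word lengths. This leads
  from \<open>par {v}\<close> back to the given vertex group.\<close>

lemma isometric_iso:
  assumes H: "group H" and K: "group K" and TH: "generates H T" and TK: "generates K (f ` T)"
    and f: "f \<in> hom H K" "bij_betw f (carrier H) (carrier K)"
  shows "isometric (cayley_graph H T) (cayley_graph K (f ` T))"
proof -
  interpret H: group H by fact
  interpret K: group K by fact
  interpret f: group_hom H K f by (simp add: group_hom_def group_hom_axioms_def H K f)
  have T: "T \<subseteq> carrier H" using TH by (simp add: generates_def)
  let ?S = "cayley_gens H T"
  have tH: "H.total_gen ?S (carrier H)" using H.cayley_total[OF TH] .
  have tK: "K.total_gen (cayley_gens K (f ` T)) (carrier K)" using K.cayley_total[OF TK] .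
  have SH: "symset H ?S" using tH by (simp add: H.total_gen_def)
  have inj: "inj_on f (carrier H)" and im: "f ` carrier H = carrier K" using f(2) by (auto simp: bij_betw_def)
  have "(\<lambda>x. inv\<^bsub>K\<^esub> x) ` (f ` T) = f ` ((\<lambda>x. inv\<^bsub>H\<^esub> x) ` T)"
    unfolding image_image
  proof (rule image_cong[OF HOL.refl])
    show "inv\<^bsub>K\<^esub> f x = f (inv\<^bsub>H\<^esub> x)" if "x \<in> T" for x
      by (rule f.hom_inv[OF subsetD[OF T that], symmetric])
  qed
  then have S: "cayley_gens K (f ` T) = f ` ?S"
    by (simp only: cayley_gens_def image_Un image_insert f.hom_one)
  have SS: "?S \<subseteq> carrier H" using SH by (simp add: symset_def)
  have "prods K (f ` ?S) n = f ` prods H ?S n" for n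
  proof (induction n)
    case (Suc n)
    have hm: "f (t \<otimes>\<^bsub>H\<^esub> x) = f t \<otimes>\<^bsub>K\<^esub> f x" if "t \<in> ?S" "x \<in> prods H ?S n" for t x
      by (rule f.hom_mult[OF subsetD[OF SS that(1)] H.prods_closed[OF SH that(2)]])
    show ?case
    proof (intro Set.set_eqI iffI)
      fix y assume "y \<in> prods K (f ` ?S) (Suc n)"
      then obtain r z where rz: "r \<in> f ` ?S" "z \<in> f ` prods H ?S n" "y = r \<otimes>\<^bsub>K\<^esub> z"
        unfolding prods.simps Suc by blast
      then obtain t x where tx: "t \<in> ?S" "r = f t" "x \<in> prods H ?S n" "z = f x" by blast
      then have "y = f (t \<otimes>\<^bsub>H\<^esub> x)" using rz(3) hm[OF tx(1,3)] by simp
      moreover have "t \<otimes>\<^bsub>H\<^esub> x \<in> prods H ?S (Suc n)" unfolding prods.simps using tx by blast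
      ultimately show "y \<in> f ` prods H ?S (Suc n)" by blast
    next
      fix y assume "y \<in> f ` prods H ?S (Suc n)"
      then obtain t x where tx: "t \<in> ?S" "x \<in> prods H ?S n" "y = f (t \<otimes>\<^bsub>H\<^esub> x)"
        unfolding prods.simps by blast
      then have "f t \<in> f ` ?S" "f x \<in> prods K (f ` ?S) n" unfolding Suc by blast+
      then show "y \<in> prods K (f ` ?S) (Suc n)" unfolding tx(3) hm[OF tx(1,2)] prods.simps by blast
    qed
  qed simp
  then have "f x \<in> prods K (f ` ?S) n \<longleftrightarrow> x \<in> prods H ?S n" if "x \<in> carrier H" for x n
    using inj_on_image_mem_iff[OF inj that, of "prods H ?S n"] H.prods_closed[OF SH] by auto
  then have len: "cayley_len K (f ` T) (f x) = cayley_len H T x" if "x \<in> carrier H" for x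
    using that by (simp add: cayley_len_def wlen_def S)
  have "isometry (cayley_graph H T) (cayley_graph K (f ` T)) (push (carrier K) (inv_into (carrier H) f))"
    unfolding cayley_graph_def
  proof (rule isometry_push[OF H.metric_graph_cayley[OF TH] K.metric_graph_cayley[OF TK], where f = f])
    show "f x \<in> carrier K \<and> inv_into (carrier H) f (f x) = x" if "x \<in> carrier H" for x
      using that inj im by auto
    show "inv_into (carrier H) f y \<in> carrier H \<and> f (inv_into (carrier H) f y) = y" if "y \<in> carrier K" for y
      using that im by (auto simp: f_inv_into_f inv_into_into)
    show "cayley_len K (f ` T) (inv\<^bsub>K\<^esub> f u \<otimes>\<^bsub>K\<^esub> f v) = cayley_len H T (inv\<^bsub>H\<^esub> u \<otimes>\<^bsub>H\<^esub> v)"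
      if "u \<in> carrier H" "v \<in> carrier H" for u v
      using len[of "inv\<^bsub>H\<^esub> u \<otimes>\<^bsub>H\<^esub> v"] that by simp
  qed
  then show ?thesis unfolding isometric_def by blast
qed

context generated_graph_group
begin

abbreviation sub :: "'v set \<Rightarrow> ('a, 'b) monoid_scheme" where
  "sub \<Lambda> \<equiv> P\<lparr>carrier := par \<Lambda>\<rparr>"

definition CM :: "'v set \<Rightarrow> ('a \<Rightarrow> real) metric" where
  "CM \<Lambda> = cayley_graph (sub \<Lambda>) (gen \<Lambda>)"

lemma group_sub: "group (sub \<Lambda>)"
  by (rule subgroup.subgroup_is_group[OF par_subgroup is_group])

lemma inv_sub: "x \<in> par \<Lambda> \<Longrightarrow> inv\<^bsub>sub \<Lambda>\<^esub> x = inv x"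
  using m_inv_consistent[OF par_subgroup] by simp

lemma generates_sub: "\<Lambda> \<noteq> {} \<Longrightarrow> generates (sub \<Lambda>) (gen \<Lambda>)"
  using generate_consistent[OF gen_par par_subgroup] generate_gen gen_par by (simp add: generates_def)

lemma cayley_len_sub: "cayley_len (sub \<Lambda>) (gen \<Lambda>) x = len \<Lambda> x"
proof -
  have "cayley_gens (sub \<Lambda>) (gen \<Lambda>) = sgen \<Lambda>"
    using inv_sub gen_par[of \<Lambda>] by (auto simp: cayley_gens_def sgen_def subset_iff image_iff)
  then show ?thesis by (simp add: cayley_len_def len_def)
qed

lemma metric_graph_sub:
  assumes "\<Lambda> \<noteq> {}"
  shows "metric_graph (par \<Lambda>) (cayley_edges (sub \<Lambda>) (gen \<Lambda>)) (\<lambda>u v. len \<Lambda> (inv u \<otimes> v))"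
proof -
  have "metric_graph (par \<Lambda>) (cayley_edges (sub \<Lambda>) (gen \<Lambda>)) (\<lambda>u v. cayley_len (sub \<Lambda>) (gen \<Lambda>) (inv\<^bsub>sub \<Lambda>\<^esub> u \<otimes> v))"
    using group.metric_graph_cayley[OF group_sub generates_sub[OF assms]] by simp
  then show ?thesis by (rule metric_graph_cong) (simp add: cayley_len_sub inv_sub)
qed

lemma generates_all: "generates P all_gens"
proof -
  have "A v \<subseteq> generate P all_gens" for v
  proof (cases "v \<in> V")
    case True
    then have "T v \<subseteq> all_gens" by (auto simp: all_gens_def)
    then show ?thesis using mono_generate generate_T by metis
  next
    case False
    then show ?thesis using A_outside generate.one by auto
  qed
  then have "generate P (\<Union>v. A v) \<subseteq> generate P all_gens"
    by (intro generate_subgroup_incl generate_is_subgroup all_gens_closed) blast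
  then show ?thesis
    using generate_A all_gens_closed generate_in_carrier[OF all_gens_closed] by (auto simp: generates_def)
qed

lemma sall_eq: "cayley_gens P all_gens = sall"
  by (simp add: cayley_gens_def sall_def)

text \<open>The other two sides, sampled and joined, form a discrete path between the ends of the
  first side, and \<open>hyperbolic_alg\<close> applies. To its 333, sampling and rounding add 2 on
  the first side and 1 on the others.\<close>

lemma hyperbolic_CM:
  assumes L: "\<not> is_singleton \<Lambda>" "\<Lambda> \<noteq> {}" and r: "336 \<le> r"
  shows "hyperbolic r (CM \<Lambda>)"
proof -
  let ?Es = "cayley_edges (sub \<Lambda>) (gen \<Lambda>)"
  interpret C: metric_graph "par \<Lambda>" ?Es "\<lambda>u v. len \<Lambda> (inv u \<otimes> v)" by (rule metric_graph_sub[OF L(2)])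
  have CM: "CM \<Lambda> = graph_metric (par \<Lambda>) ?Es" by (simp add: CM_def cayley_graph_def)
  let ?d = "graph_dist (par \<Lambda>) ?Es"
  show ?thesis
    unfolding hyperbolic_def CM C.mspace_graph C.mdist_graph
  proof (intro ballI allI impI subsetI)
    fix x y z \<alpha> \<beta> \<gamma> a
    assume x: "x \<in> C.Pt" and y: "y \<in> C.Pt" and z: "z \<in> C.Pt"
      and g: "geodesic (graph_metric (par \<Lambda>) ?Es) x y \<alpha>" "geodesic (graph_metric (par \<Lambda>) ?Es) y z \<beta>"
        "geodesic (graph_metric (par \<Lambda>) ?Es) x z \<gamma>"
      and a: "a \<in> \<alpha> ` {0..?d x y}"
    have pts: "\<And>t. t \<in> {0..?d x y} \<Longrightarrow> \<alpha> t \<in> C.Pt" "\<And>t. t \<in> {0..?d y z} \<Longrightarrow> \<beta> t \<in> C.Pt" "\<And>t. t \<in> {0..?d x z} \<Longrightarrow> \<gamma> t \<in> C.Pt"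
      using g unfolding geodesic_def C.mdist_graph C.mspace_graph by auto
    obtain n p where p: "p 0 = C.vx x" "p n = C.vx y" "\<And>i. i < n \<Longrightarrow> len \<Lambda> (inv (p i) \<otimes> p (Suc i)) \<le> 3"
      "\<And>i j. i \<le> j \<Longrightarrow> j \<le> n \<Longrightarrow> j \<le> i + len \<Lambda> (inv (p i) \<otimes> p j) + 3"
      "\<And>i. i \<le> n \<Longrightarrow> \<exists>t\<in>{0..?d x y}. p i = C.vx (\<alpha> t)"
      "\<And>t. t \<in> {0..?d x y} \<Longrightarrow> \<exists>i\<le>n. ?d (\<alpha> t) (vert (p i)) \<le> 2"
      using C.geodesic_sample[OF g(1) x y] by blast
    obtain m q where q: "q 0 = C.vx y" "q m = C.vx z" "\<And>i. i < m \<Longrightarrow> len \<Lambda> (inv (q i) \<otimes> q (Suc i)) \<le> 3"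
      "\<And>i. i \<le> m \<Longrightarrow> \<exists>t\<in>{0..?d y z}. q i = C.vx (\<beta> t)"
      using C.geodesic_sample[OF g(2) y z] by blast
    obtain k w where w: "w 0 = C.vx x" "w k = C.vx z" "\<And>i. i < k \<Longrightarrow> len \<Lambda> (inv (w i) \<otimes> w (Suc i)) \<le> 3"
      "\<And>i. i \<le> k \<Longrightarrow> \<exists>t\<in>{0..?d x z}. w i = C.vx (\<gamma> t)"
      using C.geodesic_sample[OF g(3) x z] by blast
    let ?B = "\<beta> ` {0..?d y z} \<union> \<gamma> ` {0..?d x z}"
    \<comment> \<open>From \<open>x\<close> to \<open>z\<close> along one side, and back from
      \<open>z\<close> to \<open>y\<close> along the other; both samples pass through the rounded
      \<open>z\<close>, which has index \<open>k\<close> in \<open>f\<close>.\<close>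
    define f where "f i = (if i \<le> k then w i else q (m - (i - k)))" for i
    have pp: "p i \<in> par \<Lambda>" if "i \<le> n" for i using p(5)[OF that] pts(1) C.vx_Vs by auto
    have qp: "q i \<in> par \<Lambda>" if "i \<le> m" for i using q(4)[OF that] pts(2) C.vx_Vs by auto
    have wp: "w i \<in> par \<Lambda>" if "i \<le> k" for i using w(4)[OF that] pts(3) C.vx_Vs by auto
    have fp: "f i \<in> par \<Lambda>" for i using wp qp by (simp add: f_def)
    have fB: "\<exists>b\<in>?B. b \<in> C.Pt \<and> f i = C.vx b" for i
    proof (cases "i \<le> k")
      case True
      then obtain t where "t \<in> {0..?d x z}" "w i = C.vx (\<gamma> t)" using w(4) by blast
      then show ?thesis using True pts(3) by (intro bexI[of _ "\<gamma> t"]) (auto simp: f_def)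
    next
      case False
      obtain t where "t \<in> {0..?d y z}" "q (m - (i - k)) = C.vx (\<beta> t)" using q(4)[of "m - (i - k)"] by auto
      then show ?thesis using False pts(2) by (intro bexI[of _ "\<beta> t"]) (auto simp: f_def)
    qed
    have fstep: "len \<Lambda> (inv (f i) \<otimes> f (Suc i)) \<le> 3" if i: "i < k + m" for i
    proof -
      consider "Suc i \<le> k" | "i = k" | "k < i" by linarith
      then show ?thesis
      proof cases
        case 1 then show ?thesis using w(3)[of i] by (simp add: f_def)
      next
        case 2
        then have e: "f i = q (Suc (m - 1))" "f (Suc i) = q (m - 1)" using i w q by (auto simp: f_def)
        have "len \<Lambda> (inv (q (m - 1)) \<otimes> q (Suc (m - 1))) \<le> 3" using q(3)[of "m - 1"] 2 i by simp
        then show ?thesis unfolding e using len_dist_sym[OF L(2), of "q (m - 1)" "q (Suc (m - 1))"] qp[of "m - 1"] qp[of "Suc (m - 1)"] 2 i by simp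
      next
        case 3
        let ?j = "m - (Suc i - k)"
        have e: "f i = q (Suc ?j)" "f (Suc i) = q ?j" using 3 i by (auto simp: f_def intro!: arg_cong[where f = q])
        have "len \<Lambda> (inv (q ?j) \<otimes> q (Suc ?j)) \<le> 3" using q(3)[of ?j] 3 i by simp
        moreover have "q ?j \<in> par \<Lambda>" "q (Suc ?j) \<in> par \<Lambda>" using qp[of ?j] qp[of "Suc ?j"] 3 i by auto
        ultimately show ?thesis unfolding e using len_dist_sym[OF L(2), of "q ?j" "q (Suc ?j)"] by simp
      qed
    qed
    obtain t where t: "t \<in> {0..?d x y}" "a = \<alpha> t" using a by blast
    obtain i where i: "i \<le> n" "?d a (vert (p i)) \<le> 2" using p(6)[OF t(1)] t(2) by blast
    have ends: "f 0 = p 0" "f (k + m) = p n" using p w q by (auto simp: f_def)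
    obtain j where j: "len \<Lambda> (inv (p i) \<otimes> f j) \<le> 333"
      using hyperbolic_alg[OF L pp p(3) p(4) fp fstep ends i(1)] by blast
    obtain b where b: "b \<in> ?B" "b \<in> C.Pt" "f j = C.vx b" using fB by blast
    have aP: "a \<in> C.Pt" using pts(1) t by blast
    note P = C.vert_point[OF pp[OF i(1)]] C.vert_point[OF fp[of j]]
    have "?d a b \<le> ?d a (vert (p i)) + ?d (vert (p i)) b" by (rule C.M.triangle[OF aP P(1) b(2)])
    moreover have "?d (vert (p i)) b \<le> ?d (vert (p i)) (vert (f j)) + ?d (vert (f j)) b"
      by (rule C.M.triangle[OF P b(2)])
    moreover have "?d (vert (f j)) b \<le> 1" using C.vx_near[OF b(2)] b(3) by (simp add: C.M.commute)
    moreover have "?d (vert (p i)) (vert (f j)) \<le> 333" using C.graph_dist_vert[OF pp[OF i(1)] fp[of j]] j by simp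
    ultimately have "?d a b \<le> r" using i(2) r by linarith
    then show "a \<in> nbhd (graph_metric (par \<Lambda>) ?Es) r ?B"
      using b(1) aP unfolding nbhd_def C.mspace_graph C.mdist_graph by blast
  qed
qed

end


section \<open>Heads of elements of a graph product\<close>

locale graph_of_groups =
  fixes V :: "'v set" and E :: "'v set set" and G :: "'v \<Rightarrow> ('a, 'b) monoid_scheme"
  assumes graph: "finite_simplicial_graph V E"
    and groups: "\<And>v. v \<in> V \<Longrightarrow> group (G v)"
begin

definition adj :: "'v \<Rightarrow> 'v \<Rightarrow> bool" where
  "adj v w \<longleftrightarrow> {v, w} \<in> E"

lemma adj_props: "adj v w \<Longrightarrow> v \<in> V \<and> w \<in> V \<and> v \<noteq> w" "adj v w \<longleftrightarrow> adj w v"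
proof -
  show "adj v w \<Longrightarrow> v \<in> V \<and> w \<in> V \<and> v \<noteq> w"
    using graph unfolding finite_simplicial_graph_def adj_def by (cases "v = w") fastforce+
qed (simp add: adj_def insert_commute)

lemma adj_neq: "adj v w \<Longrightarrow> v \<noteq> w" "adj v w \<Longrightarrow> w \<noteq> v"
  using adj_props by blast+

text \<open>Looks for a letter of type \<open>v\<close> that can be shuffled to the front, and gives
  up at the first letter not adjacent to \<open>v\<close>; the default \<open>\<one>\<close> means
  that there is none.\<close>

fun find :: "'v \<Rightarrow> ('v \<times> 'a) list \<Rightarrow> 'a" where
  "find v [] = \<one>\<^bsub>G v\<^esub>"
| "find v ((u, a) # w) = (if u = v then a else if adj u v then find v w else \<one>\<^bsub>G v\<^esub>)"

fun rest :: "'v \<Rightarrow> ('v \<times> 'a) list \<Rightarrow> ('v \<times> 'a) list" where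
  "rest v [] = []"
| "rest v ((u, a) # w) = (if u = v then w else if adj u v then (u, a) # rest v w else (u, a) # w)"

text \<open>All letters are non-trivial, so \<open>find u w = \<one>\<close> says that no letter of
  type \<open>u\<close> can be shuffled from \<open>w\<close> up to \<open>a\<close> and merge with
  it.\<close>

fun reduced :: "('v \<times> 'a) list \<Rightarrow> bool" where
  "reduced [] = True"
| "reduced ((u, a) # w) \<longleftrightarrow> u \<in> V \<and> a \<in> carrier (G u) \<and> a \<noteq> \<one>\<^bsub>G u\<^esub> \<and> find u w = \<one>\<^bsub>G u\<^esub> \<and> reduced w"

definition put :: "'v \<Rightarrow> 'a \<Rightarrow> ('v \<times> 'a) list \<Rightarrow> ('v \<times> 'a) list" where
  "put v h w = (if h = \<one>\<^bsub>G v\<^esub> then w else (v, h) # w)"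

text \<open>
  Van der Waerden's trick: the vertex groups act by \<open>mul\<close> on reduced words up to the commutations \<open>tr\<close>.
  The action extends to the graph product, and the head of an element is read off the image of the
  empty word.
\<close>

definition mul :: "'v \<Rightarrow> 'a \<Rightarrow> ('v \<times> 'a) list \<Rightarrow> ('v \<times> 'a) list" where
  "mul v g w = put v (g \<otimes>\<^bsub>G v\<^esub> find v w) (rest v w)"

text \<open>Commuting vertex groups act in commuting ways only up to this equivalence, because
  \<open>mul\<close> places its syllable at the front.\<close>

inductive tr :: "('v \<times> 'a) list \<Rightarrow> ('v \<times> 'a) list \<Rightarrow> bool" where
  tr_refl: "tr w w"
| tr_swap: "adj u v \<Longrightarrow> tr ((u, a) # (v, b) # w) ((v, b) # (u, a) # w)"
| tr_cons: "tr w w' \<Longrightarrow> tr (x # w) (x # w')"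
| tr_trans [trans]: "tr w w' \<Longrightarrow> tr w' w'' \<Longrightarrow> tr w w''"

lemma tr_sym: "tr w w' \<Longrightarrow> tr w' w"
  by (induction rule: tr.induct) (auto intro: tr.intros simp: adj_props(2))

lemma find_tr: "tr w w' \<Longrightarrow> find v w = find v w'"
proof (induction rule: tr.induct)
  case (tr_cons w w' x)
  then show ?case by (cases x) simp
next
  case (tr_swap u w a b l)
  then have "adj w u" "u \<noteq> w" using adj_props by blast+
  with tr_swap show ?case by auto
qed simp_all

lemma rest_tr: "tr w w' \<Longrightarrow> tr (rest v w) (rest v w')"
proof (induction rule: tr.induct)
  case (tr_cons w w' x)
  then show ?case by (cases x) (auto intro: tr.intros)
next
  case (tr_swap u w a b l)
  then have "adj w u" "u \<noteq> w" using adj_props by blast+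
  with tr_swap show ?case by (auto intro: tr.intros)
qed (auto intro: tr.intros)

lemma reduced_tr: "tr w w' \<Longrightarrow> reduced w \<Longrightarrow> reduced w'"
proof (induction rule: tr.induct)
  case (tr_cons w w' x)
  then show ?case using find_tr by (cases x) auto
next
  case (tr_swap u w a b l)
  then have "adj w u" "u \<noteq> w" using adj_props by blast+
  with tr_swap show ?case by auto
qed auto

lemma find_rest:
  assumes "adj u v"
  shows "find u (rest v w) = find u w"
proof -
  have "adj v u" "u \<noteq> v" using assms adj_props by blast+
  with assms show ?thesis by (induction v w rule: rest.induct) auto
qed

lemma find_carrier: "v \<in> V \<Longrightarrow> reduced w \<Longrightarrow> find v w \<in> carrier (G v)"
  using groups by (induction v w rule: find.induct) (auto intro: monoid.one_closed group.is_monoid)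

lemma rest_reduced: "reduced w \<Longrightarrow> reduced (rest v w) \<and> find v (rest v w) = \<one>\<^bsub>G v\<^esub>"
  by (induction v w rule: rest.induct) (auto simp: find_rest)

lemma rest_find_one: "reduced w \<Longrightarrow> find v w = \<one>\<^bsub>G v\<^esub> \<Longrightarrow> rest v w = w"
  by (induction v w rule: rest.induct) (auto split: if_splits)

lemma put_tr: "tr w w' \<Longrightarrow> tr (put v h w) (put v h w')"
  by (auto simp: put_def intro: tr.intros)

text \<open>The letter that is found commutes with every letter skipped by the search.\<close>

lemma tr_put_rest: "reduced w \<Longrightarrow> tr w (put v (find v w) (rest v w))"
proof (induction v w rule: rest.induct)
  case (2 v u a w)
  show ?case
  proof (cases "u = v \<or> \<not> adj u v")
    case True
    then show ?thesis using 2 by (auto simp: put_def intro: tr.intros)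
  next
    case False
    then have "tr ((u, a) # w) ((u, a) # put v (find v w) (rest v w))" using 2 by (intro tr_cons) auto
    also have "tr \<dots> (put v (find v w) ((u, a) # rest v w))"
      using False by (auto simp: put_def intro: tr.intros)
    finally show ?thesis using False by simp
  qed
qed (auto simp: put_def intro: tr.intros)

lemma mul_tr: "tr w w' \<Longrightarrow> tr (mul v g w) (mul v g w')"
  unfolding mul_def using find_tr[of w w' v] by (simp add: put_tr rest_tr)

lemma mul_reduced:
  assumes "v \<in> V" "g \<in> carrier (G v)" "reduced w"
  shows "reduced (mul v g w)"
proof -
  interpret group "G v" using groups assms by blast
  show ?thesis using assms rest_reduced[of w v] find_carrier[of v w] by (auto simp: mul_def put_def)
qed

lemma find_mul:
  assumes "reduced w"
  shows "find v (mul v g w) = g \<otimes>\<^bsub>G v\<^esub> find v w"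
  using rest_reduced[OF assms, of v] by (simp add: mul_def put_def)

lemma find_mul_adj: "adj v u \<Longrightarrow> find u (mul v g w) = find u w"
  using find_rest[of u v w] adj_props(2)[of v u] adj_neq[of v u] by (simp add: mul_def put_def)

lemma find_nonadj: "v \<noteq> u \<Longrightarrow> \<not> adj v u \<Longrightarrow> find v w = \<one>\<^bsub>G v\<^esub> \<or> find u w = \<one>\<^bsub>G u\<^esub>"
  by (induction v w rule: find.induct) (auto simp: adj_props(2)[of u])

lemma mul_one:
  assumes "v \<in> V" "reduced w"
  shows "tr (mul v \<one>\<^bsub>G v\<^esub> w) w"
proof -
  interpret group "G v" using groups assms by blast
  show ?thesis using tr_put_rest[OF assms(2), of v] find_carrier[OF assms] by (auto simp: mul_def intro: tr_sym)
qed

text \<open>An equality, not just up to \<open>tr\<close>: after the inner multiplication the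
  syllable of type \<open>v\<close> stands at the front or has vanished, so the outer one finds it
  there and leaves the same rest.\<close>

lemma mul_mul:
  assumes "v \<in> V" "g \<in> carrier (G v)" "h \<in> carrier (G v)" "reduced w"
  shows "mul v g (mul v h w) = mul v (g \<otimes>\<^bsub>G v\<^esub> h) w"
proof -
  interpret group "G v" using groups assms by blast
  have r: "reduced (rest v w)" "find v (rest v w) = \<one>\<^bsub>G v\<^esub>" using rest_reduced assms by blast+
  have "rest v (mul v h w) = rest v w"
    using rest_find_one[OF r] by (simp add: mul_def put_def)
  then show ?thesis
    using find_mul[OF assms(4), of v h] find_carrier[OF assms(1,4)] assms by (simp add: mul_def m_assoc)
qed

lemma rest_rest:
  assumes "adj u v"
  shows "rest u (rest v w) = rest v (rest u w)"
proof -
  have "adj v u" "u \<noteq> v" using assms adj_props by blast+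
  with assms show ?thesis by (induction v w rule: rest.induct) auto
qed

text \<open>For adjacent types \<open>find\<close> and \<open>rest\<close> do not interfere; both
  sides put the same two syllables before the same word, in opposite orders.\<close>

lemma mul_comm:
  assumes "adj u v"
  shows "tr (mul u a (mul v b w)) (mul v b (mul u a w))"
proof -
  have vu: "adj v u" "u \<noteq> v" using assms adj_props by blast+
  have p: "rest x (put y k r) = put y k (rest x r)" if "adj y x" for x y k r
    using that adj_neq by (auto simp: put_def)
  have 1: "mul u a (mul v b w) = put u (a \<otimes>\<^bsub>G u\<^esub> find u w) (put v (b \<otimes>\<^bsub>G v\<^esub> find v w) (rest u (rest v w)))"
    using find_mul_adj[OF vu(1), of b w] p[OF vu(1)] by (simp add: mul_def[of u] flip: mul_def[of v b w]) (simp add: mul_def p[OF vu(1)])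
  have 2: "mul v b (mul u a w) = put v (b \<otimes>\<^bsub>G v\<^esub> find v w) (put u (a \<otimes>\<^bsub>G u\<^esub> find u w) (rest u (rest v w)))"
    using find_mul_adj[OF assms, of a w] p[OF assms] rest_rest[OF assms] by (simp add: mul_def[of v] flip: mul_def[of u a w]) (simp add: mul_def p[OF assms])
  show ?thesis unfolding 1 2 using assms by (auto simp: put_def intro: tr.intros)
qed

section \<open>The action of the free product and of its quotient on reduced words\<close>

definition wact :: "('v \<times> 'a) list \<Rightarrow> ('v \<times> 'a) list \<Rightarrow> ('v \<times> 'a) list" where
  "wact u l = foldr (\<lambda>(v, g). mul v g) u l"

lemma wact_simps [simp]:
  "wact [] l = l" "wact ((v, g) # u) l = mul v g (wact u l)" "wact (u @ w) l = wact u (wact w l)"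
  by (simp_all add: wact_def)

lemma wact_tr: "tr l l' \<Longrightarrow> tr (wact u l) (wact u l')"
  by (induction u) (auto simp: mul_tr)

lemma wact_reduced: "u \<in> free_words V G \<Longrightarrow> reduced l \<Longrightarrow> reduced (wact u l)"
  by (induction u) (auto simp: mul_reduced)

lemma wact_free_eq: "free_eq V G u w \<Longrightarrow> reduced l \<Longrightarrow> tr (wact u l) (wact w l)"
proof (induction arbitrary: l rule: free_eq.induct)
  case (one u w v)
  then show ?case by (auto intro!: wact_tr mul_one wact_reduced)
next
  case (mult u w v g h)
  then show ?case by (auto simp: mul_mul wact_reduced intro: tr_refl)
qed (auto intro: tr.intros tr_sym)

abbreviation "F \<equiv> free_product V G"
abbreviation "cl u \<equiv> free_rel V G `` {u}"
abbreviation "N \<equiv> normal_closure F (graph_product_relators V E G)"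
abbreviation "Pr \<equiv> graph_product V E G"

lemma F_carrier: "x \<in> carrier F \<longleftrightarrow> (\<exists>u\<in>free_words V G. x = cl u)"
  by (auto simp: free_product_def quotient_def)

lemma F_mult: "u \<in> free_words V G \<Longrightarrow> w \<in> free_words V G \<Longrightarrow> cl u \<otimes>\<^bsub>F\<^esub> cl w = cl (u @ w)"
  using free_product_mult_class[of V G] groups by blast

lemma F_one: "\<one>\<^bsub>F\<^esub> = cl []"
  by (simp add: free_product_def)

lemma cl_self: "u \<in> free_words V G \<Longrightarrow> u \<in> cl u"
  by (auto simp: free_rel_def intro: free_eq.refl)

text \<open>Acts by an arbitrary word of the class; by \<open>wact_free_eq\<close> the choice does
  not matter up to \<open>tr\<close>.\<close>

definition cact :: "('v \<times> 'a) list set \<Rightarrow> ('v \<times> 'a) list \<Rightarrow> ('v \<times> 'a) list" where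
  "cact x l = wact (SOME u. u \<in> x) l"

lemma cact_cl:
  assumes "u \<in> free_words V G" "reduced l"
  shows "tr (cact (cl u) l) (wact u l)"
proof -
  have "(SOME w. w \<in> cl u) \<in> cl u" using cl_self[OF assms(1)] by (rule someI)
  then have "free_eq V G u (SOME w. w \<in> cl u)" by (simp add: free_rel_def)
  from wact_free_eq[OF this assms(2)] show ?thesis unfolding cact_def by (rule tr_sym)
qed

lemma cact_reduced:
  assumes "x \<in> carrier F" "reduced l"
  shows "reduced (cact x l)"
proof -
  obtain u where u: "u \<in> free_words V G" "x = cl u" using assms(1) unfolding F_carrier by blast
  show ?thesis unfolding u(2)
    by (rule reduced_tr[OF tr_sym[OF cact_cl[OF u(1) assms(2)]] wact_reduced[OF u(1) assms(2)]])
qed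

lemma cact_tr: "tr l l' \<Longrightarrow> tr (cact x l) (cact x l')"
  by (simp add: cact_def wact_tr)

lemma cact_mult:
  assumes "x \<in> carrier F" "y \<in> carrier F" "reduced l"
  shows "tr (cact (x \<otimes>\<^bsub>F\<^esub> y) l) (cact x (cact y l))"
proof -
  obtain u w where u: "u \<in> free_words V G" "x = cl u" and w: "w \<in> free_words V G" "y = cl w"
    using assms(1,2) unfolding F_carrier by blast
  have "tr (cact (x \<otimes>\<^bsub>F\<^esub> y) l) (wact u (wact w l))"
    using cact_cl[of "u @ w" l] u w assms(3) by (simp add: F_mult)
  also have "tr \<dots> (wact u (cact y l))"
    unfolding w(2) by (rule wact_tr[OF tr_sym[OF cact_cl[OF w(1) assms(3)]]])
  also have "tr \<dots> (cact x (cact y l))"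
    unfolding u(2) by (rule tr_sym[OF cact_cl[OF u(1) cact_reduced[OF assms(2,3)]]])
  finally show ?thesis .
qed

lemma cact_one: "reduced l \<Longrightarrow> tr (cact \<one>\<^bsub>F\<^esub> l) l"
  using cact_cl[of "[]" l] by (simp add: F_one)

sublocale F: group F
  using group_free_product groups by blast

text \<open>The elements acting trivially up to shuffles. They form a subgroup closed under
  conjugation that contains the relators, hence contain \<open>N\<close>; so the action descends to
  the graph product.\<close>

definition ker :: "('v \<times> 'a) list set set" where
  "ker = {x \<in> carrier F. \<forall>l. reduced l \<longrightarrow> tr (cact x l) l}"

lemma cact_inv:
  assumes "x \<in> carrier F" "reduced l"
  shows "tr (cact x (cact (inv\<^bsub>F\<^esub> x) l)) l" "tr (cact (inv\<^bsub>F\<^esub> x) (cact x l)) l"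
  using cact_mult[of x "inv\<^bsub>F\<^esub> x" l] cact_mult[of "inv\<^bsub>F\<^esub> x" x l] assms cact_one[OF assms(2)]
  by (auto intro: tr_trans tr_sym)

lemma subgroup_ker: "subgroup ker F"
proof
  show "x \<otimes>\<^bsub>F\<^esub> y \<in> ker" if "x \<in> ker" "y \<in> ker" for x y
  proof -
    have "tr (cact (x \<otimes>\<^bsub>F\<^esub> y) l) l" if l: "reduced l" for l
    proof -
      have c: "x \<in> carrier F" "y \<in> carrier F" using \<open>x \<in> ker\<close> \<open>y \<in> ker\<close> by (auto simp: ker_def)
      have "tr (cact x (cact y l)) (cact x l)" using \<open>y \<in> ker\<close> l by (auto simp: ker_def intro: cact_tr)
      then show ?thesis using cact_mult[OF c l] \<open>x \<in> ker\<close> l by (auto simp: ker_def intro: tr_trans)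
    qed
    then show ?thesis using that by (auto simp: ker_def)
  qed
  show "inv\<^bsub>F\<^esub> x \<in> ker" if x: "x \<in> ker" for x
  proof -
    have "tr (cact (inv\<^bsub>F\<^esub> x) l) l" if l: "reduced l" for l
    proof -
      have "tr (cact (inv\<^bsub>F\<^esub> x) l) (cact (inv\<^bsub>F\<^esub> x) (cact x l))"
        using x l by (auto simp: ker_def intro: cact_tr tr_sym)
      then show ?thesis using cact_inv(2)[of x l] x l by (auto simp: ker_def intro: tr_trans)
    qed
    then show ?thesis using x by (auto simp: ker_def)
  qed
  show "\<one>\<^bsub>F\<^esub> \<in> ker" using cact_one by (auto simp: ker_def)
qed (auto simp: ker_def)

lemma ker_conj:
  assumes g: "g \<in> carrier F" and r: "r \<in> ker"
  shows "g \<otimes>\<^bsub>F\<^esub> r \<otimes>\<^bsub>F\<^esub> inv\<^bsub>F\<^esub> g \<in> ker"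
proof -
  have rc: "r \<in> carrier F" using r by (simp add: ker_def)
  have "tr (cact (g \<otimes>\<^bsub>F\<^esub> r \<otimes>\<^bsub>F\<^esub> inv\<^bsub>F\<^esub> g) l) l" if l: "reduced l" for l
  proof -
    let ?m = "cact (inv\<^bsub>F\<^esub> g) l"
    have m: "reduced ?m" by (rule cact_reduced) (use g l in auto)
    have "tr (cact (g \<otimes>\<^bsub>F\<^esub> r \<otimes>\<^bsub>F\<^esub> inv\<^bsub>F\<^esub> g) l) (cact (g \<otimes>\<^bsub>F\<^esub> r) ?m)" using g rc l by (intro cact_mult) auto
    also have "tr \<dots> (cact g (cact r ?m))" using g rc m by (intro cact_mult) auto
    also have "tr \<dots> (cact g ?m)" using r m by (intro cact_tr) (auto simp: ker_def)
    also have "tr \<dots> l" using cact_inv(1)[OF g l] .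
    finally show ?thesis .
  qed
  then show ?thesis using g rc by (auto simp: ker_def)
qed

lemma incl_carrier: "v \<in> V \<Longrightarrow> a \<in> carrier (G v) \<Longrightarrow> free_incl V G v a \<in> carrier F"
  unfolding F_carrier free_incl_def by (intro bexI[of _ "[(v, a)]"]) auto

lemma cact_incl: "v \<in> V \<Longrightarrow> a \<in> carrier (G v) \<Longrightarrow> reduced l \<Longrightarrow> tr (cact (free_incl V G v a) l) (mul v a l)"
  using cact_cl[of "[(v, a)]" l] by (simp add: free_incl_def)

lemma incl_comm:
  assumes "adj v w" and a: "a \<in> carrier (G v)" and b: "b \<in> carrier (G w)" and l: "reduced l"
  shows "tr (cact (free_incl V G v a) (cact (free_incl V G w b) l)) (cact (free_incl V G w b) (cact (free_incl V G v a) l))"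
proof -
  have V: "v \<in> V" "w \<in> V" using assms adj_props by blast+
  have "tr (cact (free_incl V G v a) (cact (free_incl V G w b) l)) (cact (free_incl V G v a) (mul w b l))"
    by (intro cact_tr cact_incl V b l)
  also have "tr \<dots> (mul v a (mul w b l))" by (intro cact_incl V a mul_reduced b l)
  also have "tr \<dots> (mul w b (mul v a l))" using assms(1) by (rule mul_comm)
  also have "tr \<dots> (cact (free_incl V G w b) (mul v a l))" by (intro tr_sym[OF cact_incl] V a mul_reduced b l)
  also have "tr \<dots> (cact (free_incl V G w b) (cact (free_incl V G v a) l))"
    by (intro cact_tr tr_sym[OF cact_incl] V a l)
  finally show ?thesis .
qed

lemma relators_carrier: "graph_product_relators V E G \<subseteq> carrier F"
  using incl_carrier by (auto simp: graph_product_relators_def commutator_def)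

lemma relators_ker: "graph_product_relators V E G \<subseteq> ker"
proof
  fix r assume "r \<in> graph_product_relators V E G"
  then obtain v w a b where vw: "v \<in> V" "w \<in> V" "{v, w} \<in> E" "a \<in> carrier (G v)" "b \<in> carrier (G w)"
    and r: "r = commutator F (free_incl V G v a) (free_incl V G w b)"
    by (auto simp: graph_product_relators_def)
  let ?x = "free_incl V G v a" and ?y = "free_incl V G w b"
  have x: "?x \<in> carrier F" and y: "?y \<in> carrier F" using vw incl_carrier by auto
  have av: "adj v w" using vw by (simp add: adj_def)
  have "tr (cact r l) l" if l: "reduced l" for l
  proof -
    let ?m = "cact (inv\<^bsub>F\<^esub> ?y) l"
    let ?k = "cact (inv\<^bsub>F\<^esub> ?x) ?m"
    have m: "reduced ?m" by (rule cact_reduced) (use y l in auto)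
    have k: "reduced ?k" by (rule cact_reduced) (use x m in auto)
    have "tr (cact r l) (cact (?x \<otimes>\<^bsub>F\<^esub> ?y \<otimes>\<^bsub>F\<^esub> inv\<^bsub>F\<^esub> ?x) ?m)"
      unfolding r commutator_def using x y l by (intro cact_mult) auto
    also have "tr \<dots> (cact (?x \<otimes>\<^bsub>F\<^esub> ?y) ?k)" using x y m by (intro cact_mult) auto
    also have "tr \<dots> (cact ?x (cact ?y ?k))" using x y k by (intro cact_mult) auto
    also have "tr \<dots> (cact ?y (cact ?x ?k))" using incl_comm[OF av vw(4,5) k] .
    also have "tr \<dots> (cact ?y ?m)" using cact_inv(1)[OF x m] by (rule cact_tr)
    also have "tr \<dots> l" using cact_inv(1)[OF y l] .
    finally show ?thesis .
  qed
  then show "r \<in> ker" using x y by (auto simp: ker_def r commutator_def)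
qed

lemma N_ker: "N \<subseteq> ker"
  unfolding normal_closure_def
  by (rule F.generate_subgroup_incl[OF _ subgroup_ker]) (use ker_conj relators_ker in auto)

sublocale N: normal N F
  using normal_normal_closure[OF F.is_group relators_carrier] .

sublocale Pr: group Pr
  using group_graph_product groups by blast

lemma Pr_carrier: "Y \<in> carrier Pr \<longleftrightarrow> (\<exists>x\<in>carrier F. Y = N #>\<^bsub>F\<^esub> x)"
  unfolding graph_product_def by (auto simp: carrier_FactGroup)

lemma Pr_mult: "x \<in> carrier F \<Longrightarrow> y \<in> carrier F \<Longrightarrow> (N #>\<^bsub>F\<^esub> x) \<otimes>\<^bsub>Pr\<^esub> (N #>\<^bsub>F\<^esub> y) = N #>\<^bsub>F\<^esub> (x \<otimes>\<^bsub>F\<^esub> y)"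
  unfolding graph_product_def by (simp add: N.rcos_sum)

lemma Pr_one: "\<one>\<^bsub>Pr\<^esub> = N #>\<^bsub>F\<^esub> \<one>\<^bsub>F\<^esub>"
  unfolding graph_product_def using F.coset_mult_one[OF N.subset] by simp

definition gact :: "('v \<times> 'a) list set set \<Rightarrow> ('v \<times> 'a) list \<Rightarrow> ('v \<times> 'a) list" where
  "gact Y l = cact (SOME x. x \<in> Y) l"

lemma gact_coset:
  assumes x: "x \<in> carrier F" and l: "reduced l"
  shows "tr (gact (N #>\<^bsub>F\<^esub> x) l) (cact x l)"
proof -
  have "x \<in> N #>\<^bsub>F\<^esub> x" using F.rcos_self[OF x N.subgroup_axioms] .
  then have "(SOME y. y \<in> N #>\<^bsub>F\<^esub> x) \<in> N #>\<^bsub>F\<^esub> x" by (rule someI)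
  then obtain n where n: "n \<in> N" "(SOME y. y \<in> N #>\<^bsub>F\<^esub> x) = n \<otimes>\<^bsub>F\<^esub> x" by (auto simp: r_coset_def)
  have nc: "n \<in> carrier F" and nk: "n \<in> ker" using n(1) N.subset N_ker by blast+
  have "tr (cact (n \<otimes>\<^bsub>F\<^esub> x) l) (cact n (cact x l))" by (rule cact_mult[OF nc x l])
  also have "tr \<dots> (cact x l)" using nk cact_reduced[OF x l] by (simp add: ker_def)
  finally show ?thesis by (simp add: gact_def n(2))
qed

lemma gact_mult:
  assumes "Y \<in> carrier Pr" "Z \<in> carrier Pr" "reduced l"
  shows "tr (gact (Y \<otimes>\<^bsub>Pr\<^esub> Z) l) (gact Y (gact Z l))"
proof -
  obtain x y where x: "x \<in> carrier F" "Y = N #>\<^bsub>F\<^esub> x" and y: "y \<in> carrier F" "Z = N #>\<^bsub>F\<^esub> y"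
    using assms(1,2) unfolding Pr_carrier by blast
  have r: "reduced (gact Z l)" unfolding y(2)
    by (rule reduced_tr[OF tr_sym[OF gact_coset[OF y(1) assms(3)]] cact_reduced[OF y(1) assms(3)]])
  have "tr (gact (Y \<otimes>\<^bsub>Pr\<^esub> Z) l) (cact (x \<otimes>\<^bsub>F\<^esub> y) l)"
    using gact_coset[of "x \<otimes>\<^bsub>F\<^esub> y" l] x y assms(3) by (simp add: Pr_mult)
  also have "tr \<dots> (cact x (cact y l))" by (rule cact_mult[OF x(1) y(1) assms(3)])
  also have "tr \<dots> (cact x (gact Z l))"
    unfolding y(2) by (rule cact_tr[OF tr_sym[OF gact_coset[OF y(1) assms(3)]]])
  also have "tr \<dots> (gact Y (gact Z l))" unfolding x(2) by (rule tr_sym[OF gact_coset[OF x(1) r]])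
  finally show ?thesis .
qed

lemma gact_reduced:
  assumes "Y \<in> carrier Pr" "reduced l"
  shows "reduced (gact Y l)"
proof -
  obtain x where x: "x \<in> carrier F" "Y = N #>\<^bsub>F\<^esub> x" using assms(1) unfolding Pr_carrier by blast
  show ?thesis unfolding x(2)
    by (rule reduced_tr[OF tr_sym[OF gact_coset[OF x(1) assms(2)]] cact_reduced[OF x(1) assms(2)]])
qed

section \<open>Vertex groups and heads in the graph product\<close>

definition emb :: "'v \<Rightarrow> 'a \<Rightarrow> ('v \<times> 'a) list set set" where
  "emb v a = N #>\<^bsub>F\<^esub> free_incl V G v a"

definition vgrp :: "'v \<Rightarrow> ('v \<times> 'a) list set set set" where
  "vgrp v = (if v \<in> V then emb v ` carrier (G v) else {\<one>\<^bsub>Pr\<^esub>})"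

text \<open>Applied to the empty word, \<open>Y\<close> produces its reduced form up to shuffles,
  and \<open>find\<close> is invariant under shuffles.\<close>

definition head :: "'v \<Rightarrow> ('v \<times> 'a) list set set \<Rightarrow> ('v \<times> 'a) list set set" where
  "head v Y = (if v \<in> V then emb v (find v (gact Y [])) else \<one>\<^bsub>Pr\<^esub>)"

lemma emb_carrier: "v \<in> V \<Longrightarrow> a \<in> carrier (G v) \<Longrightarrow> emb v a \<in> carrier Pr"
  unfolding Pr_carrier emb_def using incl_carrier by blast

lemma emb_hom:
  assumes v: "v \<in> V"
  shows "emb v \<in> hom (G v) Pr"
proof (rule homI)
  show "emb v a \<in> carrier Pr" if "a \<in> carrier (G v)" for a using emb_carrier v that .
  fix a b assume a: "a \<in> carrier (G v)" and b: "b \<in> carrier (G v)"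
  interpret Gv: group "G v" using groups v by blast
  have "free_eq V G ([] @ [(v, a), (v, b)] @ []) ([] @ [(v, a \<otimes>\<^bsub>G v\<^esub> b)] @ [])"
    by (rule free_eq.mult) (use v a b in auto)
  then have "cl [(v, a), (v, b)] = cl [(v, a \<otimes>\<^bsub>G v\<^esub> b)]"
    by (intro equiv_class_eq[OF equiv_free_rel[of V G]]) (use groups in \<open>auto simp: free_rel_def\<close>)
  then have "free_incl V G v a \<otimes>\<^bsub>F\<^esub> free_incl V G v b = free_incl V G v (a \<otimes>\<^bsub>G v\<^esub> b)"
    unfolding free_incl_def using F_mult[of "[(v, a)]" "[(v, b)]"] v a b by simp
  then show "emb v (a \<otimes>\<^bsub>G v\<^esub> b) = emb v a \<otimes>\<^bsub>Pr\<^esub> emb v b"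
    unfolding emb_def using Pr_mult[of "free_incl V G v a" "free_incl V G v b"] incl_carrier v a b by simp
qed

lemma gact_emb: "v \<in> V \<Longrightarrow> a \<in> carrier (G v) \<Longrightarrow> reduced l \<Longrightarrow> tr (gact (emb v a) l) (mul v a l)"
  unfolding emb_def using gact_coset[OF incl_carrier] cact_incl by (blast intro: tr_trans)

lemma gact_emb_mult:
  assumes "v \<in> V" "a \<in> carrier (G v)" "Y \<in> carrier Pr"
  shows "find w (gact (emb v a \<otimes>\<^bsub>Pr\<^esub> Y) []) = find w (mul v a (gact Y []))"
proof -
  have "tr (gact (emb v a \<otimes>\<^bsub>Pr\<^esub> Y) []) (gact (emb v a) (gact Y []))"
    by (intro gact_mult emb_carrier assms) simp
  also have "tr \<dots> (mul v a (gact Y []))" by (intro gact_emb gact_reduced assms) simp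
  finally show ?thesis by (rule find_tr)
qed

lemma find_one: "find v (gact \<one>\<^bsub>Pr\<^esub> []) = \<one>\<^bsub>G v\<^esub>"
  using find_tr[OF gact_coset[of "\<one>\<^bsub>F\<^esub>" "[]"], of v] find_tr[OF cact_one[of "[]"], of v] by (simp add: Pr_one)

text \<open>An element of a vertex group can be recovered as the head of its image.\<close>

lemma emb_inj: "v \<in> V \<Longrightarrow> inj_on (emb v) (carrier (G v))"
proof (rule inj_onI)
  fix a b assume v: "v \<in> V" and ab: "a \<in> carrier (G v)" "b \<in> carrier (G v)" "emb v a = emb v b"
  interpret Gv: group "G v" using groups v by blast
  have "find v (gact (emb v c) []) = c" if "c \<in> carrier (G v)" for c
    using find_tr[OF gact_emb[OF v that, of "[]"], of v] find_mul[of "[]" v c] that by simp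
  then show "a = b" using ab by metis
qed

lemma emb_one: "v \<in> V \<Longrightarrow> emb v \<one>\<^bsub>G v\<^esub> = \<one>\<^bsub>Pr\<^esub>"
  using hom_one[OF emb_hom] groups Pr.is_group by blast

lemma emb_comm:
  assumes "adj v w" and a: "a \<in> carrier (G v)" and b: "b \<in> carrier (G w)"
  shows "emb v a \<otimes>\<^bsub>Pr\<^esub> emb w b = emb w b \<otimes>\<^bsub>Pr\<^esub> emb v a"
proof -
  let ?x = "free_incl V G v a" and ?y = "free_incl V G w b"
  have V: "v \<in> V" "w \<in> V" using assms adj_props by blast+
  have x: "?x \<in> carrier F" and y: "?y \<in> carrier F" using V a b incl_carrier by auto
  let ?c = "commutator F ?x ?y"
  have "?c \<in> graph_product_relators V E G"
    using V a b assms(1) unfolding graph_product_relators_def adj_def by blast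
  then have "\<one>\<^bsub>F\<^esub> \<otimes>\<^bsub>F\<^esub> ?c \<otimes>\<^bsub>F\<^esub> inv\<^bsub>F\<^esub> \<one>\<^bsub>F\<^esub> \<in> N"
    unfolding normal_closure_def by (intro generate.incl) blast
  then have c: "?c \<in> N" using x y by (simp add: commutator_def)
  have "?x \<otimes>\<^bsub>F\<^esub> ?y = ?c \<otimes>\<^bsub>F\<^esub> (?y \<otimes>\<^bsub>F\<^esub> ?x)" using x y by (simp add: commutator_def F.m_assoc)
  then have "N #>\<^bsub>F\<^esub> (?x \<otimes>\<^bsub>F\<^esub> ?y) = N #>\<^bsub>F\<^esub> (?c \<otimes>\<^bsub>F\<^esub> (?y \<otimes>\<^bsub>F\<^esub> ?x))" by simp
  also have "\<dots> = (N #>\<^bsub>F\<^esub> ?c) #>\<^bsub>F\<^esub> (?y \<otimes>\<^bsub>F\<^esub> ?x)"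
    using F.coset_mult_assoc[OF N.subset, of ?c "?y \<otimes>\<^bsub>F\<^esub> ?x"] c x y N.subset by auto
  also have "N #>\<^bsub>F\<^esub> ?c = N" using F.coset_join2[OF _ N.subgroup_axioms c] c N.subset by auto
  finally show ?thesis unfolding emb_def using Pr_mult x y by simp
qed

lemma generate_vgrp: "carrier Pr \<subseteq> generate Pr (\<Union>v. vgrp v)"
proof
  fix Y assume "Y \<in> carrier Pr"
  then obtain x where "x \<in> carrier F" "Y = N #>\<^bsub>F\<^esub> x" unfolding Pr_carrier by blast
  then obtain u where u: "u \<in> free_words V G" "Y = N #>\<^bsub>F\<^esub> cl u" unfolding F_carrier by blast
  have "N #>\<^bsub>F\<^esub> cl u \<in> generate Pr (\<Union>v. vgrp v)" using u(1)
  proof (induction u)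
    case Nil
    then show ?case using generate.one[of Pr "\<Union>v. vgrp v"] by (simp add: Pr_one F_one)
  next
    case (Cons p u)
    obtain v a where p: "p = (v, a)" by force
    have v: "v \<in> V" "a \<in> carrier (G v)" "u \<in> free_words V G" using Cons.prems p by auto
    have "cl u \<in> carrier F" using v(3) F_carrier by blast
    then have "N #>\<^bsub>F\<^esub> cl (p # u) = emb v a \<otimes>\<^bsub>Pr\<^esub> (N #>\<^bsub>F\<^esub> cl u)"
      using Pr_mult[OF incl_carrier[OF v(1,2)], of "cl u"] F_mult[of "[(v, a)]" u] v p
      by (simp add: emb_def free_incl_def)
    moreover have "emb v a \<in> generate Pr (\<Union>v. vgrp v)"
      using v by (intro generate.incl) (auto simp: vgrp_def)
    ultimately show ?case using generate.eng Cons.IH v by metis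
  qed
  then show "Y \<in> generate Pr (\<Union>v. vgrp v)" using u by simp
qed

text \<open>The laws for heads are those of \<open>find\<close> under \<open>mul\<close>, carried
  over by \<open>gact_emb_mult\<close>.\<close>

lemma graph_group: "graph_group Pr V adj vgrp head"
proof (intro graph_group.intro graph_group_axioms.intro Pr.is_group)
  show "finite V" using graph by (simp add: finite_simplicial_graph_def)
  show "adj w v" if "adj v w" for v w using that adj_props by blast
  show "\<not> adj v v" for v using adj_neq by blast
  show "subgroup (vgrp v) Pr" for v
  proof (cases "v \<in> V")
    case True
    have "group_hom (G v) Pr (emb v)"
      using groups[OF True] emb_hom[OF True] Pr.is_group by (simp add: group_hom_def group_hom_axioms_def)
    then show ?thesis using group_hom.img_is_subgroup True by (auto simp: vgrp_def)
  next
    case False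
    then show ?thesis using Pr.triv_subgroup by (simp add: vgrp_def)
  qed
  show "vgrp v = {\<one>\<^bsub>Pr\<^esub>}" if "v \<notin> V" for v using that by (simp add: vgrp_def)
  show "a \<otimes>\<^bsub>Pr\<^esub> b = b \<otimes>\<^bsub>Pr\<^esub> a" if "adj v w" "a \<in> vgrp v" "b \<in> vgrp w" for v w a b
    using that emb_comm[OF that(1)] adj_props(1)[OF that(1)] by (auto simp: vgrp_def)
  show "carrier Pr \<subseteq> generate Pr (\<Union> (range vgrp))" by (rule generate_vgrp)
  show "head v Y \<in> vgrp v" if "Y \<in> carrier Pr" for v Y
    using that find_carrier gact_reduced by (auto simp: head_def vgrp_def)
  show "head v \<one>\<^bsub>Pr\<^esub> = \<one>\<^bsub>Pr\<^esub>" for v using find_one emb_one by (simp add: head_def)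
  show "head v (a \<otimes>\<^bsub>Pr\<^esub> Y) = a \<otimes>\<^bsub>Pr\<^esub> head v Y" if a: "a \<in> vgrp v" and Y: "Y \<in> carrier Pr" for a v Y
  proof (cases "v \<in> V")
    case True
    then obtain b where b: "b \<in> carrier (G v)" "a = emb v b" using a by (auto simp: vgrp_def)
    have "find v (gact Y []) \<in> carrier (G v)" using find_carrier[OF True] gact_reduced[OF Y] by simp
    then show ?thesis
      using gact_emb_mult[OF True b(1) Y, of v] find_mul[of "gact Y []" v b] gact_reduced[OF Y] True b
        hom_mult[OF emb_hom[OF True]] by (simp add: head_def)
  next
    case False
    then show ?thesis using a Y by (simp add: head_def vgrp_def)
  qed
  show "head w (a \<otimes>\<^bsub>Pr\<^esub> Y) = head w Y" if a: "a \<in> vgrp v" and Y: "Y \<in> carrier Pr" and vw: "adj v w" for a v w Y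
  proof -
    have V: "v \<in> V" "w \<in> V" using vw adj_props by blast+
    then obtain b where b: "b \<in> carrier (G v)" "a = emb v b" using a by (auto simp: vgrp_def)
    then show ?thesis using gact_emb_mult[OF V(1) b(1) Y, of w] find_mul_adj[OF vw] V by (simp add: head_def)
  qed
  show "head v Y = \<one>\<^bsub>Pr\<^esub> \<or> head w Y = \<one>\<^bsub>Pr\<^esub>" if "Y \<in> carrier Pr" "v \<noteq> w" "\<not> adj v w" for v w Y
    using find_nonadj[OF that(2,3), of "gact Y []"] emb_one by (auto simp: head_def)
qed

end


section \<open>The domains\<close>

lemma set_dist_le:
  assumes "a \<in> S" "b \<in> R" "mdist m a b \<le> r"
  shows "set_dist m S R \<le> r"
proof -
  have "set_dist m S R \<le> mdist m a b"
    unfolding set_dist_def by (rule cInf_lower) (use assms in \<open>auto intro!: bdd_belowI[of _ 0]\<close>)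
  then show ?thesis using assms(3) by linarith
qed

lemma set_dist_self:
  assumes "a \<in> S" "a \<in> R" "a \<in> mspace m" "0 \<le> r"
  shows "set_dist m S R \<le> r"
proof -
  have "mdist m a a = 0" using assms(3) by simp
  then have "mdist m a a \<le> r" using assms(4) by linarith
  then show ?thesis by (rule set_dist_le[OF assms(1,2)])
qed

text \<open>Projections of points are finite, so vertices realising their distance can be
  picked.\<close>

lemma set_dist_attained:
  assumes "finite S" "finite R" "S \<noteq> {}" "R \<noteq> {}"
  shows "\<exists>a\<in>S. \<exists>b\<in>R. set_dist m S R = mdist m a b"
proof -
  let ?D = "(\<lambda>(a, b). mdist m a b) ` (S \<times> R)"
  have e: "{mdist m a b |a b. a \<in> S \<and> b \<in> R} = ?D" by auto
  have D: "finite ?D" "?D \<noteq> {}" using assms by auto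
  have "set_dist m S R \<in> ?D" unfolding set_dist_def e using Min_in[OF D] cInf_eq_Min[OF D] by simp
  then show ?thesis by auto
qed

lemma geodesic_space_quasi:
  assumes "geodesic_space m"
  shows "quasi_geodesic_space m"
  unfolding quasi_geodesic_space_def
proof (rule exI[of _ "1::real"], rule conjI, simp, rule exI[of _ "0::real"], rule conjI, simp, intro ballI)
  fix x y assume g: "x \<in> mspace m" "y \<in> mspace m"
  then obtain \<gamma> where "geodesic m x y \<gamma>" using assms unfolding geodesic_space_def by blast
  then show "\<exists>L\<ge>0. \<exists>\<gamma>\<in>{0..L} \<rightarrow> mspace m. \<gamma> 0 = x \<and> \<gamma> L = y \<and>
      (\<forall>s\<in>{0..L}. \<forall>t\<in>{0..L}. \<bar>s - t\<bar> / 1 - 0 \<le> mdist m (\<gamma> s) (\<gamma> t) \<and> mdist m (\<gamma> s) (\<gamma> t) \<le> 1 * \<bar>s - t\<bar> + 0)"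
    using g by (intro exI[of _ "mdist m x y"] conjI bexI[of _ \<gamma>]) (auto simp: geodesic_def)
qed

context generated_graph_group
begin

section \<open>Parallelism classes that meet\<close>

lemma meetsI: "k \<in> carrier P \<Longrightarrow> inv g \<otimes> k \<in> par (st \<Lambda>) \<Longrightarrow> inv h \<otimes> k \<in> par (st \<Omega>) \<Longrightarrow> meets g \<Lambda> h \<Omega>"
  unfolding meets_def by blast

lemma meets_sym: "meets g \<Lambda> h \<Omega> \<longleftrightarrow> meets h \<Omega> g \<Lambda>"
  unfolding meets_def by blast

lemma meets_cong:
  assumes "g \<in> carrier P" "g' \<in> carrier P" "inv g \<otimes> g' \<in> par (st \<Lambda>)"
  shows "meets g \<Lambda> h \<Omega> \<longleftrightarrow> meets g' \<Lambda> h \<Omega>"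
  unfolding meets_def using coset_eq[of g g' _ "st \<Lambda>"] assms by blast

lemma par_sub_st: "x \<in> par \<Lambda> \<Longrightarrow> x \<in> par (st \<Lambda>)" "x \<in> par (lk \<Lambda>) \<Longrightarrow> x \<in> par (st \<Lambda>)"
  by (auto intro: par_mono' simp: st_def)

lemma lk_anti: "\<Lambda> \<subseteq> \<Omega> \<Longrightarrow> lk \<Omega> \<subseteq> lk \<Lambda>"
  by (auto simp: lk_def)

text \<open>The two meeting points \<open>a\<close> and \<open>b\<close> differ by an element of
  \<open>par (st \<Omega>)\<close>. Its link part is absorbed at \<open>a\<close> because
  \<open>\<Lambda> \<subseteq> \<Omega>\<close>, its other part at \<open>b\<close> because
  \<open>\<Omega> \<subseteq> st \<Theta>\<close>. The last inclusion covers nesting as well as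
  orthogonality.\<close>

lemma meets_trans:
  assumes c: "g \<in> carrier P" "h \<in> carrier P" "k \<in> carrier P"
    and m: "meets g \<Lambda> h \<Omega>" "meets h \<Omega> k \<Theta>" and O: "\<Lambda> \<subseteq> \<Omega>" "\<Omega> \<subseteq> st \<Theta>"
  shows "meets g \<Lambda> k \<Theta>"
proof -
  obtain a where a: "a \<in> carrier P" "inv g \<otimes> a \<in> par (st \<Lambda>)" "inv h \<otimes> a \<in> par (st \<Omega>)"
    using m(1) unfolding meets_def by blast
  obtain b where b: "b \<in> carrier P" "inv h \<otimes> b \<in> par (st \<Omega>)" "inv k \<otimes> b \<in> par (st \<Theta>)"
    using m(2) unfolding meets_def by blast
  have "inv a \<otimes> b \<in> par (st \<Omega>)" using coset_eq[OF c(2) a(1) b(1) a(3)] b(2) by blast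
  then obtain w l where w: "w \<in> par \<Omega>" "l \<in> par (lk \<Omega>)" "inv a \<otimes> b = l \<otimes> w" using par_st by metis
  have wc: "w \<in> carrier P" "l \<in> carrier P" using w by auto
  have l: "l \<in> par (st \<Lambda>)" using par_sub_st(2)[OF par_mono'[OF w(2) lk_anti[OF O(1)]]] .
  have w': "inv w \<in> par (st \<Theta>)" using par_mono'[OF w(1) O(2)] by simp
  have "b = a \<otimes> (l \<otimes> w)" using w(3) a b by (metis inv_cancel(2))
  then have e: "a \<otimes> l = b \<otimes> inv w" using a wc by (simp add: m_assoc)
  show ?thesis
  proof (rule meetsI[of "a \<otimes> l"])
    show "inv g \<otimes> (a \<otimes> l) \<in> par (st \<Lambda>)" using par_mult[OF a(2) l] c a wc by (simp add: m_assoc)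
    show "inv k \<otimes> (a \<otimes> l) \<in> par (st \<Theta>)" unfolding e using par_mult[OF b(3) w'] c b wc by (simp add: m_assoc)
  qed (use a wc in simp)
qed

text \<open>\<open>lk \<Lambda> \<inter> \<Omega>\<close> at the common base point \<open>a\<close>
  is the container. The class of \<open>k\<close> meets the cosets of
  \<open>par (lk \<Lambda>)\<close> and of \<open>par \<Omega>\<close> through \<open>a\<close>, so
  by the Helly argument of \<open>gate_coset_meets\<close> it meets their intersection.\<close>

lemma containers_alg:
  assumes c: "g \<in> carrier P" "h \<in> carrier P" "k \<in> carrier P" "a \<in> carrier P"
    and a: "inv g \<otimes> a \<in> par (st \<Lambda>)" "inv h \<otimes> a \<in> par (st \<Omega>)"
    and m: "meets k \<Theta> h \<Omega>" "meets k \<Theta> g \<Lambda>" and O: "\<Theta> \<subseteq> \<Omega>" "\<Theta> \<subseteq> lk \<Lambda>"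
  shows "meets k \<Theta> a (lk \<Lambda> \<inter> \<Omega>)"
proof -
  obtain b where b: "b \<in> carrier P" "inv k \<otimes> b \<in> par (st \<Theta>)" "inv g \<otimes> b \<in> par (st \<Lambda>)"
    using m(2) unfolding meets_def by blast
  obtain d where d: "d \<in> carrier P" "inv k \<otimes> d \<in> par (st \<Theta>)" "inv h \<otimes> d \<in> par (st \<Omega>)"
    using m(1) unfolding meets_def by blast
  have "inv a \<otimes> b \<in> par (st \<Lambda>)" using coset_eq[OF c(1) c(4) b(1) a(1)] b(3) by blast
  then obtain w l where w: "w \<in> par \<Lambda>" "l \<in> par (lk \<Lambda>)" "inv a \<otimes> b = l \<otimes> w" using par_st by metis
  have "inv a \<otimes> d \<in> par (st \<Omega>)" using coset_eq[OF c(2) c(4) d(1) a(2)] d(3) by blast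
  then obtain y n where y: "y \<in> par \<Omega>" "n \<in> par (lk \<Omega>)" "inv a \<otimes> d = y \<otimes> n" using par_st by metis
  have cc: "w \<in> carrier P" "l \<in> carrier P" "y \<in> carrier P" "n \<in> carrier P" using w y by auto
  have "b = a \<otimes> (l \<otimes> w)" "d = a \<otimes> (y \<otimes> n)" using w(3) y(3) c b d by (metis inv_cancel(2))+
  then have e: "a \<otimes> l = b \<otimes> inv w" "a \<otimes> y = d \<otimes> inv n" using c cc by (simp_all add: m_assoc)
  have w': "inv w \<in> par (st \<Theta>)"
    using par_sub_st(2)[OF par_mono'[OF w(1), of "lk \<Theta>"]] O(2) lk_swap by simp
  have n': "inv n \<in> par (st \<Theta>)" using par_sub_st(2)[OF par_mono'[OF y(2) lk_anti[OF O(1)]]] by simp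
  have kl: "inv k \<otimes> (a \<otimes> l) \<in> par (st \<Theta>)"
    unfolding e using par_mult[OF b(2) w'] c b cc by (simp add: m_assoc)
  have ky: "inv k \<otimes> (a \<otimes> y) \<in> par (st \<Theta>)"
    unfolding e using par_mult[OF d(2) n'] c d cc by (simp add: m_assoc)
  have "inv (a \<otimes> l) \<otimes> (a \<otimes> y) \<in> par (st \<Theta>)"
    using coset_eq[OF c(3) _ _ kl, of "a \<otimes> y"] ky c cc by simp
  then have "inv l \<otimes> y \<in> par (st \<Theta>)" using c cc by (simp add: inv_mult_group m_assoc)
  from gate_coset_meets[OF w(2) y(1) this] have z: "inv l \<otimes> gate \<Omega> l \<in> par (st \<Theta>)" .
  let ?z = "gate \<Omega> l"
  have zp: "?z \<in> par (\<Omega> \<inter> lk \<Lambda>)" by (rule gate_par_inter[OF w(2)])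
  have zc: "?z \<in> carrier P" using cc by simp
  show ?thesis
  proof (rule meetsI[of "a \<otimes> ?z"])
    show "inv k \<otimes> (a \<otimes> ?z) \<in> par (st \<Theta>)"
      using par_mult[OF kl z] c cc zc by (simp add: m_assoc)
    show "inv a \<otimes> (a \<otimes> ?z) \<in> par (st (lk \<Lambda> \<inter> \<Omega>))"
      using par_sub_st(1)[OF zp] c zc by (simp add: Int_commute)
  qed (use c zc in simp)
qed

lemma par_V: "par V = carrier P"
proof -
  have "A v \<subseteq> par V" for v using A_par A_outside[of v] by (cases "v \<in> V") auto
  then have "generate P (\<Union>v. A v) \<subseteq> par V" by (intro generate_subgroup_incl par_subgroup) blast
  then show ?thesis using generate_A par_closed by blast
qed

lemma par_st_V: "par (st V) = carrier P"
  using par_mono[of V "st V"] par_V par_closed by (auto simp: st_def)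

text \<open>A domain is the set of all \<open>(h, \<Lambda>)\<close> with \<open>h\<langle>\<Lambda>\<rangle>\<close> parallel to a fixed \<open>g\<langle>\<Lambda>\<rangle>\<close>.\<close>

definition cls :: "'a \<Rightarrow> 'v set \<Rightarrow> ('a \<times> 'v set) set" where
  "cls g \<Lambda> = {(h, \<Lambda>) | h. h \<in> carrier P \<and> inv g \<otimes> h \<in> par (st \<Lambda>)}"

definition doms :: "('a \<times> 'v set) set set" where
  "doms = {cls g \<Lambda> | g \<Lambda>. g \<in> carrier P \<and> \<Lambda> \<noteq> {} \<and> \<Lambda> \<subseteq> V}"

definition rp :: "('a \<times> 'v set) set \<Rightarrow> 'a" where
  "rp W = fst (SOME p. p \<in> W)"

text \<open>All pairs in a class carry the same type. It is recorded because different
  \<open>\<Lambda>\<close> may have the same star, so that the group elements alone would not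
  determine it.\<close>

definition ty :: "('a \<times> 'v set) set \<Rightarrow> 'v set" where
  "ty W = snd (SOME p. p \<in> W)"

lemma cls_rep:
  assumes g: "g \<in> carrier P"
  shows "ty (cls g \<Lambda>) = \<Lambda>" "rp (cls g \<Lambda>) \<in> carrier P" "inv g \<otimes> rp (cls g \<Lambda>) \<in> par (st \<Lambda>)"
proof -
  have "(g, \<Lambda>) \<in> cls g \<Lambda>" using g by (simp add: cls_def)
  then have "(SOME p. p \<in> cls g \<Lambda>) \<in> cls g \<Lambda>" by (rule someI)
  then show "ty (cls g \<Lambda>) = \<Lambda>" "rp (cls g \<Lambda>) \<in> carrier P" "inv g \<otimes> rp (cls g \<Lambda>) \<in> par (st \<Lambda>)"
    by (auto simp: cls_def rp_def ty_def)
qed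

lemma cls_eq:
  assumes "g \<in> carrier P" "h \<in> carrier P" "inv g \<otimes> h \<in> par (st \<Lambda>)"
  shows "cls g \<Lambda> = cls h \<Lambda>"
  using coset_eq[OF assms(1,2) _ assms(3)] by (auto simp: cls_def)

lemma cls_doms: "g \<in> carrier P \<Longrightarrow> \<Lambda> \<noteq> {} \<Longrightarrow> \<Lambda> \<subseteq> V \<Longrightarrow> cls g \<Lambda> \<in> doms"
  by (auto simp: doms_def)

lemma doms_rep:
  assumes "W \<in> doms"
  shows "rp W \<in> carrier P" "ty W \<noteq> {}" "ty W \<subseteq> V" "W = cls (rp W) (ty W)"
proof -
  obtain g \<Lambda> where W: "W = cls g \<Lambda>" "g \<in> carrier P" "\<Lambda> \<noteq> {}" "\<Lambda> \<subseteq> V" using assms by (auto simp: doms_def)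
  note r = cls_rep[OF W(2), of \<Lambda>, folded W(1)]
  show "rp W \<in> carrier P" "ty W \<noteq> {}" "ty W \<subseteq> V" using r W(3,4) by auto
  show "W = cls (rp W) (ty W)" unfolding r(1) by (rule HOL.trans[OF W(1) cls_eq[OF W(2) r(2,3)]])
qed

section \<open>Nesting and orthogonality of domains\<close>

definition dmeets :: "('a \<times> 'v set) set \<Rightarrow> ('a \<times> 'v set) set \<Rightarrow> bool" where
  "dmeets U W \<longleftrightarrow> meets (rp U) (ty U) (rp W) (ty W)"

definition dnest :: "('a \<times> 'v set) set \<Rightarrow> ('a \<times> 'v set) set \<Rightarrow> bool" where
  "dnest U W \<longleftrightarrow> ty U \<subseteq> ty W \<and> dmeets U W"

definition dorth :: "('a \<times> 'v set) set \<Rightarrow> ('a \<times> 'v set) set \<Rightarrow> bool" where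
  "dorth U W \<longleftrightarrow> ty U \<subseteq> lk (ty W) \<and> dmeets U W"

lemma dmeets_cls: "g \<in> carrier P \<Longrightarrow> dmeets (cls g \<Lambda>) W \<longleftrightarrow> meets g \<Lambda> (rp W) (ty W)"
  using meets_cong[of g "rp (cls g \<Lambda>)" \<Lambda>] cls_rep[of g \<Lambda>] by (simp add: dmeets_def)

lemma dmeets_sym: "dmeets U W \<longleftrightarrow> dmeets W U"
  using meets_sym by (simp add: dmeets_def)

text \<open>Classes of equal type are cosets of one subgroup, so they coincide once they
  meet.\<close>

lemma dom_eqI:
  assumes "U \<in> doms" "W \<in> doms" "ty U = ty W" "dmeets U W"
  shows "U = W"
proof -
  note u = doms_rep[OF assms(1)] and w = doms_rep[OF assms(2)]
  obtain k where k: "k \<in> carrier P" "inv (rp U) \<otimes> k \<in> par (st (ty W))" "inv (rp W) \<otimes> k \<in> par (st (ty W))"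
    using assms(3,4) unfolding dmeets_def meets_def by auto
  show ?thesis using cls_eq[OF u(1) k(1)] cls_eq[OF w(1) k(1)] k u(4) w(4) assms(3) by metis
qed

lemma dnest_ty: "U \<in> doms \<Longrightarrow> W \<in> doms \<Longrightarrow> dnest U W \<Longrightarrow> U \<noteq> W \<Longrightarrow> ty U \<subset> ty W"
  using dom_eqI[of U W] by (auto simp: dnest_def)

lemma dmeets_refl: "W \<in> doms \<Longrightarrow> dmeets W W"
  unfolding dmeets_def using doms_rep(1)[of W] by (intro meetsI[of "rp W"]) auto

lemma dmeets_trans:
  assumes "U \<in> doms" "Y \<in> doms" "W \<in> doms" "dmeets U Y" "dmeets Y W" "ty U \<subseteq> ty Y" "ty Y \<subseteq> st (ty W)"
  shows "dmeets U W"
  using meets_trans[OF doms_rep(1)[OF assms(1)] doms_rep(1)[OF assms(2)] doms_rep(1)[OF assms(3)]] assms(4-)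
  unfolding dmeets_def by blast

lemma dnest_trans: "U \<in> doms \<Longrightarrow> Y \<in> doms \<Longrightarrow> W \<in> doms \<Longrightarrow> dnest U Y \<Longrightarrow> dnest Y W \<Longrightarrow> dnest U W"
  using dmeets_trans[of U Y W] by (auto simp: dnest_def st_def)

lemma dorth_dnest: "U \<in> doms \<Longrightarrow> Y \<in> doms \<Longrightarrow> W \<in> doms \<Longrightarrow> dnest U Y \<Longrightarrow> dorth Y W \<Longrightarrow> dorth U W"
  using dmeets_trans[of U Y W] by (auto simp: dnest_def dorth_def st_def)

lemma dorth_sym: "dorth U W \<longleftrightarrow> dorth W U"
  using lk_swap dmeets_sym by (auto simp: dorth_def)

lemma dorth_not_dnest: "U \<in> doms \<Longrightarrow> W \<in> doms \<Longrightarrow> dorth U W \<Longrightarrow> \<not> dnest U W"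
  using lk_disjoint[of "ty W"] doms_rep(2)[of U] by (auto simp: dorth_def dnest_def)

lemma dnest_top: "W \<in> doms \<Longrightarrow> dnest W (cls \<one> V)"
  using doms_rep[of W] cls_rep[of \<one> V] by (auto simp: dnest_def dmeets_def par_st_V intro!: meetsI[of "rp W"])

text \<open>Depends on the chosen \<open>rp W\<close>, but by \<open>dproj_base\<close> only up to a
  left translation of \<open>par (ty W)\<close>, which \<open>ddist\<close> does not see.\<close>

definition dproj :: "('a \<times> 'v set) set \<Rightarrow> 'a \<Rightarrow> 'a" where
  "dproj W h = gate (ty W) (inv (rp W) \<otimes> h)"

lemma dproj_par: "W \<in> doms \<Longrightarrow> h \<in> carrier P \<Longrightarrow> dproj W h \<in> par (ty W)"
  unfolding dproj_def using doms_rep(1) by (intro gate_in) auto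

lemma dproj_closed: "W \<in> doms \<Longrightarrow> h \<in> carrier P \<Longrightarrow> dproj W h \<in> carrier P"
  using dproj_par par_closed by blast

definition ddist :: "('a \<times> 'v set) set \<Rightarrow> 'a \<Rightarrow> 'a \<Rightarrow> nat" where
  "ddist W h k = len (ty W) (inv (dproj W h) \<otimes> dproj W k)"

lemma dproj_base:
  assumes W: "W \<in> doms" and k: "k \<in> carrier P" "inv (rp W) \<otimes> k \<in> par (st (ty W))" and h: "h \<in> carrier P"
  shows "dproj W h = dproj W k \<otimes> gate (ty W) (inv k \<otimes> h)"
proof -
  have "inv (rp W) \<otimes> h = (inv (rp W) \<otimes> k) \<otimes> (inv k \<otimes> h)" using doms_rep(1)[OF W] k(1) h by (simp add: m_assoc)
  then show ?thesis unfolding dproj_def using gate_st[OF k(2), of "inv k \<otimes> h"] k(1) h by simp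
qed

lemma ddist_base:
  assumes W: "W \<in> doms" and k: "k \<in> carrier P" "inv (rp W) \<otimes> k \<in> par (st (ty W))"
    and h: "h \<in> carrier P" "h' \<in> carrier P"
  shows "ddist W h h' = len (ty W) (inv (gate (ty W) (inv k \<otimes> h)) \<otimes> gate (ty W) (inv k \<otimes> h'))"
  using dproj_closed[OF W k(1)] k(1) h
  unfolding ddist_def dproj_base[OF W k h(1)] dproj_base[OF W k h(2)]
  by (simp add: inv_mult_group m_assoc)

lemma ddist_triangle:
  assumes W: "W \<in> doms" and "a \<in> carrier P" "b \<in> carrier P" "c \<in> carrier P"
  shows "ddist W a c \<le> ddist W a b + ddist W b c"
  unfolding ddist_def using assms dproj_par[OF W] dproj_closed[OF W]
  by (intro len_dist_triangle doms_rep(2)[OF W]) auto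

section \<open>Lipschitz bounds and the size of relative projections\<close>

lemma sall_sgen: "t \<in> sall \<Longrightarrow> \<exists>v. t \<in> sgen {v}"
  by (auto simp: sall_def all_gens_def sgen_def gen_singleton)

lemma ddist_lipschitz:
  assumes W: "W \<in> doms" and "h \<in> carrier P" "z \<in> prods P sall n"
  shows "ddist W h (h \<otimes> z) \<le> n"
  using assms(2,3)
proof (induction n arbitrary: h z)
  case 0
  then show ?case using dproj_closed[OF W, of h] by (simp add: ddist_def)
next
  case (Suc n)
  then obtain t y where t: "t \<in> sall" "y \<in> prods P sall n" "z = t \<otimes> y" by auto
  have tc: "t \<in> carrier P" "y \<in> carrier P"
    using symset_closed[OF symset_sall t(1)] prods_closed[OF symset_sall t(2)] by auto
  obtain v where v: "t \<in> sgen {v}" using sall_sgen t by blast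
  have "ddist W h (h \<otimes> t) \<le> 1"
    using gate_step[OF _ v, of "inv (rp W) \<otimes> h" "ty W"] doms_rep(1)[OF W] Suc.prems tc
    by (simp add: ddist_def dproj_def m_assoc)
  moreover have "ddist W (h \<otimes> t) (h \<otimes> t \<otimes> y) \<le> n" using Suc.IH[OF _ t(2), of "h \<otimes> t"] Suc.prems tc by simp
  moreover have "ddist W h (h \<otimes> t \<otimes> y) \<le> ddist W h (h \<otimes> t) + ddist W (h \<otimes> t) (h \<otimes> t \<otimes> y)"
    using Suc.prems tc by (intro ddist_triangle W) auto
  ultimately show ?case using t(3) Suc.prems tc by (simp add: m_assoc)
qed

text \<open>By \<open>gate_coset_len\<close> the class of \<open>U\<close> has a small image in
  \<open>W\<close>, unless \<open>ty W\<close> is covered by the star of \<open>ty U\<close>; it is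
  then a join, and its space has diameter at most 2.\<close>

lemma rho_diam:
  assumes U: "U \<in> doms" and W: "W \<in> doms" and tr: "dmeets U W \<Longrightarrow> \<not> ty W \<subseteq> ty U \<and> \<not> ty W \<subseteq> lk (ty U)"
    and k: "k \<in> carrier P" "inv (rp U) \<otimes> k \<in> par (st (ty U))" and k': "k' \<in> carrier P" "inv (rp U) \<otimes> k' \<in> par (st (ty U))"
  shows "ddist W k k' \<le> 2"
proof -
  note u = doms_rep[OF U] and w = doms_rep[OF W]
  have x: "inv (rp W) \<otimes> rp U \<in> carrier P" using u w by simp
  have e: "inv (rp W) \<otimes> rp U \<otimes> (inv (rp U) \<otimes> y) = inv (rp W) \<otimes> y" if "y \<in> carrier P" for y
    using that u(1) w(1) by (simp add: m_assoc)
  from gate_coset_len[OF x, of "st (ty U)" "ty W"] show ?thesis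
  proof
    assume "\<forall>d\<in>par (st (ty U)). \<forall>e\<in>par (st (ty U)).
      len (ty W) (inv (gate (ty W) (inv (rp W) \<otimes> rp U \<otimes> d)) \<otimes> gate (ty W) (inv (rp W) \<otimes> rp U \<otimes> e)) \<le> 1"
    from bspec[OF bspec[OF this k(2)] k'(2)] show ?thesis
      using e k(1) k'(1) by (simp add: ddist_def dproj_def)
  next
    assume "ty W \<subseteq> st (ty U) \<and> (\<exists>d\<in>par (st (ty U)). inv (rp W) \<otimes> rp U \<otimes> d \<in> par (st (ty W)))"
    then obtain d where d: "ty W \<subseteq> st (ty U)" "d \<in> par (st (ty U))" "inv (rp W) \<otimes> rp U \<otimes> d \<in> par (st (ty W))" by blast
    have dc: "d \<in> carrier P" using d(2) by simp
    have "dmeets U W" unfolding dmeets_def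
      by (rule meetsI[of "rp U \<otimes> d"]) (use d dc u(1) w(1) in \<open>simp_all add: m_assoc\<close>)
    then show ?thesis unfolding ddist_def
      using tr d(1) dproj_par[OF W] k(1) k'(1) by (intro len_join_st[OF _ d(1)]) auto
  qed
qed

lemma rho_diam_nest: "U \<in> doms \<Longrightarrow> W \<in> doms \<Longrightarrow> dnest U W \<Longrightarrow> U \<noteq> W \<Longrightarrow> \<not> ty W \<subseteq> ty U \<and> \<not> ty W \<subseteq> lk (ty U)"
  using dnest_ty[of U W] doms_rep(2)[of U] lk_disjoint[of "ty U"] by blast

lemma rho_diam_transv: "transverse dnest dorth U W \<Longrightarrow> dmeets U W \<Longrightarrow> \<not> ty W \<subseteq> ty U \<and> \<not> ty W \<subseteq> lk (ty U)"
  using dmeets_sym[of U W] lk_swap[of "ty W" "ty U"] by (auto simp: transverse_def dnest_def dorth_def)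

end


section \<open>The proto-hierarchy structure\<close>

context generated_graph_group
begin

definition dspace :: "('a \<times> 'v set) set \<Rightarrow> ('a \<Rightarrow> real) metric" where
  "dspace W = CM (ty W)"

text \<open>A point inside an edge is sent to the images of both ends. No end has to be chosen, and
  equivariance is exact.\<close>

definition dpr :: "('a \<times> 'v set) set \<Rightarrow> ('a \<Rightarrow> real) \<Rightarrow> ('a \<Rightarrow> real) set" where
  "dpr W x = (\<lambda>h. vert (dproj W h)) ` supp x"

definition drho :: "('a \<times> 'v set) set \<Rightarrow> ('a \<times> 'v set) set \<Rightarrow> ('a \<Rightarrow> real) set" where
  "drho U W = {vert (dproj W k) | k. k \<in> carrier P \<and> inv (rp U) \<otimes> k \<in> par (st (ty U))}"

abbreviation CX :: "('a \<Rightarrow> real) metric" where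
  "CX \<equiv> cayley_graph P all_gens"

text \<open>\<open>2 ^ card V\<close> bounds the length of chains of types, and 400 exceeds all
  metric constants, the largest being the 336 of \<open>hyperbolic_CM\<close>.\<close>

definition nbound :: nat where
  "nbound = 400 + 2 ^ card V"

definition bound :: real where
  "bound = real nbound"

lemma bound_ge: "400 \<le> bound"
  by (simp add: bound_def nbound_def)

sublocale CX: metric_graph "carrier P" "cayley_edges P all_gens" "\<lambda>u v. cayley_len P all_gens (inv u \<otimes> v)"
  by (rule metric_graph_cayley[OF generates_all])

lemma mspace_CX: "mspace CX = graph_points (carrier P) (cayley_edges P all_gens)"
  and mdist_CX: "mdist CX = graph_dist (carrier P) (cayley_edges P all_gens)"
  by (simp_all add: cayley_graph_def CX.mspace_graph CX.mdist_graph)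

lemma CX_supp: "x \<in> mspace CX \<Longrightarrow> supp x \<noteq> {} \<and> finite (supp x) \<and> supp x \<subseteq> carrier P"
  unfolding mspace_CX by (rule CX.supp_point)

lemma CX_prods:
  assumes "u \<in> carrier P" "v \<in> carrier P"
  shows "cayley_len P all_gens (inv u \<otimes> v) \<le> n \<longleftrightarrow> inv u \<otimes> v \<in> prods P sall n"
  using wlen_le_iff[OF cayley_total[OF generates_all]] assms unfolding cayley_len_def sall_eq by simp

lemma supp_adjacent:
  assumes x: "x \<in> mspace CX" and h: "h \<in> supp x" "h' \<in> supp x"
  shows "inv h \<otimes> h' \<in> prods P sall 1"
proof -
  have c: "h \<in> carrier P" "h' \<in> carrier P" using CX_supp[OF x] h by auto
  have "cayley_len P all_gens (inv h \<otimes> h') \<le> 1"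
    using x unfolding mspace_CX
  proof (cases rule: CX.point_cases)
    case (vertex v)
    then show ?thesis using h CX.D_refl by auto
  next
    case (edge u v)
    then have "{v, u} \<in> cayley_edges P all_gens" by (simp add: insert_commute)
    then show ?thesis using h edge CX.edge_iff[of u v] CX.edge_iff[of v u] CX.D_refl[of u] CX.D_refl[of v] by auto
  qed
  then show ?thesis using CX_prods[OF c] by blast
qed

lemma ddist_supp: "W \<in> doms \<Longrightarrow> x \<in> mspace CX \<Longrightarrow> h \<in> supp x \<Longrightarrow> h' \<in> supp x \<Longrightarrow> ddist W h h' \<le> 1"
proof -
  assume W: "W \<in> doms" and x: "x \<in> mspace CX" and h: "h \<in> supp x" "h' \<in> supp x"
  then have c: "h \<in> carrier P" "h' \<in> carrier P" using CX_supp[OF x] by auto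
  show ?thesis using ddist_lipschitz[OF W c(1) supp_adjacent[OF x h]] c by simp
qed

context
  fixes W assumes W: "W \<in> doms"
begin

interpretation C: metric_graph "par (ty W)" "cayley_edges (sub (ty W)) (gen (ty W))" "\<lambda>u v. len (ty W) (inv u \<otimes> v)"
  by (rule metric_graph_sub[OF doms_rep(2)[OF W]])

lemma dspace_graph: "dspace W = graph_metric (par (ty W)) (cayley_edges (sub (ty W)) (gen (ty W)))"
  by (simp add: dspace_def CM_def cayley_graph_def)

lemma vert_dspace: "u \<in> par (ty W) \<Longrightarrow> vert u \<in> mspace (dspace W)"
  unfolding dspace_graph C.mspace_graph by (rule C.vert_point)

lemma vert_dproj_dspace: "h \<in> carrier P \<Longrightarrow> vert (dproj W h) \<in> mspace (dspace W)"
  using vert_dspace dproj_par[OF W] by blast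

lemma mdist_vert: "u \<in> par (ty W) \<Longrightarrow> v \<in> par (ty W) \<Longrightarrow> mdist (dspace W) (vert u) (vert v) = len (ty W) (inv u \<otimes> v)"
  unfolding dspace_graph C.mdist_graph by (rule C.graph_dist_vert)

lemma mdist_dproj:
  "h \<in> carrier P \<Longrightarrow> k \<in> carrier P \<Longrightarrow> mdist (dspace W) (vert (dproj W h)) (vert (dproj W k)) = ddist W h k"
  using mdist_vert dproj_par[OF W] by (simp add: ddist_def)

lemma dspace_near: "p \<in> mspace (dspace W) \<Longrightarrow> \<exists>u\<in>par (ty W). mdist (dspace W) p (vert u) \<le> 1"
  unfolding dspace_graph C.mspace_graph C.mdist_graph using C.vx_near C.vx_Vs by blast

lemma geodesic_dspace: "geodesic_space (dspace W)"
  unfolding dspace_graph by (rule C.geodesic_space_graph)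

lemma sample_dspace:
  assumes g: "geodesic (dspace W) (vert a) (vert b) \<gamma>" and ab: "a \<in> par (ty W)" "b \<in> par (ty W)"
  shows "\<exists>n v. v 0 = a \<and> v n = b \<and> (\<forall>i<n. len (ty W) (inv (v i) \<otimes> v (Suc i)) \<le> 3) \<and>
    (\<forall>i\<le>n. v i \<in> par (ty W) \<and> (\<exists>t\<in>{0..mdist (dspace W) (vert a) (vert b)}. mdist (dspace W) (\<gamma> t) (vert (v i)) \<le> 1))"
proof -
  let ?d = "graph_dist (par (ty W)) (cayley_edges (sub (ty W)) (gen (ty W)))"
  obtain n v where v: "v 0 = a" "v n = b" "\<forall>i<n. len (ty W) (inv (v i) \<otimes> v (Suc i)) \<le> 3"
    "\<And>i. i \<le> n \<Longrightarrow> \<exists>t\<in>{0..?d (vert a) (vert b)}. v i = C.vx (\<gamma> t)"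
    using C.geodesic_sample[OF g[unfolded dspace_graph] C.vert_point[OF ab(1)] C.vert_point[OF ab(2)]]
    unfolding C.vx_vert by blast
  have P: "\<gamma> t \<in> C.Pt" if "t \<in> {0..?d (vert a) (vert b)}" for t
    using g that unfolding geodesic_def dspace_graph C.mdist_graph C.mspace_graph by auto
  have "v i \<in> par (ty W) \<and> (\<exists>t\<in>{0..?d (vert a) (vert b)}. ?d (\<gamma> t) (vert (v i)) \<le> 1)" if "i \<le> n" for i
  proof -
    obtain t where t: "t \<in> {0..?d (vert a) (vert b)}" "v i = C.vx (\<gamma> t)" using v(4)[OF \<open>i \<le> n\<close>] by blast
    then show ?thesis using C.vx_near[OF P[OF t(1)]] C.vx_Vs[OF P[OF t(1)]] by auto
  qed
  then show ?thesis using v(1-3) unfolding dspace_graph C.mdist_graph by blast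
qed

lemma dpr_props:
  assumes x: "x \<in> mspace CX"
  shows "dpr W x \<subseteq> mspace (dspace W)" "dpr W x \<noteq> {}" "finite (dpr W x)" "diam_le (dspace W) (dpr W x) 1"
proof -
  note s = CX_supp[OF x]
  show "dpr W x \<subseteq> mspace (dspace W)" using s vert_dproj_dspace by (auto simp: dpr_def)
  show "dpr W x \<noteq> {}" "finite (dpr W x)" using s by (auto simp: dpr_def)
  show "diam_le (dspace W) (dpr W x) 1"
    using s ddist_supp[OF W x] mdist_dproj unfolding diam_le_def dpr_def by (force simp: subset_iff)
qed

lemma drho_props:
  assumes U: "U \<in> doms" and tr: "dmeets U W \<Longrightarrow> \<not> ty W \<subseteq> ty U \<and> \<not> ty W \<subseteq> lk (ty U)"
  shows "drho U W \<subseteq> mspace (dspace W) \<and> drho U W \<noteq> {} \<and> diam_le (dspace W) (drho U W) bound"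
proof (intro conjI)
  show "drho U W \<subseteq> mspace (dspace W)" using vert_dproj_dspace by (auto simp: drho_def)
  have "inv (rp U) \<otimes> rp U \<in> par (st (ty U))" using doms_rep(1)[OF U] by simp
  then show "drho U W \<noteq> {}" using doms_rep(1)[OF U] unfolding drho_def by blast
  show "diam_le (dspace W) (drho U W) bound"
    unfolding diam_le_def
  proof (intro ballI)
    fix a b assume "a \<in> drho U W" "b \<in> drho U W"
    then obtain k k' where k: "a = vert (dproj W k)" "k \<in> carrier P" "inv (rp U) \<otimes> k \<in> par (st (ty U))"
      "b = vert (dproj W k')" "k' \<in> carrier P" "inv (rp U) \<otimes> k' \<in> par (st (ty U))"
      unfolding drho_def by blast
    have "ddist W k k' \<le> 2" by (rule rho_diam[OF U W tr k(2,3,5,6)])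
    then show "mdist (dspace W) a b \<le> bound" using k mdist_dproj bound_ge by simp
  qed
qed

lemma dpi_le:
  assumes "x \<in> mspace CX" "y \<in> mspace CX" "h \<in> supp x" "k \<in> supp y"
  shows "set_dist (dspace W) (dpr W x) (dpr W y) \<le> ddist W h k"
proof (rule set_dist_le)
  show "vert (dproj W h) \<in> dpr W x" "vert (dproj W k) \<in> dpr W y" using assms by (auto simp: dpr_def)
  show "mdist (dspace W) (vert (dproj W h)) (vert (dproj W k)) \<le> ddist W h k"
    using mdist_dproj CX_supp assms by (simp add: subset_iff)
qed

lemma dpi_attained:
  assumes x: "x \<in> mspace CX" and y: "y \<in> mspace CX"
  shows "\<exists>h\<in>supp x. \<exists>k\<in>supp y. set_dist (dspace W) (dpr W x) (dpr W y) = ddist W h k"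
proof -
  obtain a b where ab: "a \<in> dpr W x" "b \<in> dpr W y" "set_dist (dspace W) (dpr W x) (dpr W y) = mdist (dspace W) a b"
    using set_dist_attained[OF dpr_props(3)[OF x] dpr_props(3)[OF y] dpr_props(2)[OF x] dpr_props(2)[OF y]] by blast
  then obtain h k where "h \<in> supp x" "k \<in> supp y" "a = vert (dproj W h)" "b = vert (dproj W k)"
    by (auto simp: dpr_def)
  then show ?thesis using ab(3) mdist_dproj CX_supp[OF x] CX_supp[OF y] by (intro bexI[of _ h] bexI[of _ k]) auto
qed

end

lemma proto: "proto_hierarchy CX doms dnest dorth dspace dpr drho bound"
proof
  show "0 < bound" using bound_ge by simp
  show "quasi_geodesic_space CX"
    unfolding cayley_graph_def by (intro geodesic_space_quasi CX.geodesic_space_graph)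
  show "geodesic_space (dspace W)" if "W \<in> doms" for W using geodesic_dspace that .
  show "dpr W x \<subseteq> mspace (dspace W) \<and> dpr W x \<noteq> {} \<and> diam_le (dspace W) (dpr W x) bound"
    if "W \<in> doms" "x \<in> mspace CX" for W x
  proof -
    have "mdist (dspace W) a b \<le> bound" if "a \<in> dpr W x" "b \<in> dpr W x" for a b
      using dpr_props(4)[OF \<open>W \<in> doms\<close> \<open>x \<in> mspace CX\<close>] that bound_ge unfolding diam_le_def by fastforce
    then show ?thesis using dpr_props(1,2)[OF that] unfolding diam_le_def by blast
  qed
  show "set_dist (dspace W) (dpr W x) (dpr W y) \<le> bound * mdist CX x y + bound"
    if W: "W \<in> doms" and x: "x \<in> mspace CX" and y: "y \<in> mspace CX" for W x y
  proof -
    have P: "x \<in> CX.Pt" "y \<in> CX.Pt" using x y by (simp_all add: mspace_CX)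
    let ?h = "CX.vx x" and ?k = "CX.vx y"
    have s: "?h \<in> supp x" "?k \<in> supp y" using CX.vx_supp P by auto
    have c: "?h \<in> carrier P" "?k \<in> carrier P" using CX.vx_Vs P by auto
    let ?n = "cayley_len P all_gens (inv ?h \<otimes> ?k)"
    have "inv ?h \<otimes> ?k \<in> prods P sall ?n" using CX_prods[OF c] by blast
    from ddist_lipschitz[OF W c(1) this] have "ddist W ?h ?k \<le> ?n" using c by simp
    then have "set_dist (dspace W) (dpr W x) (dpr W y) \<le> ?n" using dpi_le[OF W x y s] by linarith
    also have "\<dots> \<le> mdist CX x y + 2" unfolding mdist_CX by (rule CX.D_le_dist[OF P])
    also have "\<dots> \<le> bound * mdist CX x y + bound"
      using mult_right_mono[of 1 bound "mdist CX x y"] bound_ge by simp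
    finally show ?thesis .
  qed
  show "mspace (dspace W) \<subseteq> nbhd (dspace W) bound (\<Union>x\<in>mspace CX. dpr W x)" if W: "W \<in> doms" for W
  proof
    fix p assume p: "p \<in> mspace (dspace W)"
    obtain u where u: "u \<in> par (ty W)" "mdist (dspace W) p (vert u) \<le> 1" using dspace_near[OF W p] by blast
    \<comment> \<open>This element of the coset at \<open>rp W\<close> projects exactly to
      \<open>u\<close>.\<close>
    let ?x = "rp W \<otimes> u"
    have c: "rp W \<in> carrier P" "u \<in> carrier P" using doms_rep(1)[OF W] u(1) by auto
    have "dproj W ?x = u" using c u(1) by (simp add: dproj_def)
    then have "vert u \<in> dpr W (vert ?x)" by (simp add: dpr_def)
    moreover have "vert ?x \<in> mspace CX" unfolding mspace_CX using c by (intro CX.vert_point) simp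
    ultimately have "vert u \<in> (\<Union>x\<in>mspace CX. dpr W x)" by blast
    moreover have "mdist (dspace W) p (vert u) \<le> bound" using u(2) bound_ge by linarith
    ultimately show "p \<in> nbhd (dspace W) bound (\<Union>x\<in>mspace CX. dpr W x)"
      using p unfolding nbhd_def by blast
  qed
  show "reflp_on doms dnest" using dmeets_refl by (auto simp: reflp_on_def dnest_def)
  show "antisymp_on doms dnest"
  proof (rule antisymp_onI)
    show "U = W" if "U \<in> doms" "W \<in> doms" "dnest U W" "dnest W U" for U W
      using that dom_eqI[OF that(1,2)] unfolding dnest_def by blast
  qed
  show "transp_on doms dnest"
    by (rule transp_onI) (rule dnest_trans)
  show "\<exists>!W. maximal_domain doms dnest W" if "doms \<noteq> {}"
  proof (rule ex1I)
    obtain W where "W \<in> doms" using \<open>doms \<noteq> {}\<close> by blast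
    then have "V \<noteq> {}" using doms_rep(2,3) by blast
    then have top: "cls \<one> V \<in> doms" by (intro cls_doms) auto
    show "maximal_domain doms dnest (cls \<one> V)"
      unfolding maximal_domain_def
    proof (intro conjI ballI impI top)
      show "W = cls \<one> V" if W: "W \<in> doms" "dnest (cls \<one> V) W" for W
        using dnest_ty[OF top W] doms_rep(3)[OF W(1)] cls_rep(1)[OF one_closed, of V] by auto
    qed
    show "W = cls \<one> V" if "maximal_domain doms dnest W" for W
      using that top dnest_top[of W] unfolding maximal_domain_def by blast
  qed
  show "drho U W \<subseteq> mspace (dspace W) \<and> drho U W \<noteq> {} \<and> diam_le (dspace W) (drho U W) bound"
    if "U \<in> doms" "W \<in> doms" "dnest U W \<and> U \<noteq> W" for U W
    using drho_props[OF that(2,1)] rho_diam_nest[of U W] that by blast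
  show "symp_on doms dorth" using dorth_sym by (auto simp: symp_on_def)
  show "\<not> dnest U W \<and> \<not> dnest W U" if "U \<in> doms" "W \<in> doms" "dorth U W" for U W
    using that dorth_not_dnest dorth_sym by blast
  show "dorth U W" if "U \<in> doms" "Y \<in> doms" "W \<in> doms" "dnest U Y" "dorth Y W" for U Y W
    using dorth_dnest that by blast
  show "drho U W \<subseteq> mspace (dspace W) \<and> drho U W \<noteq> {} \<and> diam_le (dspace W) (drho U W) bound"
    if "U \<in> doms" "W \<in> doms" "transverse dnest dorth U W" for U W
    using drho_props[OF that(2,1)] rho_diam_transv[of U W] that by blast
qed

end


section \<open>The relative HHS axioms\<close>

context generated_graph_group
begin

lemma drho_meet:
  assumes "W \<in> doms" "k \<in> carrier P" "inv (rp U) \<otimes> k \<in> par (st (ty U))"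
  shows "vert (dproj W k) \<in> drho U W" "vert (dproj W k) \<in> mspace (dspace W)"
  using assms vert_dproj_dspace unfolding drho_def by blast+

text \<open>Comparable domains of equal type coincide, so a chain embeds into the subsets of
  \<open>V\<close>.\<close>

lemma finite_complexity_doms:
  assumes F: "F \<subseteq> doms" "pairwise (\<lambda>U W. dnest U W \<or> dnest W U) F"
  shows "finite F \<and> card F \<le> nbound"
proof -
  have inj: "inj_on ty F"
  proof (rule inj_onI, rule ccontr)
    fix U W assume UW: "U \<in> F" "W \<in> F" "ty U = ty W" "U \<noteq> W"
    then have "dmeets U W" using F(2) dmeets_sym unfolding pairwise_def dnest_def by blast
    then show False using dom_eqI UW F(1) by blast
  qed
  have sub: "ty ` F \<subseteq> Pow V" using F(1) doms_rep(3) by blast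
  have fin: "finite (Pow V)" using finite_V by simp
  have "finite F" using finite_imageD[OF finite_subset[OF sub fin] inj] .
  moreover have "card F \<le> card (Pow V)" using card_inj_on_le[OF inj sub fin] .
  then have "card F \<le> 2 ^ card V" using finite_V by (simp add: card_Pow)
  then have "card F \<le> nbound" by (simp add: nbound_def)
  ultimately show ?thesis by blast
qed

lemma containers_doms:
  assumes W: "W \<in> doms" and U: "U \<in> doms" "dnest U W" and ex: "\<exists>Y\<in>doms. dnest Y W \<and> dorth Y U"
  shows "\<exists>Q\<in>doms. dnest Q W \<and> (\<forall>Y\<in>doms. dnest Y W \<and> dorth Y U \<longrightarrow> dnest Y Q)"
proof -
  note w = doms_rep[OF W] and u = doms_rep[OF U(1)]
  obtain a where a: "a \<in> carrier P" "inv (rp U) \<otimes> a \<in> par (st (ty U))" "inv (rp W) \<otimes> a \<in> par (st (ty W))"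
    using U(2) unfolding dnest_def dmeets_def meets_def by blast
  let ?L = "lk (ty U) \<inter> ty W"
  obtain Y where Y: "Y \<in> doms" "dnest Y W" "dorth Y U" using ex by blast
  have "ty Y \<subseteq> ?L" using Y by (auto simp: dnest_def dorth_def)
  then have L: "?L \<noteq> {}" "?L \<subseteq> V" using doms_rep(2)[OF Y(1)] w(3) by auto
  let ?Q = "cls a ?L"
  have Q: "?Q \<in> doms" using cls_doms[OF a(1) L] .
  have "dmeets ?Q W" unfolding dmeets_cls[OF a(1)] by (rule meetsI[of a]) (use a in auto)
  then have "dnest ?Q W" using cls_rep(1)[OF a(1)] by (auto simp: dnest_def)
  moreover have "dnest Y ?Q" if Y: "Y \<in> doms" "dnest Y W" "dorth Y U" for Y
  proof -
    have t: "ty Y \<subseteq> ty W" "ty Y \<subseteq> lk (ty U)" using Y by (auto simp: dnest_def dorth_def)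
    have "meets (rp Y) (ty Y) a ?L"
      by (rule containers_alg[OF u(1) w(1) doms_rep(1)[OF Y(1)] a])
        (use Y t in \<open>auto simp: dnest_def dorth_def dmeets_def\<close>)
    then have "dmeets Y ?Q" using dmeets_sym dmeets_cls[OF a(1)] meets_sym by blast
    then show ?thesis using t cls_rep(1)[OF a(1)] by (auto simp: dnest_def)
  qed
  ultimately show ?thesis using Q by blast
qed

lemma uniqueness_doms:
  "\<exists>\<theta>\<in>{0..} \<rightarrow> {0..}. \<forall>r\<ge>0. \<forall>x\<in>mspace CX. \<forall>y\<in>mspace CX.
    \<theta> r \<le> mdist CX x y \<longrightarrow> (\<exists>W\<in>doms. r \<le> set_dist (dspace W) (dpr W x) (dpr W y))"
proof -
  have "\<exists>N. \<forall>x\<in>carrier P. bounded_proj x n \<longrightarrow> x \<in> prods P sall N" for n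
    using uniqueness_aux[OF finite_V subset_refl] unfolding par_V by blast
  then obtain N where N: "\<And>n x. x \<in> carrier P \<Longrightarrow> bounded_proj x n \<Longrightarrow> x \<in> prods P sall (N n)" by metis
  \<comment> \<open>The 2 pays for passing from the closest points of the two supports to the chosen
    vertices.\<close>
  let ?R = "\<lambda>r::real. nat \<lceil>r\<rceil> + 2"
  \<comment> \<open>Rounding both points to vertices costs 2; one more makes the contradiction
    strict.\<close>
  let ?\<theta> = "\<lambda>r. real (N (?R r)) + 3"
  have "\<exists>W\<in>doms. r \<le> set_dist (dspace W) (dpr W x) (dpr W y)"
    if r: "0 \<le> r" and x: "x \<in> mspace CX" and y: "y \<in> mspace CX" and d: "?\<theta> r \<le> mdist CX x y" for r x y
  proof (rule ccontr)
    assume "\<not> (\<exists>W\<in>doms. r \<le> set_dist (dspace W) (dpr W x) (dpr W y))"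
    then have small: "\<And>W. W \<in> doms \<Longrightarrow> set_dist (dspace W) (dpr W x) (dpr W y) < r" by (meson not_le)
    have P: "x \<in> CX.Pt" "y \<in> CX.Pt" using x y by (simp_all add: mspace_CX)
    let ?h = "CX.vx x" and ?k = "CX.vx y"
    have s: "?h \<in> supp x" "?k \<in> supp y" using CX.vx_supp P by auto
    have c: "?h \<in> carrier P" "?k \<in> carrier P" using CX.vx_Vs P by auto
    have near: "ddist W ?h ?k \<le> ?R r" if W: "W \<in> doms" for W
    proof -
      obtain h k where hk: "h \<in> supp x" "k \<in> supp y" "set_dist (dspace W) (dpr W x) (dpr W y) = ddist W h k"
        using dpi_attained[OF W x y] by blast
      have hc: "h \<in> carrier P" "k \<in> carrier P" using hk CX_supp[OF x] CX_supp[OF y] by auto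
      have "real (ddist W h k) < r" using small[OF W] hk(3) by simp
      then have "ddist W h k \<le> nat \<lceil>r\<rceil>" by linarith
      moreover have "ddist W ?h ?k \<le> ddist W ?h h + ddist W h ?k" by (rule ddist_triangle[OF W c(1) hc(1) c(2)])
      moreover have "ddist W h ?k \<le> ddist W h k + ddist W k ?k" by (rule ddist_triangle[OF W hc c(2)])
      moreover have "ddist W ?h h \<le> 1" "ddist W k ?k \<le> 1"
        using ddist_supp[OF W x s(1) hk(1)] ddist_supp[OF W y hk(2) s(2)] by auto
      ultimately show ?thesis by linarith
    qed
    let ?z = "inv ?h \<otimes> ?k"
    have zc: "?z \<in> carrier P" using c by simp
    have "bounded_proj ?z (?R r)"
      unfolding bounded_proj_def
    proof (intro allI impI)
      fix \<Omega> e assume O: "\<Omega> \<noteq> {}" "\<Omega> \<subseteq> V" and e: "e \<in> carrier P"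
      \<comment> \<open>With this base point, \<open>?h\<close> and \<open>?k\<close> project to the
        gates of \<open>e\<close> and \<open>e \<otimes> ?z\<close>, as in
        \<open>bounded_proj\<close>.\<close>
      let ?g = "?h \<otimes> inv e"
      have g: "?g \<in> carrier P" using c e by simp
      let ?W = "cls ?g \<Omega>"
      have W: "?W \<in> doms" using cls_doms[OF g O] .
      note w = cls_rep[OF g, of \<Omega>]
      have "inv (rp ?W) \<otimes> ?g \<in> par (st (ty ?W))"
        using par_inv[OF w(3)] w(1,2) g by (simp add: inv_mult_group)
      from ddist_base[OF W g this c] have "ddist ?W ?h ?k = len \<Omega> (inv (gate \<Omega> (inv ?g \<otimes> ?h)) \<otimes> gate \<Omega> (inv ?g \<otimes> ?k))"
        using w(1) by simp
      moreover have "inv ?g \<otimes> ?h = e" "inv ?g \<otimes> ?k = e \<otimes> ?z"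
        using c e by (simp_all add: inv_mult_group m_assoc)
      ultimately show "len \<Omega> (inv (gate \<Omega> e) \<otimes> gate \<Omega> (e \<otimes> ?z)) \<le> ?R r" using near[OF W] by simp
    qed
    then have "cayley_len P all_gens ?z \<le> N (?R r)" using N[OF zc] CX_prods[OF c] by blast
    moreover have "mdist CX x y \<le> cayley_len P all_gens ?z + 2" unfolding mdist_CX by (rule CX.dist_le_D[OF P])
    ultimately show False using d by linarith
  qed
  then show ?thesis by (intro bexI[of _ ?\<theta>]) auto
qed

lemma bounded_geodesic_image_doms:
  assumes U: "U \<in> doms" and W: "W \<in> doms" and n: "dnest U W" "U \<noteq> W" and x: "x \<in> mspace CX" and y: "y \<in> mspace CX"
    and d: "bound \<le> set_dist (dspace U) (dpr U x) (dpr U y)" and a: "a \<in> dpr W x" and b: "b \<in> dpr W y"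
    and g: "geodesic (dspace W) a b \<gamma>"
  shows "\<gamma> ` {0..mdist (dspace W) a b} \<inter> nbhd (dspace W) bound (drho U W) \<noteq> {}"
proof -
  note w = doms_rep[OF W] and u = doms_rep[OF U]
  obtain h k where hk: "h \<in> supp x" "k \<in> supp y" "a = vert (dproj W h)" "b = vert (dproj W k)"
    using a b by (auto simp: dpr_def)
  have c: "h \<in> carrier P" "k \<in> carrier P" using hk CX_supp[OF x] CX_supp[OF y] by auto
  have "bound \<le> ddist U h k" using d dpi_le[OF U x y hk(1,2)] by linarith
  then have ne: "dproj U h \<noteq> dproj U k" using bound_ge dproj_closed[OF U c(2)] by (auto simp: ddist_def)
  note wp = dproj_par[OF W c(1)] dproj_par[OF W c(2)]
  obtain n v where v: "v 0 = dproj W h" "v n = dproj W k" "\<And>i. i < n \<Longrightarrow> len (ty W) (inv (v i) \<otimes> v (Suc i)) \<le> 3"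
    "\<And>i. i \<le> n \<Longrightarrow> v i \<in> par (ty W)"
    "\<And>i. i \<le> n \<Longrightarrow> \<exists>t\<in>{0..mdist (dspace W) a b}. mdist (dspace W) (\<gamma> t) (vert (v i)) \<le> 1"
    using sample_dspace[OF W g[unfolded hk(3,4)] wp] hk(3,4) by blast
  obtain e where e: "e \<in> carrier P" "inv (rp U) \<otimes> e \<in> par (st (ty U))" "inv (rp W) \<otimes> e \<in> par (st (ty W))"
    using n(1) unfolding dnest_def dmeets_def meets_def by blast
  \<comment> \<open>2 from \<open>step_change\<close>, and 3 for the steps of the sampled
    geodesic.\<close>
  obtain i z where iz: "i \<le> n" "z \<in> carrier P" "inv (rp U) \<otimes> z \<in> par (st (ty U))"
    "len (ty W) (inv (v i) \<otimes> gate (ty W) (inv (rp W) \<otimes> z)) \<le> 2 + 3"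
    using bounded_geodesic_image_alg[OF w(1) u(1) c e(1) e(3) e(2) dnest_ty[OF U W n] u(2)
      ne[unfolded dproj_def] v(4) v(1)[unfolded dproj_def] v(2)[unfolded dproj_def] v(3)] by blast
  let ?p = "vert (dproj W z)"
  have p: "?p \<in> drho U W" "?p \<in> mspace (dspace W)" using drho_meet[OF W iz(2,3)] by auto
  obtain t where t: "t \<in> {0..mdist (dspace W) a b}" "mdist (dspace W) (\<gamma> t) (vert (v i)) \<le> 1" using v(5)[OF iz(1)] by blast
  have gt: "\<gamma> t \<in> mspace (dspace W)" using g t(1) by (auto simp: geodesic_def)
  have vi: "vert (v i) \<in> mspace (dspace W)" using vert_dspace[OF W v(4)[OF iz(1)]] .
  have "mdist (dspace W) (\<gamma> t) ?p \<le> mdist (dspace W) (\<gamma> t) (vert (v i)) + mdist (dspace W) (vert (v i)) ?p"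
    by (rule mdist_triangle[OF gt vi p(2)])
  moreover have "mdist (dspace W) (vert (v i)) ?p \<le> 5"
    using mdist_vert[OF W v(4)[OF iz(1)] dproj_par[OF W iz(2)]] iz(4) by (simp add: dproj_def)
  ultimately have "mdist (dspace W) (\<gamma> t) ?p \<le> bound" using t(2) bound_ge by linarith
  then have "\<gamma> t \<in> nbhd (dspace W) bound (drho U W)" using gt p(1) unfolding nbhd_def by blast
  then show ?thesis using t(1) by blast
qed

lemma large_links_doms:
  assumes W: "W \<in> doms" and x: "x \<in> mspace CX" and y: "y \<in> mspace CX"
  shows "\<exists>F\<subseteq>{U \<in> doms. dnest U W \<and> U \<noteq> W}. finite F \<and>
    card F \<le> bound * set_dist (dspace W) (dpr W x) (dpr W y) + bound \<and>
    (\<forall>U\<in>doms. dnest U W \<and> U \<noteq> W \<longrightarrow> (\<exists>Y\<in>F. dnest U Y) \<or> set_dist (dspace U) (dpr U x) (dpr U y) \<le> bound)"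
proof -
  note w = doms_rep[OF W]
  obtain h k where hk: "h \<in> supp x" "k \<in> supp y" "set_dist (dspace W) (dpr W x) (dpr W y) = ddist W h k"
    using dpi_attained[OF W x y] by blast
  have c: "h \<in> carrier P" "k \<in> carrier P" using hk CX_supp[OF x] CX_supp[OF y] by auto
  show ?thesis
  proof (cases "is_singleton (ty W)")
    case True
    then obtain v where v: "ty W = {v}" by (auto simp: is_singleton_def)
    have "\<not> (dnest U W \<and> U \<noteq> W)" if U: "U \<in> doms" for U
      using dnest_ty[OF U W] doms_rep(2)[OF U] v by auto
    then show ?thesis using bound_ge hk(3) by (intro exI[of _ "{}"]) auto
  next
    case False
    note wp = dproj_par[OF W c(1)] dproj_par[OF W c(2)]
    obtain F where F: "finite F" "card F \<le> len (ty W) (inv (dproj W h) \<otimes> dproj W k)"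
      "\<forall>(a, M)\<in>F. a \<in> par (ty W) \<and> M \<noteq> {} \<and> M \<subset> ty W"
      "\<And>\<Omega> m. \<Omega> \<noteq> {} \<Longrightarrow> \<Omega> \<subset> ty W \<Longrightarrow> m \<in> par (ty W) \<Longrightarrow>
        (\<exists>(a, M)\<in>F. \<Omega> \<subseteq> M \<and> (\<exists>d\<in>par M. inv m \<otimes> (a \<otimes> d) \<in> par (st \<Omega>))) \<or>
        len \<Omega> (inv (gate \<Omega> (inv m \<otimes> dproj W h)) \<otimes> gate \<Omega> (inv m \<otimes> dproj W k)) \<le> 6"
      using large_links_alg[OF False w(2) wp] by blast
    let ?D = "\<lambda>(a, M). cls (rp W \<otimes> a) M"
    have D: "?D f \<in> doms \<and> dnest (?D f) W \<and> ?D f \<noteq> W" if "f \<in> F" for f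
    proof -
      obtain a M where f0: "f = (a, M)" by (cases f)
      have "a \<in> par (ty W) \<and> M \<noteq> {} \<and> M \<subset> ty W" using bspec[OF F(3) that] unfolding f0 by simp
      then have f: "f = (a, M)" "a \<in> par (ty W)" "M \<noteq> {}" "M \<subset> ty W" using f0 by auto
      have ac: "a \<in> carrier P" and g: "rp W \<otimes> a \<in> carrier P" using f(2) w(1) by auto
      have "cls (rp W \<otimes> a) M \<in> doms" by (rule cls_doms[OF g f(3)]) (use f w in auto)
      moreover have "meets (rp W \<otimes> a) M (rp W) (ty W)"
        by (rule meetsI[of "rp W \<otimes> a"]) (use g w(1) ac par_sub_st(1)[OF f(2)] in auto)
      then have "dmeets (cls (rp W \<otimes> a) M) W" using dmeets_cls[OF g] by blast
      moreover have "ty (cls (rp W \<otimes> a) M) = M" using cls_rep(1)[OF g] .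
      ultimately show ?thesis using f by (auto simp: dnest_def)
    qed
    have "real (card (?D ` F)) \<le> real (card F)" using card_image_le[OF F(1)] by simp
    also have "\<dots> \<le> real (ddist W h k)" using F(2) by (simp add: ddist_def)
    also have "\<dots> \<le> bound * real (ddist W h k) + bound"
      using mult_right_mono[of 1 bound "real (ddist W h k)"] bound_ge by simp
    finally have card: "real (card (?D ` F)) \<le> bound * set_dist (dspace W) (dpr W x) (dpr W y) + bound" using hk(3) by simp
    have "(\<exists>Y\<in>?D ` F. dnest U Y) \<or> set_dist (dspace U) (dpr U x) (dpr U y) \<le> bound"
      if U: "U \<in> doms" "dnest U W" "U \<noteq> W" for U
    proof -
      note u = doms_rep[OF U(1)]
      have sub: "ty U \<subset> ty W" using dnest_ty[OF U(1) W U(2,3)] .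
      obtain e where e: "e \<in> carrier P" "inv (rp U) \<otimes> e \<in> par (st (ty U))" "inv (rp W) \<otimes> e \<in> par (st (ty W))"
        using U(2) unfolding dnest_def dmeets_def meets_def by blast
      obtain m l where ml: "m \<in> par (ty W)" "l \<in> par (lk (ty W))" "inv (rp W) \<otimes> e = m \<otimes> l" using par_st[OF e(3)] by blast
      have mc: "m \<in> carrier P" "l \<in> carrier P" using ml by auto
      let ?e = "rp W \<otimes> m"
      have ec: "?e \<in> carrier P" using w(1) mc by simp
      have "e = rp W \<otimes> (m \<otimes> l)" using ml(3) w(1) e(1) by (metis inv_cancel(2))
      then have ee: "?e = e \<otimes> inv l" using w(1) mc by (simp add: m_assoc)
      have "inv l \<in> par (st (ty U))"
        using par_sub_st(2)[OF par_mono'[OF ml(2) lk_anti[of "ty U" "ty W"]]] sub by auto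
      then have eU: "inv (rp U) \<otimes> ?e \<in> par (st (ty U))"
        unfolding ee using par_mult[OF e(2)] u(1) e(1) mc by (simp add: m_assoc)
      from F(4)[OF u(2) sub ml(1)] show ?thesis
      proof
        assume "\<exists>(a, M)\<in>F. ty U \<subseteq> M \<and> (\<exists>d\<in>par M. inv m \<otimes> (a \<otimes> d) \<in> par (st (ty U)))"
        then obtain a M d where f: "(a, M) \<in> F" "ty U \<subseteq> M" "d \<in> par M" "inv m \<otimes> (a \<otimes> d) \<in> par (st (ty U))" by blast
        have ad: "a \<in> carrier P" "d \<in> carrier P" using F(3) f(1,3) by auto
        have g: "rp W \<otimes> a \<in> carrier P" using w(1) ad by simp
        have "meets (rp W \<otimes> a) M (rp U) (ty U)"
        proof (rule meetsI[of "rp W \<otimes> (a \<otimes> d)"])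
          show "inv (rp W \<otimes> a) \<otimes> (rp W \<otimes> (a \<otimes> d)) \<in> par (st M)"
            using w(1) ad par_sub_st(1)[OF f(3)] by (simp add: inv_mult_group m_assoc)
          show "inv (rp U) \<otimes> (rp W \<otimes> (a \<otimes> d)) \<in> par (st (ty U))"
            using par_mult[OF eU f(4)] w(1) u(1) mc ad by (simp add: m_assoc)
        qed (use w(1) ad in simp)
        then have "dmeets U (cls (rp W \<otimes> a) M)" using dmeets_sym dmeets_cls[OF g] by blast
        then have "dnest U (?D (a, M))" using f(2) cls_rep(1)[OF g] by (simp add: dnest_def)
        then show ?thesis using f(1) by blast
      next
        assume l6: "len (ty U) (inv (gate (ty U) (inv m \<otimes> dproj W h)) \<otimes> gate (ty U) (inv m \<otimes> dproj W k)) \<le> 6"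
        have eq: "gate (ty U) (inv m \<otimes> dproj W z) = gate (ty U) (inv ?e \<otimes> z)" if z: "z \<in> carrier P" for z
        proof -
          have "inv m \<otimes> dproj W z = gate (ty W) (inv m \<otimes> (inv (rp W) \<otimes> z))"
            unfolding dproj_def using gate_mult[OF par_inv[OF ml(1)]] w(1) z by simp
          also have "inv m \<otimes> (inv (rp W) \<otimes> z) = inv ?e \<otimes> z" using w(1) mc z by (simp add: inv_mult_group m_assoc)
          finally show ?thesis using gate_gate[of "inv ?e \<otimes> z" "ty U" "ty W"] sub ec z by auto
        qed
        have "ddist U h k \<le> 6" using l6 ddist_base[OF U(1) ec eU c] unfolding eq[OF c(1)] eq[OF c(2)] by simp
        then have "set_dist (dspace U) (dpr U x) (dpr U y) \<le> bound"
          using dpi_le[OF U(1) x y hk(1,2)] bound_ge by linarith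
        then show ?thesis ..
      qed
    qed
    then show ?thesis using D F(1) card by (intro exI[of _ "?D ` F"] conjI) auto
  qed
qed

lemma consistency_doms:
  assumes U: "U \<in> doms" and W: "W \<in> doms" and t: "transverse dnest dorth U W" and x: "x \<in> mspace CX"
  shows "min (set_dist (dspace W) (dpr W x) (drho U W)) (set_dist (dspace U) (dpr U x) (drho W U)) \<le> bound"
proof -
  note w = doms_rep[OF W] and u = doms_rep[OF U]
  obtain h where h: "h \<in> supp x" using CX_supp[OF x] by blast
  then have c: "h \<in> carrier P" using CX_supp[OF x] by blast
  have small: "set_dist (dspace W) (dpr W x) (drho U W) \<le> bound"
    if W: "W \<in> doms" and k: "k \<in> carrier P" "inv (rp U) \<otimes> k \<in> par (st (ty U))"
      "len (ty W) (inv (gate (ty W) (inv (rp W) \<otimes> h)) \<otimes> gate (ty W) (inv (rp W) \<otimes> k)) \<le> 2" for U W k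
  proof (rule set_dist_le)
    show "vert (dproj W h) \<in> dpr W x" using h by (simp add: dpr_def)
    show "vert (dproj W k) \<in> drho U W" by (rule drho_meet[OF W k(1,2)])
    show "mdist (dspace W) (vert (dproj W h)) (vert (dproj W k)) \<le> bound"
      using mdist_dproj[OF W c k(1)] k(3) bound_ge by (simp add: ddist_def dproj_def)
  qed
  have tr: "meets (rp W) (ty W) (rp U) (ty U) \<Longrightarrow> \<not> ty W \<subseteq> ty U \<and> \<not> ty U \<subseteq> ty W \<and> \<not> ty U \<subseteq> lk (ty W)"
    using t meets_sym unfolding transverse_def dnest_def dorth_def dmeets_def by blast
  from consistency_alg[OF w(1) u(1) c w(2) u(2) u(3) tr] show ?thesis
    using small[OF W] small[OF U] by (auto simp: min_le_iff_disj)
qed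

text \<open>Orthogonal domains meet, so the Helly property provides a common base point.\<close>

lemma common_rep:
  assumes "finite F" "F \<subseteq> doms" "pairwise dorth F"
  shows "\<exists>z\<in>carrier P. \<forall>U\<in>F. inv (rp U) \<otimes> z \<in> par (st (ty U))"
proof (rule helly[OF assms(1)])
  show "rp U \<in> carrier P" if "U \<in> F" for U using doms_rep(1) assms(2) that by blast
  show "\<exists>z\<in>carrier P. inv (rp U) \<otimes> z \<in> par (st (ty U)) \<and> inv (rp W) \<otimes> z \<in> par (st (ty W))"
    if "U \<in> F" "W \<in> F" "U \<noteq> W" for U W
  proof -
    have "dorth U W" using assms(3) that unfolding pairwise_def by blast
    then show ?thesis unfolding dorth_def dmeets_def meets_def by blast
  qed
qed

text \<open>The witness is the product of the prescribed values: each of them lies in the links of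
  all other types and so does not affect the other gates.\<close>

lemma prescribed_gates:
  assumes "finite F" "pairwise (\<lambda>U W. ty U \<subseteq> lk (ty W)) F" "\<forall>U\<in>F. q U \<in> par (ty U)"
  shows "\<exists>y\<in>par (\<Union>U\<in>F. ty U). \<forall>U\<in>F. gate (ty U) y = q U \<and> y \<in> par (st (ty U))"
  using assms
proof (induction F rule: finite_induct)
  case empty
  show ?case by (intro bexI[of _ \<one>]) auto
next
  case (insert Y F)
  have "pairwise (\<lambda>U W. ty U \<subseteq> lk (ty W)) F" using insert.prems(1) by (rule pairwise_subset) blast
  then obtain y where y: "y \<in> par (\<Union>U\<in>F. ty U)" "\<And>U. U \<in> F \<Longrightarrow> gate (ty U) y = q U \<and> y \<in> par (st (ty U))"
    using insert.IH insert.prems by blast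
  have o: "ty U \<subseteq> lk (ty Y)" "ty Y \<subseteq> lk (ty U)" if "U \<in> F" for U
  proof -
    have "U \<noteq> Y" using that insert.hyps by blast
    then show "ty U \<subseteq> lk (ty Y)" "ty Y \<subseteq> lk (ty U)" using insert.prems(1) that unfolding pairwise_def by blast+
  qed
  have yl: "y \<in> par (lk (ty Y))" by (rule par_mono'[OF y(1)]) (use o in blast)
  have yc: "y \<in> carrier P" using yl by simp
  have q: "q Y \<in> par (ty Y)" using insert.prems by blast
  let ?y = "q Y \<otimes> y"
  have "?y \<in> par (\<Union>U\<in>insert Y F. ty U)"
    by (intro par_mult par_mono'[OF y(1)] par_mono'[OF q]) auto
  moreover have "gate (ty Y) ?y = q Y \<and> ?y \<in> par (st (ty Y))"
  proof -
    have "gate (ty Y) y = \<one>" using gate_lk[OF yl one_closed] yc by simp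
    then show ?thesis using gate_mult[OF q yc] q par_mult[OF par_sub_st(1)[OF q] par_sub_st(2)[OF yl]] by simp
  qed
  moreover have "gate (ty U) ?y = q U \<and> ?y \<in> par (st (ty U))" if U: "U \<in> F" for U
  proof -
    have ql: "q Y \<in> par (lk (ty U))" by (rule par_mono'[OF q o(2)[OF U]])
    show ?thesis using gate_lk[OF ql yc] y(2)[OF U] par_mult[OF par_sub_st(2)[OF ql]] by simp
  qed
  ultimately show ?case by blast
qed

lemma partial_realisation_doms:
  assumes F: "finite F" "F \<subseteq> doms" "pairwise dorth F" and p: "\<forall>U\<in>F. p U \<in> mspace (dspace U)"
  shows "\<exists>x\<in>mspace CX. \<forall>U\<in>F. set_dist (dspace U) (dpr U x) {p U} \<le> bound \<and>
    (\<forall>W\<in>doms. (dnest U W \<and> U \<noteq> W) \<or> transverse dnest dorth W U \<longrightarrow> set_dist (dspace W) (dpr W x) (drho U W) \<le> bound)"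
proof -
  obtain z where z: "z \<in> carrier P" "\<And>U. U \<in> F \<Longrightarrow> inv (rp U) \<otimes> z \<in> par (st (ty U))"
    using common_rep[OF F] by blast
  have "\<forall>U. \<exists>u. U \<in> F \<longrightarrow> u \<in> par (ty U) \<and> mdist (dspace U) (p U) (vert u) \<le> 1"
    using dspace_near F(2) p by (meson subsetD)
  then obtain u where u: "\<And>U. U \<in> F \<Longrightarrow> u U \<in> par (ty U) \<and> mdist (dspace U) (p U) (vert (u U)) \<le> 1" by metis
  \<comment> \<open>The values relative to the base point \<open>z\<close>;
    \<open>dproj_base\<close> turns them back into \<open>u U\<close>.\<close>
  let ?q = "\<lambda>U. inv (dproj U z) \<otimes> u U"
  have "?q U \<in> par (ty U)" if "U \<in> F" for U using u[OF that] dproj_par[of U z] F(2) that z(1) by auto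
  moreover have "pairwise (\<lambda>U W. ty U \<subseteq> lk (ty W)) F" using F(3) unfolding pairwise_def dorth_def by blast
  ultimately obtain y where y: "y \<in> par (\<Union>U\<in>F. ty U)" "\<And>U. U \<in> F \<Longrightarrow> gate (ty U) y = ?q U \<and> y \<in> par (st (ty U))"
    using prescribed_gates[OF F(1), of ?q] by blast
  have yc: "y \<in> carrier P" using y(1) by simp
  let ?x = "vert (z \<otimes> y)"
  have xc: "z \<otimes> y \<in> carrier P" using z(1) yc by simp
  have x: "?x \<in> mspace CX" unfolding mspace_CX by (rule CX.vert_point[OF xc])
  show ?thesis
  proof (intro bexI[of _ ?x] ballI conjI impI x)
    fix U assume U: "U \<in> F"
    then have Ud: "U \<in> doms" using F(2) by blast
    note ur = doms_rep[OF Ud]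
    have "dproj U (z \<otimes> y) = dproj U z \<otimes> gate (ty U) (inv z \<otimes> (z \<otimes> y))"
      by (rule dproj_base[OF Ud z(1) z(2)[OF U] xc])
    then have du: "dproj U (z \<otimes> y) = u U"
      using y(2)[OF U] u[OF U] par_closed[of "u U" "ty U"] z(1) yc dproj_closed[OF Ud z(1)] by simp
    have uU: "vert (u U) \<in> mspace (dspace U)" using vert_dspace[OF Ud] u[OF U] by blast
    show "set_dist (dspace U) (dpr U ?x) {p U} \<le> bound"
    proof (rule set_dist_le[of "vert (u U)" _ "p U"])
      show "vert (u U) \<in> dpr U ?x" by (simp add: dpr_def du)
      show "mdist (dspace U) (vert (u U)) (p U) \<le> bound"
        using u[OF U] bound_ge by (simp add: mdist_commute)
    qed simp
    fix W assume W: "W \<in> doms"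
    \<comment> \<open>The point \<open>z \<otimes> y\<close> lies in the class of \<open>U\<close>,
      so its projection to \<open>W\<close> is an element of \<open>drho U W\<close>.\<close>
    have "inv (rp U) \<otimes> (z \<otimes> y) \<in> par (st (ty U))"
      using par_mult[OF z(2)[OF U], of y] y(2)[OF U] ur(1) z(1) yc by (simp add: m_assoc)
    from drho_meet[OF W xc this] show "set_dist (dspace W) (dpr W ?x) (drho U W) \<le> bound"
      using bound_ge by (intro set_dist_self[of "vert (dproj W (z \<otimes> y))"]) (auto simp: dpr_def)
  qed
qed

lemma relative_HHS_doms: "relative_HHS CX doms dnest dorth dspace dpr drho nbound"
proof (intro relative_HHS.intro relative_HHS_axioms.intro; (unfold bound_def[symmetric])?)
  show "minimal_domain doms dnest W \<or> hyperbolic bound (dspace W)" if W: "W \<in> doms" for W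
  proof (cases "is_singleton (ty W)")
    case True
    then obtain v where v: "ty W = {v}" by (auto simp: is_singleton_def)
    have "U = W" if U: "U \<in> doms" "dnest U W" for U
      using dnest_ty[OF U(1) W U(2)] doms_rep(2)[OF U(1)] v by auto
    then show ?thesis using W by (auto simp: minimal_domain_def)
  next
    case False
    then show ?thesis using hyperbolic_CM[OF False doms_rep(2)[OF W]] bound_ge by (simp add: dspace_def)
  qed
  show "set_dist (dspace W) (drho U W) (drho Y W) \<le> bound"
    if "U \<in> doms" "Y \<in> doms" and W: "W \<in> doms" and n: "dnest U Y" for U Y W
  proof -
    \<comment> \<open>A point \<open>k\<close> common to the classes of \<open>U\<close> and
      \<open>Y\<close> projects into both relative projections.\<close>
    obtain k where k: "k \<in> carrier P" "inv (rp U) \<otimes> k \<in> par (st (ty U))" "inv (rp Y) \<otimes> k \<in> par (st (ty Y))"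
      using n unfolding dnest_def dmeets_def meets_def by blast
    show ?thesis
      using drho_meet[OF W k(1,2)] drho_meet[OF W k(1,3)] bound_ge by (intro set_dist_self) auto
  qed
  show "\<gamma> ` {0..mdist (dspace W) a b} \<inter> nbhd (dspace W) bound (drho U W) \<noteq> {}"
    if "U \<in> doms" "W \<in> doms" "dnest U W \<and> U \<noteq> W" "x \<in> mspace CX" "y \<in> mspace CX"
      "bound \<le> set_dist (dspace U) (dpr U x) (dpr U y)" "a \<in> dpr W x" "b \<in> dpr W y" "geodesic (dspace W) a b \<gamma>"
    for U W x y a b \<gamma>
    using bounded_geodesic_image_doms[OF that(1,2) conjunct1[OF that(3)] conjunct2[OF that(3)] that(4-)] .
  show "proto_hierarchy CX doms dnest dorth dspace dpr drho bound" by (rule proto)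
qed (rule finite_complexity_doms containers_doms uniqueness_doms large_links_doms consistency_doms
  partial_realisation_doms; assumption)+

end


section \<open>The group action\<close>

lemma isometric_sym:
  assumes "isometric m m'"
  shows "isometric m' m"
proof -
  obtain f where f: "f ` mspace m = mspace m'" "\<And>x y. x \<in> mspace m \<Longrightarrow> y \<in> mspace m \<Longrightarrow> mdist m' (f x) (f y) = mdist m x y"
    using assms unfolding isometric_def isometry_def by blast
  have "inj_on f (mspace m)"
  proof (rule inj_onI)
    fix x y assume xy: "x \<in> mspace m" "y \<in> mspace m" "f x = f y"
    have "f y \<in> mspace m'" using f(1) xy by blast
    then have "mdist m' (f x) (f y) = 0" using xy by simp
    then show "x = y" using f(2)[OF xy(1,2)] xy by simp
  qed
  then have "bij_betw f (mspace m) (mspace m')" using f(1) by (simp add: bij_betw_def)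
  note b = bij_betw_inv_into[OF this] bij_betw_inv_into_right[OF this]
  let ?g = "inv_into (mspace m) f"
  have "?g ` mspace m' = mspace m" using b(1) by (simp add: bij_betw_def)
  moreover have "mdist m (?g x) (?g y) = mdist m' x y" if "x \<in> mspace m'" "y \<in> mspace m'" for x y
    using f(2)[of "?g x" "?g y"] b(2) that bij_betwE[OF b(1)] by simp
  ultimately show ?thesis unfolding isometric_def isometry_def by blast
qed

lemma (in group) translate_mult:
  assumes "a \<in> carrier G" "b \<in> carrier G"
  shows "cayley_translate G (a \<otimes> b) p = cayley_translate G a (cayley_translate G b p)"
  using assms by (auto simp: cayley_translate_def inv_mult_group m_assoc)

context generated_graph_group
begin

text \<open>The value outside \<open>doms\<close> is \<open>undefined\<close> because elements of
  \<open>BijGroup\<close> are extensional functions.\<close>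

definition dact :: "'a \<Rightarrow> ('a \<times> 'v set) set \<Rightarrow> ('a \<times> 'v set) set" where
  "dact a W = (if W \<in> doms then cls (a \<otimes> rp W) (ty W) else undefined)"

text \<open>The representative chosen for \<open>dact a W\<close> need not be
  \<open>a \<otimes> rp W\<close>. The gate of their quotient measures the discrepancy, and
  \<open>diso\<close> translates by it.\<close>

definition dshift :: "'a \<Rightarrow> ('a \<times> 'v set) set \<Rightarrow> 'a" where
  "dshift a W = gate (ty W) (inv (rp (dact a W)) \<otimes> (a \<otimes> rp W))"

definition diso :: "'a \<Rightarrow> ('a \<times> 'v set) set \<Rightarrow> ('a \<Rightarrow> real) \<Rightarrow> 'a \<Rightarrow> real" where
  "diso a W = cayley_translate (sub (ty W)) (dshift a W)"

lemma dact_cls: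
  assumes "a \<in> carrier P" "g \<in> carrier P" "cls g \<Lambda> \<in> doms"
  shows "dact a (cls g \<Lambda>) = cls (a \<otimes> g) \<Lambda>"
proof -
  note r = cls_rep[OF assms(2), of \<Lambda>]
  have "inv (a \<otimes> g) \<otimes> (a \<otimes> rp (cls g \<Lambda>)) = inv g \<otimes> rp (cls g \<Lambda>)"
    using assms r by (simp add: inv_mult_group m_assoc)
  then have "cls (a \<otimes> g) \<Lambda> = cls (a \<otimes> rp (cls g \<Lambda>)) \<Lambda>" using assms r by (intro cls_eq) auto
  then show ?thesis using assms(3) r(1) by (simp add: dact_def)
qed

lemma dact_props:
  assumes a: "a \<in> carrier P" and W: "W \<in> doms"
  shows "dact a W \<in> doms" "ty (dact a W) = ty W" "inv (rp (dact a W)) \<otimes> (a \<otimes> rp W) \<in> par (st (ty W))"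
proof -
  note w = doms_rep[OF W]
  have g: "a \<otimes> rp W \<in> carrier P" using a w by simp
  have e: "dact a W = cls (a \<otimes> rp W) (ty W)" using W by (simp add: dact_def)
  show "dact a W \<in> doms" unfolding e by (rule cls_doms[OF g w(2,3)])
  note r = cls_rep[OF g, of "ty W", folded e]
  show "ty (dact a W) = ty W" by (rule r(1))
  show "inv (rp (dact a W)) \<otimes> (a \<otimes> rp W) \<in> par (st (ty W))"
    using par_inv[OF r(3)] r(2) g a w(1) by (simp add: inv_mult_group m_assoc)
qed

lemma dact_mult:
  assumes a: "a \<in> carrier P" and b: "b \<in> carrier P" and W: "W \<in> doms"
  shows "dact (a \<otimes> b) W = dact a (dact b W)"
proof -
  note w = doms_rep[OF W]
  have e: "dact b W = cls (b \<otimes> rp W) (ty W)" using W by (simp add: dact_def)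
  have "dact a (dact b W) = cls (a \<otimes> (b \<otimes> rp W)) (ty W)"
    unfolding e by (rule dact_cls) (use a b w dact_props(1)[OF b W] in \<open>auto simp: e\<close>)
  then show ?thesis using W a b w(1) by (simp add: dact_def m_assoc)
qed

lemma dact_one: "W \<in> doms \<Longrightarrow> dact \<one> W = W"
  using doms_rep[of W] by (simp add: dact_def)

lemma dmeets_dact:
  assumes a: "a \<in> carrier P" and U: "U \<in> doms" and W: "W \<in> doms"
  shows "dmeets (dact a U) (dact a W) \<longleftrightarrow> dmeets U W"
proof -
  have one: "dmeets (dact c Y) (dact c Z)" if c: "c \<in> carrier P" and Y: "Y \<in> doms" and Z: "Z \<in> doms" and m: "dmeets Y Z" for c Y Z
  proof -
    obtain k where k: "k \<in> carrier P" "inv (rp Y) \<otimes> k \<in> par (st (ty Y))" "inv (rp Z) \<otimes> k \<in> par (st (ty Z))"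
      using m unfolding dmeets_def meets_def by blast
    have s: "inv (rp (dact c Q)) \<otimes> (c \<otimes> k) \<in> par (st (ty (dact c Q)))"
      if Q: "Q \<in> doms" "inv (rp Q) \<otimes> k \<in> par (st (ty Q))" for Q
      using par_mult[OF dact_props(3)[OF c Q(1)] Q(2)] doms_rep(1)[OF Q(1)] doms_rep(1)[OF dact_props(1)[OF c Q(1)]]
        c k(1) dact_props(2)[OF c Q(1)] by (simp add: m_assoc)
    show ?thesis unfolding dmeets_def
      by (rule meetsI[OF _ s[OF Y k(2)] s[OF Z k(3)]]) (use c k in simp)
  qed
  have "dact (inv a) (dact a Q) = Q" if "Q \<in> doms" for Q
    using dact_mult[of "inv a" a Q] dact_one[OF that] a that by simp
  then show ?thesis
    using one[OF a U W] one[OF inv_closed[OF a] dact_props(1)[OF a U] dact_props(1)[OF a W]] U W by auto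
qed

lemma group_action_dact: "group_action P doms dact"
proof -
  have inv: "dact (inv a) (dact a W) = W" "dact a (dact (inv a) W) = W" if "a \<in> carrier P" "W \<in> doms" for a W
    using dact_mult[of "inv a" a W] dact_mult[of a "inv a" W] dact_one[of W] that by simp_all
  have bij: "dact a \<in> Bij doms" if a: "a \<in> carrier P" for a
    unfolding Bij_def
  proof (intro IntI CollectI)
    show "dact a \<in> extensional doms" by (auto simp: extensional_def dact_def)
    show "bij_betw (dact a) doms doms"
      by (rule bij_betw_byWitness[where f' = "dact (inv a)"]) (use inv[OF a] dact_props(1) a in auto)
  qed
  have "dact (a \<otimes> b) = compose doms (dact a) (dact b)" if "a \<in> carrier P" "b \<in> carrier P" for a b
    using dact_mult[OF that] by (auto simp: compose_def fun_eq_iff dact_def)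
  then have "dact \<in> hom P (BijGroup doms)"
    using bij by (intro homI) (simp_all add: BijGroup_def)
  then show ?thesis
    using group_BijGroup is_group by (simp add: group_action_def group_hom_def group_hom_axioms_def)
qed

text \<open>Left multiplication is transitive on the classes of one type, and there are finitely
  many types.\<close>

lemma finite_orbits: "finite (orbits P doms dact)"
proof (rule finite_subset)
  show "orbits P doms dact \<subseteq> (\<lambda>\<Lambda>. {cls g \<Lambda> | g. g \<in> carrier P}) ` Pow V"
  proof
    fix S assume "S \<in> orbits P doms dact"
    then obtain W where W: "W \<in> doms" "S = orbit P dact W" by (auto simp: orbits_def)
    note w = doms_rep[OF W(1)]
    have "S = {cls g (ty W) | g. g \<in> carrier P}"
    proof (intro Set.set_eqI iffI)
      fix Y assume "Y \<in> S"
      then obtain a where "a \<in> carrier P" "Y = dact a W" by (auto simp: W(2) orbit_def)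
      then have "Y = cls (a \<otimes> rp W) (ty W)" "a \<otimes> rp W \<in> carrier P" using W(1) w(1) by (auto simp: dact_def)
      then show "Y \<in> {cls g (ty W) | g. g \<in> carrier P}" by blast
    next
      fix Y assume "Y \<in> {cls g (ty W) | g. g \<in> carrier P}"
      then obtain g where g: "g \<in> carrier P" "Y = cls g (ty W)" by blast
      then have "Y = dact (g \<otimes> inv (rp W)) W" using W(1) w(1) by (simp add: dact_def m_assoc)
      moreover have "g \<otimes> inv (rp W) \<in> carrier P" using g w(1) by simp
      ultimately show "Y \<in> S" unfolding W(2) orbit_def by blast
    qed
    then show "S \<in> (\<lambda>\<Lambda>. {cls g \<Lambda> | g. g \<in> carrier P}) ` Pow V" using w(3) by blast
  qed
  show "finite ((\<lambda>\<Lambda>. {cls g \<Lambda> | g. g \<in> carrier P}) ` Pow V)" using finite_V by simp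
qed

lemma dnest_dact: "a \<in> carrier P \<Longrightarrow> U \<in> doms \<Longrightarrow> W \<in> doms \<Longrightarrow> dnest (dact a U) (dact a W) \<longleftrightarrow> dnest U W"
  by (simp add: dnest_def dmeets_dact dact_props(2))

lemma dorth_dact: "a \<in> carrier P \<Longrightarrow> U \<in> doms \<Longrightarrow> W \<in> doms \<Longrightarrow> dorth (dact a U) (dact a W) \<longleftrightarrow> dorth U W"
  by (simp add: dorth_def dmeets_dact dact_props(2))

lemma dshift_par: "a \<in> carrier P \<Longrightarrow> W \<in> doms \<Longrightarrow> dshift a W \<in> par (ty W)"
  unfolding dshift_def using doms_rep(1) dact_props(1) by (intro gate_in) auto

text \<open>The cocycle rule \<open>gate_st\<close> makes the projections equivariant without any
  error.\<close>

lemma dproj_dact: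
  assumes a: "a \<in> carrier P" and W: "W \<in> doms" and h: "h \<in> carrier P"
  shows "dproj (dact a W) (a \<otimes> h) = dshift a W \<otimes> dproj W h"
proof -
  note p = dact_props[OF a W]
  have c: "rp W \<in> carrier P" "rp (dact a W) \<in> carrier P" using doms_rep(1) W p(1) by auto
  have "inv (rp (dact a W)) \<otimes> (a \<otimes> h) = (inv (rp (dact a W)) \<otimes> (a \<otimes> rp W)) \<otimes> (inv (rp W) \<otimes> h)"
    using a h c by (simp add: m_assoc)
  then show ?thesis unfolding dproj_def dshift_def p(2) using gate_st[OF p(3), of "inv (rp W) \<otimes> h"] c h by simp
qed

text \<open>The shifts form a cocycle, so the isometries compose exactly.\<close>

lemma dshift_mult:
  assumes a: "a \<in> carrier P" and b: "b \<in> carrier P" and W: "W \<in> doms"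
  shows "dshift (a \<otimes> b) W = dshift a (dact b W) \<otimes> dshift b W"
proof -
  note p = dact_props[OF b W] and q = dact_props[OF a dact_props(1)[OF b W]]
  have c: "rp W \<in> carrier P" "rp (dact b W) \<in> carrier P" "rp (dact a (dact b W)) \<in> carrier P"
    using doms_rep(1) W p(1) q(1) by auto
  have "inv (rp (dact a (dact b W))) \<otimes> (a \<otimes> b \<otimes> rp W) =
      (inv (rp (dact a (dact b W))) \<otimes> (a \<otimes> rp (dact b W))) \<otimes> (inv (rp (dact b W)) \<otimes> (b \<otimes> rp W))"
    using a b c by (simp add: m_assoc)
  then show ?thesis
    unfolding dshift_def dact_mult[OF a b W] p(2)
    using gate_st[OF q(3)[unfolded p(2)], of "inv (rp (dact b W)) \<otimes> (b \<otimes> rp W)"] b c by simp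
qed

lemma diso_vert:
  assumes "a \<in> carrier P" "W \<in> doms" "u \<in> par (ty W)"
  shows "diso a W (vert u) = vert (dshift a W \<otimes> u)"
  using group.translate_vert[OF group_sub, of "dshift a W" "ty W" u] dshift_par[OF assms(1,2)] assms(3)
  by (simp add: diso_def)

lemma diso_dpr:
  assumes a: "a \<in> carrier P" and W: "W \<in> doms" and x: "x \<in> mspace CX"
  shows "diso a W ` dpr W x = dpr (dact a W) (cayley_translate P a x)"
proof -
  have s: "supp x \<subseteq> carrier P" using CX_supp[OF x] by blast
  have "diso a W ` dpr W x = (\<lambda>h. diso a W (vert (dproj W h))) ` supp x" by (simp add: dpr_def image_image)
  also have "\<dots> = (\<lambda>h. vert (dproj (dact a W) (a \<otimes> h))) ` supp x"
  proof (rule image_cong[OF HOL.refl])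
    fix h assume "h \<in> supp x"
    then have h: "h \<in> carrier P" using s by blast
    show "diso a W (vert (dproj W h)) = vert (dproj (dact a W) (a \<otimes> h))"
      using diso_vert[OF a W dproj_par[OF W h]] dproj_dact[OF a W h] by simp
  qed
  also have "\<dots> = dpr (dact a W) (cayley_translate P a x)"
    unfolding dpr_def supp_translate[OF a s] image_image ..
  finally show ?thesis .
qed

lemma diso_drho:
  assumes a: "a \<in> carrier P" and U: "U \<in> doms" and W: "W \<in> doms"
  shows "vert (dproj (dact a W) (a \<otimes> rp U)) \<in> diso a W ` drho U W"
    "vert (dproj (dact a W) (a \<otimes> rp U)) \<in> drho (dact a U) (dact a W)"
    "vert (dproj (dact a W) (a \<otimes> rp U)) \<in> mspace (dspace (dact a W))"
proof -
  note u = doms_rep[OF U] and p = dact_props[OF a U]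
  have "vert (dproj W (rp U)) \<in> drho U W" using drho_meet(1)[OF W u(1), of U] u(1) by simp
  moreover have "diso a W (vert (dproj W (rp U))) = vert (dproj (dact a W) (a \<otimes> rp U))"
    using diso_vert[OF a W dproj_par[OF W u(1)]] dproj_dact[OF a W u(1)] by simp
  ultimately show "vert (dproj (dact a W) (a \<otimes> rp U)) \<in> diso a W ` drho U W" by (metis image_eqI)
  have c: "a \<otimes> rp U \<in> carrier P" using a u by simp
  show "vert (dproj (dact a W) (a \<otimes> rp U)) \<in> drho (dact a U) (dact a W)"
    "vert (dproj (dact a W) (a \<otimes> rp U)) \<in> mspace (dspace (dact a W))"
    using drho_meet[OF dact_props(1)[OF a W] c, of "dact a U"] p(2,3) by auto
qed

lemma relative_HHG_doms: "relative_HHG P all_gens doms dnest dorth dspace dpr drho nbound dact diso"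
proof (intro relative_HHG.intro relative_HHG_axioms.intro group_action_dact relative_HHS_doms)
  show "finite all_gens" using finite_V finite_T by (simp add: all_gens_def)
  show "generates P all_gens" by (rule generates_all)
  show "finite (orbits P doms dact)" by (rule finite_orbits)
  show "dnest (dact a U) (dact a W) \<longleftrightarrow> dnest U W" if "a \<in> carrier P" "U \<in> doms" "W \<in> doms" for a U W
    using dnest_dact that .
  show "dorth (dact a U) (dact a W) \<longleftrightarrow> dorth U W" if "a \<in> carrier P" "U \<in> doms" "W \<in> doms" for a U W
    using dorth_dact that .
  show "transverse dnest dorth (dact a U) (dact a W) \<longleftrightarrow> transverse dnest dorth U W"
    if "a \<in> carrier P" "U \<in> doms" "W \<in> doms" for a U W
    using that by (simp add: transverse_def dnest_dact dorth_dact)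
  show "isometry (dspace W) (dspace (dact a W)) (diso a W)" if "a \<in> carrier P" "W \<in> doms" for a W
    using group.isometry_translate[OF group_sub generates_sub[OF doms_rep(2)[OF that(2)]], of "dshift a W"]
      dshift_par[OF that] dact_props(2)[OF that] by (simp add: dspace_def CM_def diso_def)
  show "diso (a \<otimes> b) W p = diso a (dact b W) (diso b W p)"
    if a: "a \<in> carrier P" and b: "b \<in> carrier P" and W: "W \<in> doms" and "p \<in> mspace (dspace W)" for a b W p
    using group.translate_mult[OF group_sub, of "dshift a (dact b W)" "ty W" "dshift b W" p]
      dshift_par[OF a dact_props(1)[OF b W]] dshift_par[OF b W] dact_props(2)[OF b W] dshift_mult[OF a b W]
    by (simp add: diso_def)
  show "set_dist (dspace (dact a W)) (diso a W ` dpr W x) (dpr (dact a W) (cayley_translate P a x)) \<le> real nbound"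
    if a: "a \<in> carrier P" and W: "W \<in> doms" and x: "x \<in> mspace CX" for a W x
  proof -
    obtain h where h: "h \<in> supp x" using CX_supp[OF x] by blast
    then have hc: "h \<in> carrier P" using CX_supp[OF x] by blast
    have s: "supp x \<subseteq> carrier P" using CX_supp[OF x] by blast
    have "a \<otimes> h \<in> supp (cayley_translate P a x)" unfolding supp_translate[OF a s] using h by blast
    then have "vert (dproj (dact a W) (a \<otimes> h)) \<in> dpr (dact a W) (cayley_translate P a x)" by (simp add: dpr_def)
    moreover have "vert (dproj (dact a W) (a \<otimes> h)) \<in> mspace (dspace (dact a W))"
      using vert_dproj_dspace[OF dact_props(1)[OF a W]] a hc by simp
    ultimately show ?thesis unfolding diso_dpr[OF a W x] by (intro set_dist_self) auto
  qed
  show "set_dist (dspace (dact a W)) (diso a W ` drho U W) (drho (dact a U) (dact a W)) \<le> real nbound"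
    if "a \<in> carrier P" "U \<in> doms" "W \<in> doms" for a U W
    using diso_drho[OF that] by (intro set_dist_self) auto
qed

text \<open>Every vertex of \<open>ty W\<close> gives a domain nested in \<open>W\<close>; a minimal
  domain therefore has a single vertex as its type, and \<open>gen\<close> is the chosen finite
  generating set there.\<close>

lemma minimal_doms:
  assumes "minimal_domain doms dnest W"
  shows "\<exists>v\<in>V. dspace W = cayley_graph (sub {v}) (T v)"
proof -
  have W: "W \<in> doms" and min: "\<And>U. U \<in> doms \<Longrightarrow> dnest U W \<Longrightarrow> U = W" using assms by (auto simp: minimal_domain_def)
  note w = doms_rep[OF W]
  obtain v where v: "v \<in> ty W" using w(2) by blast
  have U: "cls (rp W) {v} \<in> doms" using w v by (intro cls_doms) auto
  have "dmeets (cls (rp W) {v}) W" unfolding dmeets_cls[OF w(1)] using w(1) by (intro meetsI[of "rp W"]) auto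
  then have "dnest (cls (rp W) {v}) W" using v cls_rep(1)[OF w(1)] by (simp add: dnest_def)
  then have "W = cls (rp W) {v}" using min[OF U] by simp
  then have "ty W = {v}" using cls_rep(1)[OF w(1), of "{v}"] by metis
  then show ?thesis using v w(3) by (auto simp: dspace_def CM_def gen_singleton)
qed

end

theorem theoremA:
  fixes V :: "'v set" and E :: "'v set set" and G :: "'v \<Rightarrow> ('a, 'b) monoid_scheme"
  assumes "finite_simplicial_graph V E"
    and "\<And>v. v \<in> V \<Longrightarrow> group (G v)"
    and "\<And>v. v \<in> V \<Longrightarrow> carrier (G v) \<noteq> {\<one>\<^bsub>G v\<^esub>}"
    and "\<And>v. v \<in> V \<Longrightarrow> finitely_generated (G v)"
  shows "\<exists>k>0. \<exists>T (\<SS> :: (('v, 'a) graph_product_elt \<times> 'v set) set set) nest orth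
      (C :: _ \<Rightarrow> (('v, 'a) graph_product_elt \<Rightarrow> real) metric) proj \<rho> act iso.
    relative_HHG (graph_product V E G) T \<SS> nest orth C proj \<rho> k act iso \<and>
    (\<forall>W. minimal_domain \<SS> nest W \<longrightarrow>
      (\<exists>v\<in>V. \<exists>T\<^sub>v. finite T\<^sub>v \<and> generates (G v) T\<^sub>v \<and> isometric (C W) (cayley_graph (G v) T\<^sub>v)))"
proof -
  interpret graph_of_groups V E G by (rule graph_of_groups.intro) (use assms(1,2) in auto)
  have "\<forall>v. \<exists>S. v \<in> V \<longrightarrow> finite S \<and> generates (G v) S" using assms(4) unfolding finitely_generated_def by blast
  then obtain S where S: "\<And>v. v \<in> V \<Longrightarrow> finite (S v)" "\<And>v. v \<in> V \<Longrightarrow> generates (G v) (S v)" by metis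
  \<comment> \<open>Outside \<open>V\<close> the vertex group is trivial and is generated by the
    empty set.\<close>
  define T where "T v = (if v \<in> V then emb v ` S v else {})" for v
  have hom: "group_hom (G v) Pr (emb v)" if "v \<in> V" for v
    using groups[OF that] emb_hom[OF that] Pr.is_group by (simp add: group_hom_def group_hom_axioms_def)
  interpret generated_graph_group Pr V adj vgrp head T
  proof (intro generated_graph_group.intro generated_graph_group_axioms.intro graph_group)
    show "finite (T v)" for v using S(1) by (simp add: T_def)
    show "generate Pr (T v) = vgrp v" for v
    proof (cases "v \<in> V")
      case True
      have "S v \<subseteq> carrier (G v)" "generate (G v) (S v) = carrier (G v)" using S(2)[OF True] by (auto simp: generates_def)
      then show ?thesis using group_hom.generate_img[OF hom[OF True], of "S v"] True by (simp add: T_def vgrp_def)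
    next
      case False
      then show ?thesis using Pr.generate_empty by (simp add: T_def vgrp_def)
    qed
    show "vgrp v \<noteq> {\<one>\<^bsub>Pr\<^esub>}" if v: "v \<in> V" for v
    proof
      assume "vgrp v = {\<one>\<^bsub>Pr\<^esub>}"
      then have im: "emb v ` carrier (G v) = {\<one>\<^bsub>Pr\<^esub>}" using v by (simp add: vgrp_def)
      interpret Gv: group "G v" using groups[OF v] .
      have "x = \<one>\<^bsub>G v\<^esub>" if "x \<in> carrier (G v)" for x
      proof (rule inj_onD[OF emb_inj[OF v] _ that Gv.one_closed])
        show "emb v x = emb v \<one>\<^bsub>G v\<^esub>" using im that emb_one[OF v] by auto
      qed
      then show False using assms(3)[OF v] by auto
    qed
  qed
  have iso: "isometric (dspace W) (cayley_graph (G v) (S v))"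
    if v: "v \<in> V" and W: "dspace W = cayley_graph (sub {v}) (T v)" for v W
  proof -
    have pv: "par {v} = emb v ` carrier (G v)" using par_singleton v by (simp add: vgrp_def)
    have T: "T v = emb v ` S v" using v by (simp add: T_def)
    have "emb v \<in> hom (G v) (sub {v})"
      using emb_hom[OF v] pv unfolding hom_def by auto
    moreover have "bij_betw (emb v) (carrier (G v)) (carrier (sub {v}))"
      using emb_inj[OF v] pv by (simp add: bij_betw_def)
    moreover have "generates (sub {v}) (emb v ` S v)"
      using generates_sub[of "{v}"] by (simp add: gen_singleton T)
    ultimately have "isometric (cayley_graph (G v) (S v)) (cayley_graph (sub {v}) (emb v ` S v))"
      by (intro isometric_iso groups[OF v] group_sub S(2)[OF v])
    then show ?thesis using isometric_sym W T by simp
  qed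
  have "0 < nbound" by (simp add: nbound_def)
  moreover have "\<exists>v\<in>V. \<exists>R. finite R \<and> generates (G v) R \<and> isometric (dspace W) (cayley_graph (G v) R)"
    if min: "minimal_domain doms dnest W" for W
  proof -
    obtain v where "v \<in> V" "dspace W = cayley_graph (sub {v}) (T v)" using minimal_doms[OF min] by blast
    then show ?thesis using iso[of v W] S[of v] by blast
  qed
  ultimately show ?thesis
    by (intro exI[of _ nbound] conjI exI[of _ all_gens] exI[of _ doms] exI[of _ dnest] exI[of _ dorth]
      exI[of _ dspace] exI[of _ dpr] exI[of _ drho] exI[of _ dact] exI[of _ diso] relative_HHG_doms) auto
qed

end
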